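(* Let $A$ be a finite-dimensional symmetric $k$-algebra, let $P$ be a projective $A$-module, and suppose that $E=\operatorname{End}_A(P)^{\mathrm{op}}$ is twisted-periodic of period $n$, with periodic twist $\Psi_P=X\otimes_A-:D^b(A)\to D^b(A)$. Then $\Psi_P(K)\cong K$ for all $K\in P^\perp$, and $\Psi_P(P)\cong P[n]$.
   Context: $k$ is an algebraically closed field; all algebras are finite-dimensional, all modules are finitely generated left modules, and $k$ acts centrally on bimodules. An algebra $A$ is symmetric if $A\cong\operatorname{Hom}_k(A,k)$ as $A$-$A$-bimodules. Complexes are cohomological, $[1]$ shifts to the left. $D^b(A)$ is the bounded derived category of finitely generated $A$-modules, and $P^\perp=\{L\in D^b(A)\mid\operatorname{Hom}_{D^b(A)}(P,L[i])=0\text{ for all }i\in\mathbb{Z}\}$. $P$ is an $A$-$E$-bimodule and $P^\vee=\operatorname{Hom}_A(P,A)$ is an $E$-$A$-bimodule. For an automorphism $\sigma$ of the algebra $E$, $E_\sigma$ is the $E$-$E$-bimodule $E$ with right action twisted by $\sigma$. $E$ is twisted-periodic of period $n\geq1$ if for some automorphism $\sigma$ there is an exact sequence $P_{n-1}\xrightarrow{d_{n-1}}\cdots\to P_1\xrightarrow{d_1}P_0$ of projective $E\otimes_kE^{\mathrm{op}}$-modules with $\operatorname{coker} d_1\cong E$ and $\ker d_{n-1}\cong E_\sigma$. The complex $Y=(P_{n-1}\to\cdots\to P_0)$, with $P_0$ in degree $0$, is called a truncated resolution of $E$; the isomorphism $\operatorname{coker}d_1\cong E$ gives a map of complexes of bimodules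 $f:Y\to E$. Let $g$ be the composition of maps of complexes of $A$-$A$-bimodules $$P\otimes_EY\otimes_EP^\vee\xrightarrow{P\otimes f\otimes P^\vee}P\otimes_EE\otimes_EP^\vee\xrightarrow{\sim}P\otimes_EP^\vee\xrightarrow{\mathrm{ev}}A,$$ where $\mathrm{ev}(p\otimes\phi)=\phi(p)$, and let $X=\operatorname{cone}(g)$. The periodic twist is $\Psi_P=X\otimes_A-$. *)

theory Defs
  imports "HOL-Algebra.Algebra"
begin

section \<open>Algebras, modules and bimodules\<close>

text \<open>
  The locales \<open>module\<close> and \<open>algebra\<close> of HOL-Algebra require a commutative ring of scalars
  (respectively a commutative algebra), so the noncommutative notions are introduced here, on the
  same records. In a \<open>module\<close> record the fields \<open>mult\<close> and \<open>one\<close> are meaningful only if the record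
  is an algebra; for plain modules they are irrelevant.
\<close>

locale lmodule = R?: ring R + M?: abelian_group M
  for R :: "('r, 'x) ring_scheme" (structure) and M :: "('r, 'm, 'y) module_scheme" (structure) +
  assumes "\<lbrakk>a \<in> carrier R; x \<in> carrier M\<rbrakk> \<Longrightarrow> a \<odot>\<^bsub>M\<^esub> x \<in> carrier M"
    and "\<lbrakk>a \<in> carrier R; b \<in> carrier R; x \<in> carrier M\<rbrakk> \<Longrightarrow>
      (a \<oplus>\<^bsub>R\<^esub> b) \<odot>\<^bsub>M\<^esub> x = a \<odot>\<^bsub>M\<^esub> x \<oplus>\<^bsub>M\<^esub> b \<odot>\<^bsub>M\<^esub> x"
    and "\<lbrakk>a \<in> carrier R; x \<in> carrier M; y \<in> carrier M\<rbrakk> \<Longrightarrow>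
      a \<odot>\<^bsub>M\<^esub> (x \<oplus>\<^bsub>M\<^esub> y) = a \<odot>\<^bsub>M\<^esub> x \<oplus>\<^bsub>M\<^esub> a \<odot>\<^bsub>M\<^esub> y"
    and "\<lbrakk>a \<in> carrier R; b \<in> carrier R; x \<in> carrier M\<rbrakk> \<Longrightarrow>
      (a \<otimes>\<^bsub>R\<^esub> b) \<odot>\<^bsub>M\<^esub> x = a \<odot>\<^bsub>M\<^esub> (b \<odot>\<^bsub>M\<^esub> x)"
    and "x \<in> carrier M \<Longrightarrow> \<one>\<^bsub>R\<^esub> \<odot>\<^bsub>M\<^esub> x = x"

locale k_algebra = module K A + ring A for K (structure) and A (structure) +
  assumes "\<lbrakk>c \<in> carrier K; x \<in> carrier A; y \<in> carrier A\<rbrakk> \<Longrightarrow>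
      (c \<odot>\<^bsub>A\<^esub> x) \<otimes>\<^bsub>A\<^esub> y = c \<odot>\<^bsub>A\<^esub> (x \<otimes>\<^bsub>A\<^esub> y)"
    and "\<lbrakk>c \<in> carrier K; x \<in> carrier A; y \<in> carrier A\<rbrakk> \<Longrightarrow>
      x \<otimes>\<^bsub>A\<^esub> (c \<odot>\<^bsub>A\<^esub> y) = c \<odot>\<^bsub>A\<^esub> (x \<otimes>\<^bsub>A\<^esub> y)"

record ('r, 's, 'm) bimod = "('r, 'm) module" +
  rsmult :: "'m \<Rightarrow> 's \<Rightarrow> 'm"

text \<open>
  Bimodules over \<open>K\<close>-algebras \<open>R\<close> and \<open>S\<close> with \<open>K\<close> acting centrally (the last axiom); these are the
  same as left modules over the tensor product over \<open>K\<close> of \<open>R\<close> and the opposite of \<open>S\<close>.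
\<close>

locale bimodule = lmodule R M
  for K :: "('k, 'x) ring_scheme" and R :: "('k, 'r, 'y) module_scheme"
    and S :: "('k, 's, 'z) module_scheme" and M :: "('r, 's, 'm) bimod" +
  assumes "k_algebra K R" and "k_algebra K S"
    and "\<lbrakk>s \<in> carrier S; x \<in> carrier M\<rbrakk> \<Longrightarrow> rsmult M x s \<in> carrier M"
    and "\<lbrakk>s \<in> carrier S; t \<in> carrier S; x \<in> carrier M\<rbrakk> \<Longrightarrow>
      rsmult M x (s \<oplus>\<^bsub>S\<^esub> t) = rsmult M x s \<oplus>\<^bsub>M\<^esub> rsmult M x t"
    and "\<lbrakk>s \<in> carrier S; x \<in> carrier M; y \<in> carrier M\<rbrakk> \<Longrightarrow>
      rsmult M (x \<oplus>\<^bsub>M\<^esub> y) s = rsmult M x s \<oplus>\<^bsub>M\<^esub> rsmult M y s"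
    and "\<lbrakk>s \<in> carrier S; t \<in> carrier S; x \<in> carrier M\<rbrakk> \<Longrightarrow>
      rsmult M x (s \<otimes>\<^bsub>S\<^esub> t) = rsmult M (rsmult M x s) t"
    and "x \<in> carrier M \<Longrightarrow> rsmult M x \<one>\<^bsub>S\<^esub> = x"
    and "\<lbrakk>r \<in> carrier R; s \<in> carrier S; x \<in> carrier M\<rbrakk> \<Longrightarrow>
      rsmult M (r \<odot>\<^bsub>M\<^esub> x) s = r \<odot>\<^bsub>M\<^esub> (rsmult M x s)"
    and "\<lbrakk>c \<in> carrier K; x \<in> carrier M\<rbrakk> \<Longrightarrow>
      (c \<odot>\<^bsub>R\<^esub> \<one>\<^bsub>R\<^esub>) \<odot>\<^bsub>M\<^esub> x = rsmult M x (c \<odot>\<^bsub>S\<^esub> \<one>\<^bsub>S\<^esub>)"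

definition lmod_hom ::
  "('r, 'x) ring_scheme \<Rightarrow> ('r, 'm, 'y) module_scheme \<Rightarrow> ('r, 'n, 'z) module_scheme \<Rightarrow> ('m \<Rightarrow> 'n) set"
  where "lmod_hom R M N = {f \<in> carrier M \<rightarrow> carrier N.
    (\<forall>x\<in>carrier M. \<forall>y\<in>carrier M. f (x \<oplus>\<^bsub>M\<^esub> y) = f x \<oplus>\<^bsub>N\<^esub> f y) \<and>
    (\<forall>r\<in>carrier R. \<forall>x\<in>carrier M. f (r \<odot>\<^bsub>M\<^esub> x) = r \<odot>\<^bsub>N\<^esub> f x)}"

definition bimod_hom ::
  "('r, 'x) ring_scheme \<Rightarrow> ('s, 'y) ring_scheme \<Rightarrow> ('r, 's, 'm) bimod \<Rightarrow> ('r, 's, 'n) bimod \<Rightarrow> ('m \<Rightarrow> 'n) set"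
  where "bimod_hom R S M N = {f \<in> lmod_hom R M N.
    \<forall>s\<in>carrier S. \<forall>x\<in>carrier M. f (rsmult M x s) = rsmult N (f x) s}"

definition bimod_iso ::
  "('r, 'x) ring_scheme \<Rightarrow> ('s, 'y) ring_scheme \<Rightarrow> ('r, 's, 'm) bimod \<Rightarrow> ('r, 's, 'n) bimod \<Rightarrow> ('m \<Rightarrow> 'n) set"
  where "bimod_iso R S M N = {f \<in> bimod_hom R S M N. bij_betw f (carrier M) (carrier N)}"

definition fin_gen :: "('r, 'x) ring_scheme \<Rightarrow> ('r, 'm, 'y) module_scheme \<Rightarrow> bool"
  where "fin_gen R M \<longleftrightarrow> (\<exists>S. finite S \<and> S \<subseteq> carrier M \<and>
    (\<forall>N. submodule N R M \<and> S \<subseteq> N \<longrightarrow> N = carrier M))"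

definition bimod_fin_gen :: "('r, 'x) ring_scheme \<Rightarrow> ('s, 'y) ring_scheme \<Rightarrow> ('r, 's, 'm) bimod \<Rightarrow> bool"
  where "bimod_fin_gen R S M \<longleftrightarrow> (\<exists>B. finite B \<and> B \<subseteq> carrier M \<and>
    (\<forall>N. submodule N R M \<and> (\<forall>x\<in>N. \<forall>s\<in>carrier S. rsmult M x s \<in> N) \<and> B \<subseteq> N \<longrightarrow> N = carrier M))"

text \<open>
  Where a definition quantifies over finitely generated modules over a finite-dimensional
  \<open>K\<close>-algebra, their carriers are taken in the type \<open>'k univ\<close>. It contains the \<open>K\<close>-vector spaces
  \<open>K\<^sup>d\<close> for all \<open>d\<close> (as finitely supported sequences), hence a copy of every finite-dimensional
  module, so nothing is lost. Modules that are given rather than quantified over may have their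
  carriers in any type.
\<close>

type_synonym 'k univ = "nat \<Rightarrow> 'k"

definition projective_lmodule :: "('k, 'a) module \<Rightarrow> ('a, 'p) module \<Rightarrow> bool"
  where "projective_lmodule A P \<longleftrightarrow> lmodule A P \<and>
    (\<forall>(N :: ('a, 'k univ) module) (N' :: ('a, 'k univ) module) g f.
      lmodule A N \<and> fin_gen A N \<and> lmodule A N' \<and> fin_gen A N' \<and>
      g \<in> lmod_hom A N N' \<and> g ` carrier N = carrier N' \<and> f \<in> lmod_hom A P N' \<longrightarrow>
      (\<exists>h \<in> lmod_hom A P N. \<forall>x\<in>carrier P. g (h x) = f x))"

definition projective_bimodule ::
  "'k ring \<Rightarrow> ('k, 'r) module \<Rightarrow> ('k, 's) module \<Rightarrow> ('r, 's, 'p) bimod \<Rightarrow> bool"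
  where "projective_bimodule K R S P \<longleftrightarrow> bimodule K R S P \<and>
    (\<forall>(N :: ('r, 's, 'k univ) bimod) (N' :: ('r, 's, 'k univ) bimod) g f.
      bimodule K R S N \<and> bimod_fin_gen R S N \<and> bimodule K R S N' \<and> bimod_fin_gen R S N' \<and>
      g \<in> bimod_hom R S N N' \<and> g ` carrier N = carrier N' \<and> f \<in> bimod_hom R S P N' \<longrightarrow>
      (\<exists>h \<in> bimod_hom R S P N. \<forall>x\<in>carrier P. g (h x) = f x))"

definition reg_bimod :: "('a, 'x) ring_scheme \<Rightarrow> ('a, 'a, 'a) bimod"
  where "reg_bimod A = \<lparr>carrier = carrier A, monoid.mult = monoid.mult A, monoid.one = monoid.one A,
    ring.zero = ring.zero A, ring.add = ring.add A, smult = monoid.mult A, rsmult = monoid.mult A\<rparr>"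

text \<open>The bimodule \<open>E\<^sub>\<sigma>\<close>.\<close>

definition twisted_reg :: "('a, 'x) ring_scheme \<Rightarrow> ('a \<Rightarrow> 'a) \<Rightarrow> ('a, 'a, 'a) bimod"
  where "twisted_reg E \<sigma> = (reg_bimod E)\<lparr>rsmult := \<lambda>x e. x \<otimes>\<^bsub>E\<^esub> \<sigma> e\<rparr>"

text \<open>
  Sets of module homomorphisms that serve as carriers consist of extensional functions, so that
  equality of homomorphisms is equality of elements.
\<close>

definition k_dual :: "'k ring \<Rightarrow> ('k, 'a) module \<Rightarrow> ('a, 'a, 'a \<Rightarrow> 'k) bimod"
  where "k_dual K A =
    \<lparr>carrier = lmod_hom K A (reg_bimod K) \<inter> extensional (carrier A),
     monoid.mult = undefined, monoid.one = undefined,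
     ring.zero = (\<lambda>x\<in>carrier A. \<zero>\<^bsub>K\<^esub>),
     ring.add = (\<lambda>\<phi> \<psi>. \<lambda>x\<in>carrier A. \<phi> x \<oplus>\<^bsub>K\<^esub> \<psi> x),
     smult = (\<lambda>a \<phi>. \<lambda>x\<in>carrier A. \<phi> (x \<otimes>\<^bsub>A\<^esub> a)),
     rsmult = (\<lambda>\<phi> a. \<lambda>x\<in>carrier A. \<phi> (a \<otimes>\<^bsub>A\<^esub> x))\<rparr>"

definition symmetric_algebra :: "'k ring \<Rightarrow> ('k, 'a) module \<Rightarrow> bool"
  where "symmetric_algebra K A \<longleftrightarrow> k_algebra K A \<and> bimod_iso A A (reg_bimod A) (k_dual K A) \<noteq> {}"

text \<open>The \<open>K\<close>-algebra \<open>E = End\<^sub>A(P)\<^sup>o\<^sup>p\<close>.\<close>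

definition End_op :: "('k, 'a) module \<Rightarrow> ('a, 'p) module \<Rightarrow> ('k, 'p \<Rightarrow> 'p) module"
  where "End_op A P =
    \<lparr>carrier = lmod_hom A P P \<inter> extensional (carrier P),
     monoid.mult = (\<lambda>\<phi> \<psi>. compose (carrier P) \<psi> \<phi>),
     monoid.one = (\<lambda>p\<in>carrier P. p),
     ring.zero = (\<lambda>p\<in>carrier P. \<zero>\<^bsub>P\<^esub>),
     ring.add = (\<lambda>\<phi> \<psi>. \<lambda>p\<in>carrier P. \<phi> p \<oplus>\<^bsub>P\<^esub> \<psi> p),
     smult = (\<lambda>c \<phi>. \<lambda>p\<in>carrier P. (c \<odot>\<^bsub>A\<^esub> \<one>\<^bsub>A\<^esub>) \<odot>\<^bsub>P\<^esub> \<phi> p)\<rparr>"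

definition P_bimod :: "('a, 'p) module \<Rightarrow> ('a, 'p \<Rightarrow> 'p, 'p) bimod"
  where "P_bimod P = module.extend P (bimod.fields (\<lambda>p e. e p))"

definition P_dual :: "('k, 'a) module \<Rightarrow> ('a, 'p) module \<Rightarrow> ('p \<Rightarrow> 'p, 'a, 'p \<Rightarrow> 'a) bimod"
  where "P_dual A P =
    \<lparr>carrier = lmod_hom A P (reg_bimod A) \<inter> extensional (carrier P),
     monoid.mult = undefined, monoid.one = undefined,
     ring.zero = (\<lambda>p\<in>carrier P. \<zero>\<^bsub>A\<^esub>),
     ring.add = (\<lambda>\<phi> \<psi>. \<lambda>p\<in>carrier P. \<phi> p \<oplus>\<^bsub>A\<^esub> \<psi> p),
     smult = (\<lambda>e \<phi>. \<lambda>p\<in>carrier P. \<phi> (e p)),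
     rsmult = (\<lambda>\<phi> a. \<lambda>p\<in>carrier P. \<phi> p \<otimes>\<^bsub>A\<^esub> a)\<rparr>"

definition quot_bimod :: "('r, 's, 'm) bimod \<Rightarrow> 'm set \<Rightarrow> ('r, 's, 'm set) bimod"
  where "quot_bimod M B =
    \<lparr>carrier = a_r_coset M B ` carrier M, monoid.mult = undefined, monoid.one = undefined,
     ring.zero = B, ring.add = set_add M,
     smult = (\<lambda>r U. B <+>\<^bsub>M\<^esub> smult M r ` U),
     rsmult = (\<lambda>U s. B <+>\<^bsub>M\<^esub> (\<lambda>x. rsmult M x s) ` U)\<rparr>"

definition bimod_sum :: "('r, 's, 'm) bimod \<Rightarrow> ('r, 's, 'n) bimod \<Rightarrow> ('r, 's, 'm \<times> 'n) bimod"
  where "bimod_sum M N =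
    \<lparr>carrier = carrier M \<times> carrier N, monoid.mult = undefined, monoid.one = undefined,
     ring.zero = (\<zero>\<^bsub>M\<^esub>, \<zero>\<^bsub>N\<^esub>),
     ring.add = (\<lambda>(x, y) (x', y'). (x \<oplus>\<^bsub>M\<^esub> x', y \<oplus>\<^bsub>N\<^esub> y')),
     smult = (\<lambda>r (x, y). (r \<odot>\<^bsub>M\<^esub> x, r \<odot>\<^bsub>N\<^esub> y)),
     rsmult = (\<lambda>(x, y) s. (rsmult M x s, rsmult N y s))\<rparr>"

definition dsum :: "('i \<Rightarrow> ('r, 'm) module) \<Rightarrow> ('r, 'i \<Rightarrow> 'm) module"
  where "dsum F =
    \<lparr>carrier = {u. (\<forall>i. u i \<in> carrier (F i)) \<and> finite {i. u i \<noteq> \<zero>\<^bsub>F i\<^esub>}},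
     monoid.mult = undefined, monoid.one = undefined,
     ring.zero = (\<lambda>i. \<zero>\<^bsub>F i\<^esub>),
     ring.add = (\<lambda>u v i. u i \<oplus>\<^bsub>F i\<^esub> v i),
     smult = (\<lambda>r u i. r \<odot>\<^bsub>F i\<^esub> u i)\<rparr>"


section \<open>Tensor products\<close>

text \<open>
  The tensor product of \<open>M\<close> and \<open>N\<close> over \<open>S\<close> is the quotient of the free abelian group on
  \<open>carrier M \<times> carrier N\<close> by the subgroup generated by the usual relations. All maps out of
  it (module structures, maps \<open>f \<otimes> g\<close>, evaluation) are given by \<open>tensor_lift\<close>, the group homomorphism
  induced by a balanced map \<open>\<beta>\<close>: its value on a coset is the common value of the additive extension
  of \<open>\<beta>\<close> on the elements of that coset.
\<close>

type_synonym ('m, 'n) tens = "('m \<times> 'n \<Rightarrow>\<^sub>0 int) set"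

definition tensor_relations ::
  "('r, 's, 'm) bimod \<Rightarrow> ('s, 'x) ring_scheme \<Rightarrow> ('s, 'n, 'y) module_scheme \<Rightarrow> ('m \<times> 'n \<Rightarrow>\<^sub>0 int) set"
  where "tensor_relations M S N =
    {frag_of (x \<oplus>\<^bsub>M\<^esub> x', y) - frag_of (x, y) - frag_of (x', y) | x x' y.
      x \<in> carrier M \<and> x' \<in> carrier M \<and> y \<in> carrier N} \<union>
    {frag_of (x, y \<oplus>\<^bsub>N\<^esub> y') - frag_of (x, y) - frag_of (x, y') | x y y'.
      x \<in> carrier M \<and> y \<in> carrier N \<and> y' \<in> carrier N} \<union>
    {frag_of (rsmult M x s, y) - frag_of (x, s \<odot>\<^bsub>N\<^esub> y) | x s y.
      x \<in> carrier M \<and> s \<in> carrier S \<and> y \<in> carrier N}"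

definition tensor_subgroup ::
  "('r, 's, 'm) bimod \<Rightarrow> ('s, 'x) ring_scheme \<Rightarrow> ('s, 'n, 'y) module_scheme \<Rightarrow> ('m \<times> 'n \<Rightarrow>\<^sub>0 int) set"
  where "tensor_subgroup M S N =
    generate (free_Abelian_group (carrier M \<times> carrier N)) (tensor_relations M S N)"

definition tensor_group ::
  "('r, 's, 'm) bimod \<Rightarrow> ('s, 'x) ring_scheme \<Rightarrow> ('s, 'n, 'y) module_scheme \<Rightarrow> ('m, 'n) tens ring"
  where "tensor_group M S N =
    (let Q = free_Abelian_group (carrier M \<times> carrier N) Mod tensor_subgroup M S N
     in \<lparr>carrier = carrier Q, monoid.mult = undefined, monoid.one = undefined,
           ring.zero = monoid.one Q, ring.add = monoid.mult Q\<rparr>)"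

definition pure_tensor ::
  "('r, 's, 'm) bimod \<Rightarrow> ('s, 'x) ring_scheme \<Rightarrow> ('s, 'n, 'y) module_scheme \<Rightarrow> 'm \<Rightarrow> 'n \<Rightarrow> ('m, 'n) tens"
  where "pure_tensor M S N x y =
    tensor_subgroup M S N #>\<^bsub>free_Abelian_group (carrier M \<times> carrier N)\<^esub> frag_of (x, y)"

definition additive_extension :: "('g, 'z) ring_scheme \<Rightarrow> ('b \<Rightarrow> 'g) \<Rightarrow> ('b \<Rightarrow>\<^sub>0 int) \<Rightarrow> 'g"
  where "additive_extension G \<beta> c =
    (\<Oplus>\<^bsub>G\<^esub>b \<in> Poly_Mapping.keys c. [Poly_Mapping.lookup c b] \<cdot>\<^bsub>G\<^esub> \<beta> b)"

definition tensor_lift :: "('g, 'z) ring_scheme \<Rightarrow> ('m \<Rightarrow> 'n \<Rightarrow> 'g) \<Rightarrow> ('m, 'n) tens \<Rightarrow> 'g"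
  where "tensor_lift G \<beta> U = the_elem (additive_extension G (case_prod \<beta>) ` U)"

definition tensor ::
  "('r, 's, 'm) bimod \<Rightarrow> ('s, 'x) ring_scheme \<Rightarrow> ('s, 'n, 'y) module_scheme \<Rightarrow> ('r, ('m, 'n) tens) module"
  where "tensor M S N = ring.extend (tensor_group M S N) (module.fields
    (\<lambda>r. tensor_lift (tensor_group M S N) (\<lambda>x y. pure_tensor M S N (r \<odot>\<^bsub>M\<^esub> x) y)))"

definition tensor_bimod ::
  "('r, 's, 'm) bimod \<Rightarrow> ('s, 'x) ring_scheme \<Rightarrow> ('s, 't, 'n) bimod \<Rightarrow> ('r, 't, ('m, 'n) tens) bimod"
  where "tensor_bimod M S N = module.extend (tensor M S N) (bimod.fields
    (\<lambda>u t. tensor_lift (tensor_group M S N) (\<lambda>x y. pure_tensor M S N x (rsmult N y t)) u))"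

text \<open>The map \<open>f \<otimes> g\<close>; the modules given are those of the target.\<close>

definition tensor_map ::
  "('r, 's, 'm) bimod \<Rightarrow> ('s, 'x) ring_scheme \<Rightarrow> ('s, 'n, 'y) module_scheme \<Rightarrow>
    ('m0 \<Rightarrow> 'm) \<Rightarrow> ('n0 \<Rightarrow> 'n) \<Rightarrow> ('m0, 'n0) tens \<Rightarrow> ('m, 'n) tens"
  where "tensor_map M S N f g = tensor_lift (tensor_group M S N) (\<lambda>x y. pure_tensor M S N (f x) (g y))"


section \<open>Complexes\<close>

record ('o, 'm) cpx =
  obj :: "int \<Rightarrow> 'o"
  dif :: "int \<Rightarrow> 'm \<Rightarrow> 'm"

definition stalk :: "('m, 'z) ring_scheme \<Rightarrow> (('m, 'z) ring_scheme, 'm) cpx"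
  where "stalk M = \<lparr>obj = (\<lambda>i. if i = 0 then M else M\<lparr>carrier := {\<zero>\<^bsub>M\<^esub>}\<rparr>), dif = (\<lambda>_ _. \<zero>\<^bsub>M\<^esub>)\<rparr>"

definition shift :: "int \<Rightarrow> (('m, 'z) ring_scheme, 'm) cpx \<Rightarrow> (('m, 'z) ring_scheme, 'm) cpx"
  where "shift n C =
    \<lparr>obj = (\<lambda>i. obj C (i + n)),
     dif = (\<lambda>i x. if even n then dif C (i + n) x else \<ominus>\<^bsub>obj C (i + n + 1)\<^esub> dif C (i + n) x)\<rparr>"

definition cone ::
  "(int \<Rightarrow> 'm \<Rightarrow> 'n) \<Rightarrow> (('r, 's, 'm) bimod, 'm) cpx \<Rightarrow> (('r, 's, 'n) bimod, 'n) cpx \<Rightarrow>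
    (('r, 's, 'm \<times> 'n) bimod, 'm \<times> 'n) cpx"
  where "cone g C D =
    \<lparr>obj = (\<lambda>i. bimod_sum (obj C (i + 1)) (obj D i)),
     dif = (\<lambda>i (x, y). (\<ominus>\<^bsub>obj C (i + 2)\<^esub> dif C (i + 1) x, g (i + 1) x \<oplus>\<^bsub>obj D (i + 1)\<^esub> dif D i y))\<rparr>"

text \<open>
  The total tensor product of a complex of bimodules and a complex of left modules: in degree \<open>n\<close> the
  direct sum over \<open>j\<close> of \<open>C\<^sup>j \<otimes> L\<^sup>n\<^sup>-\<^sup>j\<close>, with \<open>d(x \<otimes> y) = dx \<otimes> y + (-1)\<^sup>j x \<otimes> dy\<close> for \<open>x\<close> of degree \<open>j\<close>.
\<close>

definition tensor_cpx ::
  "(('r, 's, 'm) bimod, 'm) cpx \<Rightarrow> ('s, 'x) ring_scheme \<Rightarrow> (('s, 'n) module, 'n) cpx \<Rightarrow>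
    (('r, int \<Rightarrow> ('m, 'n) tens) module, int \<Rightarrow> ('m, 'n) tens) cpx"
  where "tensor_cpx C S L =
    \<lparr>obj = (\<lambda>n. dsum (\<lambda>j. tensor (obj C j) S (obj L (n - j)))),
     dif = (\<lambda>n u j.
       let T = tensor (obj C j) S (obj L (n + 1 - j));
           a = tensor_map (obj C j) S (obj L (n + 1 - j)) (dif C (j - 1)) (\<lambda>y. y) (u (j - 1));
           b = tensor_map (obj C j) S (obj L (n + 1 - j)) (\<lambda>x. x) (dif L (n - j)) (u j)
       in a \<oplus>\<^bsub>T\<^esub> (if even j then b else \<ominus>\<^bsub>T\<^esub> b))\<rparr>"

definition cochain_complex :: "('r, 'x) ring_scheme \<Rightarrow> (('r, 'm) module, 'm) cpx \<Rightarrow> bool"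
  where "cochain_complex R C \<longleftrightarrow> (\<forall>i. lmodule R (obj C i) \<and> dif C i \<in> lmod_hom R (obj C i) (obj C (i + 1)) \<and>
    (\<forall>x\<in>carrier (obj C i). dif C (i + 1) (dif C i x) = \<zero>\<^bsub>obj C (i + 2)\<^esub>))"

definition chain_map ::
  "('r, 'x) ring_scheme \<Rightarrow> (('r, 'm) module, 'm) cpx \<Rightarrow> (('r, 'n) module, 'n) cpx \<Rightarrow> (int \<Rightarrow> 'm \<Rightarrow> 'n) \<Rightarrow> bool"
  where "chain_map R C D \<phi> \<longleftrightarrow> (\<forall>i. \<phi> i \<in> lmod_hom R (obj C i) (obj D i) \<and>
    (\<forall>x\<in>carrier (obj C i). \<phi> (i + 1) (dif C i x) = dif D i (\<phi> i x)))"

definition homotopic ::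
  "('r, 'x) ring_scheme \<Rightarrow> (('r, 'm) module, 'm) cpx \<Rightarrow> (('r, 'n) module, 'n) cpx \<Rightarrow>
    (int \<Rightarrow> 'm \<Rightarrow> 'n) \<Rightarrow> (int \<Rightarrow> 'm \<Rightarrow> 'n) \<Rightarrow> bool"
  where "homotopic R C D \<phi> \<psi> \<longleftrightarrow> (\<exists>h. (\<forall>i. h i \<in> lmod_hom R (obj C i) (obj D (i - 1))) \<and>
    (\<forall>i. \<forall>x\<in>carrier (obj C i).
      \<phi> i x \<ominus>\<^bsub>obj D i\<^esub> \<psi> i x = dif D (i - 1) (h i x) \<oplus>\<^bsub>obj D i\<^esub> h (i + 1) (dif C i x)))"

definition cocycles :: "(('r, 'm) module, 'm) cpx \<Rightarrow> int \<Rightarrow> 'm set"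
  where "cocycles C i = {x \<in> carrier (obj C i). dif C i x = \<zero>\<^bsub>obj C (i + 1)\<^esub>}"

definition coboundaries :: "(('r, 'm) module, 'm) cpx \<Rightarrow> int \<Rightarrow> 'm set"
  where "coboundaries C i = dif C (i - 1) ` carrier (obj C (i - 1))"

definition cohomology :: "(('r, 'm) module, 'm) cpx \<Rightarrow> int \<Rightarrow> 'm set set"
  where "cohomology C i = a_r_coset (obj C i) (coboundaries C i) ` cocycles C i"

definition quasi_iso ::
  "('r, 'x) ring_scheme \<Rightarrow> (('r, 'm) module, 'm) cpx \<Rightarrow> (('r, 'n) module, 'n) cpx \<Rightarrow> (int \<Rightarrow> 'm \<Rightarrow> 'n) \<Rightarrow> bool"
  where "quasi_iso R C D \<phi> \<longleftrightarrow> chain_map R C D \<phi> \<and>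
    (\<forall>i. bij_betw (\<lambda>U. coboundaries D i <+>\<^bsub>obj D i\<^esub> \<phi> i ` U) (cohomology C i) (cohomology D i))"


section \<open>The bounded derived category\<close>

text \<open>
  The bounded derived category is the localisation of the homotopy category of bounded complexes of
  finitely generated left \<open>A\<close>-modules at the quasi-isomorphisms, with morphisms from \<open>L\<close> to \<open>M\<close>
  represented by roofs \<open>(Z, s, f)\<close>, i.e. \<open>L \<leftarrow> Z \<rightarrow> M\<close> with \<open>s : Z \<rightarrow> L\<close> a quasi-isomorphism.
  The apex \<open>Z\<close> has its modules in \<open>'k univ\<close>; for \<open>L\<close> and \<open>M\<close> any carrier types are allowed, and
  these may differ.
\<close>

definition Db :: "('k, 'a) module \<Rightarrow> (('a, 'm) module, 'm) cpx set"
  where "Db A = {C. cochain_complex A C \<and> (\<forall>i. fin_gen A (obj C i)) \<and>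
    (\<exists>N. \<forall>i. \<bar>i\<bar> > N \<longrightarrow> carrier (obj C i) = {\<zero>\<^bsub>obj C i\<^esub>})}"

type_synonym ('k, 'a) ucpx = "(('a, 'k univ) module, 'k univ) cpx"

type_synonym ('k, 'a, 'l, 'm) roof =
  "('k, 'a) ucpx \<times> (int \<Rightarrow> 'k univ \<Rightarrow> 'l) \<times> (int \<Rightarrow> 'k univ \<Rightarrow> 'm)"

definition roofs ::
  "('k, 'a) module \<Rightarrow> (('a, 'l) module, 'l) cpx \<Rightarrow> (('a, 'm) module, 'm) cpx \<Rightarrow> ('k, 'a, 'l, 'm) roof set"
  where "roofs A L M = {(Z, s, f). Z \<in> Db A \<and> quasi_iso A Z L s \<and> chain_map A Z M f}"

definition roof_equiv ::
  "('k, 'a) module \<Rightarrow> (('a, 'l) module, 'l) cpx \<Rightarrow> (('a, 'm) module, 'm) cpx \<Rightarrow>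
    ('k, 'a, 'l, 'm) roof \<Rightarrow> ('k, 'a, 'l, 'm) roof \<Rightarrow> bool"
  where "roof_equiv A L M = (\<lambda>(Z, s, f) (Z', s', f').
    \<exists>(W :: ('k, 'a) ucpx) t t'. W \<in> Db A \<and> chain_map A W Z t \<and> chain_map A W Z' t' \<and>
      quasi_iso A W L (\<lambda>i. s i \<circ> t i) \<and>
      homotopic A W L (\<lambda>i. s i \<circ> t i) (\<lambda>i. s' i \<circ> t' i) \<and>
      homotopic A W M (\<lambda>i. f i \<circ> t i) (\<lambda>i. f' i \<circ> t' i))"

text \<open>\<open>roof_comp A M r r' q\<close>: the roof \<open>q\<close> represents the composite of \<open>r : L \<rightarrow> M\<close> followed by \<open>r' : M \<rightarrow> N\<close>.\<close>

definition roof_comp ::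
  "('k, 'a) module \<Rightarrow> (('a, 'm) module, 'm) cpx \<Rightarrow>
    ('k, 'a, 'l, 'm) roof \<Rightarrow> ('k, 'a, 'm, 'n) roof \<Rightarrow> ('k, 'a, 'l, 'n) roof \<Rightarrow> bool"
  where "roof_comp A M = (\<lambda>(Z, s, f) (Z', s', f') q.
    \<exists>(W :: ('k, 'a) ucpx) t u. W \<in> Db A \<and> quasi_iso A W Z t \<and> chain_map A W Z' u \<and>
      homotopic A W M (\<lambda>i. f i \<circ> t i) (\<lambda>i. s' i \<circ> u i) \<and>
      q = (W, (\<lambda>i. s i \<circ> t i), (\<lambda>i. f' i \<circ> u i)))"

text \<open>
  A morphism represented by a roof \<open>(Z, s, f)\<close> is zero, respectively the identity of \<open>L\<close>, iff the roof
  is equivalent to \<open>(Z, s, 0)\<close>, respectively to \<open>(Z, s, s)\<close>.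
\<close>

definition roof_is_zero ::
  "('k, 'a) module \<Rightarrow> (('a, 'l) module, 'l) cpx \<Rightarrow> (('a, 'm) module, 'm) cpx \<Rightarrow> ('k, 'a, 'l, 'm) roof \<Rightarrow> bool"
  where "roof_is_zero A L M = (\<lambda>(Z, s, f). roof_equiv A L M (Z, s, f) (Z, s, \<lambda>i _. \<zero>\<^bsub>obj M i\<^esub>))"

definition roof_is_id ::
  "('k, 'a) module \<Rightarrow> (('a, 'l) module, 'l) cpx \<Rightarrow> ('k, 'a, 'l, 'l) roof \<Rightarrow> bool"
  where "roof_is_id A L = (\<lambda>(Z, s, f). roof_equiv A L L (Z, s, f) (Z, s, s))"

definition Db_iso ::
  "('k, 'a) module \<Rightarrow> (('a, 'l) module, 'l) cpx \<Rightarrow> (('a, 'm) module, 'm) cpx \<Rightarrow> bool"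
  where "Db_iso A L M \<longleftrightarrow> L \<in> Db A \<and> M \<in> Db A \<and>
    (\<exists>r \<in> roofs A L M. \<exists>r' \<in> roofs A M L. \<exists>q q'.
      roof_comp A M r r' q \<and> roof_is_id A L q \<and> roof_comp A L r' r q' \<and> roof_is_id A M q')"

definition perp :: "('k, 'a) module \<Rightarrow> ('a, 'p) module \<Rightarrow> (('a, 'l) module, 'l) cpx set"
  where "perp A P = {L \<in> Db A. \<forall>i. \<forall>r \<in> roofs A (stalk P) (shift i L). roof_is_zero A (stalk P) (shift i L) r}"


section \<open>Twisted-periodic algebras and periodic twists\<close>

text \<open>
  The image of the map ending in \<open>Y\<^sup>i\<close> in the sequence
  \<open>0 \<rightarrow> E\<^sub>\<sigma> \<rightarrow> P\<^sub>n\<^sub>-\<^sub>1 \<rightarrow> \<dots> \<rightarrow> P\<^sub>0\<close>, where \<open>P\<^sub>j = Y\<^sup>-\<^sup>j\<close> and the first map is \<open>\<iota>\<close>.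
\<close>

definition incoming_image ::
  "('e, 'x) ring_scheme \<Rightarrow> nat \<Rightarrow> (('e, 'e, 'y) bimod, 'y) cpx \<Rightarrow> ('e \<Rightarrow> 'y) \<Rightarrow> int \<Rightarrow> 'y set"
  where "incoming_image E n Y \<iota> i =
    (if i = 1 - int n then \<iota> ` carrier E else dif Y (i - 1) ` carrier (obj Y (i - 1)))"

text \<open>
  The data of a twisted-periodic structure of period \<open>n\<close> on \<open>E\<close>: the automorphism \<open>\<sigma>\<close>, the truncated
  resolution \<open>Y\<close>, the isomorphism \<open>\<iota>\<close> from \<open>E\<^sub>\<sigma>\<close> to the kernel of \<open>d\<^sub>n\<^sub>-\<^sub>1\<close>, and the isomorphism \<open>h\<close>
  from the cokernel of \<open>d\<^sub>1\<close> to \<open>E\<close>. For \<open>n = 1\<close> there are no differentials between the \<open>P\<^sub>j\<close>, and the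
  data amount to a short exact sequence \<open>0 \<rightarrow> E\<^sub>\<sigma> \<rightarrow> P\<^sub>0 \<rightarrow> E \<rightarrow> 0\<close>: here \<open>d\<^sub>1\<close> is read as \<open>\<iota>\<close>.
\<close>

definition truncated_resolution ::
  "'k ring \<Rightarrow> ('k, 'e) module \<Rightarrow> nat \<Rightarrow> ('e \<Rightarrow> 'e) \<Rightarrow> (('e, 'e, 'y) bimod, 'y) cpx \<Rightarrow>
    ('e \<Rightarrow> 'y) \<Rightarrow> ('y set \<Rightarrow> 'e) \<Rightarrow> bool"
  where "truncated_resolution K E n \<sigma> Y \<iota> h \<longleftrightarrow>
    n \<ge> 1 \<and>
    \<sigma> \<in> ring_iso E E \<and> (\<forall>c\<in>carrier K. \<forall>x\<in>carrier E. \<sigma> (c \<odot>\<^bsub>E\<^esub> x) = c \<odot>\<^bsub>E\<^esub> \<sigma> x) \<and>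
    (\<forall>i. projective_bimodule K E E (obj Y i) \<and> bimod_fin_gen E E (obj Y i) \<and>
      dif Y i \<in> bimod_hom E E (obj Y i) (obj Y (i + 1))) \<and>
    (\<forall>i. i < 1 - int n \<or> i > 0 \<longrightarrow> carrier (obj Y i) = {\<zero>\<^bsub>obj Y i\<^esub>}) \<and>
    \<iota> \<in> bimod_hom E E (twisted_reg E \<sigma>) (obj Y (1 - int n)) \<and> inj_on \<iota> (carrier E) \<and>
    (\<forall>i. 1 - int n \<le> i \<and> i < 0 \<longrightarrow>
      {x \<in> carrier (obj Y i). dif Y i x = \<zero>\<^bsub>obj Y (i + 1)\<^esub>} = incoming_image E n Y \<iota> i) \<and>
    h \<in> bimod_iso E E (quot_bimod (obj Y 0) (incoming_image E n Y \<iota> 0)) (reg_bimod E)"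

text \<open>The degree-zero component of the map of complexes \<open>f : Y \<rightarrow> E\<close>; all other components are zero.\<close>

definition augmentation ::
  "('e, 'x) ring_scheme \<Rightarrow> nat \<Rightarrow> (('e, 'e, 'y) bimod, 'y) cpx \<Rightarrow> ('e \<Rightarrow> 'y) \<Rightarrow> ('y set \<Rightarrow> 'e) \<Rightarrow> 'y \<Rightarrow> 'e"
  where "augmentation E n Y \<iota> h y = h (incoming_image E n Y \<iota> 0 +>\<^bsub>obj Y 0\<^esub> y)"

definition sandwich ::
  "('k, 'a) module \<Rightarrow> ('a, 'p) module \<Rightarrow> (('p \<Rightarrow> 'p, 'p \<Rightarrow> 'p, 'y) bimod, 'y) cpx \<Rightarrow>
    (('a, 'a, (('p, 'y) tens, 'p \<Rightarrow> 'a) tens) bimod, (('p, 'y) tens, 'p \<Rightarrow> 'a) tens) cpx"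
  where "sandwich A P Y = (let E = End_op A P in
    \<lparr>obj = (\<lambda>i. tensor_bimod (tensor_bimod (P_bimod P) E (obj Y i)) E (P_dual A P)),
     dif = (\<lambda>i. tensor_map (tensor_bimod (P_bimod P) E (obj Y (i + 1))) E (P_dual A P)
       (tensor_map (P_bimod P) E (obj Y (i + 1)) (\<lambda>p. p) (dif Y i)) (\<lambda>\<phi>. \<phi>))\<rparr>)"

definition evaluation ::
  "('k, 'a) module \<Rightarrow> ('p, 'p \<Rightarrow> 'a) tens \<Rightarrow> 'a"
  where "evaluation A = tensor_lift A (\<lambda>p \<phi>. \<phi> p)"

definition twist_map ::
  "('k, 'a) module \<Rightarrow> ('a, 'p) module \<Rightarrow> (('p \<Rightarrow> 'p, 'p \<Rightarrow> 'p, 'y) bimod, 'y) cpx \<Rightarrow>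
    ('y \<Rightarrow> 'p \<Rightarrow> 'p) \<Rightarrow> int \<Rightarrow> (('p, 'y) tens, 'p \<Rightarrow> 'a) tens \<Rightarrow> 'a"
  where "twist_map A P Y f i = (let E = End_op A P in
    if i = 0 then
      evaluation A
      \<circ> tensor_map (P_bimod P) E (P_dual A P) (tensor_lift P (\<lambda>p e. rsmult (P_bimod P) p e)) (\<lambda>\<phi>. \<phi>)
      \<circ> tensor_map (tensor_bimod (P_bimod P) E (reg_bimod E)) E (P_dual A P)
          (tensor_map (P_bimod P) E (reg_bimod E) (\<lambda>p. p) f) (\<lambda>\<phi>. \<phi>)
    else (\<lambda>_. \<zero>\<^bsub>A\<^esub>))"

text \<open>
  The complex \<open>X\<close> and the periodic twist \<open>X \<otimes>\<^sub>A -\<close> on objects. All terms of \<open>X\<close> are projective as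
  right \<open>A\<close>-modules, so the underived tensor product of complexes is the functor on the derived category.
\<close>

definition twist_complex ::
  "('k, 'a) module \<Rightarrow> ('a, 'p) module \<Rightarrow> nat \<Rightarrow> (('p \<Rightarrow> 'p, 'p \<Rightarrow> 'p, 'y) bimod, 'y) cpx \<Rightarrow>
    (('p \<Rightarrow> 'p) \<Rightarrow> 'y) \<Rightarrow> ('y set \<Rightarrow> 'p \<Rightarrow> 'p) \<Rightarrow>
    (('a, 'a, (('p, 'y) tens, 'p \<Rightarrow> 'a) tens \<times> 'a) bimod, (('p, 'y) tens, 'p \<Rightarrow> 'a) tens \<times> 'a) cpx"
  where "twist_complex A P n Y \<iota> h =
    cone (twist_map A P Y (augmentation (End_op A P) n Y \<iota> h)) (sandwich A P Y) (stalk (reg_bimod A))"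

definition periodic_twist ::
  "('k, 'a) module \<Rightarrow> ('a, 'p) module \<Rightarrow> nat \<Rightarrow> (('p \<Rightarrow> 'p, 'p \<Rightarrow> 'p, 'y) bimod, 'y) cpx \<Rightarrow>
    (('p \<Rightarrow> 'p) \<Rightarrow> 'y) \<Rightarrow> ('y set \<Rightarrow> 'p \<Rightarrow> 'p) \<Rightarrow> (('a, 'l) module, 'l) cpx \<Rightarrow>
    (('a, int \<Rightarrow> ((('p, 'y) tens, 'p \<Rightarrow> 'a) tens \<times> 'a, 'l) tens) module,
      int \<Rightarrow> ((('p, 'y) tens, 'p \<Rightarrow> 'a) tens \<times> 'a, 'l) tens) cpx"
  where "periodic_twist A P n Y \<iota> h L = tensor_cpx (twist_complex A P n Y \<iota> h) A L"

end

theory Submission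
 imports Defs
begin

text \<open>
  Write \<open>P\<^sup>\<or> = Hom\<^sub>A(P, A)\<close>. Since \<open>Y\<close> lives in degrees \<open>1 - n, \<dots>, 0\<close>, the complex \<open>X\<close> lives in degrees
  \<open>-n, \<dots>, 0\<close>: its term in degree \<open>j < 0\<close> is the sandwich \<open>P \<otimes> Y\<^sup>j\<^sup>+\<^sup>1 \<otimes> P\<^sup>\<or>\<close> over \<open>E\<close>, and its term in degree \<open>0\<close>
  is \<open>A\<close>. Both claims rest on one computation. As \<open>P\<close> is finitely generated projective, there is a dual
  basis, that is, an element \<open>\<omega> = \<Sum> \<phi>\<^sub>b \<otimes> b\<close> of \<open>P\<^sup>\<or> \<otimes>\<^sub>A P\<close> with \<open>\<Sum> \<phi>\<^sub>b(p) b = p\<close> for all \<open>p\<close>. It gives natural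
  isomorphisms between \<open>T \<otimes>\<^sub>E P\<^sup>\<or> \<otimes>\<^sub>A L\<close> and \<open>T \<otimes>\<^sub>E Hom\<^sub>A(P, L)\<close> for every bimodule \<open>T\<close> and module \<open>L\<close>
  (\<open>hom_a\<close>, \<open>hom_b\<close>).

  Let \<open>L\<close> be in the orthogonal of \<open>P\<close>. Then the complex of \<open>E\<close>-modules \<open>Hom\<^sub>A(P, L)\<close> is exact (\<open>perp_exact\<close>). The
  bimodule \<open>Y\<^sup>i\<close> is projective, hence a direct summand of \<open>Y\<^sup>i \<otimes>\<^sub>K E\<close>; so \<open>P \<otimes>\<^sub>E Y\<^sup>i\<close> is a direct summand of a
  right \<open>E\<close>-module induced from \<open>K\<close> (\<open>right_split_tensor\<close>), and tensoring with it preserves exactness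
  (\<open>right_split_exact\<close>). Therefore all rows \<open>X\<^sup>j \<otimes>\<^sub>A L\<close> with \<open>j < 0\<close> of the double complex are exact, and its total
  complex is quasi-isomorphic to the row \<open>j = 0\<close>, which is \<open>L\<close> (\<open>row_quasi_iso\<close>, \<open>twist_perp\<close>).

  For \<open>L = P\<close> the same isomorphisms and \<open>Hom\<^sub>A(P, P) = E\<close> turn \<open>X \<otimes>\<^sub>A P\<close>, up to signs, into
  \<open>P \<otimes> Y\<^sup>1\<^sup>-\<^sup>n \<rightarrow> \<dots> \<rightarrow> P \<otimes> Y\<^sup>0 \<rightarrow> P \<otimes> E\<close>. The sequence \<open>0 \<rightarrow> E\<^sub>\<sigma> \<rightarrow> Y\<^sup>1\<^sup>-\<^sup>n \<rightarrow> \<dots> \<rightarrow> Y\<^sup>0 \<rightarrow> E \<rightarrow> 0\<close> consists of projective left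
  \<open>E\<close>-modules, so it splits as a sequence of left modules and stays exact after applying \<open>P \<otimes>\<^sub>E -\<close>
  (\<open>splitting_step\<close>, \<open>PY_exact\<close>, \<open>PY_bottom\<close>). The only cohomology is thus that of degree \<open>-n\<close>, and \<open>p \<mapsto> p \<otimes> \<iota>(1)\<close>
  identifies it with \<open>P\<close>; the twist \<open>\<sigma>\<close> affects only the right action and disappears (\<open>twist_P\<close>).

  Quasi-isomorphisms \<open>L \<leftarrow> Z \<rightarrow> M\<close> yield an isomorphism in the derived category (\<open>Db_iso_of_quasi_isos\<close>). Finite
  dimension over \<open>K\<close> enters twice: it allows finitely generated modules to be replaced by copies in \<open>'k univ\<close>,
  where projectivity is tested and where roofs have their apex, and it provides linear sections.
\<close>

text \<open>
  Short forms of constants that occur in almost every statement. \<open>scalar R c\<close> is the image of \<open>c\<close> under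
  \<open>K \<rightarrow> R\<close>; the ground field acts on every module through it.
\<close>

abbreviation (input) "scalar R c \<equiv> c \<odot>\<^bsub>R\<^esub> \<one>\<^bsub>R\<^esub>"
abbreviation (input) "car \<equiv> carrier"
abbreviation (input) "pure \<equiv> pure_tensor"
abbreviation (input) "tgrp \<equiv> tensor_group"
abbreviation (input) "lift \<equiv> tensor_lift"
abbreviation (input) "tbim \<equiv> tensor_bimod"
abbreviation (input) "tmap \<equiv> tensor_map"
abbreviation (input) "reg \<equiv> reg_bimod"
abbreviation (input) "bdry \<equiv> coboundaries"

section \<open>Additive maps and tensor products\<close>

lemmas (in abelian_group) abg = abelian_group_axioms

lemma (in abelian_group) a_inv_zero [simp]: "\<ominus> \<zero> = \<zero>"
 using add.inv_one by (simp add: a_inv_def)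

text \<open>
  Only the carriers and additions of the two records enter, so that the same notion serves for rings,
  modules, bimodules and tensor products.
\<close>

definition add_hom :: "('a, 'x) ring_scheme => ('b, 'y) ring_scheme => ('a => 'b) set"
 where "add_hom G H = {f \<in> car G \<rightarrow> car H.
  \<forall>x\<in>car G. \<forall>y\<in>car G. f (x \<oplus>\<^bsub>G\<^esub> y) = f x \<oplus>\<^bsub>H\<^esub> f y}"

lemma add_homI:
 "[|!!x. x \<in> car G ==> f x \<in> car H;
  !!x y. [|x \<in> car G; y \<in> car G|] ==> f (x \<oplus>\<^bsub>G\<^esub> y) = f x \<oplus>\<^bsub>H\<^esub> f y|] ==> f \<in> add_hom G H"
 by (auto simp: add_hom_def)

lemma add_hom_closed: "[|f \<in> add_hom G H; x \<in> car G|] ==> f x \<in> car H"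
 by (auto simp: add_hom_def)

lemma add_hom_add:
 "[|f \<in> add_hom G H; x \<in> car G; y \<in> car G|] ==> f (x \<oplus>\<^bsub>G\<^esub> y) = f x \<oplus>\<^bsub>H\<^esub> f y"
 by (auto simp: add_hom_def)

lemma add_hom_zero:
 assumes "abelian_group G" "abelian_group H" "f \<in> add_hom G H"
 shows "f \<zero>\<^bsub>G\<^esub> = \<zero>\<^bsub>H\<^esub>"
proof -
 interpret G: abelian_group G by fact
 interpret H: abelian_group H by fact
 have "f \<zero>\<^bsub>G\<^esub> \<oplus>\<^bsub>H\<^esub> f \<zero>\<^bsub>G\<^esub> = f \<zero>\<^bsub>G\<^esub>"
  using add_hom_add[OF assms(3), of "\<zero>\<^bsub>G\<^esub>" "\<zero>\<^bsub>G\<^esub>"] by simp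
 then show ?thesis
  using add_hom_closed[OF assms(3), of "\<zero>\<^bsub>G\<^esub>"]
  by (metis H.add.l_cancel_one H.zero_closed G.zero_closed)
qed

lemma add_hom_neg:
 assumes "abelian_group G" "abelian_group H" "f \<in> add_hom G H" "x \<in> car G"
 shows "f (\<ominus>\<^bsub>G\<^esub> x) = \<ominus>\<^bsub>H\<^esub> f x"
proof -
 interpret G: abelian_group G by fact
 interpret H: abelian_group H by fact
 have "f (\<ominus>\<^bsub>G\<^esub> x) \<oplus>\<^bsub>H\<^esub> f x = \<zero>\<^bsub>H\<^esub>"
  using add_hom_add[OF assms(3), of "\<ominus>\<^bsub>G\<^esub> x" x] assms(4) add_hom_zero[OF assms(1-3)]
  by (simp add: G.l_neg)
 then show ?thesis
  using add_hom_closed[OF assms(3)] assms(4) by (metis G.a_inv_closed H.minus_equality)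
qed

lemma add_hom_minus:
 assumes "abelian_group G" "abelian_group H" "f \<in> add_hom G H" "x \<in> car G" "y \<in> car G"
 shows "f (x \<ominus>\<^bsub>G\<^esub> y) = f x \<ominus>\<^bsub>H\<^esub> f y"
 using assms
 by (simp add: a_minus_def add_hom_add[OF assms(3)] add_hom_neg[OF assms(1-3)] abelian_group.a_inv_closed)

lemma add_hom_comp:
 "[|f \<in> add_hom G H; g \<in> add_hom H J|] ==> (%x. g (f x)) \<in> add_hom G J"
 by (auto simp: add_hom_def Pi_iff)

lemma add_hom_plus:
 assumes "abelian_group H" "f \<in> add_hom G H" "g \<in> add_hom G H"
 shows "(%x. f x \<oplus>\<^bsub>H\<^esub> g x) \<in> add_hom G H"
proof -
 interpret H: abelian_group H by fact
 show ?thesis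
  using assms(2,3) by (auto simp: add_hom_def H.a_ac Pi_iff)
qed

lemma add_hom_uminus:
 assumes "abelian_group H" "f \<in> add_hom G H"
 shows "(%x. \<ominus>\<^bsub>H\<^esub> f x) \<in> add_hom G H"
proof -
 interpret H: abelian_group H by fact
 show ?thesis
  using assms(2) by (auto simp: add_hom_def H.minus_add Pi_iff)
qed

lemma add_hom_id: "(%x. x) \<in> add_hom G G"
 by (auto simp: add_hom_def)

lemma add_hom_const_zero: "abelian_group H ==> (%x. \<zero>\<^bsub>H\<^esub>) \<in> add_hom G H"
 by (auto simp: add_hom_def abelian_group.axioms abelian_monoid.zero_closed abelian_monoid.l_zero)

definition balanced where
 "balanced M S N G \<beta> \<longleftrightarrow>
  (\<forall>x\<in>car M. \<forall>y\<in>car N. \<beta> x y \<in> car G) \<and>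
  (\<forall>x\<in>car M. \<forall>x'\<in>car M. \<forall>y\<in>car N. \<beta> (x \<oplus>\<^bsub>M\<^esub> x') y = \<beta> x y \<oplus>\<^bsub>G\<^esub> \<beta> x' y) \<and>
  (\<forall>x\<in>car M. \<forall>y\<in>car N. \<forall>y'\<in>car N. \<beta> x (y \<oplus>\<^bsub>N\<^esub> y') = \<beta> x y \<oplus>\<^bsub>G\<^esub> \<beta> x y') \<and>
  (\<forall>x\<in>car M. \<forall>s\<in>car S. \<forall>y\<in>car N. \<beta> (rsmult M x s) y = \<beta> x (s \<odot>\<^bsub>N\<^esub> y))"

lemma balancedI:
 assumes "!!x y. [|x \<in> car M; y \<in> car N|] ==> \<beta> x y \<in> car G"
  and "!!x x' y. [|x \<in> car M; x' \<in> car M; y \<in> car N|] ==> \<beta> (x \<oplus>\<^bsub>M\<^esub> x') y = \<beta> x y \<oplus>\<^bsub>G\<^esub> \<beta> x' y"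
  and "!!x y y'. [|x \<in> car M; y \<in> car N; y' \<in> car N|] ==> \<beta> x (y \<oplus>\<^bsub>N\<^esub> y') = \<beta> x y \<oplus>\<^bsub>G\<^esub> \<beta> x y'"
  and "!!x s y. [|x \<in> car M; s \<in> car S; y \<in> car N|] ==> \<beta> (rsmult M x s) y = \<beta> x (s \<odot>\<^bsub>N\<^esub> y)"
 shows "balanced M S N G \<beta>"
 using assms by (auto simp: balanced_def)

lemma balancedD:
 assumes "balanced M S N G \<beta>"
 shows "[|x \<in> car M; y \<in> car N|] ==> \<beta> x y \<in> car G"
  and "[|x \<in> car M; x' \<in> car M; y \<in> car N|] ==> \<beta> (x \<oplus>\<^bsub>M\<^esub> x') y = \<beta> x y \<oplus>\<^bsub>G\<^esub> \<beta> x' y"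
  and "[|x \<in> car M; y \<in> car N; y' \<in> car N|] ==> \<beta> x (y \<oplus>\<^bsub>N\<^esub> y') = \<beta> x y \<oplus>\<^bsub>G\<^esub> \<beta> x y'"
  and "[|x \<in> car M; s \<in> car S; y \<in> car N|] ==> \<beta> (rsmult M x s) y = \<beta> x (s \<odot>\<^bsub>N\<^esub> y)"
 using assms unfolding balanced_def by blast+

lemma additive_extension_superset:
 assumes "abelian_group G" "!!b. b \<in> T ==> \<beta> b \<in> car G" "finite T" "Poly_Mapping.keys c \<subseteq> T"
 shows "additive_extension G \<beta> c = (\<Oplus>\<^bsub>G\<^esub>b\<in>T. [Poly_Mapping.lookup c b] \<cdot>\<^bsub>G\<^esub> \<beta> b)"
proof -
 interpret abelian_group G by fact
 have "[(0::int)] \<cdot>\<^bsub>G\<^esub> x = \<zero>\<^bsub>G\<^esub>" for x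
  by (simp add: add_pow_def)
 then show ?thesis
  unfolding additive_extension_def
  by (intro add.finprod_mono_neutral_cong_left)
   (use assms in "auto simp: in_keys_iff add.int_pow_closed")
qed

lemma additive_extension_add_hom:
 assumes "abelian_group G" "!!b. b \<in> B ==> \<beta> b \<in> car G"
  and "Poly_Mapping.keys c \<subseteq> B" "Poly_Mapping.keys c' \<subseteq> B"
 shows "additive_extension G \<beta> c \<in> car G"
  and "additive_extension G \<beta> (c + c') = additive_extension G \<beta> c \<oplus>\<^bsub>G\<^esub> additive_extension G \<beta> c'"
proof -
 interpret abelian_group G by fact
 define T where "T = Poly_Mapping.keys c \<union> Poly_Mapping.keys c'"
 have T: "finite T" "!!b. b \<in> T ==> \<beta> b \<in> car G"
  using assms by (auto simp: T_def)
 show "additive_extension G \<beta> c \<in> car G"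
  unfolding additive_extension_def
  by (rule add.finprod_closed) (use assms in "auto simp: add.int_pow_closed")
 have "additive_extension G \<beta> (c + c') = (\<Oplus>\<^bsub>G\<^esub>b\<in>T. [Poly_Mapping.lookup (c + c') b] \<cdot>\<^bsub>G\<^esub> \<beta> b)"
  by (rule additive_extension_superset[OF assms(1) T(2,1)]) (use keys_add[of c c'] in "auto simp: T_def")
 also have "\<dots> = (\<Oplus>\<^bsub>G\<^esub>b\<in>T. [Poly_Mapping.lookup c b] \<cdot>\<^bsub>G\<^esub> \<beta> b \<oplus>\<^bsub>G\<^esub> [Poly_Mapping.lookup c' b] \<cdot>\<^bsub>G\<^esub> \<beta> b)"
  by (rule add.finprod_cong') (use T in "auto simp: lookup_add add.int_pow_mult add.int_pow_closed")
 also have "\<dots> = (\<Oplus>\<^bsub>G\<^esub>b\<in>T. [Poly_Mapping.lookup c b] \<cdot>\<^bsub>G\<^esub> \<beta> b) \<oplus>\<^bsub>G\<^esub> (\<Oplus>\<^bsub>G\<^esub>b\<in>T. [Poly_Mapping.lookup c' b] \<cdot>\<^bsub>G\<^esub> \<beta> b)"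
  by (rule add.finprod_multf) (use T in "auto simp: add.int_pow_closed")
 also have "\<dots> = additive_extension G \<beta> c \<oplus>\<^bsub>G\<^esub> additive_extension G \<beta> c'"
  using additive_extension_superset[OF assms(1) T(2,1), where c = c] additive_extension_superset[OF assms(1) T(2,1), where c = c']
  by (auto simp: T_def)
 finally show "additive_extension G \<beta> (c + c') = additive_extension G \<beta> c \<oplus>\<^bsub>G\<^esub> additive_extension G \<beta> c'" .
qed

lemma additive_extension_frag_of:
 assumes "abelian_group G" "\<beta> b \<in> car G"
 shows "additive_extension G \<beta> (frag_of b) = \<beta> b"
proof -
 interpret abelian_group G by fact
 show ?thesis
  using assms(2) by (simp add: additive_extension_def)
qed

lemma additive_extension_hom:
 assumes "abelian_group G" "!!b. b \<in> B ==> \<beta> b \<in> car G"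
 shows "additive_extension G \<beta> \<in> hom (free_Abelian_group B) (add_monoid G)"
 by (rule homI) (auto simp: additive_extension_add_hom[OF assms, where B = B])

lemma tensor_simps [simp]:
 "car (tensor M S N) = car (tgrp M S N)"
 "ring.zero (tensor M S N) = ring.zero (tgrp M S N)"
 "ring.add (tensor M S N) = ring.add (tgrp M S N)"
 "car (tbim M S N') = car (tgrp M S N')"
 "ring.zero (tbim M S N') = ring.zero (tgrp M S N')"
 "ring.add (tbim M S N') = ring.add (tgrp M S N')"
 by (simp_all add: tensor_def tensor_bimod_def module.defs ring.defs bimod.defs)

lemma tensor_smult_def:
 "smult (tensor M S N) = (%r. lift (tgrp M S N) (%x y. pure M S N (r \<odot>\<^bsub>M\<^esub> x) y))"
 "smult (tbim M S N') = (%r. lift (tgrp M S N') (%x y. pure M S N' (r \<odot>\<^bsub>M\<^esub> x) y))"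
 "rsmult (tbim M S N') = (%u t. lift (tgrp M S N') (%x y. pure M S N' x (rsmult N' y t)) u)"
 by (simp_all add: tensor_def tensor_bimod_def module.defs ring.defs bimod.defs)

text \<open>
  The data that the construction of the tensor product uses. The subgroup of relations is normal, and \<open>Q\<close> is
  the quotient group that underlies \<open>tensor_group\<close>.
\<close>

locale tensor_pair = M: abelian_group M + N: abelian_group N
 for M :: "('r, 's, 'm) bimod" and S :: "('s, 'x) ring_scheme" and N :: "('s, 'n, 'y) module_scheme" +
 assumes rsmult_closed [simp]: "[|x \<in> car M; s \<in> car S|] ==> rsmult M x s \<in> car M"
  and lsmult_closed [simp]: "[|s \<in> car S; y \<in> car N|] ==> s \<odot>\<^bsub>N\<^esub> y \<in> car N"
begin

abbreviation "F \<equiv> free_Abelian_group (car M \<times> car N)"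

lemma relations_closed: "tensor_relations M S N \<subseteq> car F"
proof
 fix r assume "r \<in> tensor_relations M S N"
 moreover have "frag_of a - frag_of b \<in> car F"
  if "a \<in> car M \<times> car N" "b \<in> car M \<times> car N" for a b
  using that keys_diff[of "frag_of a" "frag_of b"] by auto
 moreover have "frag_of a - frag_of b - frag_of c \<in> car F"
  if "a \<in> car M \<times> car N" "b \<in> car M \<times> car N" "c \<in> car M \<times> car N" for a b c
  using that keys_diff[of "frag_of a" "frag_of b"] keys_diff[of "frag_of a - frag_of b" "frag_of c"] by fastforce
 ultimately show "r \<in> car F"
  unfolding tensor_relations_def by (elim UnE CollectE exE conjE) (simp_all del: carrier_free_Abelian_group_iff)
qed

sublocale F: comm_group F
 by (rule abelian_free_Abelian_group)

lemma H_subgroup: "subgroup (tensor_subgroup M S N) F"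
 unfolding tensor_subgroup_def by (rule F.generate_is_subgroup) (rule relations_closed)

lemma H_normal: "tensor_subgroup M S N \<lhd> F"
 by (rule F.subgroup_imp_normal[OF H_subgroup])

sublocale Q: comm_group "F Mod tensor_subgroup M S N"
 by (rule F.abelian_FactGroup[OF H_subgroup])

lemma group_simps:
 "car (tgrp M S N) = car (F Mod tensor_subgroup M S N)"
 "ring.zero (tgrp M S N) = \<one>\<^bsub>F Mod tensor_subgroup M S N\<^esub>"
 "ring.add (tgrp M S N) = monoid.mult (F Mod tensor_subgroup M S N)"
 by (simp_all add: tensor_group_def Let_def)

sublocale T: abelian_group "tgrp M S N"
proof (rule abelian_groupI)
 fix x assume "x \<in> car (tgrp M S N)"
 then show "\<exists>y\<in>car (tgrp M S N). y \<oplus>\<^bsub>tgrp M S N\<^esub> x = \<zero>\<^bsub>tgrp M S N\<^esub>"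
  unfolding group_simps using Q.l_inv_ex by blast
qed (simp_all only: group_simps Q.m_ac Q.l_one Q.r_one Q.m_closed Q.one_closed)

lemma frag_closed: "[|x \<in> car M; y \<in> car N|] ==> frag_of (x, y) \<in> car F"
 by simp

lemma coset_closed: "c \<in> car F ==> tensor_subgroup M S N #>\<^bsub>F\<^esub> c \<in> car (tgrp M S N)"
 unfolding group_simps FactGroup_def RCOSETS_def by auto

lemma pure_closed [simp]:
 "[|x \<in> car M; y \<in> car N|] ==> pure M S N x y \<in> car (tgrp M S N)"
 unfolding pure_tensor_def by (rule coset_closed) simp

lemma coset_add:
 "[|c \<in> car F; c' \<in> car F|] ==> (tensor_subgroup M S N #>\<^bsub>F\<^esub> c) \<oplus>\<^bsub>tgrp M S N\<^esub> (tensor_subgroup M S N #>\<^bsub>F\<^esub> c')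
  = tensor_subgroup M S N #>\<^bsub>F\<^esub> (c + c')"
 unfolding group_simps FactGroup_def by (simp add: normal.rcos_sum[OF H_normal])

lemma coset_eqI:
 assumes "c \<in> car F" "c' \<in> car F" "c - c' \<in> tensor_subgroup M S N"
 shows "tensor_subgroup M S N #>\<^bsub>F\<^esub> c = tensor_subgroup M S N #>\<^bsub>F\<^esub> c'"
proof -
 have "c \<in> tensor_subgroup M S N #>\<^bsub>F\<^esub> c'"
  using assms(3) by (force simp: r_coset_def)
 then show ?thesis
  using F.repr_independence[OF _ assms(2) H_subgroup] by simp
qed

lemma frag_diff_closed: "[|a \<in> car F; b \<in> car F|] ==> a + b \<in> car F"
 using F.m_closed[of a b] by simp

lemma pure_add_left:
 assumes "x \<in> car M" "x' \<in> car M" "y \<in> car N"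
 shows "pure M S N (x \<oplus>\<^bsub>M\<^esub> x') y = pure M S N x y \<oplus>\<^bsub>tgrp M S N\<^esub> pure M S N x' y"
proof -
 have "frag_of (x \<oplus>\<^bsub>M\<^esub> x', y) - frag_of (x, y) - frag_of (x', y) \<in> tensor_subgroup M S N"
  unfolding tensor_subgroup_def
  by (rule generate.incl) (use assms in "auto simp: tensor_relations_def")
 then show ?thesis
  unfolding pure_tensor_def
  by (subst coset_add, use assms in simp, use assms in simp, intro coset_eqI frag_closed frag_diff_closed)
   (use assms in "simp_all add: diff_diff_eq")
qed

lemma pure_add_right:
 assumes "x \<in> car M" "y \<in> car N" "y' \<in> car N"
 shows "pure M S N x (y \<oplus>\<^bsub>N\<^esub> y') = pure M S N x y \<oplus>\<^bsub>tgrp M S N\<^esub> pure M S N x y'"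
proof -
 have "frag_of (x, y \<oplus>\<^bsub>N\<^esub> y') - frag_of (x, y) - frag_of (x, y') \<in> tensor_subgroup M S N"
  unfolding tensor_subgroup_def
  by (rule generate.incl) (use assms in "auto simp: tensor_relations_def")
 then show ?thesis
  unfolding pure_tensor_def
  by (subst coset_add, use assms in simp, use assms in simp, intro coset_eqI frag_closed frag_diff_closed)
   (use assms in "simp_all add: diff_diff_eq")
qed

lemma pure_middle:
 assumes "x \<in> car M" "s \<in> car S" "y \<in> car N"
 shows "pure M S N (rsmult M x s) y = pure M S N x (s \<odot>\<^bsub>N\<^esub> y)"
 unfolding pure_tensor_def
proof (rule coset_eqI)
 show "frag_of (rsmult M x s, y) - frag_of (x, s \<odot>\<^bsub>N\<^esub> y) \<in> tensor_subgroup M S N"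
  unfolding tensor_subgroup_def
  by (rule generate.incl) (use assms in "auto simp: tensor_relations_def")
qed (use assms in auto)

lemma pure_zero_left [simp]:
 "y \<in> car N ==> pure M S N \<zero>\<^bsub>M\<^esub> y = \<zero>\<^bsub>tgrp M S N\<^esub>"
 by (rule add_hom_zero[OF M.abg T.abg, of "%x. pure M S N x y"])
  (simp_all add: add_hom_def pure_add_left)

lemma pure_zero_right [simp]:
 "x \<in> car M ==> pure M S N x \<zero>\<^bsub>N\<^esub> = \<zero>\<^bsub>tgrp M S N\<^esub>"
 by (rule add_hom_zero[OF N.abg T.abg, of "pure M S N x"])
  (simp_all add: add_hom_def pure_add_right)

lemma pure_neg_left:
 "[|x \<in> car M; y \<in> car N|] ==> pure M S N (\<ominus>\<^bsub>M\<^esub> x) y = \<ominus>\<^bsub>tgrp M S N\<^esub> pure M S N x y"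
 by (rule add_hom_neg[OF M.abg T.abg, of "%x. pure M S N x y"])
  (simp_all add: add_hom_def pure_add_left)

text \<open>
  The negative of a pure tensor is pure, so sums of pure tensors already form a subgroup; it contains the
  classes of the generators.
\<close>

lemma tensor_induct [consumes 1, case_names pure add]:
 assumes "u \<in> car (tgrp M S N)"
  and pure: "!!x y. [|x \<in> car M; y \<in> car N|] ==> P (pure M S N x y)"
  and add: "!!u v. [|u \<in> car (tgrp M S N); v \<in> car (tgrp M S N); P u; P v|]
   ==> P (u \<oplus>\<^bsub>tgrp M S N\<^esub> v)"
 shows "P u"
proof -
 obtain c where c: "c \<in> car F" "u = tensor_subgroup M S N #>\<^bsub>F\<^esub> c"
  using assms(1) unfolding group_simps FactGroup_def RCOSETS_def by auto
 have zero: "P \<zero>\<^bsub>tgrp M S N\<^esub>"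
  using pure[of "\<zero>\<^bsub>M\<^esub>" "\<zero>\<^bsub>N\<^esub>"] by simp
 let ?G = "tgrp M S N"
 let ?Q = "%c. c \<in> car F \<and> P (tensor_subgroup M S N #>\<^bsub>F\<^esub> c) \<and> P (\<ominus>\<^bsub>?G\<^esub> (tensor_subgroup M S N #>\<^bsub>F\<^esub> c))"
 have z: "tensor_subgroup M S N #>\<^bsub>F\<^esub> 0 = \<zero>\<^bsub>?G\<^esub>"
  using F.coset_mult_one[of "tensor_subgroup M S N"] subgroup.subset[OF H_subgroup]
  unfolding group_simps FactGroup_def by simp
 have "?Q c"
  using c(1)[unfolded carrier_free_Abelian_group_iff]
 proof (induction c rule: frag_induction)
  case zero
  then show ?case using z \<open>P \<zero>\<^bsub>?G\<^esub>\<close> by simp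
 next
  case (one b)
  then obtain x y where b: "b = (x, y)" "x \<in> car M" "y \<in> car N" by auto
  then show ?case
   using pure[of x y] pure[of "\<ominus>\<^bsub>M\<^esub> x" y] one
   by (simp add: pure_tensor_def[symmetric] pure_neg_left)
 next
  case (diff a b)
  let ?c = "%c. tensor_subgroup M S N #>\<^bsub>F\<^esub> c"
  have cl: "?c a \<in> car ?G" "?c b \<in> car ?G" "a - b \<in> car F"
   using diff coset_closed keys_diff[of a b] by auto
  have "?c (a - b) \<oplus>\<^bsub>?G\<^esub> ?c b = ?c a"
   using diff cl coset_add[of "a - b" b] by simp
  then have e: "?c (a - b) = ?c a \<oplus>\<^bsub>?G\<^esub> \<ominus>\<^bsub>?G\<^esub> ?c b"
   using cl coset_closed[OF cl(3)] by (metis T.add.inv_solve_right)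
  then have e': "\<ominus>\<^bsub>?G\<^esub> ?c (a - b) = \<ominus>\<^bsub>?G\<^esub> ?c a \<oplus>\<^bsub>?G\<^esub> ?c b"
   using cl by (simp add: T.minus_add)
  show ?case
   using diff cl add by (simp add: e' del: carrier_free_Abelian_group_iff) (simp add: e)
 qed
 then show ?thesis using c by simp
qed

context
 fixes G :: "('g, 'z) ring_scheme" and \<beta>
 assumes G: "abelian_group G" and \<beta>: "balanced M S N G \<beta>"
begin

text \<open>
  A balanced map sends each defining relation to zero, and its additive extension is a homomorphism. This is
  what makes \<open>tensor_lift\<close> well defined.
\<close>

lemma ext_kills: "c \<in> tensor_subgroup M S N ==> additive_extension G (case_prod \<beta>) c = \<zero>\<^bsub>G\<^esub>"
proof -
 interpret G: abelian_group G by (rule G)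
 interpret h: group_hom F "add_monoid G" "additive_extension G (case_prod \<beta>)"
  by (intro group_hom.intro group_hom_axioms.intro F.is_group G.a_group additive_extension_hom)
   (use G balancedD(1)[OF \<beta>] in auto)
 have fr: "additive_extension G (case_prod \<beta>) (frag_of (x, y)) = \<beta> x y" if "x \<in> car M" "y \<in> car N" for x y
  using additive_extension_frag_of[OF G, of "case_prod \<beta>" "(x,y)"] balancedD(1)[OF \<beta>] that by simp
 have df: "additive_extension G (case_prod \<beta>) (a - b) =
   additive_extension G (case_prod \<beta>) a \<ominus>\<^bsub>G\<^esub> additive_extension G (case_prod \<beta>) b \<and> a - b \<in> car F"
  if "a \<in> car F" "b \<in> car F" for a b
 proof -
  have c: "a - b \<in> car F" using that keys_diff[of a b] by auto
  then have "additive_extension G (case_prod \<beta>) (a - b) \<oplus>\<^bsub>G\<^esub> additive_extension G (case_prod \<beta>) b = additive_extension G (case_prod \<beta>) a"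
   using h.hom_mult[of "a - b" b] that by simp
  then show ?thesis
   using c that h.hom_closed[of "a-b"] h.hom_closed[of a] h.hom_closed[of b] unfolding a_minus_def
   by (metis G.add.inv_solve_right partial_object.select_convs(1))
 qed
 have c1: "a \<oplus>\<^bsub>G\<^esub> b \<oplus>\<^bsub>G\<^esub> \<ominus>\<^bsub>G\<^esub> a \<oplus>\<^bsub>G\<^esub> \<ominus>\<^bsub>G\<^esub> b = \<zero>\<^bsub>G\<^esub>" if "a \<in> car G" "b \<in> car G" for a b
  using that by (metis G.add.inv_mult_group G.add.m_comm G.add.m_assoc G.a_closed G.a_inv_closed G.r_neg)
 have "tensor_relations M S N \<subseteq> kernel F (add_monoid G) (additive_extension G (case_prod \<beta>))"
 proof
  fix r assume r: "r \<in> tensor_relations M S N"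
  have "additive_extension G (case_prod \<beta>) r = \<zero>\<^bsub>G\<^esub>"
   using r unfolding tensor_relations_def
   by (elim UnE CollectE exE conjE)
    (use balancedD[OF \<beta>] in "simp_all add: df fr G.r_neg a_minus_def c1 del: carrier_free_Abelian_group_iff add: frag_closed")
  then show "r \<in> kernel F (add_monoid G) (additive_extension G (case_prod \<beta>))"
   using subsetD[OF relations_closed r] by (simp add: kernel_def)
 qed
 then have "tensor_subgroup M S N \<subseteq> kernel F (add_monoid G) (additive_extension G (case_prod \<beta>))"
  unfolding tensor_subgroup_def by (rule F.generate_subgroup_incl) (rule h.subgroup_kernel)
 then show "c \<in> tensor_subgroup M S N ==> additive_extension G (case_prod \<beta>) c = \<zero>\<^bsub>G\<^esub>"
  by (auto simp: kernel_def)
qed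

lemma lift_coset:
 assumes "c \<in> car F"
 shows "lift G \<beta> (tensor_subgroup M S N #>\<^bsub>F\<^esub> c) = additive_extension G (case_prod \<beta>) c"
proof -
 interpret G: abelian_group G by (rule G)
 have cl: "case_prod \<beta> b \<in> car G" if "b \<in> car M \<times> car N" for b
  using balancedD(1)[OF \<beta>] that by auto
 have "additive_extension G (case_prod \<beta>) (h + c) = additive_extension G (case_prod \<beta>) c"
  if "h \<in> tensor_subgroup M S N" for h
 proof -
  have "h \<in> car F" by (rule subsetD[OF subgroup.subset[OF H_subgroup] that])
  then show ?thesis
   using additive_extension_add_hom[OF G cl, where c = h and c' = c] additive_extension_add_hom(1)[OF G cl, where c = c and c' = c] ext_kills[OF that] assms by simp
 qed
 moreover have "0 \<in> tensor_subgroup M S N"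
  using subgroup.one_closed[OF H_subgroup] by simp
 ultimately have "additive_extension G (case_prod \<beta>) ` (tensor_subgroup M S N #>\<^bsub>F\<^esub> c) = {additive_extension G (case_prod \<beta>) c}"
  by (force simp: r_coset_def)
 then show ?thesis by (simp add: tensor_lift_def)
qed

lemma lift_pure:
 "[|x \<in> car M; y \<in> car N|] ==> lift G \<beta> (pure M S N x y) = \<beta> x y"
 unfolding pure_tensor_def
 by (simp add: lift_coset additive_extension_frag_of[OF G] balancedD(1)[OF \<beta>])

lemma lift_add_hom: "lift G \<beta> \<in> add_hom (tgrp M S N) G"
proof -
 interpret G: abelian_group G by (rule G)
 have cl: "case_prod \<beta> b \<in> car G" if "b \<in> car M \<times> car N" for b
  using balancedD(1)[OF \<beta>] that by auto
 have ex: "\<exists>c. c \<in> car F \<and> u = tensor_subgroup M S N #>\<^bsub>F\<^esub> c" if "u \<in> car (tgrp M S N)" for u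
  using that unfolding group_simps FactGroup_def RCOSETS_def by (simp del: carrier_free_Abelian_group_iff) blast
 show ?thesis
 proof (rule add_homI)
  fix u assume "u \<in> car (tgrp M S N)"
  then obtain c where "c \<in> car F" "u = tensor_subgroup M S N #>\<^bsub>F\<^esub> c" using ex by blast
  then show "lift G \<beta> u \<in> car G"
   using additive_extension_add_hom(1)[OF G cl, where c = c and c' = c] by (simp add: lift_coset)
 next
  fix u v assume "u \<in> car (tgrp M S N)" "v \<in> car (tgrp M S N)"
  then obtain c d where c: "c \<in> car F" "u = tensor_subgroup M S N #>\<^bsub>F\<^esub> c"
   and d: "d \<in> car F" "v = tensor_subgroup M S N #>\<^bsub>F\<^esub> d" using ex by metis
  then show "lift G \<beta> (u \<oplus>\<^bsub>tgrp M S N\<^esub> v) = lift G \<beta> u \<oplus>\<^bsub>G\<^esub> lift G \<beta> v"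
   using additive_extension_add_hom(2)[OF G cl, where c = c and c' = d] frag_diff_closed[of c d]
   by (simp add: coset_add lift_coset del: carrier_free_Abelian_group_iff) (simp add: lift_coset)
 qed
qed

lemmas lift_closed [simp] = add_hom_closed[OF lift_add_hom]
lemmas lift_add = add_hom_add[OF lift_add_hom]
lemmas lift_zero [simp] = add_hom_zero[OF T.abg G lift_add_hom]

end

lemma add_hom_eqI:
 assumes "f \<in> add_hom (tgrp M S N) G" "g \<in> add_hom (tgrp M S N) G"
  and "!!x y. [|x \<in> car M; y \<in> car N|] ==> f (pure M S N x y) = g (pure M S N x y)"
  and "u \<in> car (tgrp M S N)"
 shows "f u = g u"
 using assms(4)
 by (induction u rule: tensor_induct) (use assms in "simp_all add: add_hom_add")

lemma lift_cong:
 assumes "u \<in> car (tgrp M S N)" "abelian_group G" "balanced M S N G \<beta>" "balanced M S N G \<gamma>"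
  and "!!x y. [|x \<in> car M; y \<in> car N|] ==> \<beta> x y = \<gamma> x y"
 shows "lift G \<beta> u = lift G \<gamma> u"
 by (rule add_hom_eqI[OF lift_add_hom[OF assms(2,3)] lift_add_hom[OF assms(2,4)] _ assms(1)])
  (simp add: lift_pure assms)

text \<open>
  For maps out of iterated tensor products: there the inner balanced map depends on the outer argument.
\<close>

lemma lift_param_add:
 assumes "u \<in> car (tgrp M S N)" "abelian_group G"
  and "balanced M S N G \<beta>" "balanced M S N G \<gamma>" "balanced M S N G \<delta>"
  and "!!x y. [|x \<in> car M; y \<in> car N|] ==> \<delta> x y = \<beta> x y \<oplus>\<^bsub>G\<^esub> \<gamma> x y"
 shows "lift G \<delta> u = lift G \<beta> u \<oplus>\<^bsub>G\<^esub> lift G \<gamma> u"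
 by (rule add_hom_eqI[OF lift_add_hom[OF assms(2,5)]
   add_hom_plus[OF assms(2) lift_add_hom[OF assms(2,3)] lift_add_hom[OF assms(2,4)]] _ assms(1)])
  (simp add: lift_pure assms)

lemma lift_hom_comp:
 assumes "u \<in> car (tgrp M S N)" "abelian_group G" "abelian_group G'"
  and "balanced M S N G \<beta>" "f \<in> add_hom G G'" "balanced M S N G' \<gamma>"
  and "!!x y. [|x \<in> car M; y \<in> car N|] ==> f (\<beta> x y) = \<gamma> x y"
 shows "f (lift G \<beta> u) = lift G' \<gamma> u"
 by (rule add_hom_eqI[OF add_hom_comp[OF lift_add_hom[OF assms(2,4)] assms(5)] lift_add_hom[OF assms(3,6)] _ assms(1)])
  (simp add: lift_pure assms)

end

lemma balanced_tensor_map: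
 assumes "tensor_pair M' S N'" "f \<in> add_hom M M'" "g \<in> add_hom N N'"
  and "!!x s. [|x \<in> car M; s \<in> car S|] ==> f (rsmult M x s) = rsmult M' (f x) s"
  and "!!s y. [|s \<in> car S; y \<in> car N|] ==> g (s \<odot>\<^bsub>N\<^esub> y) = s \<odot>\<^bsub>N'\<^esub> g y"
 shows "balanced M S N (tgrp M' S N') (%x y. pure M' S N' (f x) (g y))"
proof -
 interpret tensor_pair M' S N' by fact
 show ?thesis
  by (rule balancedI)
   (use assms in "auto simp: add_hom_closed add_hom_add pure_add_left pure_add_right pure_middle")
qed

section \<open>Modules and bimodules\<close>

lemma abelian_group_cong:
 assumes "abelian_group G" "car H = car G" "\<zero>\<^bsub>H\<^esub> = \<zero>\<^bsub>G\<^esub>" "ring.add H = ring.add G"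
 shows "abelian_group H"
proof -
 interpret G: abelian_group G by fact
 show ?thesis
 proof (rule abelian_groupI)
  fix x assume "x \<in> car H"
  then show "\<exists>y\<in>car H. y \<oplus>\<^bsub>H\<^esub> x = \<zero>\<^bsub>H\<^esub>"
   by (intro bexI[of _ "\<ominus>\<^bsub>G\<^esub> x"]) (simp_all add: assms G.l_neg)
 qed (auto simp: assms(2-) G.a_ac)
qed

context lmodule
begin

text \<open>
  The axioms of the locale are anonymous; they receive names by splitting their conjunction.
\<close>

lemmas laws = lmodule_axioms[unfolded lmodule_def lmodule_axioms_def conj_assoc, THEN conjunct2, THEN conjunct2]
lemmas laws' = laws[THEN conjunct2, THEN conjunct2]
lemmas sc_closed [simp] = laws[THEN conjunct1, rule_format]
lemmas sc_ladd = laws[THEN conjunct2, THEN conjunct1, rule_format]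
lemmas sc_radd = laws'[THEN conjunct1, rule_format]
lemmas sc_assoc = laws'[THEN conjunct2, THEN conjunct1, rule_format]
lemmas sc_one [simp] = laws'[THEN conjunct2, THEN conjunct2, rule_format]

lemma sc_left_hom: "x \<in> car M ==> (%a. a \<odot>\<^bsub>M\<^esub> x) \<in> add_hom R M"
 by (rule add_homI) (simp_all add: sc_ladd)

lemma sc_right_hom: "a \<in> car R ==> (%x. a \<odot>\<^bsub>M\<^esub> x) \<in> add_hom M M"
 by (rule add_homI) (simp_all add: sc_radd)

lemma sc_lzero [simp]: "x \<in> car M ==> \<zero>\<^bsub>R\<^esub> \<odot>\<^bsub>M\<^esub> x = \<zero>\<^bsub>M\<^esub>"
 by (rule add_hom_zero[OF R.abg M.abg sc_left_hom])

lemma sc_rzero [simp]: "a \<in> car R ==> a \<odot>\<^bsub>M\<^esub> \<zero>\<^bsub>M\<^esub> = \<zero>\<^bsub>M\<^esub>"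
 by (rule add_hom_zero[OF M.abg M.abg sc_right_hom])

lemma sc_lneg: "[|a \<in> car R; x \<in> car M|] ==> (\<ominus>\<^bsub>R\<^esub> a) \<odot>\<^bsub>M\<^esub> x = \<ominus>\<^bsub>M\<^esub> (a \<odot>\<^bsub>M\<^esub> x)"
 by (rule add_hom_neg[OF R.abg M.abg sc_left_hom])

lemma sc_rneg: "[|a \<in> car R; x \<in> car M|] ==> a \<odot>\<^bsub>M\<^esub> (\<ominus>\<^bsub>M\<^esub> x) = \<ominus>\<^bsub>M\<^esub> (a \<odot>\<^bsub>M\<^esub> x)"
 by (rule add_hom_neg[OF M.abg M.abg sc_right_hom])

end

lemma lmoduleI:
 assumes "ring R" "abelian_group M"
  and "!!a x. [|a \<in> car R; x \<in> car M|] ==> a \<odot>\<^bsub>M\<^esub> x \<in> car M"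
  and "!!a b x. [|a \<in> car R; b \<in> car R; x \<in> car M|] ==>
   (a \<oplus>\<^bsub>R\<^esub> b) \<odot>\<^bsub>M\<^esub> x = a \<odot>\<^bsub>M\<^esub> x \<oplus>\<^bsub>M\<^esub> b \<odot>\<^bsub>M\<^esub> x"
  and "!!a x y. [|a \<in> car R; x \<in> car M; y \<in> car M|] ==>
   a \<odot>\<^bsub>M\<^esub> (x \<oplus>\<^bsub>M\<^esub> y) = a \<odot>\<^bsub>M\<^esub> x \<oplus>\<^bsub>M\<^esub> a \<odot>\<^bsub>M\<^esub> y"
  and "!!a b x. [|a \<in> car R; b \<in> car R; x \<in> car M|] ==>
   (a \<otimes>\<^bsub>R\<^esub> b) \<odot>\<^bsub>M\<^esub> x = a \<odot>\<^bsub>M\<^esub> (b \<odot>\<^bsub>M\<^esub> x)"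
  and "!!x. x \<in> car M ==> \<one>\<^bsub>R\<^esub> \<odot>\<^bsub>M\<^esub> x = x"
 shows "lmodule R M"
 using assms by (intro lmodule.intro lmodule_axioms.intro)

context bimodule
begin

lemmas bm = bimodule_axioms
lemmas bilaws = bimodule_axioms[unfolded bimodule_def bimodule_axioms_def conj_assoc, THEN conjunct2]
lemmas bilaws1 = bilaws[THEN conjunct2, THEN conjunct2]
lemmas bilaws2 = bilaws1[THEN conjunct2, THEN conjunct2]
lemmas bilaws3 = bilaws2[THEN conjunct2, THEN conjunct2]
lemmas kR = bilaws[THEN conjunct1]
lemmas kS = bilaws[THEN conjunct2, THEN conjunct1]
lemmas rs_closed [simp] = bilaws1[THEN conjunct1, rule_format]
lemmas rs_sadd = bilaws1[THEN conjunct2, THEN conjunct1, rule_format]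
lemmas rs_add = bilaws2[THEN conjunct1, rule_format]
lemmas rs_assoc = bilaws2[THEN conjunct2, THEN conjunct1, rule_format]
lemmas rs_one [simp] = bilaws3[THEN conjunct1, rule_format]
lemmas rs_sc = bilaws3[THEN conjunct2, THEN conjunct1, rule_format]
lemmas central = bilaws3[THEN conjunct2, THEN conjunct2, rule_format]

lemma ringS: "ring S"
 using kS by (auto simp: k_algebra_def)

lemma lmod: "lmodule R M"
 by (rule lmodule_axioms)

lemma rs_hom: "s \<in> car S ==> (%x. rsmult M x s) \<in> add_hom M M"
 by (rule add_homI) (simp_all add: rs_add)

lemma rs_zero [simp]: "s \<in> car S ==> rsmult M \<zero>\<^bsub>M\<^esub> s = \<zero>\<^bsub>M\<^esub>"
 by (rule add_hom_zero[OF M.abg M.abg rs_hom])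

lemma rs_neg: "[|s \<in> car S; x \<in> car M|] ==> rsmult M (\<ominus>\<^bsub>M\<^esub> x) s = \<ominus>\<^bsub>M\<^esub> rsmult M x s"
 by (rule add_hom_neg[OF M.abg M.abg rs_hom])

end

lemma bimoduleI:
 assumes "lmodule R M" "k_algebra K R" "k_algebra K S"
  and "!!s x. [|s \<in> car S; x \<in> car M|] ==> rsmult M x s \<in> car M"
  and "!!s t x. [|s \<in> car S; t \<in> car S; x \<in> car M|] ==>
   rsmult M x (s \<oplus>\<^bsub>S\<^esub> t) = rsmult M x s \<oplus>\<^bsub>M\<^esub> rsmult M x t"
  and "!!s x y. [|s \<in> car S; x \<in> car M; y \<in> car M|] ==>
   rsmult M (x \<oplus>\<^bsub>M\<^esub> y) s = rsmult M x s \<oplus>\<^bsub>M\<^esub> rsmult M y s"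
  and "!!s t x. [|s \<in> car S; t \<in> car S; x \<in> car M|] ==>
   rsmult M x (s \<otimes>\<^bsub>S\<^esub> t) = rsmult M (rsmult M x s) t"
  and "!!x. x \<in> car M ==> rsmult M x \<one>\<^bsub>S\<^esub> = x"
  and "!!r s x. [|r \<in> car R; s \<in> car S; x \<in> car M|] ==>
   rsmult M (r \<odot>\<^bsub>M\<^esub> x) s = r \<odot>\<^bsub>M\<^esub> (rsmult M x s)"
  and "!!c x. [|c \<in> car K; x \<in> car M|] ==>
   (scalar R c) \<odot>\<^bsub>M\<^esub> x = rsmult M x (scalar S c)"
 shows "bimodule K R S M"
 using assms by (intro bimodule.intro bimodule_axioms.intro)

lemma lmod_homD:
 assumes "f \<in> lmod_hom R M N"
 shows "f \<in> add_hom M N" "x \<in> car M ==> f x \<in> car N"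
  "[|x \<in> car M; y \<in> car M|] ==> f (x \<oplus>\<^bsub>M\<^esub> y) = f x \<oplus>\<^bsub>N\<^esub> f y"
  "[|r \<in> car R; x \<in> car M|] ==> f (r \<odot>\<^bsub>M\<^esub> x) = r \<odot>\<^bsub>N\<^esub> f x"
 using assms by (auto simp: lmod_hom_def add_hom_def)

lemma lmod_homI:
 assumes "f \<in> add_hom M N" "!!r x. [|r \<in> car R; x \<in> car M|] ==> f (r \<odot>\<^bsub>M\<^esub> x) = r \<odot>\<^bsub>N\<^esub> f x"
 shows "f \<in> lmod_hom R M N"
 using assms by (auto simp: lmod_hom_def add_hom_def)

lemma bimod_homD:
 assumes "f \<in> bimod_hom R S M N"
 shows "f \<in> lmod_hom R M N" "f \<in> add_hom M N" "x \<in> car M ==> f x \<in> car N"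
  "[|x \<in> car M; y \<in> car M|] ==> f (x \<oplus>\<^bsub>M\<^esub> y) = f x \<oplus>\<^bsub>N\<^esub> f y"
  "[|r \<in> car R; x \<in> car M|] ==> f (r \<odot>\<^bsub>M\<^esub> x) = r \<odot>\<^bsub>N\<^esub> f x"
  "[|s \<in> car S; x \<in> car M|] ==> f (rsmult M x s) = rsmult N (f x) s"
 using assms by (auto simp: bimod_hom_def lmod_hom_def add_hom_def)

lemma bimod_homI:
 assumes "f \<in> add_hom M N" "!!r x. [|r \<in> car R; x \<in> car M|] ==> f (r \<odot>\<^bsub>M\<^esub> x) = r \<odot>\<^bsub>N\<^esub> f x"
  "!!s x. [|s \<in> car S; x \<in> car M|] ==> f (rsmult M x s) = rsmult N (f x) s"
 shows "f \<in> bimod_hom R S M N"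
 using assms by (auto simp: bimod_hom_def lmod_hom_def add_hom_def)

lemma lmod_hom_zero:
 assumes "lmodule R M" "lmodule R N" "f \<in> lmod_hom R M N"
 shows "f \<zero>\<^bsub>M\<^esub> = \<zero>\<^bsub>N\<^esub>"
 using assms add_hom_zero[of M N f] by (auto simp: lmodule_def lmod_homD(1))

lemma lmod_hom_neg:
 assumes "lmodule R M" "lmodule R N" "f \<in> lmod_hom R M N" "x \<in> car M"
 shows "f (\<ominus>\<^bsub>M\<^esub> x) = \<ominus>\<^bsub>N\<^esub> f x"
 using assms add_hom_neg[of M N f] by (auto simp: lmodule_def lmod_homD(1))

lemma lmod_hom_comp: "[|f \<in> lmod_hom R M N; g \<in> lmod_hom R N Q|] ==> (%x. g (f x)) \<in> lmod_hom R M Q"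
 by (auto simp: lmod_hom_def Pi_iff)

lemma bimod_hom_comp: "[|f \<in> bimod_hom R S M N; g \<in> bimod_hom R S N Q|] ==> (%x. g (f x)) \<in> bimod_hom R S M Q"
 by (auto simp: bimod_hom_def lmod_hom_def Pi_iff)

lemma abelian_of_lmodule: "lmodule R M ==> abelian_group M"
 by (simp add: lmodule_def)

lemma abelian_of_bimodule: "bimodule K R S M ==> abelian_group M"
 by (auto simp: bimodule_def lmodule_def)

lemma lmodule_of_bimodule: "bimodule K R S M ==> lmodule R M"
 by (simp add: bimodule_def)

lemma tensor_pairI: "[|bimodule K R S M; lmodule S N|] ==> tensor_pair M S N"
 by (intro tensor_pair.intro tensor_pair_axioms.intro)
  (auto simp: abelian_of_lmodule abelian_of_bimodule bimodule.rs_closed lmodule.sc_closed)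

context
 fixes K :: "('k, 'x1) ring_scheme" and R :: "('k, 'r, 'x2) module_scheme" and S :: "('k, 's, 'x3) module_scheme"
  and M :: "('r, 's, 'm) bimod" and N :: "('s, 'n, 'x4) module_scheme"
 assumes M: "bimodule K R S M" and N: "lmodule S N"
begin

interpretation M: bimodule K R S M by (rule M)
interpretation N: lmodule S N by (rule N)
interpretation T: tensor_pair M S N by (rule tensor_pairI[OF M N])

lemma tensor_smult_balanced:
 "r \<in> car R ==> balanced M S N (tgrp M S N) (%x y. pure M S N (r \<odot>\<^bsub>M\<^esub> x) y)"
 by (rule balanced_tensor_map[OF T.tensor_pair_axioms M.sc_right_hom add_hom_id]) (auto simp: M.rs_sc)

lemma tensor_smult_pure:
 "[|r \<in> car R; x \<in> car M; y \<in> car N|] ==>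
  r \<odot>\<^bsub>tensor M S N\<^esub> pure M S N x y = pure M S N (r \<odot>\<^bsub>M\<^esub> x) y"
 by (simp add: tensor_smult_def T.lift_pure[OF T.T.abg tensor_smult_balanced])

lemma tensor_smult_add_hom:
 "r \<in> car R ==> (%u. r \<odot>\<^bsub>tensor M S N\<^esub> u) \<in> add_hom (tgrp M S N) (tgrp M S N)"
 by (simp add: tensor_smult_def T.lift_add_hom[OF T.T.abg tensor_smult_balanced])

lemma tensor_abelian_group: "abelian_group (tensor M S N)"
 by (rule abelian_group_cong[OF T.T.abg]) simp_all

lemma lmodule_tensor: "lmodule R (tensor M S N)"
proof (rule lmoduleI[OF M.R.ring_axioms tensor_abelian_group])
 fix a x assume "a \<in> car R" "x \<in> car (tensor M S N)"
 then show "a \<odot>\<^bsub>tensor M S N\<^esub> x \<in> car (tensor M S N)"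
  using add_hom_closed[OF tensor_smult_add_hom] by simp
next
 fix a b u assume ab: "a \<in> car R" "b \<in> car R" and u: "u \<in> car (tensor M S N)"
 show "(a \<oplus>\<^bsub>R\<^esub> b) \<odot>\<^bsub>tensor M S N\<^esub> u = a \<odot>\<^bsub>tensor M S N\<^esub> u \<oplus>\<^bsub>tensor M S N\<^esub> b \<odot>\<^bsub>tensor M S N\<^esub> u"
  using T.add_hom_eqI[OF tensor_smult_add_hom[of "a \<oplus>\<^bsub>R\<^esub> b"]
    add_hom_plus[OF T.T.abg tensor_smult_add_hom[OF ab(1)] tensor_smult_add_hom[OF ab(2)]], of u] ab u
  by (simp add: tensor_smult_pure M.sc_ladd T.pure_add_left)
 show "(a \<otimes>\<^bsub>R\<^esub> b) \<odot>\<^bsub>tensor M S N\<^esub> u = a \<odot>\<^bsub>tensor M S N\<^esub> (b \<odot>\<^bsub>tensor M S N\<^esub> u)"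
  using T.add_hom_eqI[OF tensor_smult_add_hom[of "a \<otimes>\<^bsub>R\<^esub> b"]
    add_hom_comp[OF tensor_smult_add_hom[OF ab(2)] tensor_smult_add_hom[OF ab(1)]], of u] ab u
  by (simp add: tensor_smult_pure M.sc_assoc)
next
 fix a u v assume "a \<in> car R" "u \<in> car (tensor M S N)" "v \<in> car (tensor M S N)"
 then show "a \<odot>\<^bsub>tensor M S N\<^esub> (u \<oplus>\<^bsub>tensor M S N\<^esub> v) = a \<odot>\<^bsub>tensor M S N\<^esub> u \<oplus>\<^bsub>tensor M S N\<^esub> a \<odot>\<^bsub>tensor M S N\<^esub> v"
  using add_hom_add[OF tensor_smult_add_hom] by simp
next
 fix u assume "u \<in> car (tensor M S N)"
 then show "\<one>\<^bsub>R\<^esub> \<odot>\<^bsub>tensor M S N\<^esub> u = u"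
  using T.add_hom_eqI[OF tensor_smult_add_hom[of "\<one>\<^bsub>R\<^esub>"] add_hom_id, of u]
  by (simp add: tensor_smult_pure)
qed

end

lemma tensor_neg [simp]: "\<ominus>\<^bsub>tensor M S N\<^esub> u = \<ominus>\<^bsub>tgrp M S N\<^esub> u"
 by (simp add: a_inv_def m_inv_def)

lemma tensor_bimod_neg [simp]: "\<ominus>\<^bsub>tbim M S N\<^esub> u = \<ominus>\<^bsub>tgrp M S N\<^esub> u"
 by (simp add: a_inv_def m_inv_def)

context
 fixes K :: "('k, 'x1) ring_scheme" and R :: "('k, 'r, 'x2) module_scheme" and S :: "('k, 's, 'x3) module_scheme"
  and Q :: "('k, 't, 'x5) module_scheme"
  and M :: "('r, 's, 'm) bimod" and N :: "('s, 't, 'n) bimod"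
 assumes M: "bimodule K R S M" and N: "bimodule K S Q N"
begin

interpretation M: bimodule K R S M by (rule M)
interpretation N: bimodule K S Q N by (rule N)
interpretation T: tensor_pair M S N by (rule tensor_pairI[OF M N.lmod])

lemma tensor_bimod_smult_eq: "r \<odot>\<^bsub>tbim M S N\<^esub> u = r \<odot>\<^bsub>tensor M S N\<^esub> u"
 by (simp add: tensor_smult_def)

lemma tensor_rsmult_balanced:
 "t \<in> car Q ==> balanced M S N (tgrp M S N) (%x y. pure M S N x (rsmult N y t))"
 by (rule balanced_tensor_map[OF T.tensor_pair_axioms add_hom_id N.rs_hom]) (auto simp: N.rs_sc)

lemma tensor_rsmult_pure:
 "[|t \<in> car Q; x \<in> car M; y \<in> car N|] ==>
  rsmult (tbim M S N) (pure M S N x y) t = pure M S N x (rsmult N y t)"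
 by (simp add: tensor_smult_def T.lift_pure[OF T.T.abg tensor_rsmult_balanced])

lemma tensor_rsmult_add_hom:
 "t \<in> car Q ==> (%u. rsmult (tbim M S N) u t) \<in> add_hom (tgrp M S N) (tgrp M S N)"
 by (simp add: tensor_smult_def T.lift_add_hom[OF T.T.abg tensor_rsmult_balanced])

lemma bimodule_tensor: "bimodule K R Q (tbim M S N)"
proof (rule bimoduleI[OF _ M.kR N.kS])
 note [simp] = tensor_bimod_smult_eq
 note sm = lmodule_tensor[OF M N.lmod] and p = tensor_smult_pure[OF M N.lmod] and rp = tensor_rsmult_pure
 note rh = tensor_rsmult_add_hom and sh = tensor_smult_add_hom[OF M N.lmod]
 show "lmodule R (tbim M S N)"
 proof (rule lmoduleI[OF M.R.ring_axioms])
  show "abelian_group (tbim M S N)"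
   by (rule abelian_group_cong[OF T.T.abg]) simp_all
 qed (use lmodule.sc_closed[OF sm] lmodule.sc_ladd[OF sm] lmodule.sc_radd[OF sm] lmodule.sc_assoc[OF sm] lmodule.sc_one[OF sm] in simp_all)
 fix t u assume tu: "t \<in> car Q" "u \<in> car (tbim M S N)"
 show "rsmult (tbim M S N) u t \<in> car (tbim M S N)"
  using add_hom_closed[OF rh] tu by simp
next
 interpret Q: ring Q by (rule N.ringS)
 fix s t u assume a: "s \<in> car Q" "t \<in> car Q" and u: "u \<in> car (tbim M S N)"
 show "rsmult (tbim M S N) u (s \<oplus>\<^bsub>Q\<^esub> t) =
   rsmult (tbim M S N) u s \<oplus>\<^bsub>tbim M S N\<^esub> rsmult (tbim M S N) u t"
  using T.add_hom_eqI[OF tensor_rsmult_add_hom[of "s \<oplus>\<^bsub>Q\<^esub> t"]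
    add_hom_plus[OF T.T.abg tensor_rsmult_add_hom[OF a(1)] tensor_rsmult_add_hom[OF a(2)]], of u] a u
  by (simp add: tensor_rsmult_pure N.rs_sadd T.pure_add_right)
 show "rsmult (tbim M S N) u (s \<otimes>\<^bsub>Q\<^esub> t) = rsmult (tbim M S N) (rsmult (tbim M S N) u s) t"
  using T.add_hom_eqI[OF tensor_rsmult_add_hom[of "s \<otimes>\<^bsub>Q\<^esub> t"]
    add_hom_comp[OF tensor_rsmult_add_hom[OF a(1)] tensor_rsmult_add_hom[OF a(2)]], of u] a u
  by (simp add: tensor_rsmult_pure N.rs_assoc)
next
 fix s u v assume "s \<in> car Q" "u \<in> car (tbim M S N)" "v \<in> car (tbim M S N)"
 then show "rsmult (tbim M S N) (u \<oplus>\<^bsub>tbim M S N\<^esub> v) s =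
   rsmult (tbim M S N) u s \<oplus>\<^bsub>tbim M S N\<^esub> rsmult (tbim M S N) v s"
  using add_hom_add[OF tensor_rsmult_add_hom] by simp
next
 interpret Q: ring Q by (rule N.ringS)
 fix u assume "u \<in> car (tbim M S N)"
 then show "rsmult (tbim M S N) u \<one>\<^bsub>Q\<^esub> = u"
  using T.add_hom_eqI[OF tensor_rsmult_add_hom[of "\<one>\<^bsub>Q\<^esub>"] add_hom_id, of u]
  by (simp add: tensor_rsmult_pure)
next
 fix r s u assume a: "r \<in> car R" "s \<in> car Q" "u \<in> car (tbim M S N)"
 then show "rsmult (tbim M S N) (r \<odot>\<^bsub>tbim M S N\<^esub> u) s =
   r \<odot>\<^bsub>tbim M S N\<^esub> rsmult (tbim M S N) u s"
  using T.add_hom_eqI[OF add_hom_comp[OF tensor_smult_add_hom[OF M N.lmod a(1)] tensor_rsmult_add_hom[OF a(2)]]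
    add_hom_comp[OF tensor_rsmult_add_hom[OF a(2)] tensor_smult_add_hom[OF M N.lmod a(1)]], of u]
  by (simp add: tensor_rsmult_pure tensor_smult_pure[OF M N.lmod] tensor_bimod_smult_eq)
next
 interpret kR: k_algebra K R by (rule M.kR)
 interpret kS: k_algebra K S by (rule M.kS)
 interpret kQ: k_algebra K Q by (rule N.kS)
 fix c u assume c: "c \<in> car K" and u: "u \<in> car (tbim M S N)"
 have c': "scalar R c \<in> car R" "scalar Q c \<in> car Q" "scalar S c \<in> car S"
  using c by auto
 show "(scalar R c) \<odot>\<^bsub>tbim M S N\<^esub> u = rsmult (tbim M S N) u (scalar Q c)"
  using T.add_hom_eqI[OF tensor_smult_add_hom[OF M N.lmod c'(1)] tensor_rsmult_add_hom[OF c'(2)], of u] u c c'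
  by (simp add: tensor_rsmult_pure tensor_smult_pure[OF M N.lmod] tensor_bimod_smult_eq M.central N.central[symmetric] T.pure_middle)
qed

end

lemma bimod_sum_simps [simp]:
 "car (bimod_sum M N) = car M \<times> car N"
 "\<zero>\<^bsub>bimod_sum M N\<^esub> = (\<zero>\<^bsub>M\<^esub>, \<zero>\<^bsub>N\<^esub>)"
 "p \<oplus>\<^bsub>bimod_sum M N\<^esub> q = (fst p \<oplus>\<^bsub>M\<^esub> fst q, snd p \<oplus>\<^bsub>N\<^esub> snd q)"
 "r \<odot>\<^bsub>bimod_sum M N\<^esub> p = (r \<odot>\<^bsub>M\<^esub> fst p, r \<odot>\<^bsub>N\<^esub> snd p)"
 "rsmult (bimod_sum M N) p s = (rsmult M (fst p) s, rsmult N (snd p) s)"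
 by (simp_all add: bimod_sum_def split: prod.splits)

lemma bimodule_sum:
 assumes "bimodule K R S M" "bimodule K R S N"
 shows "bimodule K R S (bimod_sum M N)"
proof -
 interpret M: bimodule K R S M by fact
 interpret N: bimodule K R S N by fact
 show ?thesis
 proof (rule bimoduleI[OF _ M.kR M.kS])
  show "lmodule R (bimod_sum M N)"
  proof (rule lmoduleI[OF M.R.ring_axioms])
   show "abelian_group (bimod_sum M N)"
   proof (rule abelian_groupI)
    fix p assume p: "p \<in> car (bimod_sum M N)"
    show "\<exists>q\<in>car (bimod_sum M N). q \<oplus>\<^bsub>bimod_sum M N\<^esub> p = \<zero>\<^bsub>bimod_sum M N\<^esub>"
     by (rule bexI[of _ "(\<ominus>\<^bsub>M\<^esub> fst p, \<ominus>\<^bsub>N\<^esub> snd p)"]) (use p in "auto simp: M.M.l_neg N.M.l_neg")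
   qed (auto simp: M.M.a_ac N.M.a_ac)
  qed (auto simp: M.sc_ladd N.sc_ladd M.sc_radd N.sc_radd M.sc_assoc N.sc_assoc)
 qed (auto simp: M.rs_sadd N.rs_sadd M.rs_add N.rs_add M.rs_assoc N.rs_assoc M.rs_sc N.rs_sc M.central N.central)
qed

lemma reg_bimod_simps [simp]:
 "car (reg A) = car A" "\<zero>\<^bsub>reg A\<^esub> = \<zero>\<^bsub>A\<^esub>" "ring.add (reg A) = ring.add A"
 "monoid.mult (reg A) = monoid.mult A" "\<one>\<^bsub>reg A\<^esub> = \<one>\<^bsub>A\<^esub>"
 "smult (reg A) = monoid.mult A" "rsmult (reg A) = monoid.mult A"
 by (simp_all add: reg_bimod_def)

lemma k_algebraD:
 assumes "k_algebra K A"
 shows "module K A" "ring A"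
  "[|c \<in> car K; x \<in> car A; y \<in> car A|] ==> (c \<odot>\<^bsub>A\<^esub> x) \<otimes>\<^bsub>A\<^esub> y = c \<odot>\<^bsub>A\<^esub> (x \<otimes>\<^bsub>A\<^esub> y)"
  "[|c \<in> car K; x \<in> car A; y \<in> car A|] ==> x \<otimes>\<^bsub>A\<^esub> (c \<odot>\<^bsub>A\<^esub> y) = c \<odot>\<^bsub>A\<^esub> (x \<otimes>\<^bsub>A\<^esub> y)"
 using assms unfolding k_algebra_def k_algebra_axioms_def by blast+

lemma abelian_group_reg: assumes "ring A" shows "abelian_group (reg A)"
 by (rule abelian_group_cong[OF ring.is_abelian_group[OF assms]]) simp_all

lemma bimodule_reg:
 assumes "k_algebra K A"
 shows "bimodule K A A (reg A)"
proof -
 interpret k_algebra K A by fact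
 show ?thesis
 proof (rule bimoduleI[OF _ assms assms])
  show "lmodule A (reg A)"
   by (rule lmoduleI[OF ring_axioms abelian_group_reg[OF ring_axioms]]) (auto simp: l_distr r_distr m_assoc)
 qed (auto simp: r_distr l_distr m_assoc k_algebraD[OF assms])
qed

lemma k_algebra_self:
 assumes "cring K"
 shows "k_algebra K (reg K)"
proof -
 interpret cring K by fact
 have r: "ring (reg K)"
  by (rule ringI[OF abelian_group_reg[OF ring_axioms]])
   (auto intro!: monoidI simp: l_distr r_distr m_assoc)
 show ?thesis
  unfolding k_algebra_def k_algebra_axioms_def module_def module_axioms_def
  using r abelian_group_reg[OF ring_axioms] cring_axioms
  by (auto simp: l_distr r_distr m_assoc m_lcomm)
qed

section \<open>Finite dimension\<close>

text \<open>
  Vector subspaces and finite dimension, without forming the vector space: \<open>K\<close> acts on an \<open>R\<close>-module through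
  the scalars of the algebra \<open>R\<close>.
\<close>

definition ksub where
 "ksub K R M W \<longleftrightarrow> W \<subseteq> car M \<and> \<zero>\<^bsub>M\<^esub> \<in> W \<and> (\<forall>x\<in>W. \<forall>y\<in>W. x \<oplus>\<^bsub>M\<^esub> y \<in> W) \<and>
  (\<forall>c\<in>car K. \<forall>x\<in>W. (scalar R c) \<odot>\<^bsub>M\<^esub> x \<in> W)"

definition kfin where
 "kfin K R M \<longleftrightarrow> (\<exists>B. finite B \<and> B \<subseteq> car M \<and> (\<forall>W. ksub K R M W \<and> B \<subseteq> W --> W = car M))"

text \<open>
  Source and target may be modules over different \<open>K\<close>-algebras.
\<close>

definition klin where
 "klin K R M S N = {f \<in> add_hom M N. \<forall>c\<in>car K. \<forall>x\<in>car M.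
  f ((scalar R c) \<odot>\<^bsub>M\<^esub> x) = (scalar S c) \<odot>\<^bsub>N\<^esub> f x}"

lemma klinI:
 "[|f \<in> add_hom M N; !!c x. [|c \<in> car K; x \<in> car M|] ==>
  f ((scalar R c) \<odot>\<^bsub>M\<^esub> x) = (scalar S c) \<odot>\<^bsub>N\<^esub> f x|] ==> f \<in> klin K R M S N"
 by (simp add: klin_def)

lemma klinD:
 assumes "f \<in> klin K R M S N"
 shows "f \<in> add_hom M N" "[|c \<in> car K; x \<in> car M|] ==>
  f ((scalar R c) \<odot>\<^bsub>M\<^esub> x) = (scalar S c) \<odot>\<^bsub>N\<^esub> f x"
 using assms by (simp_all add: klin_def)

lemma kscalar_closed: "[|k_algebra K R; c \<in> car K|] ==> scalar R c \<in> car R"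
 by (rule module.smult_closed[OF k_algebraD(1) _ ring.ring_simprules(6)[OF k_algebraD(2)]])

lemma kscalar_mult:
 assumes "k_algebra K R" "c \<in> car K" "r \<in> car R"
 shows "(scalar R c) \<otimes>\<^bsub>R\<^esub> r = c \<odot>\<^bsub>R\<^esub> r" "r \<otimes>\<^bsub>R\<^esub> (scalar R c) = c \<odot>\<^bsub>R\<^esub> r"
proof -
 interpret ring R by (rule k_algebraD(2)[OF assms(1)])
 show "(scalar R c) \<otimes>\<^bsub>R\<^esub> r = c \<odot>\<^bsub>R\<^esub> r" "r \<otimes>\<^bsub>R\<^esub> (scalar R c) = c \<odot>\<^bsub>R\<^esub> r"
  using assms(2,3) by (simp_all add: k_algebraD(3,4)[OF assms(1)])
qed

lemma kscalar_times:
 assumes "k_algebra K R" "c \<in> car K" "d \<in> car K"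
 shows "(c \<otimes>\<^bsub>K\<^esub> d) \<odot>\<^bsub>R\<^esub> \<one>\<^bsub>R\<^esub> = (scalar R c) \<otimes>\<^bsub>R\<^esub> (scalar R d)"
 using assms kscalar_closed[OF assms(1)]
 by (simp add: kscalar_mult(1)[OF assms(1)] module.smult_assoc1[OF k_algebraD(1)] ring.ring_simprules(6)[OF k_algebraD(2)])

lemma kscalar_central:
 assumes "k_algebra K R" "c \<in> car K" "r \<in> car R"
 shows "(scalar R c) \<otimes>\<^bsub>R\<^esub> r = r \<otimes>\<^bsub>R\<^esub> (scalar R c)"
 by (simp add: kscalar_mult[OF assms])

text \<open>
  The standard argument for finite dimension below: the elements with a desired linear property form a
  subspace, so a spanning set suffices.
\<close>

lemma ksub_preimage:
 assumes "abelian_group M" "abelian_group N" "f \<in> klin K R M S N" "ksub K S N W"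
  and "!!c x. [|c \<in> car K; x \<in> car M|] ==> (scalar R c) \<odot>\<^bsub>M\<^esub> x \<in> car M"
 shows "ksub K R M {x \<in> car M. f x \<in> W}"
proof -
 interpret M: abelian_group M by fact
 show ?thesis
  using assms(4) add_hom_zero[OF assms(1,2) klinD(1)[OF assms(3)]]
  by (auto simp: ksub_def add_hom_add[OF klinD(1)[OF assms(3)]] klinD(2)[OF assms(3)] assms(5))
qed

lemma kscalar_sc_closed: "[|k_algebra K R; lmodule R M; c \<in> car K; x \<in> car M|] ==> (scalar R c) \<odot>\<^bsub>M\<^esub> x \<in> car M"
 by (simp add: lmodule.sc_closed kscalar_closed)

lemma submodule_if_closed:
 assumes "lmodule R M" "W \<subseteq> car M" "\<zero>\<^bsub>M\<^esub> \<in> W" "!!x y. [|x \<in> W; y \<in> W|] ==> x \<oplus>\<^bsub>M\<^esub> y \<in> W"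
  "!!r x. [|r \<in> car R; x \<in> W|] ==> r \<odot>\<^bsub>M\<^esub> x \<in> W"
 shows "submodule W R M"
proof -
 interpret lmodule R M by fact
 have "\<ominus>\<^bsub>M\<^esub> x \<in> W" if "x \<in> W" for x
  using assms(5)[of "\<ominus>\<^bsub>R\<^esub> \<one>\<^bsub>R\<^esub>" x] that assms(2) by (auto simp: sc_lneg subset_iff)
 then show ?thesis
  using assms(2-5)
  by (intro submodule.intro subgroup.intro submodule_axioms.intro) (simp_all add: a_inv_def)
qed

lemma ksub_of_submodule:
 assumes "k_algebra K R" "submodule W R M"
 shows "ksub K R M W"
proof -
 interpret submodule W R M by fact
 show ?thesis
  unfolding ksub_def using subset one_closed m_closed smult_closed kscalar_closed[OF assms(1)] by auto
qed

lemma kfin_imp_fin_gen: "[|k_algebra K R; kfin K R M|] ==> fin_gen R M"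
 unfolding kfin_def fin_gen_def by (meson ksub_of_submodule)

lemma kfin_imp_bimod_fin_gen: "[|k_algebra K R; kfin K R M|] ==> bimod_fin_gen R S M"
 unfolding kfin_def bimod_fin_gen_def by (meson ksub_of_submodule)

lemma kfin_image:
 assumes "abelian_group M" "abelian_group N" "f \<in> klin K R M S N" "f ` car M = car N" "kfin K R M"
  and "!!c x. [|c \<in> car K; x \<in> car M|] ==> (scalar R c) \<odot>\<^bsub>M\<^esub> x \<in> car M"
 shows "kfin K S N"
proof -
 obtain B where B: "finite B" "B \<subseteq> car M" "!!W. ksub K R M W ==> B \<subseteq> W ==> W = car M"
  using assms(5) unfolding kfin_def by blast
 have "W = car N" if W: "ksub K S N W" "f ` B \<subseteq> W" for W
 proof -
  have "{x \<in> car M. f x \<in> W} = car M"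
   by (rule B(3)[OF ksub_preimage[OF assms(1-3) W(1) assms(6)]]) (use B(2) W(2) in auto)
  then have "f x \<in> W" if "x \<in> car M" for x using that by blast
  then have "car N \<subseteq> W" using assms(4)[symmetric] by auto
  then show ?thesis using W(1) by (auto simp: ksub_def)
 qed
 then show ?thesis
  unfolding kfin_def using B(1,2) assms(4) by (intro exI[of _ "f ` B"]) auto
qed

text \<open>
  The values of \<open>\<beta>\<close> on a pair of spanning sets span, by linearity in each argument separately.
\<close>

lemma kfin_bilinear:
 assumes M: "k_algebra K R" "lmodule R M" "kfin K R M" and N: "k_algebra K S" "lmodule S N" "kfin K S N"
  and G: "abelian_group G"
  and l: "!!y. y \<in> car N ==> (%x. \<beta> x y) \<in> klin K R M Q G"
  and r: "!!x. x \<in> car M ==> \<beta> x \<in> klin K S N Q G"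
  and span: "!!W. [|ksub K Q G W; !!x y. [|x \<in> car M; y \<in> car N|] ==> \<beta> x y \<in> W|] ==> car G \<subseteq> W"
 shows "kfin K Q G"
proof -
 obtain B where B: "finite B" "B \<subseteq> car M" "!!W. ksub K R M W ==> B \<subseteq> W ==> W = car M"
  using M(3) unfolding kfin_def by blast
 obtain C where C: "finite C" "C \<subseteq> car N" "!!W. ksub K S N W ==> C \<subseteq> W ==> W = car N"
  using N(3) unfolding kfin_def by blast
 let ?D = "(%(x, y). \<beta> x y) ` (B \<times> C)"
 have "W = car G" if W: "ksub K Q G W" "?D \<subseteq> W" for W
 proof -
  have 1: "\<beta> x y \<in> W" if x: "x \<in> car M" and y: "y \<in> C" for x y
  proof -
   have "{x \<in> car M. \<beta> x y \<in> W} = car M"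
    by (rule B(3)[OF ksub_preimage[OF abelian_of_lmodule[OF M(2)] G l W(1) kscalar_sc_closed[OF M(1,2)]]])
     (use B(2) C(2) W(2) y in auto)
   then show ?thesis using x by auto
  qed
  have 2: "\<beta> x y \<in> W" if x: "x \<in> car M" and y: "y \<in> car N" for x y
  proof -
   have "{y \<in> car N. \<beta> x y \<in> W} = car N"
    by (rule C(3)[OF ksub_preimage[OF abelian_of_lmodule[OF N(2)] G r W(1) kscalar_sc_closed[OF N(1,2)]]])
     (use C(2) 1 x in auto)
   then show ?thesis using y by auto
  qed
  show ?thesis using span[OF W(1) 2] W(1) by (auto simp: ksub_def)
 qed
 moreover have "?D \<subseteq> car G"
  using B(2) C(2) add_hom_closed[OF klinD(1)[OF r]] by auto
 ultimately show ?thesis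
  unfolding kfin_def using B(1) C(1) by (intro exI[of _ ?D]) auto
qed

lemma klin_lmod_hom: "[|k_algebra K R; f \<in> lmod_hom R M N|] ==> f \<in> klin K R M R N"
 by (rule klinI) (auto simp: lmod_homD kscalar_closed)

lemma klin_orbit:
 assumes "k_algebra K R" "lmodule R M" "x \<in> car M"
 shows "(%a. a \<odot>\<^bsub>M\<^esub> x) \<in> klin K R (reg R) R M"
 using lmodule.sc_left_hom[OF assms(2,3)] lmodule.sc_assoc[OF assms(2)] assms kscalar_closed[OF assms(1)]
 by (auto simp: klin_def add_hom_def)

lemma klin_right_orbit:
 assumes "bimodule K R S M" "x \<in> car M"
 shows "(%s. rsmult M x s) \<in> klin K S (reg S) R M"
proof (rule klinI)
 interpret bimodule K R S M by fact
 show "rsmult M x \<in> add_hom (reg S) M"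
  by (rule add_homI) (simp_all add: assms rs_sadd)
 fix c s assume "c \<in> car K" "s \<in> car (reg S)"
 then show "rsmult M x (c \<odot>\<^bsub>S\<^esub> \<one>\<^bsub>S\<^esub> \<odot>\<^bsub>reg S\<^esub> s) = scalar R c \<odot>\<^bsub>M\<^esub> rsmult M x s"
  using kscalar_closed[OF kS] kscalar_closed[OF kR] assms(2) by (simp add: rs_assoc central[symmetric] rs_sc)
qed

lemma kfin_reg:
 assumes "k_algebra K A" "fin_gen K A"
 shows "kfin K A (reg A)"
proof -
 interpret module K A by (rule k_algebraD(1)[OF assms(1)])
 obtain B where B: "finite B" "B \<subseteq> car A" "!!N. submodule N K A ==> B \<subseteq> N ==> N = car A"
  using assms(2) unfolding fin_gen_def by blast
 have "W = car A" if W: "ksub K A (reg A) W" "B \<subseteq> W" for W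
 proof (rule B(3)[OF _ W(2)])
  have sc: "c \<odot>\<^bsub>A\<^esub> x \<in> W" if "c \<in> car K" "x \<in> W" for c x
  proof -
   have "x \<in> car A" "(scalar A c) \<otimes>\<^bsub>A\<^esub> x \<in> W" using W(1) that by (auto simp: ksub_def)
   then show ?thesis by (simp only: kscalar_mult(1)[OF assms(1) that(1)])
  qed
  show "submodule W K A"
  proof (rule submoduleI)
   show "\<ominus>\<^bsub>A\<^esub> a \<in> W" if "a \<in> W" for a
   proof -
    have "(\<ominus>\<^bsub>K\<^esub> \<one>\<^bsub>K\<^esub>) \<odot>\<^bsub>A\<^esub> a = \<ominus>\<^bsub>A\<^esub> a"
     using that W(1) smult_l_minus[of "\<one>\<^bsub>K\<^esub>" a] by (auto simp: ksub_def)
    then show ?thesis using sc[of "\<ominus>\<^bsub>K\<^esub> \<one>\<^bsub>K\<^esub>" a] that by simp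
   qed
  qed (use W(1) sc in "auto simp: ksub_def")
 qed
 then show ?thesis
  unfolding kfin_def using B(1,2) by (intro exI[of _ B]) auto
qed

text \<open>
  The products of a spanning set of the algebra with the generators span the module.
\<close>

lemma kfin_of_fin_gen:
 assumes R: "k_algebra K R" "kfin K R (reg R)" and M: "lmodule R M" "fin_gen R M"
 shows "kfin K R M"
proof -
 interpret lmodule R M by fact
 obtain B where B: "finite B" "B \<subseteq> car M" "!!N. submodule N R M ==> B \<subseteq> N ==> N = car M"
  using M(2) unfolding fin_gen_def by blast
 obtain C where C: "finite C" "C \<subseteq> car R" "!!W. ksub K R (reg R) W ==> C \<subseteq> W ==> W = car R"
  using R(2) unfolding kfin_def by auto
 let ?D = "(%(a, x). a \<odot>\<^bsub>M\<^esub> x) ` (C \<times> B)"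
 have "W = car M" if W: "ksub K R M W" "?D \<subseteq> W" for W
 proof -
  have 1: "a \<odot>\<^bsub>M\<^esub> x \<in> W" if a: "a \<in> car R" and x: "x \<in> B" for a x
  proof -
   have x': "x \<in> car M" using x B(2) by auto
   have "{a \<in> car (reg R). a \<odot>\<^bsub>M\<^esub> x \<in> W} = car R"
    by (rule C(3)[OF ksub_preimage[OF abelian_group_reg[OF R.ring_axioms] M.abg klin_orbit[OF R(1) M(1) x'] W(1)]])
     (use C(2) W(2) x kscalar_closed[OF R(1)] in auto)
   then show ?thesis using a by auto
  qed
  have "{x \<in> car M. \<forall>a\<in>car R. a \<odot>\<^bsub>M\<^esub> x \<in> W} = car M"
  proof (rule B(3))
   show "submodule {x \<in> car M. \<forall>a\<in>car R. a \<odot>\<^bsub>M\<^esub> x \<in> W} R M"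
    by (rule submodule_if_closed[OF M(1)])
     (use W(1) in "auto simp: ksub_def sc_radd sc_assoc[symmetric]")
  qed (use B(2) 1 in auto)
  then have "\<one>\<^bsub>R\<^esub> \<odot>\<^bsub>M\<^esub> x \<in> W" if "x \<in> car M" for x
   using that by blast
  then have "car M \<subseteq> W" by auto
  then show ?thesis using W(1) by (auto simp: ksub_def)
 qed
 moreover have "?D \<subseteq> car M" using B(2) C(2) by (auto simp: subset_iff)
 ultimately show ?thesis
  unfolding kfin_def using B(1) C(1) by (intro exI[of _ ?D]) auto
qed

lemma kfin_of_bimod_fin_gen:
 assumes M: "bimodule K R S M" "bimod_fin_gen R S M"
  and R: "kfin K R (reg R)" and S: "kfin K S (reg S)"
 shows "kfin K R M"
proof -
 interpret bimodule K R S M by fact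
 interpret S: ring S by (rule ringS)
 obtain B where B0: "finite B \<and> B \<subseteq> car M \<and>
   (\<forall>N. submodule N R M \<and> (\<forall>x\<in>N. \<forall>s\<in>car S. rsmult M x s \<in> N) \<and> B \<subseteq> N --> N = car M)"
  using M(2)[unfolded bimod_fin_gen_def] by (elim exE)
 have B: "finite B" "B \<subseteq> car M"
  "submodule N R M ==> (\<forall>x\<in>N. \<forall>s\<in>car S. rsmult M x s \<in> N) ==> B \<subseteq> N ==> N = car M" for N
  using B0[THEN conjunct1] B0[THEN conjunct2, THEN conjunct1] B0[THEN conjunct2, THEN conjunct2, THEN spec, of N] by simp_all
 obtain C where C: "finite C" "C \<subseteq> car R" "!!W. ksub K R (reg R) W ==> C \<subseteq> W ==> W = car R"
  using R unfolding kfin_def by auto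
 obtain D where D: "finite D" "D \<subseteq> car S" "!!W. ksub K S (reg S) W ==> D \<subseteq> W ==> W = car S"
  using S unfolding kfin_def by auto
 let ?D = "(%(a, x, s). a \<odot>\<^bsub>M\<^esub> rsmult M x s) ` (C \<times> B \<times> D)"
 have "W = car M" if W: "ksub K R M W" "?D \<subseteq> W" for W
 proof -
  have 1: "a \<odot>\<^bsub>M\<^esub> rsmult M x s \<in> W" if a: "a \<in> car R" and x: "x \<in> B" and s: "s \<in> D" for a x s
  proof -
   have x': "rsmult M x s \<in> car M" using x s B(2) D(2) by (auto simp: subset_iff)
   have "{a \<in> car (reg R). a \<odot>\<^bsub>M\<^esub> rsmult M x s \<in> W} = car R"
    by (rule C(3)[OF ksub_preimage[OF abelian_group_reg[OF R.ring_axioms] M.abg klin_orbit[OF kR lmod x'] W(1)]])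
     (use C(2) W(2) x s kscalar_closed[OF kR] in "auto simp: image_subset_iff")
   then show ?thesis using a by auto
  qed
  have 2: "a \<odot>\<^bsub>M\<^esub> rsmult M x s \<in> W" if a: "a \<in> car R" and x: "x \<in> B" and s: "s \<in> car S" for a x s
  proof -
   have x': "a \<odot>\<^bsub>M\<^esub> x \<in> car M" "x \<in> car M" using x a B(2) by auto
   have "{s \<in> car (reg S). rsmult M (a \<odot>\<^bsub>M\<^esub> x) s \<in> W} = car S"
    by (rule D(3)[OF ksub_preimage[OF abelian_group_reg[OF S.ring_axioms] M.abg klin_right_orbit[OF M(1) x'(1)] W(1)]])
     (use D(2) 1[OF a x] a x' kscalar_closed[OF kS] in "auto simp: rs_sc subset_iff")
   then have "rsmult M (a \<odot>\<^bsub>M\<^esub> x) s \<in> W" using s by blast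
   then show ?thesis using s a x' by (simp add: rs_sc)
  qed
  let ?N = "{x \<in> car M. \<forall>a\<in>car R. \<forall>s\<in>car S. a \<odot>\<^bsub>M\<^esub> rsmult M x s \<in> W}"
  have "?N = car M"
  proof (rule B(3))
   show "submodule ?N R M"
    by (rule submodule_if_closed[OF lmod])
     (use W(1) in "auto simp: ksub_def sc_radd sc_assoc[symmetric] rs_add rs_sc")
  qed (use B(2) 2 in "auto simp: rs_assoc[symmetric]")
  then have "\<one>\<^bsub>R\<^esub> \<odot>\<^bsub>M\<^esub> rsmult M x \<one>\<^bsub>S\<^esub> \<in> W" if "x \<in> car M" for x
   using that by blast
  then have "car M \<subseteq> W" by auto
  then show ?thesis using W(1) by (auto simp: ksub_def)
 qed
 moreover have "?D \<subseteq> car M" using B(2) C(2) D(2) by (auto simp: subset_iff)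
 ultimately show ?thesis
  unfolding kfin_def using B(1) C(1) D(1) by (intro exI[of _ ?D]) auto
qed

lemma kfin_tensor:
 assumes M: "bimodule K R S M" "kfin K R M" and N: "lmodule S N" "kfin K S N"
 shows "kfin K R (tensor M S N)"
proof -
 interpret M: bimodule K R S M by fact
 interpret N: lmodule S N by fact
 interpret T: tensor_pair M S N by (rule tensor_pairI[OF M(1) N(1)])
 note tp = tensor_smult_pure[OF M(1) N(1)]
 show ?thesis
 proof (rule kfin_bilinear[OF M.kR M.lmod M(2) M.kS N(1,2) tensor_abelian_group[OF M(1) N(1)], where \<beta> = "pure M S N"])
  fix y assume "y \<in> car N"
  then show "(%x. pure M S N x y) \<in> klin K R M R (tensor M S N)"
   by (intro klinI add_homI) (simp_all add: T.pure_add_left tp kscalar_closed[OF M.kR])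
 next
  fix x assume "x \<in> car M"
  then show "pure M S N x \<in> klin K S N R (tensor M S N)"
   by (intro klinI add_homI)
    (simp_all add: T.pure_add_right tp kscalar_closed[OF M.kR] kscalar_closed[OF M.kS] M.central T.pure_middle)
 next
  fix W assume W: "ksub K R (tensor M S N) W" "!!x y. [|x \<in> car M; y \<in> car N|] ==> pure M S N x y \<in> W"
  have "u \<in> W" if "u \<in> car (tgrp M S N)" for u
   using that by (induction u rule: T.tensor_induct) (use W in "auto simp: ksub_def")
  then show "car (tensor M S N) \<subseteq> W" by auto
 qed
qed

lemma kfin_cong:
 assumes "car M' = car M" "\<zero>\<^bsub>M'\<^esub> = \<zero>\<^bsub>M\<^esub>"
  "!!x y. [|x \<in> car M; y \<in> car M|] ==> x \<oplus>\<^bsub>M'\<^esub> y = x \<oplus>\<^bsub>M\<^esub> y"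
  "!!c x. [|c \<in> car K; x \<in> car M|] ==> (scalar R' c) \<odot>\<^bsub>M'\<^esub> x = (scalar R c) \<odot>\<^bsub>M\<^esub> x"
  "kfin K R M"
 shows "kfin K R' M'"
proof -
 have "ksub K R' M' W \<longleftrightarrow> ksub K R M W" for W
  unfolding ksub_def assms(1,2) using assms(3,4) by (simp add: subset_iff cong: conj_cong)
 then show ?thesis using assms(5) unfolding kfin_def assms(1) by simp
qed

lemma kfin_tensor_bimod:
 assumes M: "bimodule K R S M" "kfin K R M" and N: "bimodule K S Q N" "kfin K S N"
 shows "kfin K R (tbim M S N)"
 by (rule kfin_cong[OF _ _ _ _ kfin_tensor[OF M lmodule_of_bimodule[OF N(1)] N(2)]])
  (simp_all add: tensor_bimod_smult_eq[OF M(1) N(1)])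

lemma kfin_sum:
 assumes M: "bimodule K R S M" "kfin K R M" and N: "bimodule K R S N" "kfin K R N"
 shows "kfin K R (bimod_sum M N)"
proof -
 interpret M: bimodule K R S M by fact
 interpret N: bimodule K R S N by fact
 interpret MN: bimodule K R S "bimod_sum M N" by (rule bimodule_sum[OF M(1) N(1)])
 obtain B where B: "finite B" "B \<subseteq> car M" "!!W. ksub K R M W ==> B \<subseteq> W ==> W = car M"
  using M(2) unfolding kfin_def by blast
 obtain C where C: "finite C" "C \<subseteq> car N" "!!W. ksub K R N W ==> C \<subseteq> W ==> W = car N"
  using N(2) unfolding kfin_def by blast
 let ?D = "(%x. (x, \<zero>\<^bsub>N\<^esub>)) ` B \<union> (%y. (\<zero>\<^bsub>M\<^esub>, y)) ` C"
 have "W = car (bimod_sum M N)" if W: "ksub K R (bimod_sum M N) W" "?D \<subseteq> W" for W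
 proof -
  have 1: "{x \<in> car M. (x, \<zero>\<^bsub>N\<^esub>) \<in> W} = car M"
   by (rule B(3)[OF ksub_preimage[OF M.M.abg MN.M.abg klinI[OF add_homI] W(1)]])
    (use W(2) B(2) kscalar_closed[OF M.kR] in auto)
  have 2: "{y \<in> car N. (\<zero>\<^bsub>M\<^esub>, y) \<in> W} = car N"
   by (rule C(3)[OF ksub_preimage[OF N.M.abg MN.M.abg klinI[OF add_homI] W(1)]])
    (use W(2) C(2) kscalar_closed[OF M.kR] in auto)
  have "(x, y) \<in> W" if "x \<in> car M" "y \<in> car N" for x y
  proof -
   have "(x, \<zero>\<^bsub>N\<^esub>) \<oplus>\<^bsub>bimod_sum M N\<^esub> (\<zero>\<^bsub>M\<^esub>, y) \<in> W"
    using W(1) 1 2 that unfolding ksub_def by blast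
   then show ?thesis using that by simp
  qed
  then show ?thesis using W(1) by (auto simp: ksub_def)
 qed
 moreover have "?D \<subseteq> car (bimod_sum M N)" using B(2) C(2) by auto
 ultimately show ?thesis
  unfolding kfin_def using B(1) C(1) by (intro exI[of _ ?D]) auto
qed

text \<open>
  Induction over a spanning set of the source, maintaining a subspace \<open>V\<close> of the target with a linear section.
  If \<open>f b\<close> lies outside \<open>V\<close>, then elements of \<open>V + K f(b)\<close> have a unique expression \<open>v + c f(b)\<close>, since a nonzero
  multiple of \<open>f b\<close> in \<open>V\<close> could be divided by its coefficient; the section is extended by \<open>f(b) \<mapsto> b\<close>.
\<close>

lemma klin_section:
 assumes K: "field K" and M: "k_algebra K R" "lmodule R M" "kfin K R M"
  and N: "k_algebra K S" "lmodule S N" and f: "f \<in> klin K R M S N"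
 obtains \<tau> where "!!y. y \<in> f ` car M ==> \<tau> y \<in> car M \<and> f (\<tau> y) = y"
  and "!!y z. [|y \<in> f ` car M; z \<in> f ` car M|] ==> \<tau> (y \<oplus>\<^bsub>N\<^esub> z) = \<tau> y \<oplus>\<^bsub>M\<^esub> \<tau> z"
  and "!!c y. [|c \<in> car K; y \<in> f ` car M|] ==>
   \<tau> ((scalar S c) \<odot>\<^bsub>N\<^esub> y) = (scalar R c) \<odot>\<^bsub>M\<^esub> \<tau> y"
proof -
 interpret K: field K by fact
 interpret M: lmodule R M by fact
 interpret N: lmodule S N by fact
 interpret kR: k_algebra K R by fact
 interpret kS: k_algebra K S by fact
 let ?m = "%c x. (scalar R c) \<odot>\<^bsub>M\<^esub> x"
 let ?n = "%c x. (scalar S c) \<odot>\<^bsub>N\<^esub> x"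
 note fa = klinD(1)[OF f] and fk = klinD(2)[OF f]
 have mc [simp]: "?m c x \<in> car M" if "c \<in> car K" "x \<in> car M" for c x using that by simp
 have nc [simp]: "?n c x \<in> car N" if "c \<in> car K" "x \<in> car N" for c x using that by simp
 have ma: "?m (c \<oplus>\<^bsub>K\<^esub> c') x = ?m c x \<oplus>\<^bsub>M\<^esub> ?m c' x" if "c \<in> car K" "c' \<in> car K" "x \<in> car M" for c c' x
  using that by (simp add: kR.smult_l_distr M.sc_ladd)
 have na: "?n (c \<oplus>\<^bsub>K\<^esub> c') x = ?n c x \<oplus>\<^bsub>N\<^esub> ?n c' x" if "c \<in> car K" "c' \<in> car K" "x \<in> car N" for c c' x
  using that by (simp add: kS.smult_l_distr N.sc_ladd)
 have mm: "?m (c \<otimes>\<^bsub>K\<^esub> c') x = ?m c (?m c' x)" if "c \<in> car K" "c' \<in> car K" "x \<in> car M" for c c' x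
  using that by (simp add: kscalar_times[OF M(1)] M.sc_assoc)
 have nn: "?n (c \<otimes>\<^bsub>K\<^esub> c') x = ?n c (?n c' x)" if "c \<in> car K" "c' \<in> car K" "x \<in> car N" for c c' x
  using that by (simp add: kscalar_times[OF N(1)] N.sc_assoc)
 obtain B where B: "finite B" "B \<subseteq> car M" "!!W. ksub K R M W ==> B \<subseteq> W ==> W = car M"
  using M(3) unfolding kfin_def by blast
 define good where "good V \<tau> \<longleftrightarrow> ksub K S N V \<and> (\<forall>y\<in>V. \<tau> y \<in> car M \<and> f (\<tau> y) = y) \<and>
  (\<forall>y\<in>V. \<forall>z\<in>V. \<tau> (y \<oplus>\<^bsub>N\<^esub> z) = \<tau> y \<oplus>\<^bsub>M\<^esub> \<tau> z) \<and> (\<forall>c\<in>car K. \<forall>y\<in>V. \<tau> (?n c y) = ?m c (\<tau> y))" for V \<tau>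
 have "\<exists>V \<tau>. good V \<tau> \<and> f ` B \<subseteq> V"
  using B(1,2)
 proof (induction B rule: finite_induct)
  case empty
  have "good {\<zero>\<^bsub>N\<^esub>} (%_. \<zero>\<^bsub>M\<^esub>)"
   unfolding good_def ksub_def
   using add_hom_zero[OF M.M.abg N.M.abg fa] by auto
  then show ?case by blast
 next
  case (insert b B)
  then obtain V \<tau> where V: "good V \<tau>" "f ` B \<subseteq> V" by auto
  have b: "b \<in> car M" "f b \<in> car N" using insert add_hom_closed[OF fa] by auto
  have Vs: "V \<subseteq> car N" "\<zero>\<^bsub>N\<^esub> \<in> V" "!!x y. [|x \<in> V; y \<in> V|] ==> x \<oplus>\<^bsub>N\<^esub> y \<in> V"
   "!!c x. [|c \<in> car K; x \<in> V|] ==> ?n c x \<in> V"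
   and t: "!!y. y \<in> V ==> \<tau> y \<in> car M \<and> f (\<tau> y) = y"
   "!!y z. [|y \<in> V; z \<in> V|] ==> \<tau> (y \<oplus>\<^bsub>N\<^esub> z) = \<tau> y \<oplus>\<^bsub>M\<^esub> \<tau> z"
   "!!c y. [|c \<in> car K; y \<in> V|] ==> \<tau> (?n c y) = ?m c (\<tau> y)"
   using V(1) unfolding good_def ksub_def by blast+
  show ?case
  proof (cases "f b \<in> V")
   case True
   then show ?thesis using V by auto
  next
   case False
   have Vn: "\<ominus>\<^bsub>N\<^esub> y \<in> V" if "y \<in> V" for y
    using Vs(4)[of "\<ominus>\<^bsub>K\<^esub> \<one>\<^bsub>K\<^esub>" y] that Vs(1) by (auto simp: kS.smult_l_minus N.sc_lneg subset_iff)
   have uniq: "v = v' \<and> c = c'"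
    if e: "v \<oplus>\<^bsub>N\<^esub> ?n c (f b) = v' \<oplus>\<^bsub>N\<^esub> ?n c' (f b)" and h: "v \<in> V" "v' \<in> V" "c \<in> car K" "c' \<in> car K" for v v' c c'
   proof -
    have hv: "v \<in> car N" "v' \<in> car N" using h Vs(1) by auto
    have "c = c'"
    proof (rule ccontr)
     assume ne: "c \<noteq> c'"
     let ?d = "c \<oplus>\<^bsub>K\<^esub> \<ominus>\<^bsub>K\<^esub> c'"
     have d: "?d \<in> Units K" using ne h by (auto simp: K.field_Units K.add.inv_solve_right' K.r_neg1)
     have n': "?n (\<ominus>\<^bsub>K\<^esub> c') (f b) = \<ominus>\<^bsub>N\<^esub> ?n c' (f b)"
      using h b by (simp add: kS.smult_l_minus N.sc_lneg)
     let ?p = "?n c (f b)" and ?q = "?n c' (f b)"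
     have pq: "?p \<in> car N" "?q \<in> car N" using h b by auto
     have "v \<oplus>\<^bsub>N\<^esub> (?p \<oplus>\<^bsub>N\<^esub> \<ominus>\<^bsub>N\<^esub> ?q) = v'"
      using e pq hv by (simp add: N.M.a_assoc[symmetric]) (simp add: N.M.a_assoc N.M.r_neg)
     then have "?p \<oplus>\<^bsub>N\<^esub> \<ominus>\<^bsub>N\<^esub> ?q = \<ominus>\<^bsub>N\<^esub> v \<oplus>\<^bsub>N\<^esub> v'"
      using pq hv by (auto simp: N.M.a_assoc[symmetric] N.M.l_neg)
     then have "?n ?d (f b) \<in> V" using na[of c "\<ominus>\<^bsub>K\<^esub> c'" "f b"] n' h b Vn Vs(3) by auto
     then have "?n (inv\<^bsub>K\<^esub> ?d) (?n ?d (f b)) \<in> V" using d Vs(4) by auto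
     moreover have "?n (inv\<^bsub>K\<^esub> ?d) (?n ?d (f b)) = f b"
      using d b nn[of "inv\<^bsub>K\<^esub> ?d" ?d "f b"] h by (auto simp: kS.smult_one)
     ultimately show False using False by simp
    qed
    then show ?thesis using e h hv b by (simp add: N.M.add.r_cancel)
   qed
   define V' where "V' = {v \<oplus>\<^bsub>N\<^esub> ?n c (f b) | v c. v \<in> V \<and> c \<in> car K}"
   define \<tau>' where "\<tau>' y = (THE x. \<exists>v c. v \<in> V \<and> c \<in> car K \<and> y = v \<oplus>\<^bsub>N\<^esub> ?n c (f b) \<and> x = \<tau> v \<oplus>\<^bsub>M\<^esub> ?m c b)" for y
   have t': "\<tau>' (v \<oplus>\<^bsub>N\<^esub> ?n c (f b)) = \<tau> v \<oplus>\<^bsub>M\<^esub> ?m c b" if "v \<in> V" "c \<in> car K" for v c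
    unfolding \<tau>'_def using that uniq by (intro the_equality) blast+
   have add: "(v \<oplus>\<^bsub>N\<^esub> ?n c (f b)) \<oplus>\<^bsub>N\<^esub> (v' \<oplus>\<^bsub>N\<^esub> ?n c' (f b)) = (v \<oplus>\<^bsub>N\<^esub> v') \<oplus>\<^bsub>N\<^esub> ?n (c \<oplus>\<^bsub>K\<^esub> c') (f b)"
    if "v \<in> V" "c \<in> car K" "v' \<in> V" "c' \<in> car K" for v c v' c'
    using that Vs(1) b by (subst na) (auto simp: N.M.a_ac subset_iff)
   have sc: "?n d (v \<oplus>\<^bsub>N\<^esub> ?n c (f b)) = ?n d v \<oplus>\<^bsub>N\<^esub> ?n (d \<otimes>\<^bsub>K\<^esub> c) (f b)"
    if "v \<in> V" "c \<in> car K" "d \<in> car K" for v c d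
    using that Vs(1) b by (subst nn) (auto simp: N.sc_radd subset_iff)
   have VV: "v \<oplus>\<^bsub>N\<^esub> ?n c (f b) \<in> V'" if "v \<in> V" "c \<in> car K" for v c
    using that by (auto simp: V'_def)
   have "ksub K S N V'"
    unfolding ksub_def
   proof (intro conjI ballI)
    show "V' \<subseteq> car N" using Vs(1) b by (auto simp: V'_def)
    show "\<zero>\<^bsub>N\<^esub> \<in> V'" using VV[OF Vs(2) K.zero_closed] b by (simp add: kS.smult_l_null)
    show "x \<oplus>\<^bsub>N\<^esub> y \<in> V'" if "x \<in> V'" "y \<in> V'" for x y
     using that Vs(3) add unfolding V'_def by (smt (verit, best) K.a_closed mem_Collect_eq)
    show "?n c x \<in> V'" if "c \<in> car K" "x \<in> V'" for c x
     using that Vs(4) sc unfolding V'_def by (smt (verit, best) K.m_closed mem_Collect_eq)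
   qed
   moreover have "\<tau>' y \<in> car M \<and> f (\<tau>' y) = y" if "y \<in> V'" for y
    using that t(1) b fk unfolding V'_def by (auto simp: t' add_hom_add[OF fa])
   moreover have "\<tau>' (y \<oplus>\<^bsub>N\<^esub> z) = \<tau>' y \<oplus>\<^bsub>M\<^esub> \<tau>' z" if yz: "y \<in> V'" "z \<in> V'" for y z
   proof -
    obtain v c v' c' where v: "v \<in> V" "c \<in> car K" "y = v \<oplus>\<^bsub>N\<^esub> ?n c (f b)" "v' \<in> V" "c' \<in> car K" "z = v' \<oplus>\<^bsub>N\<^esub> ?n c' (f b)"
     using yz unfolding V'_def by blast
    have "\<tau> v \<in> car M" "\<tau> v' \<in> car M" using t(1) v by auto
    then show ?thesis
     using v b Vs(3) by (simp add: add t' t(2)) (simp add: kR.smult_l_distr M.sc_ladd M.M.a_ac)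
   qed
   moreover have "\<tau>' (?n d y) = ?m d (\<tau>' y)" if d: "d \<in> car K" and y: "y \<in> V'" for d y
   proof -
    obtain v c where v: "v \<in> V" "c \<in> car K" "y = v \<oplus>\<^bsub>N\<^esub> ?n c (f b)"
     using y unfolding V'_def by blast
    have "\<tau> v \<in> car M" using t(1) v by auto
    then have "\<tau> (?n d v) \<oplus>\<^bsub>M\<^esub> ?m (d \<otimes>\<^bsub>K\<^esub> c) b = ?m d (\<tau> v \<oplus>\<^bsub>M\<^esub> ?m c b)"
     using v b d by (simp add: t(3) mm M.sc_radd)
    then show ?thesis
     using sc[OF v(1,2) d] t'[OF Vs(4)[OF d v(1)] K.m_closed[OF d v(2)]] t'[OF v(1,2)] v(3) by simp
   qed
   ultimately have "good V' \<tau>'"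
    unfolding good_def by blast
   moreover have "V \<subseteq> V'"
   proof
    fix v assume "v \<in> V"
    then show "v \<in> V'" using VV[of v "\<zero>\<^bsub>K\<^esub>"] b Vs(1) by (auto simp: kS.smult_l_null)
   qed
   moreover have "f b \<in> V'"
    using VV[OF Vs(2) K.one_closed] b by (simp add: kS.smult_one)
   ultimately show ?thesis using V(2) by blast
  qed
 qed
 then obtain V \<tau> where V: "good V \<tau>" "f ` B \<subseteq> V" by blast
 have "{x \<in> car M. f x \<in> V} = car M"
  by (rule B(3)[OF ksub_preimage[OF M.M.abg N.M.abg f]])
   (use V B(2) in "auto simp: good_def")
 then have "f ` car M \<subseteq> V" by auto
 then show thesis
  using V(1) that[of \<tau>] unfolding good_def by (auto simp: subset_iff)
qed

text \<open>
  Elements are encoded by coordinates along a spanning set that is built up one vector at a time. Only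
  injectivity is needed of the code, as the module structure is transported along it.
\<close>

lemma kfin_inj_univ:
 fixes K :: "('k, 'x) ring_scheme" and M :: "('r, 'm, 'y) module_scheme"
 assumes M: "k_algebra K R" "lmodule R M" "kfin K R M"
 obtains j :: "'m => 'k univ" where "inj_on j (car M)"
proof -
 interpret M: lmodule R M by fact
 interpret kR: k_algebra K R by fact
 let ?m = "%c x. (scalar R c) \<odot>\<^bsub>M\<^esub> x"
 obtain B where B: "finite B" "B \<subseteq> car M" "!!W. ksub K R M W ==> B \<subseteq> W ==> W = car M"
  using M(3) unfolding kfin_def by blast
 have "\<exists>V. \<exists>j :: 'm => 'k univ. ksub K R M V \<and> B \<subseteq> V \<and> inj_on j V"
  using B(1,2)
 proof (induction B rule: finite_induct)
  case empty
  have "ksub K R M {\<zero>\<^bsub>M\<^esub>}" unfolding ksub_def by auto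
  then show ?case by (intro exI[of _ "{\<zero>\<^bsub>M\<^esub>}"]) auto
 next
  case (insert b B)
  then obtain V and j :: "'m => 'k univ" where V: "ksub K R M V" "B \<subseteq> V" "inj_on j V" by auto
  have b: "b \<in> car M" using insert by auto
  have Vs: "V \<subseteq> car M" "\<zero>\<^bsub>M\<^esub> \<in> V" "!!x y. [|x \<in> V; y \<in> V|] ==> x \<oplus>\<^bsub>M\<^esub> y \<in> V"
   "!!c x. [|c \<in> car K; x \<in> V|] ==> ?m c x \<in> V"
   using V(1) unfolding ksub_def by blast+
  define V' where "V' = {v \<oplus>\<^bsub>M\<^esub> ?m c b | v c. v \<in> V \<and> c \<in> car K}"
  have VV: "v \<oplus>\<^bsub>M\<^esub> ?m c b \<in> V'" if "v \<in> V" "c \<in> car K" for v c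
   using that by (auto simp: V'_def)
  have add: "(v \<oplus>\<^bsub>M\<^esub> ?m c b) \<oplus>\<^bsub>M\<^esub> (v' \<oplus>\<^bsub>M\<^esub> ?m c' b) = (v \<oplus>\<^bsub>M\<^esub> v') \<oplus>\<^bsub>M\<^esub> ?m (c \<oplus>\<^bsub>K\<^esub> c') b"
   if "v \<in> V" "c \<in> car K" "v' \<in> V" "c' \<in> car K" for v c v' c'
   using that Vs(1) b by (auto simp: M.M.a_ac subset_iff kR.smult_l_distr M.sc_ladd)
  have sc: "?m d (v \<oplus>\<^bsub>M\<^esub> ?m c b) = ?m d v \<oplus>\<^bsub>M\<^esub> ?m (d \<otimes>\<^bsub>K\<^esub> c) b"
   if "v \<in> V" "c \<in> car K" "d \<in> car K" for v c d
   using that Vs(1) b by (auto simp: M.sc_radd subset_iff kscalar_times[OF M(1)] M.sc_assoc)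
  have "ksub K R M V'"
   unfolding ksub_def
  proof (intro conjI ballI)
   show "V' \<subseteq> car M" using Vs(1) b by (auto simp: V'_def)
   show "\<zero>\<^bsub>M\<^esub> \<in> V'" using VV[OF Vs(2) kR.R.zero_closed] b by (simp add: kR.smult_l_null)
   show "x \<oplus>\<^bsub>M\<^esub> y \<in> V'" if "x \<in> V'" "y \<in> V'" for x y
    using that Vs(3) add unfolding V'_def by (smt (verit, best) kR.R.a_closed mem_Collect_eq)
   show "?m c x \<in> V'" if "c \<in> car K" "x \<in> V'" for c x
    using that Vs(4) sc unfolding V'_def by (smt (verit, best) kR.R.m_closed mem_Collect_eq)
  qed
  moreover have "insert b B \<subseteq> V'"
  proof -
   have "v \<in> V'" if "v \<in> V" for v
    using VV[OF that kR.R.zero_closed] b Vs(1) that by (auto simp: kR.smult_l_null)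
   moreover have "b \<in> V'" using VV[OF Vs(2) kR.R.one_closed] b by (simp add: kR.smult_one)
   ultimately show ?thesis using V(2) by auto
  qed
  moreover have "\<exists>j' :: 'm => 'k univ. inj_on j' V'"
  proof -
   have "\<forall>y\<in>V'. \<exists>p. fst p \<in> V \<and> y = fst p \<oplus>\<^bsub>M\<^esub> ?m (snd p) b"
    by (auto simp: V'_def)
   then obtain p where p: "!!y. y \<in> V' ==> fst (p y) \<in> V \<and> y = fst (p y) \<oplus>\<^bsub>M\<^esub> ?m (snd (p y)) b"
    by metis
   \<comment> \<open>Prepend the coefficient of \<open>b\<close> to the sequence that encodes the remaining summand.\<close>
   define j' where "j' y = case_nat (snd (p y)) (j (fst (p y)))" for y
   have "y = z" if "y \<in> V'" "z \<in> V'" "j' y = j' z" for y z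
   proof -
    have "snd (p y) = snd (p z)" using fun_cong[OF that(3), of 0] by (simp add: j'_def)
    moreover have "j (fst (p y)) = j (fst (p z))"
     using fun_cong[OF that(3), of "Suc _"] by (auto simp: j'_def)
    then have "fst (p y) = fst (p z)" using V(3) p that by (auto simp: inj_on_def)
    ultimately show ?thesis using p that by metis
   qed
   then show ?thesis unfolding inj_on_def by blast
  qed
  ultimately show ?case by blast
 qed
 then obtain V and j :: "'m => 'k univ" where V: "ksub K R M V" "B \<subseteq> V" "inj_on j V" by blast
 then have "V = car M" using B(3) by blast
 then show thesis using V(3) that by blast
qed

section \<open>Transport of structure and lifting\<close>

text \<open>
  The structure of \<open>M\<close> moved to the image of an injection \<open>j\<close>, so that \<open>j\<close> becomes an isomorphism.
\<close>

definition transport_module :: "('m => 'u) => ('r, 'm, 'y) module_scheme => ('r, 'u) module"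
 where "transport_module j M = (let i = inv_into (car M) j in
  \<lparr>carrier = j ` car M, monoid.mult = undefined, monoid.one = undefined,
   ring.zero = j \<zero>\<^bsub>M\<^esub>, ring.add = (%x y. j (i x \<oplus>\<^bsub>M\<^esub> i y)), smult = (%r x. j (r \<odot>\<^bsub>M\<^esub> i x))\<rparr>)"

definition transport_bimod :: "('m => 'u) => ('r, 's, 'm) bimod => ('r, 's, 'u) bimod"
 where "transport_bimod j M = module.extend (transport_module j M)
  (bimod.fields (%x s. j (rsmult M (inv_into (car M) j x) s)))"

lemma transport_module_simps:
 "car (transport_module j M) = j ` car M"
 "\<zero>\<^bsub>transport_module j M\<^esub> = j \<zero>\<^bsub>M\<^esub>"
 "x \<oplus>\<^bsub>transport_module j M\<^esub> y = j (inv_into (car M) j x \<oplus>\<^bsub>M\<^esub> inv_into (car M) j y)"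
 "r \<odot>\<^bsub>transport_module j M\<^esub> x = j (r \<odot>\<^bsub>M\<^esub> inv_into (car M) j x)"
 by (simp_all add: transport_module_def Let_def)

lemma transport_bimod_simps:
 "car (transport_bimod j N) = j ` car N"
 "\<zero>\<^bsub>transport_bimod j N\<^esub> = j \<zero>\<^bsub>N\<^esub>"
 "x \<oplus>\<^bsub>transport_bimod j N\<^esub> y = j (inv_into (car N) j x \<oplus>\<^bsub>N\<^esub> inv_into (car N) j y)"
 "r \<odot>\<^bsub>transport_bimod j N\<^esub> x = j (r \<odot>\<^bsub>N\<^esub> inv_into (car N) j x)"
 "rsmult (transport_bimod j N) x s = j (rsmult N (inv_into (car N) j x) s)"
 by (simp_all add: transport_bimod_def transport_module_def module.defs bimod.defs Let_def)

lemma transport_abelian_group: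
 assumes "abelian_group M" "inj_on j (car M)" "car T = j ` car M" "\<zero>\<^bsub>T\<^esub> = j \<zero>\<^bsub>M\<^esub>"
  "!!x y. [|x \<in> car M; y \<in> car M|] ==> j x \<oplus>\<^bsub>T\<^esub> j y = j (x \<oplus>\<^bsub>M\<^esub> y)"
 shows "abelian_group T"
proof -
 interpret M: abelian_group M by fact
 show ?thesis
 proof (rule abelian_groupI)
  fix x assume "x \<in> car T"
  then obtain m where m: "m \<in> car M" "x = j m" using assms(3) by auto
  then show "\<exists>y\<in>car T. y \<oplus>\<^bsub>T\<^esub> x = \<zero>\<^bsub>T\<^esub>"
   by (intro bexI[of _ "j (\<ominus>\<^bsub>M\<^esub> m)"]) (simp_all add: assms(3-5) M.l_neg)
 qed (auto simp: assms(3-5) M.a_ac)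
qed

lemma transport_lmodule:
 assumes "lmodule R M" "inj_on j (car M)"
 shows "lmodule R (transport_module j M)"
  and "j \<in> lmod_hom R M (transport_module j M)"
  and "inv_into (car M) j \<in> lmod_hom R (transport_module j M) M"
proof -
 interpret M: lmodule R M by fact
 note [simp] = transport_module_simps inv_into_f_f[OF assms(2)]
 show "lmodule R (transport_module j M)"
  by (rule lmoduleI[OF M.R.ring_axioms transport_abelian_group[OF M.M.abg assms(2)]])
   (auto simp: M.sc_ladd M.sc_radd M.sc_assoc)
 show "j \<in> lmod_hom R M (transport_module j M)" "inv_into (car M) j \<in> lmod_hom R (transport_module j M) M"
  by (auto simp: lmod_hom_def)
qed

lemma transport_bimodule:
 assumes "bimodule K R S M" "inj_on j (car M)"
 shows "bimodule K R S (transport_bimod j M)"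
  and "j \<in> bimod_hom R S M (transport_bimod j M)"
  and "inv_into (car M) j \<in> bimod_hom R S (transport_bimod j M) M"
proof -
 interpret M: bimodule K R S M by fact
 note [simp] = transport_bimod_simps inv_into_f_f[OF assms(2)]
 have l: "lmodule R (transport_bimod j M)"
  by (rule lmoduleI[OF M.R.ring_axioms transport_abelian_group[OF M.M.abg assms(2)]])
   (auto simp: M.sc_ladd M.sc_radd M.sc_assoc)
 show "bimodule K R S (transport_bimod j M)"
  by (rule bimoduleI[OF l M.kR M.kS]) (auto simp: M.rs_sadd M.rs_add M.rs_assoc M.rs_sc M.central)
 show "j \<in> bimod_hom R S M (transport_bimod j M)" "inv_into (car M) j \<in> bimod_hom R S (transport_bimod j M) M"
  by (auto simp: lmod_hom_def bimod_hom_def)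
qed

lemma kfin_lmod_image:
 assumes "k_algebra K R" "lmodule R M" "lmodule R N" "f \<in> lmod_hom R M N" "f ` car M = car N" "kfin K R M"
 shows "kfin K R N"
 by (rule kfin_image[OF abelian_of_lmodule[OF assms(2)] abelian_of_lmodule[OF assms(3)] klin_lmod_hom[OF assms(1,4)] assms(5,6)])
  (rule kscalar_sc_closed[OF assms(1,2)])

text \<open>
  Projectivity is defined by lifting problems in \<open>'k univ\<close>. A finite-dimensional problem in any other type is
  transported there.
\<close>

lemma projective_lmodule_lift:
 fixes A :: "('k, 'a) module"
 assumes P: "projective_lmodule A P" and A: "k_algebra K A"
  and N: "lmodule A N" "kfin K A N" and N': "lmodule A N'" "kfin K A N'"
  and g: "g \<in> lmod_hom A N N'" "g ` car N = car N'" and f: "f \<in> lmod_hom A P N'"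
 obtains h where "h \<in> lmod_hom A P N" "!!x. x \<in> car P ==> g (h x) = f x"
proof -
 obtain j :: "_ => 'k univ" where j: "inj_on j (car N)" using kfin_inj_univ[OF A N] .
 obtain j' :: "_ => 'k univ" where j': "inj_on j' (car N')" using kfin_inj_univ[OF A N'] .
 let ?T = "transport_module j N" and ?T' = "transport_module j' N'"
 note t = transport_lmodule[OF N(1) j] and t' = transport_lmodule[OF N'(1) j']
 let ?g = "%x. j' (g (inv_into (car N) j x))"
 have "?g \<in> lmod_hom A ?T ?T'"
  using lmod_hom_comp[OF lmod_hom_comp[OF t(3) g(1)] t'(2)] .
 moreover have "?g ` car ?T = car ?T'"
  using g(2) inv_into_f_f[OF j] by (auto simp: transport_module_simps image_iff) (metis image_iff)+
 moreover have "fin_gen A ?T" "fin_gen A ?T'"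
  using kfin_lmod_image[OF A N(1) t(1,2) _ N(2)] kfin_lmod_image[OF A N'(1) t'(1,2) _ N'(2)]
  by (auto intro!: kfin_imp_fin_gen[OF A] simp: transport_module_simps)
 moreover have "(%x. j' (f x)) \<in> lmod_hom A P ?T'" using lmod_hom_comp[OF f t'(2)] .
 ultimately obtain h where h: "h \<in> lmod_hom A P ?T" "!!x. x \<in> car P ==> ?g (h x) = j' (f x)"
  using P t(1) t'(1) unfolding projective_lmodule_def by meson
 have "g (inv_into (car N) j (h x)) = f x" if "x \<in> car P" for x
 proof -
  have "inv_into (car N) j (h x) \<in> car N"
   using lmod_homD(2)[OF t(3) lmod_homD(2)[OF h(1) that]] .
  then show ?thesis
   using h(2)[OF that] inj_onD[OF j'] lmod_homD(2)[OF g(1)] lmod_homD(2)[OF f that] by blast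
 qed
 then show thesis using that[OF lmod_hom_comp[OF h(1) t(3)]] by blast
qed

lemma projective_bimodule_lift:
 fixes K :: "'k ring" and R :: "('k, 'r) module"
 assumes P: "projective_bimodule K R S P"
  and N: "bimodule K R S N" "kfin K R N" and N': "bimodule K R S N'" "kfin K R N'"
  and g: "g \<in> bimod_hom R S N N'" "g ` car N = car N'" and f: "f \<in> bimod_hom R S P N'"
 obtains h where "h \<in> bimod_hom R S P N" "!!x. x \<in> car P ==> g (h x) = f x"
proof -
 note A = bimodule.kR[OF N(1)] and lm = lmodule_of_bimodule
 obtain j :: "_ => 'k univ" where j: "inj_on j (car N)" using kfin_inj_univ[OF A lm[OF N(1)] N(2)] .
 obtain j' :: "_ => 'k univ" where j': "inj_on j' (car N')" using kfin_inj_univ[OF A lm[OF N'(1)] N'(2)] .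
 let ?T = "transport_bimod j N" and ?T' = "transport_bimod j' N'"
 note t = transport_bimodule[OF N(1) j] and t' = transport_bimodule[OF N'(1) j']
 let ?g = "%x. j' (g (inv_into (car N) j x))"
 have "?g \<in> bimod_hom R S ?T ?T'"
  using bimod_hom_comp[OF bimod_hom_comp[OF t(3) g(1)] t'(2)] .
 moreover have "?g ` car ?T = car ?T'"
  using g(2) inv_into_f_f[OF j] by (auto simp: transport_bimod_simps image_iff) (metis image_iff)+
 moreover have "bimod_fin_gen R S ?T" "bimod_fin_gen R S ?T'"
  using kfin_lmod_image[OF A lm[OF N(1)] lm[OF t(1)] bimod_homD(1)[OF t(2)] _ N(2)]
   kfin_lmod_image[OF A lm[OF N'(1)] lm[OF t'(1)] bimod_homD(1)[OF t'(2)] _ N'(2)]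
  by (auto intro!: kfin_imp_bimod_fin_gen[OF A] simp: transport_bimod_simps)
 moreover have "(%x. j' (f x)) \<in> bimod_hom R S P ?T'" using bimod_hom_comp[OF f t'(2)] .
 ultimately obtain h where h: "h \<in> bimod_hom R S P ?T" "!!x. x \<in> car P ==> ?g (h x) = j' (f x)"
  using P t(1) t'(1) unfolding projective_bimodule_def by meson
 have "g (inv_into (car N) j (h x)) = f x" if "x \<in> car P" for x
 proof -
  have "inv_into (car N) j (h x) \<in> car N"
   using bimod_homD(3)[OF t(3) bimod_homD(3)[OF h(1) that]] .
  then show ?thesis
   using h(2)[OF that] inj_onD[OF j'] bimod_homD(3)[OF g(1)] bimod_homD(3)[OF f that] by blast
 qed
 then show thesis using that[OF bimod_hom_comp[OF h(1) t(3)]] by blast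
qed

section \<open>Direct sums\<close>

lemma dsum_simps [simp]:
 "car (dsum F) = {u. (\<forall>i. u i \<in> car (F i)) \<and> finite {i. u i \<noteq> \<zero>\<^bsub>F i\<^esub>}}"
 "\<zero>\<^bsub>dsum F\<^esub> = (%i. \<zero>\<^bsub>F i\<^esub>)"
 "u \<oplus>\<^bsub>dsum F\<^esub> v = (%i. u i \<oplus>\<^bsub>F i\<^esub> v i)"
 "r \<odot>\<^bsub>dsum F\<^esub> u = (%i. r \<odot>\<^bsub>F i\<^esub> u i)"
 by (simp_all add: dsum_def)

lemma lmodule_dsum:
 assumes F: "!!i. lmodule R (F i)" and R: "ring R"
 shows "lmodule R (dsum F)"
proof -
 note sc = lmodule.sc_closed[OF F] lmodule.sc_ladd[OF F] lmodule.sc_radd[OF F] lmodule.sc_assoc[OF F]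
  lmodule.sc_one[OF F] lmodule.sc_rzero[OF F]
 have ab: "abelian_group (F i)" for i by (rule abelian_of_lmodule[OF F])
 note am = abelian_group.axioms(1)[OF ab]
 note ag = abelian_monoid.a_closed[OF am] abelian_monoid.zero_closed[OF am] abelian_monoid.l_zero[OF am]
 have fa: "finite {i. u i \<oplus>\<^bsub>F i\<^esub> v i \<noteq> \<zero>\<^bsub>F i\<^esub>}"
  if "finite {i. u i \<noteq> \<zero>\<^bsub>F i\<^esub>}" "finite {i. v i \<noteq> \<zero>\<^bsub>F i\<^esub>}" for u v
  by (rule finite_subset[OF _ finite_UnI[OF that]]) (auto simp: ag)
 have fs: "finite {i. r \<odot>\<^bsub>F i\<^esub> u i \<noteq> \<zero>\<^bsub>F i\<^esub>}" if "finite {i. u i \<noteq> \<zero>\<^bsub>F i\<^esub>}" "r \<in> car R" for r u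
  by (rule finite_subset[OF _ that(1)]) (use that(2) in "auto simp: sc")
 show ?thesis
 proof (rule lmoduleI[OF R])
  show "abelian_group (dsum F)"
  proof (rule abelian_groupI)
   fix u assume u: "u \<in> car (dsum F)"
   have m: "(\<ominus>\<^bsub>R\<^esub> \<one>\<^bsub>R\<^esub>) \<odot>\<^bsub>F i\<^esub> u i \<oplus>\<^bsub>F i\<^esub> u i = \<zero>\<^bsub>F i\<^esub>" for i
   proof -
    interpret lmodule R "F i" by (rule F)
    show ?thesis using u by (simp add: sc_lneg M.l_neg)
   qed
   have r: "\<ominus>\<^bsub>R\<^esub> \<one>\<^bsub>R\<^esub> \<in> car R" by (simp add: R ring.ring_simprules)
   show "\<exists>v\<in>car (dsum F). v \<oplus>\<^bsub>dsum F\<^esub> u = \<zero>\<^bsub>dsum F\<^esub>"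
    by (rule bexI[of _ "%i. (\<ominus>\<^bsub>R\<^esub> \<one>\<^bsub>R\<^esub>) \<odot>\<^bsub>F i\<^esub> u i"]) (use u r fs m sc in auto)
  qed (auto simp: ag fa abelian_monoid.a_assoc[OF am] intro!: abelian_monoid.a_comm[OF am])
 qed (auto simp: sc fa fs)
qed

definition dsum_single :: "('i => ('r, 'm) module) => 'i => 'm => 'i => 'm"
 where "dsum_single F i x = (%k. if k = i then x else \<zero>\<^bsub>F k\<^esub>)"

lemma dsum_single_hom:
 assumes F: "!!i. lmodule R (F i)"
 shows "dsum_single F i \<in> lmod_hom R (F i) (dsum F)"
proof -
 have ab: "abelian_monoid (F i)" for i by (rule abelian_group.axioms(1)[OF abelian_of_lmodule[OF F]])
 show ?thesis
  by (auto simp: lmod_hom_def dsum_single_def fun_eq_iff lmodule.sc_rzero[OF F]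
    abelian_monoid.zero_closed[OF ab] abelian_monoid.l_zero[OF ab] intro: finite_subset[of _ "{i}"])
qed

text \<open>
  An element of a direct sum is a finite sum of elements supported at one index.
\<close>

lemma dsum_closure:
 assumes F: "!!i. lmodule R (F i)" and R: "ring R" and u: "u \<in> car (dsum F)"
  and W: "\<zero>\<^bsub>dsum F\<^esub> \<in> W" "!!v w. [|v \<in> W; w \<in> W|] ==> v \<oplus>\<^bsub>dsum F\<^esub> w \<in> W"
  and s: "!!i x. [|x \<in> car (F i); u i \<noteq> \<zero>\<^bsub>F i\<^esub>|] ==> dsum_single F i x \<in> W"
 shows "u \<in> W"
proof -
 have ab: "abelian_monoid (F i)" for i by (rule abelian_group.axioms(1)[OF abelian_of_lmodule[OF F]])
 have "!!J. finite J ==> J \<subseteq> {i. u i \<noteq> \<zero>\<^bsub>F i\<^esub>} ==> (%i. if i \<in> J then u i else \<zero>\<^bsub>F i\<^esub>) \<in> W"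
 proof -
  fix J assume "finite J" "J \<subseteq> {i. u i \<noteq> \<zero>\<^bsub>F i\<^esub>}"
  then show "(%i. if i \<in> J then u i else \<zero>\<^bsub>F i\<^esub>) \<in> W"
  proof (induction J rule: finite_induct)
   case empty
   then show ?case using W(1) by simp
  next
   case (insert b J)
   have "dsum_single F b (u b) \<oplus>\<^bsub>dsum F\<^esub> (%i. if i \<in> J then u i else \<zero>\<^bsub>F i\<^esub>) \<in> W"
    by (rule W(2)[OF s insert.IH]) (use insert.prems u in auto)
   also have "dsum_single F b (u b) \<oplus>\<^bsub>dsum F\<^esub> (%i. if i \<in> J then u i else \<zero>\<^bsub>F i\<^esub>) =
     (%i. if i \<in> insert b J then u i else \<zero>\<^bsub>F i\<^esub>)"
    using insert.hyps u by (auto simp: dsum_single_def fun_eq_iff abelian_monoid.l_zero[OF ab] abelian_monoid.r_zero[OF ab]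
      abelian_monoid.zero_closed[OF ab])
   finally show ?case .
  qed
 qed
 from this[of "{i. u i \<noteq> \<zero>\<^bsub>F i\<^esub>}"] have "(%i. if u i \<noteq> \<zero>\<^bsub>F i\<^esub> then u i else \<zero>\<^bsub>F i\<^esub>) \<in> W" using u by simp
 also have "(%i. if u i \<noteq> \<zero>\<^bsub>F i\<^esub> then u i else \<zero>\<^bsub>F i\<^esub>) = u" by auto
 finally show ?thesis .
qed

lemma kfin_dsum:
 assumes R: "k_algebra K R" and F: "!!i. lmodule R (F i)" and J: "finite J" "!!i. i \<notin> J ==> car (F i) = {\<zero>\<^bsub>F i\<^esub>}"
  and fin: "!!i. i \<in> J ==> kfin K R (F i)"
 shows "kfin K R (dsum F)"
proof -
 have rR: "ring R" by (rule k_algebraD(2)[OF R])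
 note ab = abelian_of_lmodule[OF F] abelian_of_lmodule[OF lmodule_dsum[of R F, OF F rR]]
 have "\<forall>i\<in>J. \<exists>B. finite B \<and> B \<subseteq> car (F i) \<and> (\<forall>W. ksub K R (F i) W \<and> B \<subseteq> W --> W = car (F i))"
  using fin unfolding kfin_def by blast
 then obtain B where B: "!!i. i \<in> J ==> finite (B i)" "!!i. i \<in> J ==> B i \<subseteq> car (F i)"
  "!!i W. i \<in> J ==> ksub K R (F i) W ==> B i \<subseteq> W ==> W = car (F i)"
  by metis
 let ?D = "\<Union>i\<in>J. dsum_single F i ` B i"
 have "W = car (dsum F)" if W: "ksub K R (dsum F) W" "?D \<subseteq> W" for W
 proof -
  have 1: "dsum_single F i x \<in> W" if "i \<in> J" "x \<in> car (F i)" for i x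
  proof -
   have "{x \<in> car (F i). dsum_single F i x \<in> W} = car (F i)"
    by (rule B(3)[OF that(1) ksub_preimage[OF ab klin_lmod_hom[OF R dsum_single_hom[of R F, OF F]] W(1)
        kscalar_sc_closed[OF R F]]])
     (use B(2)[OF that(1)] bspec[OF W(2)[unfolded UN_subset_iff] that(1)] in "auto simp: image_subset_iff")
   then show ?thesis using that by auto
  qed
  have "u \<in> W" if u: "u \<in> car (dsum F)" for u
  proof -
   have iJ: "i \<in> J" if "u i \<noteq> \<zero>\<^bsub>F i\<^esub>" for i
    using J(2)[of i] u that by auto
   show ?thesis
   by (rule dsum_closure[of R F, OF F rR u]) (use W(1) 1 iJ u in "auto simp: ksub_def")
  qed
  then show ?thesis using W(1) by (auto simp: ksub_def)
 qed
 moreover have "?D \<subseteq> car (dsum F)"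
  using B(2) lmod_homD(2)[OF dsum_single_hom[of R F, OF F]] by blast
 ultimately show ?thesis
  unfolding kfin_def using B(1) J(1) by (intro exI[of _ ?D]) auto
qed

section \<open>Endomorphism algebra and dual basis\<close>

definition Hom :: "('a, 'x) ring_scheme => ('a, 'p, 'y) module_scheme => ('a, 'l, 'z) module_scheme => ('p => 'p, 'p => 'l) module"
 where "Hom A P L =
  \<lparr>carrier = lmod_hom A P L \<inter> extensional (car P), monoid.mult = undefined, monoid.one = undefined,
   ring.zero = (\<lambda>p\<in>car P. \<zero>\<^bsub>L\<^esub>), ring.add = (%\<phi> \<psi>. \<lambda>p\<in>car P. \<phi> p \<oplus>\<^bsub>L\<^esub> \<psi> p),
   smult = (%e \<phi>. \<lambda>p\<in>car P. \<phi> (e p))\<rparr>"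

lemma Hom_simps [simp]:
 "car (Hom A P L) = lmod_hom A P L \<inter> extensional (car P)"
 "\<zero>\<^bsub>Hom A P L\<^esub> = (\<lambda>p\<in>car P. \<zero>\<^bsub>L\<^esub>)"
 "\<phi> \<oplus>\<^bsub>Hom A P L\<^esub> \<psi> = (\<lambda>p\<in>car P. \<phi> p \<oplus>\<^bsub>L\<^esub> \<psi> p)"
 "e \<odot>\<^bsub>Hom A P L\<^esub> \<phi> = (\<lambda>p\<in>car P. \<phi> (e p))"
 by (simp_all add: Hom_def)

lemma P_dual_simps [simp]:
 "car (P_dual A P) = lmod_hom A P (reg A) \<inter> extensional (car P)"
 "\<zero>\<^bsub>P_dual A P\<^esub> = (\<lambda>p\<in>car P. \<zero>\<^bsub>A\<^esub>)"
 "\<phi> \<oplus>\<^bsub>P_dual A P\<^esub> \<psi> = (\<lambda>p\<in>car P. \<phi> p \<oplus>\<^bsub>A\<^esub> \<psi> p)"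
 "e \<odot>\<^bsub>P_dual A P\<^esub> \<phi> = (\<lambda>p\<in>car P. \<phi> (e p))"
 "rsmult (P_dual A P) \<phi> a = (\<lambda>p\<in>car P. \<phi> p \<otimes>\<^bsub>A\<^esub> a)"
 by (simp_all add: P_dual_def)

lemma End_op_simps [simp]:
 "car (End_op A P) = lmod_hom A P P \<inter> extensional (car P)"
 "\<zero>\<^bsub>End_op A P\<^esub> = (\<lambda>p\<in>car P. \<zero>\<^bsub>P\<^esub>)"
 "\<one>\<^bsub>End_op A P\<^esub> = (\<lambda>p\<in>car P. p)"
 "\<phi> \<oplus>\<^bsub>End_op A P\<^esub> \<psi> = (\<lambda>p\<in>car P. \<phi> p \<oplus>\<^bsub>P\<^esub> \<psi> p)"
 "\<phi> \<otimes>\<^bsub>End_op A P\<^esub> \<psi> = (\<lambda>p\<in>car P. \<psi> (\<phi> p))"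
 "c \<odot>\<^bsub>End_op A P\<^esub> \<phi> = (\<lambda>p\<in>car P. (scalar A c) \<odot>\<^bsub>P\<^esub> \<phi> p)"
 by (simp_all add: End_op_def compose_def)

lemma P_bimod_simps [simp]:
 "car (P_bimod P) = car P" "\<zero>\<^bsub>P_bimod P\<^esub> = \<zero>\<^bsub>P\<^esub>" "ring.add (P_bimod P) = ring.add P"
 "smult (P_bimod P) = smult P" "rsmult (P_bimod P) p e = e p"
 by (simp_all add: P_bimod_def module.defs bimod.defs)

lemma hom_eqI:
 "[|\<phi> \<in> extensional D; \<psi> \<in> extensional D; !!p. p \<in> D ==> \<phi> p = \<psi> p|] ==> \<phi> = \<psi>"
 by (rule extensionalityI)

lemma lmod_hom_restrict [simp]:
 assumes "lmodule A P"
 shows "restrict f (car P) \<in> lmod_hom A P L \<longleftrightarrow> f \<in> lmod_hom A P L"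
proof -
 interpret lmodule A P by fact
 show ?thesis
  unfolding lmod_hom_def by (auto simp: Pi_iff)
qed

lemma lmod_hom_plus:
 assumes "lmodule A L" "f \<in> lmod_hom A P L" "g \<in> lmod_hom A P L"
 shows "(%x. f x \<oplus>\<^bsub>L\<^esub> g x) \<in> lmod_hom A P L"
 using add_hom_plus[OF abelian_of_lmodule[OF assms(1)] lmod_homD(1)[OF assms(2)] lmod_homD(1)[OF assms(3)]] assms
 by (intro lmod_homI) (auto simp: lmod_homD lmodule.sc_radd)

lemma lmod_hom_uminus:
 assumes "lmodule A L" "f \<in> lmod_hom A P L"
 shows "(%x. \<ominus>\<^bsub>L\<^esub> f x) \<in> lmod_hom A P L"
 using add_hom_uminus[OF abelian_of_lmodule[OF assms(1)] lmod_homD(1)[OF assms(2)]] assms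
 by (intro lmod_homI) (auto simp: lmod_homD lmodule.sc_rneg)

lemma lmod_hom_const_zero:
 assumes "lmodule A L"
 shows "(%x. \<zero>\<^bsub>L\<^esub>) \<in> lmod_hom A P L"
proof -
 interpret lmodule A L by fact
 show ?thesis by (auto simp: lmod_hom_def)
qed

lemma lmod_hom_id: "(%x. x) \<in> lmod_hom A P P"
 by (auto simp: lmod_hom_def)

lemma Hom_abelian_group:
 assumes P: "lmodule A P" and L: "lmodule A L"
 shows "abelian_group (Hom A P L)"
proof -
 interpret P: lmodule A P by fact
 interpret L: lmodule A L by fact
 show ?thesis
 proof (rule abelian_groupI)
  fix \<phi> assume \<phi>: "\<phi> \<in> car (Hom A P L)"
  show "\<exists>\<psi>\<in>car (Hom A P L). \<psi> \<oplus>\<^bsub>Hom A P L\<^esub> \<phi> = \<zero>\<^bsub>Hom A P L\<^esub>"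
   by (rule bexI[of _ "\<lambda>p\<in>car P. \<ominus>\<^bsub>L\<^esub> \<phi> p"])
    (use \<phi> lmod_homD(2) in "auto simp: P L lmod_hom_uminus intro!: restrict_ext L.M.l_neg")
 qed (auto simp: P L lmod_hom_plus lmod_hom_const_zero lmod_homD(2) L.M.a_ac intro!: restrict_ext intro: hom_eqI)
qed

lemma k_algebra_End_op:
 assumes A: "k_algebra K A" and P: "lmodule A P"
 shows "k_algebra K (End_op A P)"
proof -
 interpret P: lmodule A P by fact
 interpret A: k_algebra K A by fact
 have ab: "abelian_group (End_op A P)"
  by (rule abelian_group_cong[OF Hom_abelian_group[OF P P]]) (auto simp: fun_eq_iff)
 have ring: "ring (End_op A P)"
  by (rule ringI[OF ab monoidI])
   (auto simp: P lmod_hom_plus lmod_hom_comp lmod_hom_id lmod_homD(2,3) intro!: restrict_ext intro: hom_eqI)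
 have sc: "(%p. (scalar A c) \<odot>\<^bsub>P\<^esub> \<phi> p) \<in> lmod_hom A P P" if "c \<in> car K" "\<phi> \<in> lmod_hom A P P" for c \<phi>
  using that kscalar_closed[OF A that(1)] kscalar_central[OF A that(1)]
  by (intro lmod_homI add_homI) (simp_all add: lmod_homD P.sc_radd P.sc_assoc[symmetric])
 have "module K (End_op A P)"
  unfolding module_def module_axioms_def
  using ab A.R.cring_axioms kscalar_closed[OF A]
  by (auto simp: P sc lmod_homD(2) P.sc_radd P.sc_ladd A.smult_l_distr P.sc_assoc kscalar_times[OF A] A.smult_one intro!: restrict_ext intro: hom_eqI)
 then show ?thesis
  unfolding k_algebra_def k_algebra_axioms_def
  using ring kscalar_closed[OF A]
  by (auto simp: lmod_homD(2,4) intro!: restrict_ext)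
qed

lemma lmodule_Hom:
 assumes A: "k_algebra K A" and P: "lmodule A P" and L: "lmodule A L"
 shows "lmodule (End_op A P) (Hom A P L)"
 by (rule lmoduleI[OF k_algebraD(2)[OF k_algebra_End_op[OF A P]] Hom_abelian_group[OF P L]])
  (auto simp: P L lmod_hom_comp lmod_homD(2,3) intro!: restrict_ext intro: hom_eqI)

lemma bimodule_P:
 assumes A: "k_algebra K A" and P: "lmodule A P"
 shows "bimodule K A (End_op A P) (P_bimod P)"
proof (rule bimoduleI[OF _ A k_algebra_End_op[OF A P]])
 interpret P: lmodule A P by fact
 show "lmodule A (P_bimod P)"
  by (rule lmoduleI[OF P.R.ring_axioms abelian_group_cong[OF P.M.abg]])
   (auto simp: P.sc_ladd P.sc_radd P.sc_assoc)
qed (auto simp: lmod_homD)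

lemma bimodule_P_dual:
 assumes A: "k_algebra K A" and P: "lmodule A P"
 shows "bimodule K (End_op A P) A (P_dual A P)"
proof -
 interpret P: lmodule A P by fact

 interpret R: bimodule K A A "reg A" by (rule bimodule_reg[OF A])
 have ab: "abelian_group (P_dual A P)"
  by (rule abelian_group_cong[OF Hom_abelian_group[OF P R.lmod]]) (auto simp: fun_eq_iff)
 have l: "lmodule (End_op A P) (P_dual A P)"
  by (rule lmoduleI[OF k_algebraD(2)[OF k_algebra_End_op[OF A P]] ab])
  (auto simp: P lmod_hom_plus[OF R.lmod, simplified] lmod_hom_comp lmod_homD(2,3) intro!: restrict_ext intro: hom_eqI)
 have cl: "\<phi> p \<in> car A" if "\<phi> \<in> lmod_hom A P (reg A)" "p \<in> car P" for \<phi> p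
  using lmod_homD(2)[OF that] by simp
 have rs: "(%p. \<phi> p \<otimes>\<^bsub>A\<^esub> a) \<in> lmod_hom A P (reg A)"
  if "\<phi> \<in> lmod_hom A P (reg A)" "a \<in> car A" for \<phi> a
  using that by (intro lmod_homI add_homI) (simp_all add: lmod_homD cl P.R.l_distr P.R.m_assoc)
 have ce: "\<phi> ((scalar A c) \<odot>\<^bsub>P\<^esub> p) = \<phi> p \<otimes>\<^bsub>A\<^esub> (scalar A c)"
  if "\<phi> \<in> lmod_hom A P (reg A)" "c \<in> car K" "p \<in> car P" for p c \<phi>
  using that kscalar_closed[OF A that(2)] by (simp add: lmod_homD cl kscalar_mult[OF A that(2)])
 show ?thesis
  by (rule bimoduleI[OF l k_algebra_End_op[OF A P] A])
   (auto simp: P rs cl ce P.R.r_distr P.R.l_distr P.R.m_assoc lmod_homD(2) intro!: restrict_ext intro: hom_eqI)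
qed

declare Hom_simps(1) [simp del] P_dual_simps(1) [simp del] End_op_simps(1) [simp del]

lemma add_hom_finsum:
 assumes "abelian_group G" "abelian_group H" "f \<in> add_hom G H" "finite B" "g \<in> B \<rightarrow> car G"
 shows "f (\<Oplus>\<^bsub>G\<^esub>b\<in>B. g b) = (\<Oplus>\<^bsub>H\<^esub>b\<in>B. f (g b))"
proof -
 interpret G: abelian_group G by fact
 interpret H: abelian_group H by fact
 show ?thesis
  using assms(4,5)
 proof (induction B rule: finite_induct)
  case empty
  then show ?case using add_hom_zero[OF assms(1-3)] by simp
 next
  case (insert b B)
  then have "(%b. f (g b)) \<in> B \<rightarrow> car H" "f (g b) \<in> car H" "g \<in> B \<rightarrow> car G" "g b \<in> car G"
   using add_hom_closed[OF assms(3)] by auto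
  then show ?case
   using insert by (simp add: add_hom_add[OF assms(3)])
 qed
qed

lemma lmodule_truncate: "lmodule R M ==> lmodule R (module.truncate M)"
proof -
 assume "lmodule R M"
 then interpret lmodule R M .
 show ?thesis
  by (rule lmoduleI[OF R.ring_axioms abelian_group_cong[OF M.abg]])
   (auto simp: module.defs sc_ladd sc_radd sc_assoc)
qed

lemma lmodule_zero_carrier: "lmodule R M ==> lmodule R (M\<lparr>carrier := {\<zero>\<^bsub>M\<^esub>}\<rparr>)"
proof -
 assume "lmodule R M"
 then interpret lmodule R M .
 show ?thesis
  by (rule lmoduleI[OF R.ring_axioms abelian_groupI]) (auto)
qed

lemma kfin_zero_carrier: "car M = {\<zero>\<^bsub>M\<^esub>} ==> kfin K R M"
 unfolding kfin_def ksub_def by (intro exI[of _ "{}"]) auto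

locale projective_setup =
 fixes K :: "'k ring" and A :: "('k, 'a) module" and P :: "('a, 'p) module"
 assumes K: "field K" and A: "k_algebra K A" and finA: "kfin K A (reg A)"
  and projP: "projective_lmodule A P" and finP: "kfin K A P"
begin

abbreviation "E \<equiv> End_op A P"
abbreviation "Pd \<equiv> P_dual A P"

sublocale A: k_algebra K A by (rule A)
sublocale P: lmodule A P
 using projP by (simp add: projective_lmodule_def)

lemma Pm: "lmodule A P" by (rule P.lmodule_axioms)

sublocale Pb: bimodule K A E "P_bimod P" by (rule bimodule_P[OF A Pm])
sublocale Pd: bimodule K E A Pd by (rule bimodule_P_dual[OF A Pm])
sublocale PdP: tensor_pair Pd A P by (rule tensor_pairI[OF Pd.bm Pm])

lemma E: "k_algebra K E" by (rule k_algebra_End_op[OF A Pm])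

lemma Pd_mem: "\<phi> \<in> car Pd \<longleftrightarrow> \<phi> \<in> lmod_hom A P (reg A) \<and> \<phi> \<in> extensional (car P)"
 by (simp add: P_dual_simps(1))

lemma E_mem: "e \<in> car E \<longleftrightarrow> e \<in> lmod_hom A P P \<and> e \<in> extensional (car P)"
 by (simp add: End_op_simps(1))

lemma Hom_mem: "\<psi> \<in> car (Hom A P L) \<longleftrightarrow> \<psi> \<in> lmod_hom A P L \<and> \<psi> \<in> extensional (car P)"
 by (simp add: Hom_simps(1))

lemma Pd_apply [simp]: "[|\<phi> \<in> car Pd; p \<in> car P|] ==> \<phi> p \<in> car A"
 and Pd_add: "[|\<phi> \<in> car Pd; p \<in> car P; q \<in> car P|] ==> \<phi> (p \<oplus>\<^bsub>P\<^esub> q) = \<phi> p \<oplus>\<^bsub>A\<^esub> \<phi> q"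
 and Pd_smult: "[|\<phi> \<in> car Pd; r \<in> car A; p \<in> car P|] ==> \<phi> (r \<odot>\<^bsub>P\<^esub> p) = r \<otimes>\<^bsub>A\<^esub> \<phi> p"
 using lmod_homD(2-)[of \<phi> A P "reg A"] by (auto simp: Pd_mem)

lemma E_apply [simp]: "[|e \<in> car E; p \<in> car P|] ==> e p \<in> car P"
 and E_add: "[|e \<in> car E; p \<in> car P; q \<in> car P|] ==> e (p \<oplus>\<^bsub>P\<^esub> q) = e p \<oplus>\<^bsub>P\<^esub> e q"
 and E_smult: "[|e \<in> car E; r \<in> car A; p \<in> car P|] ==> e (r \<odot>\<^bsub>P\<^esub> p) = r \<odot>\<^bsub>P\<^esub> e p"
 using lmod_homD(2-)[of e A P P] by (auto simp: E_mem)

lemma Hom_apply [simp]: "[|\<psi> \<in> car (Hom A P L); p \<in> car P|] ==> \<psi> p \<in> car L"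
 and Hom_add: "[|\<psi> \<in> car (Hom A P L); p \<in> car P; q \<in> car P|] ==> \<psi> (p \<oplus>\<^bsub>P\<^esub> q) = \<psi> p \<oplus>\<^bsub>L\<^esub> \<psi> q"
 and Hom_smult: "[|\<psi> \<in> car (Hom A P L); r \<in> car A; p \<in> car P|] ==> \<psi> (r \<odot>\<^bsub>P\<^esub> p) = r \<odot>\<^bsub>L\<^esub> \<psi> p"
 using lmod_homD(2-)[of \<psi> A P L] by (auto simp: Hom_mem)

lemma E_eqI: "[|\<phi> \<in> car E; \<psi> \<in> car E; !!p. p \<in> car P ==> \<phi> p = \<psi> p|] ==> \<phi> = \<psi>"
 by (auto intro: hom_eqI simp: E_mem)

lemma Hom_eqI: "[|\<phi> \<in> car (Hom A P L); \<psi> \<in> car (Hom A P L); !!p. p \<in> car P ==> \<phi> p = \<psi> p|] ==> \<phi> = \<psi>"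
 by (auto intro: hom_eqI simp: Hom_mem)

text \<open>
  The image of \<open>\<phi> \<otimes> l\<close> under the canonical map from \<open>P\<^sup>\<or> \<otimes>\<^sub>A L\<close> to \<open>Hom\<^sub>A(P, L)\<close>.
\<close>

definition br :: "('a, 'l, 'z) module_scheme => ('p => 'a) => 'l => 'p => 'l"
 where "br L \<phi> l = (\<lambda>p\<in>car P. \<phi> p \<odot>\<^bsub>L\<^esub> l)"

context
 fixes L :: "('a, 'l, 'z) module_scheme"
 assumes L: "lmodule A L"
begin

interpretation L: lmodule A L by (rule L)

lemma Hom_ag: "abelian_group (Hom A P L)"
 by (rule Hom_abelian_group[OF Pm L])

lemma br_closed: "[|\<phi> \<in> car Pd; l \<in> car L|] ==> br L \<phi> l \<in> car (Hom A P L)"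
proof -
 assume a: "\<phi> \<in> car Pd" "l \<in> car L"
 have "(%p. \<phi> p \<odot>\<^bsub>L\<^esub> l) \<in> lmod_hom A P L"
  using a by (intro lmod_homI add_homI) (simp_all add: Pd_add Pd_smult L.sc_ladd L.sc_assoc)
 then show ?thesis by (simp add: br_def Pm Hom_mem)
qed

lemma br_balanced: "balanced Pd A L (Hom A P L) (br L)"
proof (rule balancedI)
 fix \<phi> \<phi>' l assume "\<phi> \<in> car Pd" "\<phi>' \<in> car Pd" "l \<in> car L"
 then show "br L (\<phi> \<oplus>\<^bsub>Pd\<^esub> \<phi>') l = br L \<phi> l \<oplus>\<^bsub>Hom A P L\<^esub> br L \<phi>' l"
  using Pd_apply[of \<phi>] Pd_apply[of \<phi>'] by (auto simp: br_def L.sc_ladd intro!: restrict_ext)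
next
 fix \<phi> l l' assume "\<phi> \<in> car Pd" "l \<in> car L" "l' \<in> car L"
 then show "br L \<phi> (l \<oplus>\<^bsub>L\<^esub> l') = br L \<phi> l \<oplus>\<^bsub>Hom A P L\<^esub> br L \<phi> l'"
  using Pd_apply[of \<phi>] by (auto simp: br_def L.sc_radd intro!: restrict_ext)
next
 fix \<phi> a l assume "\<phi> \<in> car Pd" "a \<in> car A" "l \<in> car L"
 then show "br L (rsmult Pd \<phi> a) l = br L \<phi> (a \<odot>\<^bsub>L\<^esub> l)"
  using Pd_apply[of \<phi>] by (auto simp: br_def L.sc_assoc intro!: restrict_ext)
qed (rule br_closed)

lemma br_E: "[|e \<in> car E; \<phi> \<in> car Pd; l \<in> car L|] ==> br L (e \<odot>\<^bsub>Pd\<^esub> \<phi>) l = e \<odot>\<^bsub>Hom A P L\<^esub> br L \<phi> l"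
 using E_apply[of e] by (auto simp: br_def intro!: restrict_ext)

lemma br_hom_balanced:
 assumes "\<psi> \<in> car (Hom A P L)"
 shows "balanced Pd A P (Hom A P L) (%\<phi> q. br L \<phi> (\<psi> q))"
 using assms balancedD[OF br_balanced]
 by (intro balancedI) (simp_all add: Hom_add Hom_smult del: Hom_simps)

lemma eval_hom: "p \<in> car P ==> (%\<psi>. \<psi> p) \<in> add_hom (Hom A P L) L"
 by (rule add_homI) simp_all

end

lemma ev_balanced:
 assumes "p \<in> car P"
 shows "balanced Pd A P P (%\<phi> q. \<phi> p \<odot>\<^bsub>P\<^esub> q)"
 by (rule balancedI)
  (use assms in "simp_all add: P.sc_ladd P.sc_radd P.sc_assoc")

text \<open>
  Let \<open>B\<close> be a finite set of generators. The surjection \<open>\<pi>\<close> from the free module on \<open>B\<close> onto \<open>P\<close> has a section \<open>s\<close>;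
  its coordinates \<open>\<phi>\<^sub>b\<close> satisfy \<open>\<Sum> \<phi>\<^sub>b(p) b = \<pi>(s p) = p\<close>, so \<open>\<Sum> \<phi>\<^sub>b \<otimes> b\<close> has the required property.
\<close>

lemma dual_basis:
 "\<exists>\<omega>\<in>car (tgrp Pd A P). \<forall>p\<in>car P. lift P (%\<phi> q. \<phi> p \<odot>\<^bsub>P\<^esub> q) \<omega> = p"
proof -
 interpret rA: bimodule K A A "reg A" by (rule bimodule_reg[OF A])
 obtain B where B: "finite B" "B \<subseteq> car P" "!!N. submodule N A P ==> B \<subseteq> N ==> N = car P"
  using kfin_imp_fin_gen[OF A finP] unfolding fin_gen_def by blast
 define R0 where "R0 = module.truncate (reg A)"
 define F where "F b = (if b \<in> B then R0 else R0\<lparr>carrier := {\<zero>\<^bsub>R0\<^esub>}\<rparr>)" for b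
 have R0 [simp]: "car R0 = car A" "\<zero>\<^bsub>R0\<^esub> = \<zero>\<^bsub>A\<^esub>" "ring.add R0 = ring.add A" "smult R0 = monoid.mult A"
  by (simp_all add: R0_def module.defs)
 have R0m: "lmodule A R0" unfolding R0_def by (rule lmodule_truncate[OF rA.lmod])
 have Fm: "lmodule A (F b)" for b
  unfolding F_def using R0m lmodule_zero_carrier[OF R0m] by simp
 have "kfin K A R0" by (rule kfin_cong[OF _ _ _ _ finA]) simp_all
 then have Fk: "kfin K A (F b)" for b
  unfolding F_def using kfin_zero_carrier[of "R0\<lparr>carrier := {\<zero>\<^bsub>R0\<^esub>}\<rparr>" K A] by simp
 have Fs: "\<zero>\<^bsub>F b\<^esub> = \<zero>\<^bsub>A\<^esub>" "ring.add (F b) = ring.add A" "smult (F b) = monoid.mult A"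
  "car (F b) \<subseteq> car A" for b
  by (simp_all add: F_def)
 have D: "lmodule A (dsum F)" by (rule lmodule_dsum[of A F, OF Fm k_algebraD(2)[OF A]])
 have Dk: "kfin K A (dsum F)"
  by (rule kfin_dsum[of K A F, OF A Fm B(1) _ Fk]) (simp add: F_def)
 define \<pi> where "\<pi> u = (\<Oplus>\<^bsub>P\<^esub>b\<in>B. u b \<odot>\<^bsub>P\<^esub> b)" for u
 have uA: "u b \<in> car A" if "u \<in> car (dsum F)" for u b
  using that Fs(4)[of b] by auto
 have smc: "(%b. u b \<odot>\<^bsub>P\<^esub> b) \<in> B \<rightarrow> car P" if "u \<in> car (dsum F)" for u
  using uA[OF that] B(2) by auto
 have \<pi>: "\<pi> \<in> lmod_hom A (dsum F) P"
 proof (intro lmod_homI add_homI)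
  show "\<pi> u \<in> car P" if "u \<in> car (dsum F)" for u
   unfolding \<pi>_def by (rule P.M.finsum_closed[OF smc[OF that]])
  show "\<pi> (u \<oplus>\<^bsub>dsum F\<^esub> v) = \<pi> u \<oplus>\<^bsub>P\<^esub> \<pi> v" if uv: "u \<in> car (dsum F)" "v \<in> car (dsum F)" for u v
  proof -
   have "\<pi> (u \<oplus>\<^bsub>dsum F\<^esub> v) = (\<Oplus>\<^bsub>P\<^esub>b\<in>B. u b \<odot>\<^bsub>P\<^esub> b \<oplus>\<^bsub>P\<^esub> v b \<odot>\<^bsub>P\<^esub> b)"
    unfolding \<pi>_def
    by (rule P.M.finsum_cong') (use B(2) uA[OF uv(1)] uA[OF uv(2)] in "auto simp: Fs P.sc_ladd subset_iff")
   then show ?thesis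
    unfolding \<pi>_def using P.M.finsum_addf[OF smc[OF uv(1)] smc[OF uv(2)]] by simp
  qed
  show "\<pi> (r \<odot>\<^bsub>dsum F\<^esub> u) = r \<odot>\<^bsub>P\<^esub> \<pi> u" if r: "r \<in> car A" and u: "u \<in> car (dsum F)" for r u
  proof -
   have "r \<odot>\<^bsub>P\<^esub> \<pi> u = (\<Oplus>\<^bsub>P\<^esub>b\<in>B. r \<odot>\<^bsub>P\<^esub> (u b \<odot>\<^bsub>P\<^esub> b))"
    unfolding \<pi>_def
    by (rule add_hom_finsum[OF P.M.abg P.M.abg P.sc_right_hom[OF r] B(1) smc[OF u]])
   also have "\<dots> = \<pi> (r \<odot>\<^bsub>dsum F\<^esub> u)"
    unfolding \<pi>_def
    by (rule P.M.finsum_cong') (use B(2) uA[OF u] r in "auto simp: Fs P.sc_assoc subset_iff")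
   finally show ?thesis ..
  qed
 qed
 have "\<pi> ` car (dsum F) = car P"
 proof (rule B(3))
  interpret D: lmodule A "dsum F" by (rule D)
  show "submodule (\<pi> ` car (dsum F)) A P"
  proof (rule submodule_if_closed[OF Pm])
   show "\<zero>\<^bsub>P\<^esub> \<in> \<pi> ` car (dsum F)"
    using lmod_hom_zero[OF D Pm \<pi>] D.M.zero_closed by (metis imageI)
  next
   fix x y assume "x \<in> \<pi> ` car (dsum F)" "y \<in> \<pi> ` car (dsum F)"
   then obtain u v where uv: "u \<in> car (dsum F)" "x = \<pi> u" "v \<in> car (dsum F)" "y = \<pi> v" by (elim imageE)
   show "x \<oplus>\<^bsub>P\<^esub> y \<in> \<pi> ` car (dsum F)"
    unfolding uv(2,4) lmod_homD(3)[OF \<pi> uv(1,3), symmetric] by (rule imageI[OF D.M.a_closed[OF uv(1,3)]])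
  next
   fix r x assume r: "r \<in> car A" and "x \<in> \<pi> ` car (dsum F)"
   then obtain u where u: "u \<in> car (dsum F)" "x = \<pi> u" by (elim imageE)
   show "r \<odot>\<^bsub>P\<^esub> x \<in> \<pi> ` car (dsum F)"
    unfolding u(2) lmod_homD(4)[OF \<pi> r u(1), symmetric] by (rule imageI[OF D.sc_closed[OF r u(1)]])
  qed (use lmod_homD(2)[OF \<pi>] in blast)
  show "B \<subseteq> \<pi> ` car (dsum F)"
  proof
   fix b assume b: "b \<in> B"
   let ?u = "dsum_single F b \<one>\<^bsub>A\<^esub>"
   have u: "?u \<in> car (dsum F)"
    by (rule lmod_homD(2)[OF dsum_single_hom[of A F, OF Fm]]) (use b in "simp add: F_def")
   have "\<pi> ?u = (\<Oplus>\<^bsub>P\<^esub>c\<in>B. if b = c then c else \<zero>\<^bsub>P\<^esub>)"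
    unfolding \<pi>_def
    by (rule P.M.finsum_cong') (use B(2) in "auto simp: dsum_single_def Fs subset_iff")
   also have "\<dots> = b"
    using P.M.finsum_singleton[OF b B(1), of "%c. c"] B(2) by auto
   finally show "b \<in> \<pi> ` car (dsum F)" using u by (metis imageI)
  qed
 qed
 then obtain s where s: "s \<in> lmod_hom A P (dsum F)" "!!p. p \<in> car P ==> \<pi> (s p) = p"
  using projective_lmodule_lift[OF projP A D Dk Pm finP \<pi> _ lmod_hom_id] by metis
 have sD: "s p \<in> car (dsum F)" if "p \<in> car P" for p using lmod_homD(2)[OF s(1) that] .
 define \<phi> where "\<phi> b = (\<lambda>p\<in>car P. s p b)" for b
 have \<phi>: "\<phi> b \<in> car Pd" for b
 proof -
  have "(%p. s p b) \<in> lmod_hom A P (reg A)"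
   by (intro lmod_homI add_homI) (use uA[OF sD] in "simp_all add: lmod_homD[OF s(1)] Fs")
  then show ?thesis by (simp add: \<phi>_def Pm Pd_mem)
 qed
 let ?T = "tgrp Pd A P"
 define \<omega> where "\<omega> = (\<Oplus>\<^bsub>?T\<^esub>b\<in>B. pure Pd A P (\<phi> b) b)"
 have cl: "(%b. pure Pd A P (\<phi> b) b) \<in> B \<rightarrow> car ?T"
  using \<phi> B(2) by auto
 have "\<omega> \<in> car ?T" unfolding \<omega>_def by (rule PdP.T.finsum_closed[OF cl])
 moreover have "lift P (%\<phi> q. \<phi> p \<odot>\<^bsub>P\<^esub> q) \<omega> = p" if p: "p \<in> car P" for p
 proof -
  have "lift P (%\<phi> q. \<phi> p \<odot>\<^bsub>P\<^esub> q) \<omega> =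
    (\<Oplus>\<^bsub>P\<^esub>b\<in>B. lift P (%\<phi> q. \<phi> p \<odot>\<^bsub>P\<^esub> q) (pure Pd A P (\<phi> b) b))"
   unfolding \<omega>_def
   by (rule add_hom_finsum[OF PdP.T.abg P.M.abg
      PdP.lift_add_hom[OF P.M.abg ev_balanced[OF p]] B(1) cl])
  also have "\<dots> = \<pi> (s p)"
   unfolding \<pi>_def
   by (rule P.M.finsum_cong')
    (use B(2) \<phi> p uA[OF sD[OF p]] in
     \<open>auto simp: subset_iff PdP.lift_pure[OF P.M.abg ev_balanced[OF p]] \<phi>_def\<close>)
  finally show ?thesis using s(2)[OF p] by simp
 qed
 ultimately show ?thesis by blast
qed

definition \<omega> where
 "\<omega> = (SOME \<omega>. \<omega> \<in> car (tgrp Pd A P) \<and> (\<forall>p\<in>car P. lift P (%\<phi> q. \<phi> p \<odot>\<^bsub>P\<^esub> q) \<omega> = p))"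

lemma \<omega>_closed [simp]: "\<omega> \<in> car (tgrp Pd A P)"
 and \<omega>_eval: "p \<in> car P ==> lift P (%\<phi> q. \<phi> p \<odot>\<^bsub>P\<^esub> q) \<omega> = p"
proof -
 have "\<exists>\<omega>. \<omega> \<in> car (tgrp Pd A P) \<and> (\<forall>p\<in>car P. lift P (%\<phi> q. \<phi> p \<odot>\<^bsub>P\<^esub> q) \<omega> = p)"
  using dual_basis by blast
 from someI_ex[OF this] show "\<omega> \<in> car (tgrp Pd A P)"
  "p \<in> car P ==> lift P (%\<phi> q. \<phi> p \<odot>\<^bsub>P\<^esub> q) \<omega> = p"
  unfolding \<omega>_def[symmetric] by blast+
qed

text \<open>
  Homomorphisms commute with the expansion \<open>p = \<Sum> \<phi>\<^sub>b(p) b\<close>.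
\<close>

lemma \<omega>_Hom:
 assumes L: "lmodule A L" and \<psi>: "\<psi> \<in> car (Hom A P L)"
 shows "lift (Hom A P L) (%\<phi> q. br L \<phi> (\<psi> q)) \<omega> = \<psi>"
proof (rule Hom_eqI[OF _ \<psi>])
 interpret L: lmodule A L by fact
 note bal = br_hom_balanced[OF L \<psi>] and H = Hom_ag[OF L]
 show "lift (Hom A P L) (%\<phi> q. br L \<phi> (\<psi> q)) \<omega> \<in> car (Hom A P L)"
  by (rule PdP.lift_closed[OF H bal]) simp
 fix p assume p: "p \<in> car P"
 have b2: "balanced Pd A P L (%\<phi> q. \<phi> p \<odot>\<^bsub>L\<^esub> \<psi> q)"
  by (rule balancedI)
   (use p \<psi> in "simp_all add: L.sc_ladd L.sc_radd L.sc_assoc Hom_add Hom_smult")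
 have "lift (Hom A P L) (%\<phi> q. br L \<phi> (\<psi> q)) \<omega> p = lift L (%\<phi> q. \<phi> p \<odot>\<^bsub>L\<^esub> \<psi> q) \<omega>"
  by (rule PdP.lift_hom_comp[OF \<omega>_closed H L.M.abg bal eval_hom[OF L p] b2])
   (simp add: br_def p)
 also have "\<dots> = \<psi> (lift P (%\<phi> q. \<phi> p \<odot>\<^bsub>P\<^esub> q) \<omega>)"
  by (rule PdP.lift_hom_comp[OF \<omega>_closed P.M.abg L.M.abg ev_balanced[OF p] _ b2, symmetric])
   (use \<psi> p in "simp_all add: Hom_smult Hom_add add_hom_def")
 finally show "lift (Hom A P L) (%\<phi> q. br L \<phi> (\<psi> q)) \<omega> p = \<psi> p"
  using \<omega>_eval[OF p] by simp
qed

end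

text \<open>
  States that \<open>u\<close> is a sum of pure tensors from \<open>F\<close>, in the form of an induction principle; this avoids
  handling the sum itself.
\<close>

definition tensor_generates where
 "tensor_generates M S N F u \<longleftrightarrow> (\<forall>V. (\<forall>(x, y)\<in>F. pure M S N x y \<in> V) \<and>
  (\<forall>v\<in>V. \<forall>w\<in>V. v \<oplus>\<^bsub>tgrp M S N\<^esub> w \<in> V) --> u \<in> V)"

lemma tensor_generatesD:
 "[|tensor_generates M S N F u; !!x y. (x, y) \<in> F ==> pure M S N x y \<in> V;
  !!v w. [|v \<in> V; w \<in> V|] ==> v \<oplus>\<^bsub>tgrp M S N\<^esub> w \<in> V|] ==> u \<in> V"
 unfolding tensor_generates_def by (drule spec[of _ V]) auto

lemma tensor_finite_support:
 assumes "tensor_pair M S N" "u \<in> car (tgrp M S N)"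
 shows "\<exists>F. finite F \<and> F \<subseteq> car M \<times> car N \<and> tensor_generates M S N F u"
proof -
 interpret tensor_pair M S N by fact
 show ?thesis
  using assms(2)
 proof (induction u rule: tensor_induct)
  case (pure x y)
  then show ?case by (intro exI[of _ "{(x, y)}"]) (auto simp: tensor_generates_def)
 next
  case (add u v)
  obtain F where F: "finite F" "F \<subseteq> car M \<times> car N" "tensor_generates M S N F u"
   using add.IH(1) by blast
  obtain F' where F': "finite F'" "F' \<subseteq> car M \<times> car N" "tensor_generates M S N F' v"
   using add.IH(2) by blast
  have "tensor_generates M S N (F \<union> F') (u \<oplus>\<^bsub>tgrp M S N\<^esub> v)"
   unfolding tensor_generates_def
  proof (intro allI impI, elim conjE)
   fix V assume V: "\<forall>(x, y)\<in>F \<union> F'. pure M S N x y \<in> V" "\<forall>v\<in>V. \<forall>w\<in>V. v \<oplus>\<^bsub>tgrp M S N\<^esub> w \<in> V"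
   have "u \<in> V" by (rule tensor_generatesD[OF F(3)]) (use V in auto)
   moreover have "v \<in> V" by (rule tensor_generatesD[OF F'(3)]) (use V in auto)
   ultimately show "u \<oplus>\<^bsub>tgrp M S N\<^esub> v \<in> V" using V(2) by simp
  qed
  then show ?case using F(1,2) F'(1,2) by (intro exI[of _ "F \<union> F'"]) auto
 qed
qed

context projective_setup
begin

lemma br_right_hom: "[|lmodule A L; \<phi> \<in> car Pd|] ==> br L \<phi> \<in> add_hom L (Hom A P L)"
 by (rule add_homI) (rule balancedD(1,3)[OF br_balanced]; assumption)+

lemma br_klin:
 assumes L: "lmodule A L" and \<phi>: "\<phi> \<in> car Pd"
 shows "br L \<phi> \<in> klin K A L E (Hom A P L)"
proof (rule klinI[OF br_right_hom[OF L \<phi>]])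
 interpret L: lmodule A L by fact
 fix c l assume c: "c \<in> car K" and l: "l \<in> car L"
 show "br L \<phi> ((scalar A c) \<odot>\<^bsub>L\<^esub> l) = (scalar E c) \<odot>\<^bsub>Hom A P L\<^esub> br L \<phi> l"
  unfolding br_def
  using kscalar_closed[OF A c] \<phi> l
  by (auto simp: L.sc_assoc[symmetric] Pd_smult kscalar_central[OF A c] intro!: restrict_ext)
qed

text \<open>
  By \<open>\<omega>_Hom\<close>, the maps \<open>br L \<phi> l\<close> with \<open>\<phi>\<close> from the finite support of \<open>\<omega>\<close> and \<open>l\<close> from a spanning set of \<open>L\<close> span.
\<close>

lemma kfin_Hom:
 assumes L: "lmodule A L" "kfin K A L"
 shows "kfin K E (Hom A P L)"
proof -
 interpret L: lmodule A L by fact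
 interpret H: lmodule E "Hom A P L" by (rule lmodule_Hom[OF A Pm L(1)])
 obtain F where F: "finite F" "F \<subseteq> car Pd \<times> car P" "tensor_generates Pd A P F \<omega>"
  using tensor_finite_support[OF PdP.tensor_pair_axioms \<omega>_closed] by blast
 obtain B where B: "finite B" "B \<subseteq> car L" "!!W. ksub K A L W ==> B \<subseteq> W ==> W = car L"
  using L(2) unfolding kfin_def by blast
 let ?D = "(%(f, l). br L (fst f) l) ` (F \<times> B)"
 have "W = car (Hom A P L)" if W: "ksub K E (Hom A P L) W" "?D \<subseteq> W" for W
 proof -
  have 1: "br L (fst f) l \<in> W" if f: "f \<in> F" and l: "l \<in> car L" for f l
  proof -
   have f': "fst f \<in> car Pd" using f F(2) by auto
   have "{l \<in> car L. br L (fst f) l \<in> W} = car L"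
    by (rule B(3)[OF ksub_preimage[OF L.M.abg Hom_ag[OF L(1)] br_klin[OF L(1) f'] W(1) kscalar_sc_closed[OF A L(1)]]])
     (use B(2) W(2) f in "auto simp: image_subset_iff")
   then show ?thesis using l by blast
  qed
  have "\<psi> \<in> W" if \<psi>: "\<psi> \<in> car (Hom A P L)" for \<psi>
  proof -
   note bal = br_hom_balanced[OF L(1) \<psi>] and H = Hom_ag[OF L(1)]
   let ?V = "{u \<in> car (tgrp Pd A P). lift (Hom A P L) (%\<phi> q. br L \<phi> (\<psi> q)) u \<in> W}"
   have "\<omega> \<in> ?V"
   proof (rule tensor_generatesD[OF F(3)])
    fix x y assume xy: "(x, y) \<in> F"
    then have "x \<in> car Pd" "y \<in> car P" using F(2) by auto
    then show "pure Pd A P x y \<in> ?V"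
     using 1[OF xy, of "\<psi> y"] \<psi> by (simp add: PdP.lift_pure[OF H bal])
   next
    fix v w assume "v \<in> ?V" "w \<in> ?V"
    then show "v \<oplus>\<^bsub>tgrp Pd A P\<^esub> w \<in> ?V"
     using W(1) by (auto simp: PdP.lift_add[OF H bal] ksub_def simp del: Hom_simps)
   qed
   then show ?thesis using \<omega>_Hom[OF L(1) \<psi>] by simp
  qed
  then show ?thesis using W(1) by (auto simp: ksub_def)
 qed
 moreover have "?D \<subseteq> car (Hom A P L)"
 proof -
  have "br L (fst f) l \<in> car (Hom A P L)" if "f \<in> F" "l \<in> B" for f l
   by (rule br_closed[OF L(1)]) (use that F(2) B(2) in auto)
  then show ?thesis by auto
 qed
 ultimately show ?thesis
  unfolding kfin_def using B(1) F(1) by (intro exI[of _ ?D]) auto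
qed

lemma rA: "lmodule A (reg A)"
 by (rule lmodule_of_bimodule[OF bimodule_reg[OF A]])

lemma finE: "kfin K E (reg E)"
 by (rule kfin_cong[OF _ _ _ _ kfin_Hom[OF Pm finP]])
  (auto simp: E_mem Hom_mem P_bimod_def)

lemma finPd: "kfin K E Pd"
 by (rule kfin_cong[OF _ _ _ _ kfin_Hom[OF rA finA]])
  (auto simp: Pd_mem Hom_mem)

lemma finPb: "kfin K A (P_bimod P)"
 by (rule kfin_cong[OF _ _ _ _ finP]) auto

lemma Pd_reg: "car (Hom A P (reg A)) = car Pd"
 by (auto simp: Pd_mem Hom_mem)

lemma rsmult_Pd_br: "[|\<phi> \<in> car Pd; a \<in> car A|] ==> br (reg A) \<phi> a = rsmult Pd \<phi> a"
 by (auto simp: br_def intro!: restrict_ext)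

lemma \<omega>_Pd:
 assumes G: "abelian_group G" and \<phi>: "\<phi> \<in> car Pd" and g: "g \<in> add_hom Pd G"
  and bal: "balanced Pd A P G (%\<phi>' q. g (rsmult Pd \<phi>' (\<phi> q)))"
 shows "lift G (%\<phi>' q. g (rsmult Pd \<phi>' (\<phi> q))) \<omega> = g \<phi>"
proof -
 let ?H = "Hom A P (reg A)"
 have \<phi>': "\<phi> \<in> car ?H" using \<phi> Pd_reg by simp
 have g': "g \<in> add_hom ?H G"
  using g Pd_reg by (auto simp: add_hom_def)
 have "lift G (%\<phi>' q. g (rsmult Pd \<phi>' (\<phi> q))) \<omega> = g (lift ?H (%\<phi>' q. br (reg A) \<phi>' (\<phi> q)) \<omega>)"
  by (rule PdP.lift_hom_comp[OF \<omega>_closed Hom_ag[OF rA] G br_hom_balanced[OF rA \<phi>'] g' bal, symmetric])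
   (simp only: rsmult_Pd_br Pd_apply[OF \<phi>])
 then show ?thesis using \<omega>_Hom[OF rA \<phi>'] by simp
qed

lemma PdP_map_balanced:
 assumes "e \<in> car (Hom A P P)"
 shows "balanced Pd A P (tgrp Pd A P) (%\<phi> q. pure Pd A P \<phi> (e q))"
 by (rule balancedI)
  (use assms in "simp_all add: PdP.pure_add_left PdP.pure_add_right Hom_add Hom_smult PdP.pure_middle del: P_dual_simps")

lemma tensor_reconstruct:
 assumes z: "z \<in> car (tgrp Pd A P)"
 shows "lift (tgrp Pd A P)
  (%\<phi> q. pure Pd A P \<phi> (lift (Hom A P P) (br P) z q)) \<omega> = z"
 using z
proof (induction z rule: PdP.tensor_induct)
 case (pure \<phi> q)
 have "br P \<phi> q \<in> car (Hom A P P)" by (rule br_closed[OF Pm pure])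
 note bal = PdP_map_balanced[OF this]
 have e: "pure Pd A P \<phi>' (br P \<phi> q q') = pure Pd A P (rsmult Pd \<phi>' (\<phi> q')) q"
  if "\<phi>' \<in> car Pd" "q' \<in> car P" for \<phi>' q'
  using that pure PdP.pure_middle[OF that(1) _ pure(2), of "\<phi> q'"] by (simp add: br_def)
 have g: "(%\<phi>. pure Pd A P \<phi> q) \<in> add_hom Pd (tgrp Pd A P)"
  by (rule add_homI) (simp_all add: pure PdP.pure_add_left del: P_dual_simps)
 have bal2: "balanced Pd A P (tgrp Pd A P) (%\<phi>' q'. pure Pd A P (rsmult Pd \<phi>' (\<phi> q')) q)"
  using bal e unfolding balanced_def by (simp del: P_dual_simps)
 have "lift (tgrp Pd A P) (%\<phi>' q'. pure Pd A P \<phi>' (br P \<phi> q q')) \<omega> =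
   lift (tgrp Pd A P) (%\<phi>' q'. pure Pd A P (rsmult Pd \<phi>' (\<phi> q')) q) \<omega>"
  by (rule PdP.lift_cong[OF \<omega>_closed PdP.T.abg bal bal2 e])
 also have "\<dots> = pure Pd A P \<phi> q"
  using \<omega>_Pd[OF PdP.T.abg pure(1) g] bal2 by simp
 finally show ?case
  by (simp only: PdP.lift_pure[OF Hom_ag[OF Pm] br_balanced[OF Pm] pure])
next
 case (add u v)
 let ?z = "lift (Hom A P P) (br P)"
 have zc: "?z u \<in> car (Hom A P P)" if "u \<in> car (tgrp Pd A P)" for u
  by (rule PdP.lift_closed[OF Hom_ag[OF Pm] br_balanced[OF Pm] that])
 have "lift (tgrp Pd A P) (%\<phi> q. pure Pd A P \<phi> (?z (u \<oplus>\<^bsub>tgrp Pd A P\<^esub> v) q)) \<omega> =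
   lift (tgrp Pd A P) (%\<phi> q. pure Pd A P \<phi> (?z u q)) \<omega> \<oplus>\<^bsub>tgrp Pd A P\<^esub>
   lift (tgrp Pd A P) (%\<phi> q. pure Pd A P \<phi> (?z v q)) \<omega>"
 proof (rule PdP.lift_param_add[OF \<omega>_closed PdP.T.abg])
  show "pure Pd A P \<phi> (?z (u \<oplus>\<^bsub>tgrp Pd A P\<^esub> v) q) =
    pure Pd A P \<phi> (?z u q) \<oplus>\<^bsub>tgrp Pd A P\<^esub> pure Pd A P \<phi> (?z v q)"
   if "\<phi> \<in> car Pd" "q \<in> car P" for \<phi> q
   using that add.hyps zc by (simp add: PdP.lift_add[OF Hom_ag[OF Pm] br_balanced[OF Pm]] PdP.pure_add_right)
 qed (intro PdP_map_balanced zc PdP.T.a_closed add.hyps)+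
 then show ?case using add.IH by simp
qed

text \<open>
  The two actions of \<open>E\<close> on \<open>P\<^sup>\<or> \<otimes>\<^sub>A P\<close> agree on \<open>\<omega>\<close>, because under the isomorphism with \<open>Hom\<^sub>A(P, P)\<close> the
  element \<open>\<omega>\<close> corresponds to the identity, and \<open>e \<circ> 1 = 1 \<circ> e\<close>.
\<close>

lemma \<omega>_E_commute:
 assumes e: "e \<in> car E" and G: "abelian_group G" and g: "g \<in> add_hom (tgrp Pd A P) G"
  and b1: "balanced Pd A P G (%\<phi> q. g (pure Pd A P (e \<odot>\<^bsub>Pd\<^esub> \<phi>) q))"
  and b2: "balanced Pd A P G (%\<phi> q. g (pure Pd A P \<phi> (e q)))"
 shows "lift G (%\<phi> q. g (pure Pd A P (e \<odot>\<^bsub>Pd\<^esub> \<phi>) q)) \<omega> =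
  lift G (%\<phi> q. g (pure Pd A P \<phi> (e q))) \<omega>"
proof -
 let ?T = "tgrp Pd A P" and ?H = "Hom A P P"
 have e': "e \<in> car ?H" using e by (simp add: E_mem Hom_mem)
 have Tag: "abelian_group ?T" by (rule PdP.T.abg)
 have c1: "balanced Pd A P ?T (%\<phi> q. pure Pd A P (e \<odot>\<^bsub>Pd\<^esub> \<phi>) q)"
  by (rule tensor_smult_balanced[OF Pd.bm Pm e])
 have c2: "balanced Pd A P ?T (%\<phi> q. pure Pd A P \<phi> (e q))"
  by (rule PdP_map_balanced[OF e'])
 define l where "l = lift ?T (%\<phi> q. pure Pd A P (e \<odot>\<^bsub>Pd\<^esub> \<phi>) q) \<omega>"
 define r where "r = lift ?T (%\<phi> q. pure Pd A P \<phi> (e q)) \<omega>"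
 have lr: "l \<in> car ?T" "r \<in> car ?T"
  unfolding l_def r_def by (simp_all only: PdP.lift_closed[OF Tag c1] PdP.lift_closed[OF Tag c2] \<omega>_closed)
 have ebr: "br P (e \<odot>\<^bsub>Pd\<^esub> \<phi>) q = e \<odot>\<^bsub>?H\<^esub> br P \<phi> q" if "\<phi> \<in> car Pd" "q \<in> car P" for \<phi> q
  by (rule br_E[OF Pm e that])
 interpret H: lmodule E ?H by (rule lmodule_Hom[OF A Pm Pm])
 have id: "(\<lambda>p\<in>car P. p) \<in> car ?H" by (simp add: Hom_mem lmod_hom_id Pm)
 have brl: "balanced Pd A P ?H (%\<phi> q. br P (e \<odot>\<^bsub>Pd\<^esub> \<phi>) q)"
  by (rule balancedI)
   (use e balancedD[OF br_balanced[OF Pm]] Pd.sc_closed Pd.sc_radd Pd.rs_sc[symmetric] in "simp_all del: P_dual_simps Hom_simps")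
 have evl: "lift ?H (br P) l = e"
 proof -
  have "lift ?H (br P) l = lift ?H (%\<phi> q. br P (e \<odot>\<^bsub>Pd\<^esub> \<phi>) q) \<omega>"
   unfolding l_def
   by (rule PdP.lift_hom_comp[OF \<omega>_closed Tag Hom_ag[OF Pm] c1 PdP.lift_add_hom[OF Hom_ag[OF Pm] br_balanced[OF Pm]] brl])
    (simp only: PdP.lift_pure[OF Hom_ag[OF Pm] br_balanced[OF Pm]] Pd.sc_closed e)
  also have "\<dots> = e \<odot>\<^bsub>?H\<^esub> lift ?H (br P) \<omega>"
   by (rule PdP.lift_hom_comp[OF \<omega>_closed Hom_ag[OF Pm] Hom_ag[OF Pm] br_balanced[OF Pm] H.sc_right_hom[OF e] brl, symmetric])
    (simp only: ebr)
  also have "lift ?H (br P) \<omega> = (\<lambda>p\<in>car P. p)"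
  proof -
   have "lift ?H (br P) \<omega> = lift ?H (%\<phi> q. br P \<phi> ((\<lambda>p\<in>car P. p) q)) \<omega>"
    by (rule PdP.lift_cong[OF \<omega>_closed Hom_ag[OF Pm] br_balanced[OF Pm] br_hom_balanced[OF Pm id]]) simp
   then show ?thesis using \<omega>_Hom[OF Pm id] by simp
  qed
  also have "e \<odot>\<^bsub>?H\<^esub> (\<lambda>p\<in>car P. p) = e"
   using e by (intro E_eqI[OF _ e]) (auto simp: E_mem Pm lmod_homD intro: lmod_hom_comp[OF _ lmod_hom_id, unfolded o_def] cong: restrict_cong)
  finally show ?thesis .
 qed
 have evr: "lift ?H (br P) r = e"
 proof -
  have "lift ?H (br P) r = lift ?H (%\<phi> q. br P \<phi> (e q)) \<omega>"
   unfolding r_def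
   by (rule PdP.lift_hom_comp[OF \<omega>_closed Tag Hom_ag[OF Pm] c2 PdP.lift_add_hom[OF Hom_ag[OF Pm] br_balanced[OF Pm]] br_hom_balanced[OF Pm e']])
    (simp only: PdP.lift_pure[OF Hom_ag[OF Pm] br_balanced[OF Pm]] E_apply[OF e])
  then show ?thesis using \<omega>_Hom[OF Pm e'] by simp
 qed
 have "l = r"
  using tensor_reconstruct[OF lr(1)] tensor_reconstruct[OF lr(2)] evl evr by simp
 moreover have "lift G (%\<phi> q. g (pure Pd A P (e \<odot>\<^bsub>Pd\<^esub> \<phi>) q)) \<omega> = g l"
  unfolding l_def by (rule PdP.lift_hom_comp[OF \<omega>_closed Tag G c1 g b1, symmetric]) simp
 moreover have "lift G (%\<phi> q. g (pure Pd A P \<phi> (e q))) \<omega> = g r"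
  unfolding r_def by (rule PdP.lift_hom_comp[OF \<omega>_closed Tag G c2 g b2, symmetric]) simp
 ultimately show ?thesis by simp
qed

end

section \<open>Functoriality of tensor products\<close>

definition rmod_hom where
 "rmod_hom S M N = {f \<in> add_hom M N. \<forall>x\<in>car M. \<forall>s\<in>car S. f (rsmult M x s) = rsmult N (f x) s}"

lemma rmod_homI:
 "[|f \<in> add_hom M N; !!x s. [|x \<in> car M; s \<in> car S|] ==> f (rsmult M x s) = rsmult N (f x) s|] ==> f \<in> rmod_hom S M N"
 by (simp add: rmod_hom_def)

lemma rmod_homD:
 assumes "f \<in> rmod_hom S M N"
 shows "f \<in> add_hom M N" "x \<in> car M ==> f x \<in> car N"
  "[|x \<in> car M; y \<in> car M|] ==> f (x \<oplus>\<^bsub>M\<^esub> y) = f x \<oplus>\<^bsub>N\<^esub> f y"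
  "[|x \<in> car M; s \<in> car S|] ==> f (rsmult M x s) = rsmult N (f x) s"
 using assms by (auto simp: rmod_hom_def add_hom_closed add_hom_add)

lemma rmod_hom_of_bimod_hom: "f \<in> bimod_hom R S M N ==> f \<in> rmod_hom S M N"
 by (rule rmod_homI) (auto simp: bimod_homD)

lemma rmod_hom_id: "(%x. x) \<in> rmod_hom S M M"
 by (simp add: rmod_hom_def add_hom_id)

lemma tensor_map_balanced:
 assumes "tensor_pair M' S N'" "f \<in> rmod_hom S M M'" "g \<in> lmod_hom S N N'"
 shows "balanced M S N (tgrp M' S N') (%x y. pure M' S N' (f x) (g y))"
 by (rule balanced_tensor_map[OF assms(1) rmod_homD(1)[OF assms(2)] lmod_homD(1)[OF assms(3)]])
  (simp_all add: rmod_homD(4)[OF assms(2)] lmod_homD(4)[OF assms(3)])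

context
 fixes M :: "('r, 's, 'm) bimod" and S :: "('s, 'x) ring_scheme" and N :: "('s, 'n, 'y) module_scheme"
  and M' :: "('r2, 's, 'm2) bimod" and N' :: "('s, 'n2, 'y2) module_scheme" and f g
 assumes MN: "tensor_pair M S N" and MN': "tensor_pair M' S N'" and f: "f \<in> rmod_hom S M M'" and g: "g \<in> lmod_hom S N N'"
begin

lemma tensor_map_hom: "tmap M' S N' f g \<in> add_hom (tgrp M S N) (tgrp M' S N')"
proof -
 interpret MN': tensor_pair M' S N' by (rule MN')
 show ?thesis
  unfolding tensor_map_def
  by (rule tensor_pair.lift_add_hom[OF MN MN'.T.abg tensor_map_balanced[OF MN' f g]])
qed

lemma tensor_map_pure:
 "[|x \<in> car M; y \<in> car N|] ==> tmap M' S N' f g (pure M S N x y) = pure M' S N' (f x) (g y)"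
proof -
 interpret MN': tensor_pair M' S N' by (rule MN')
 show "[|x \<in> car M; y \<in> car N|] ==> tmap M' S N' f g (pure M S N x y) = pure M' S N' (f x) (g y)"
  unfolding tensor_map_def
  by (rule tensor_pair.lift_pure[OF MN MN'.T.abg tensor_map_balanced[OF MN' f g]])
qed

end

lemma tensor_map_lmod_hom:
 assumes M: "bimodule K R S M" and N: "lmodule S N" and M': "bimodule K R S M'" and N': "lmodule S N'"
  and f: "f \<in> bimod_hom R S M M'" and g: "g \<in> lmod_hom S N N'"
 shows "tmap M' S N' f g \<in> lmod_hom R (tensor M S N) (tensor M' S N')"
proof -
 interpret MN: tensor_pair M S N by (rule tensor_pairI[OF M N])
 interpret MN': tensor_pair M' S N' by (rule tensor_pairI[OF M' N'])
 note tm = tensor_map_hom[OF MN.tensor_pair_axioms MN'.tensor_pair_axioms rmod_hom_of_bimod_hom[OF f] g]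
 note tp = tensor_map_pure[OF MN.tensor_pair_axioms MN'.tensor_pair_axioms rmod_hom_of_bimod_hom[OF f] g]
 show ?thesis
 proof (rule lmod_homI)
  show "tmap M' S N' f g \<in> add_hom (tensor M S N) (tensor M' S N')"
   using tm by (simp add: add_hom_def)
  fix r u assume r: "r \<in> car R" and u: "u \<in> car (tensor M S N)"
  show "tmap M' S N' f g (r \<odot>\<^bsub>tensor M S N\<^esub> u) = r \<odot>\<^bsub>tensor M' S N'\<^esub> tmap M' S N' f g u"
   using u MN.add_hom_eqI[OF add_hom_comp[OF tensor_smult_add_hom[OF M N r] tm] add_hom_comp[OF tm tensor_smult_add_hom[OF M' N' r]], of u]
   by (simp add: tensor_smult_pure[OF M N r] tensor_smult_pure[OF M' N' r] tp bimod_homD(3,5)[OF f] r lmod_homD(2)[OF g]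
     lmodule.sc_closed[OF lmodule_of_bimodule[OF M]])
 qed
qed

lemma tensor_map_bimod_hom:
 assumes M: "bimodule K R S M" and N: "bimodule K S Q N" and M': "bimodule K R S M'" and N': "bimodule K S Q N'"
  and f: "f \<in> bimod_hom R S M M'" and g: "g \<in> bimod_hom S Q N N'"
 shows "tmap M' S N' f g \<in> bimod_hom R Q (tbim M S N) (tbim M' S N')"
proof -
 note l = lmodule_of_bimodule
 interpret MN: tensor_pair M S N by (rule tensor_pairI[OF M l[OF N]])
 interpret MN': tensor_pair M' S N' by (rule tensor_pairI[OF M' l[OF N']])
 note tm = tensor_map_hom[OF MN.tensor_pair_axioms MN'.tensor_pair_axioms rmod_hom_of_bimod_hom[OF f] bimod_homD(1)[OF g]]
 note tp = tensor_map_pure[OF MN.tensor_pair_axioms MN'.tensor_pair_axioms rmod_hom_of_bimod_hom[OF f] bimod_homD(1)[OF g]]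
 note lm = tensor_map_lmod_hom[OF M l[OF N] M' l[OF N'] f bimod_homD(1)[OF g]]
 show ?thesis
 proof (rule bimod_homI)
  show "tmap M' S N' f g \<in> add_hom (tbim M S N) (tbim M' S N')"
   using tm by (simp add: add_hom_def)
  show "tmap M' S N' f g (r \<odot>\<^bsub>tbim M S N\<^esub> u) = r \<odot>\<^bsub>tbim M' S N'\<^esub> tmap M' S N' f g u"
   if "r \<in> car R" "u \<in> car (tbim M S N)" for r u
   using lmod_homD(4)[OF lm that(1)] that(2) by (simp add: tensor_bimod_smult_eq[OF M N] tensor_bimod_smult_eq[OF M' N'])
  fix q u assume q: "q \<in> car Q" and u: "u \<in> car (tbim M S N)"
  show "tmap M' S N' f g (rsmult (tbim M S N) u q) = rsmult (tbim M' S N') (tmap M' S N' f g u) q"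
   using u MN.add_hom_eqI[OF add_hom_comp[OF tensor_rsmult_add_hom[OF M N q] tm] add_hom_comp[OF tm tensor_rsmult_add_hom[OF M' N' q]], of u]
   by (simp add: tensor_rsmult_pure[OF M N q] tensor_rsmult_pure[OF M' N' q] tp bimod_homD(3,6)[OF g] q bimod_homD(3)[OF f]
     bimodule.rs_closed[OF N])
 qed
qed

section \<open>The sandwiched functor\<close>

context projective_setup
begin

definition push :: "('l => 'l2) => ('p => 'l) => 'p => 'l2"
 where "push d \<psi> = (\<lambda>p\<in>car P. d (\<psi> p))"

lemma push_closed: "[|d \<in> lmod_hom A L L'; \<psi> \<in> car (Hom A P L)|] ==> push d \<psi> \<in> car (Hom A P L')"
 unfolding push_def Hom_mem using lmod_hom_comp[of \<psi> A P L d L'] by (simp add: Pm)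

lemma push_hom: "d \<in> lmod_hom A L L' ==> push d \<in> lmod_hom E (Hom A P L) (Hom A P L')"
 by (intro lmod_homI add_homI push_closed) (auto simp: push_def lmod_homD intro!: restrict_ext)

lemma push_br: "[|d \<in> lmod_hom A L L'; \<phi> \<in> car Pd; l \<in> car L|] ==> push d (br L \<phi> l) = br L' \<phi> (d l)"
 by (auto simp: push_def br_def lmod_homD intro!: restrict_ext)

text \<open>
  The mutually inverse maps \<open>t \<otimes> \<phi> \<otimes> l \<mapsto> t \<otimes> \<phi>(-) l\<close> and \<open>t \<otimes> \<psi> \<mapsto> \<Sum> t \<otimes> \<phi>\<^sub>b \<otimes> \<psi>(b)\<close>.
\<close>

definition hom_a where
 "hom_a T L = lift (tgrp T E (Hom A P L))
  (%u l. lift (tgrp T E (Hom A P L)) (%t \<phi>. pure T E (Hom A P L) t (br L \<phi> l)) u)"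

definition hom_b where
 "hom_b T L = lift (tgrp (tbim T E Pd) A L)
  (%t \<psi>. lift (tgrp (tbim T E Pd) A L)
   (%\<phi> q. pure (tbim T E Pd) A L (pure T E Pd t \<phi>) (\<psi> q)) \<omega>)"

context
 fixes T :: "('a, 'p => 'p, 't) bimod" and L :: "('a, 'l) module"
 assumes T: "bimodule K A E T" and L: "lmodule A L"
begin

abbreviation (input) "HL \<equiv> Hom A P L"
abbreviation (input) "S \<equiv> tbim T E Pd"

interpretation L: lmodule A L by (rule L)
interpretation T: bimodule K A E T by (rule T)
interpretation H: lmodule E HL by (rule lmodule_Hom[OF A Pm L])
interpretation S: bimodule K A A S by (rule bimodule_tensor[OF T Pd.bm])
interpretation TP: tensor_pair T E Pd by (rule tensor_pairI[OF T Pd.lmod])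
interpretation SL: tensor_pair S A L by (rule tensor_pairI[OF S.bm L])
interpretation TH: tensor_pair T E HL by (rule tensor_pairI[OF T H.lmodule_axioms])

lemma a_inner: "l \<in> car L ==> balanced T E Pd (tgrp T E HL) (%t \<phi>. pure T E HL t (br L \<phi> l))"
 using balancedD[OF br_balanced[OF L]] br_E[OF L]
 by (intro balancedI) (simp_all add: TH.pure_add_left TH.pure_add_right TH.pure_middle del: Hom_simps P_dual_simps)

lemmas a_in_pure = TP.lift_pure[OF TH.T.abg a_inner]
lemmas a_in_hom = TP.lift_add_hom[OF TH.T.abg a_inner]

lemma a_outer: "balanced S A L (tgrp T E HL) (%u l. lift (tgrp T E HL) (%t \<phi>. pure T E HL t (br L \<phi> l)) u)"
proof (rule balancedI)
 fix u l assume "u \<in> car S" "l \<in> car L"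
 then show "lift (tgrp T E HL) (%t \<phi>. pure T E HL t (br L \<phi> l)) u \<in> car (tgrp T E HL)"
  using add_hom_closed[OF a_in_hom] by simp
next
 fix u v l assume "u \<in> car S" "v \<in> car S" "l \<in> car L"
 then show "lift (tgrp T E HL) (%t \<phi>. pure T E HL t (br L \<phi> l)) (u \<oplus>\<^bsub>S\<^esub> v) =
  lift (tgrp T E HL) (%t \<phi>. pure T E HL t (br L \<phi> l)) u \<oplus>\<^bsub>tgrp T E HL\<^esub>
  lift (tgrp T E HL) (%t \<phi>. pure T E HL t (br L \<phi> l)) v"
  using add_hom_add[OF a_in_hom] by simp
next
 fix u l l' assume u: "u \<in> car S" and l: "l \<in> car L" "l' \<in> car L"
 show "lift (tgrp T E HL) (%t \<phi>. pure T E HL t (br L \<phi> (l \<oplus>\<^bsub>L\<^esub> l'))) u =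
  lift (tgrp T E HL) (%t \<phi>. pure T E HL t (br L \<phi> l)) u \<oplus>\<^bsub>tgrp T E HL\<^esub>
  lift (tgrp T E HL) (%t \<phi>. pure T E HL t (br L \<phi> l')) u"
  by (rule TP.lift_param_add[OF _ TH.T.abg a_inner a_inner a_inner])
   (use u l balancedD[OF br_balanced[OF L]] in "simp_all add: TH.pure_add_right del: Hom_simps")
next
 fix u a l assume u: "u \<in> car S" and a: "a \<in> car A" and l: "l \<in> car L"
 let ?f = "%l. lift (tgrp T E HL) (%t \<phi>. pure T E HL t (br L \<phi> l))"
 have al: "a \<odot>\<^bsub>L\<^esub> l \<in> car L" using a l by simp
 have "?f l (rsmult S u a) = ?f (a \<odot>\<^bsub>L\<^esub> l) u"
 proof (rule TP.add_hom_eqI[OF add_hom_comp[OF tensor_rsmult_add_hom[OF T Pd.bm a] a_in_hom[OF l]] a_in_hom[OF al]])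
  fix t \<phi> assume t: "t \<in> car T" and \<phi>: "\<phi> \<in> car Pd"
  show "?f l (rsmult S (pure T E Pd t \<phi>) a) = ?f (a \<odot>\<^bsub>L\<^esub> l) (pure T E Pd t \<phi>)"
   using t \<phi> a l al Pd.rs_closed[OF a \<phi>] balancedD(4)[OF br_balanced[OF L] \<phi> a l]
   by (simp add: tensor_rsmult_pure[OF T Pd.bm] a_in_pure del: P_dual_simps)
 qed (use u in simp)
 then show "lift (tgrp T E HL) (%t \<phi>. pure T E HL t (br L \<phi> l)) (rsmult S u a) =
  lift (tgrp T E HL) (%t \<phi>. pure T E HL t (br L \<phi> (a \<odot>\<^bsub>L\<^esub> l))) u" .
qed

lemma hom_a_hom: "hom_a T L \<in> add_hom (tgrp S A L) (tgrp T E HL)"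
 unfolding hom_a_def by (rule SL.lift_add_hom[OF TH.T.abg a_outer])

lemma hom_a_pure:
 "[|t \<in> car T; \<phi> \<in> car Pd; l \<in> car L|] ==>
  hom_a T L (pure S A L (pure T E Pd t \<phi>) l) = pure T E HL t (br L \<phi> l)"
 unfolding hom_a_def
 by (subst SL.lift_pure[OF TH.T.abg a_outer]) (simp_all add: a_in_pure)

lemma triple_eqI:
 assumes f: "f \<in> add_hom (tgrp S A L) G" and g: "g \<in> add_hom (tgrp S A L) G"
  and eq: "!!t \<phi> l. [|t \<in> car T; \<phi> \<in> car Pd; l \<in> car L|] ==>
   f (pure S A L (pure T E Pd t \<phi>) l) = g (pure S A L (pure T E Pd t \<phi>) l)"
  and w: "w \<in> car (tgrp S A L)"
 shows "f w = g w"
proof (rule SL.add_hom_eqI[OF f g _ w])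
 fix u l assume u: "u \<in> car S" and l: "l \<in> car L"
 have h: "(%u. f (pure S A L u l)) \<in> add_hom (tgrp T E Pd) G"
  "(%u. g (pure S A L u l)) \<in> add_hom (tgrp T E Pd) G"
  by (rule add_hom_comp[OF _ f] add_hom_comp[OF _ g], rule add_homI,
    use l SL.pure_add_left in "auto simp: SL.pure_closed[simplified]")+
 show "f (pure S A L u l) = g (pure S A L u l)"
  by (rule TP.add_hom_eqI[OF h]) (use u l eq in auto)
qed

lemma b_inner:
 assumes t: "t \<in> car T" and \<psi>: "\<psi> \<in> car HL"
 shows "balanced Pd A P (tgrp S A L) (%\<phi> q. pure S A L (pure T E Pd t \<phi>) (\<psi> q))"
proof (rule balancedI)
 fix \<phi> a q assume h: "\<phi> \<in> car Pd" "a \<in> car A" "q \<in> car P"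
 have "pure T E Pd t (rsmult Pd \<phi> a) = rsmult S (pure T E Pd t \<phi>) a"
  by (rule tensor_rsmult_pure[OF T Pd.bm h(2) t h(1), symmetric])
 then show "pure S A L (pure T E Pd t (rsmult Pd \<phi> a)) (\<psi> q) =
  pure S A L (pure T E Pd t \<phi>) (\<psi> (a \<odot>\<^bsub>P\<^esub> q))"
  using h t \<psi> SL.pure_middle[of "pure T E Pd t \<phi>" a "\<psi> q"] by (simp add: Hom_smult)
qed (use assms SL.pure_add_left in "simp_all add: TP.pure_add_right SL.pure_add_right Hom_add SL.pure_closed[simplified] del: P_dual_simps")

text \<open>
  The condition that \<open>t e \<otimes> \<psi>\<close> and \<open>t \<otimes> e \<psi>\<close> have the same image is \<open>\<omega>_E_commute\<close>.
\<close>

lemma b_outer: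
 "balanced T E HL (tgrp S A L) (%t \<psi>. lift (tgrp S A L)
   (%\<phi> q. pure S A L (pure T E Pd t \<phi>) (\<psi> q)) \<omega>)"
proof (rule balancedI)
 fix t \<psi> assume "t \<in> car T" "\<psi> \<in> car HL"
 then show "lift (tgrp S A L) (%\<phi> q. pure S A L (pure T E Pd t \<phi>) (\<psi> q)) \<omega> \<in> car (tgrp S A L)"
  using PdP.lift_closed[OF SL.T.abg b_inner \<omega>_closed] by simp
next
 fix t t' \<psi> assume h: "t \<in> car T" "t' \<in> car T" "\<psi> \<in> car HL"
 show "lift (tgrp S A L) (%\<phi> q. pure S A L (pure T E Pd (t \<oplus>\<^bsub>T\<^esub> t') \<phi>) (\<psi> q)) \<omega> =
  lift (tgrp S A L) (%\<phi> q. pure S A L (pure T E Pd t \<phi>) (\<psi> q)) \<omega> \<oplus>\<^bsub>tgrp S A L\<^esub>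
  lift (tgrp S A L) (%\<phi> q. pure S A L (pure T E Pd t' \<phi>) (\<psi> q)) \<omega>"
  by (rule PdP.lift_param_add[OF \<omega>_closed SL.T.abg b_inner b_inner b_inner])
   (use h SL.pure_add_left in "simp_all add: TP.pure_add_left")
next
 fix t \<psi> \<psi>' assume h: "t \<in> car T" "\<psi> \<in> car HL" "\<psi>' \<in> car HL"
 have h': "\<psi> \<oplus>\<^bsub>HL\<^esub> \<psi>' \<in> car HL" using h by (rule_tac H.M.a_closed)
 show "lift (tgrp S A L) (%\<phi> q. pure S A L (pure T E Pd t \<phi>) ((\<psi> \<oplus>\<^bsub>HL\<^esub> \<psi>') q)) \<omega> =
  lift (tgrp S A L) (%\<phi> q. pure S A L (pure T E Pd t \<phi>) (\<psi> q)) \<omega> \<oplus>\<^bsub>tgrp S A L\<^esub>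
  lift (tgrp S A L) (%\<phi> q. pure S A L (pure T E Pd t \<phi>) (\<psi>' q)) \<omega>"
  by (rule PdP.lift_param_add[OF \<omega>_closed SL.T.abg b_inner[OF h(1,2)] b_inner[OF h(1,3)] b_inner[OF h(1) h']])
   (use h in "simp_all add: SL.pure_add_right")
next
 fix t e \<psi> assume h: "t \<in> car T" "e \<in> car E" "\<psi> \<in> car HL"
 let ?g = "lift (tgrp S A L) (%\<phi> q. pure S A L (pure T E Pd t \<phi>) (\<psi> q))"
 have te: "rsmult T t e \<in> car T" using h by simp
 have e\<psi>: "e \<odot>\<^bsub>HL\<^esub> \<psi> \<in> car HL" by (rule H.sc_closed[OF h(2,3)])
 have gp: "?g (pure Pd A P \<phi> q) = pure S A L (pure T E Pd t \<phi>) (\<psi> q)"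
  if "\<phi> \<in> car Pd" "q \<in> car P" for \<phi> q
  by (rule PdP.lift_pure[OF SL.T.abg b_inner[OF h(1,3)] that])
 have e1: "?g (pure Pd A P (e \<odot>\<^bsub>Pd\<^esub> \<phi>) q) = pure S A L (pure T E Pd (rsmult T t e) \<phi>) (\<psi> q)"
  if "\<phi> \<in> car Pd" "q \<in> car P" for \<phi> q
  using gp[OF Pd.sc_closed[OF h(2) that(1)] that(2)] TP.pure_middle[OF h(1,2) that(1)] by (simp del: P_dual_simps)
 have e2: "?g (pure Pd A P \<phi> (e q)) = pure S A L (pure T E Pd t \<phi>) ((e \<odot>\<^bsub>HL\<^esub> \<psi>) q)"
  if "\<phi> \<in> car Pd" "q \<in> car P" for \<phi> q
  using gp[OF that(1) E_apply[OF h(2) that(2)]] that by simp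
 have b1: "balanced Pd A P (tgrp S A L) (%\<phi> q. ?g (pure Pd A P (e \<odot>\<^bsub>Pd\<^esub> \<phi>) q))"
  using b_inner[OF te h(3)] e1 unfolding balanced_def by (simp del: P_dual_simps)
 have b2: "balanced Pd A P (tgrp S A L) (%\<phi> q. ?g (pure Pd A P \<phi> (e q)))"
  using b_inner[OF h(1) e\<psi>] e2 unfolding balanced_def by (simp del: P_dual_simps Hom_simps)
 have "lift (tgrp S A L) (%\<phi> q. pure S A L (pure T E Pd (rsmult T t e) \<phi>) (\<psi> q)) \<omega> =
   lift (tgrp S A L) (%\<phi> q. ?g (pure Pd A P (e \<odot>\<^bsub>Pd\<^esub> \<phi>) q)) \<omega>"
  by (rule PdP.lift_cong[OF \<omega>_closed SL.T.abg b_inner[OF te h(3)] b1 e1[symmetric]])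
 also have "\<dots> = lift (tgrp S A L) (%\<phi> q. ?g (pure Pd A P \<phi> (e q))) \<omega>"
  by (rule \<omega>_E_commute[OF h(2) SL.T.abg PdP.lift_add_hom[OF SL.T.abg b_inner[OF h(1,3)]] b1 b2])
 also have "\<dots> = lift (tgrp S A L) (%\<phi> q. pure S A L (pure T E Pd t \<phi>) ((e \<odot>\<^bsub>HL\<^esub> \<psi>) q)) \<omega>"
  by (rule PdP.lift_cong[OF \<omega>_closed SL.T.abg b2 b_inner[OF h(1) e\<psi>] e2])
 finally show "lift (tgrp S A L) (%\<phi> q. pure S A L (pure T E Pd (rsmult T t e) \<phi>) (\<psi> q)) \<omega> =
   lift (tgrp S A L) (%\<phi> q. pure S A L (pure T E Pd t \<phi>) ((e \<odot>\<^bsub>HL\<^esub> \<psi>) q)) \<omega>" .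
qed

lemma hom_b_hom: "hom_b T L \<in> add_hom (tgrp T E HL) (tgrp S A L)"
 unfolding hom_b_def by (rule TH.lift_add_hom[OF SL.T.abg b_outer])

lemma hom_b_pure:
 "[|t \<in> car T; \<psi> \<in> car HL|] ==> hom_b T L (pure T E HL t \<psi>) =
  lift (tgrp S A L) (%\<phi> q. pure S A L (pure T E Pd t \<phi>) (\<psi> q)) \<omega>"
 unfolding hom_b_def by (rule TH.lift_pure[OF SL.T.abg b_outer])

text \<open>
  This is \<open>\<omega>_Pd\<close>: moving \<open>\<phi>(b)\<close> across the tensor sign gives \<open>\<Sum> \<phi>\<^sub>b \<phi>(b) = \<phi>\<close>.
\<close>

lemma hom_ba:
 assumes "w \<in> car (tgrp S A L)"
 shows "hom_b T L (hom_a T L w) = w"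
proof (rule triple_eqI[OF add_hom_comp[OF hom_a_hom hom_b_hom] add_hom_id _ assms])
 fix t \<phi> l assume t: "t \<in> car T" and \<phi>: "\<phi> \<in> car Pd" and l: "l \<in> car L"
 let ?g = "%\<phi>. pure S A L (pure T E Pd t \<phi>) l"
 note br = br_closed[OF L \<phi> l]
 have g: "?g \<in> add_hom Pd (tgrp S A L)"
  by (rule add_homI) (use t l SL.pure_add_left in "simp_all add: TP.pure_add_right SL.pure_closed[simplified] del: P_dual_simps")
 have eq: "pure S A L (pure T E Pd t \<phi>') (br L \<phi> l q) = ?g (rsmult Pd \<phi>' (\<phi> q))"
  if "\<phi>' \<in> car Pd" "q \<in> car P" for \<phi>' q
 proof -
  have "\<phi> q \<in> car A" using \<phi> that by simp
  then show ?thesis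
   using tensor_rsmult_pure[OF T Pd.bm _ t that(1), of "\<phi> q"] SL.pure_middle[of "pure T E Pd t \<phi>'" "\<phi> q" l] that t l
   by (simp add: br_def del: P_dual_simps)
 qed
 have bal: "balanced Pd A P (tgrp S A L) (%\<phi>' q. ?g (rsmult Pd \<phi>' (\<phi> q)))"
  using b_inner[OF t br] eq unfolding balanced_def by (simp del: P_dual_simps)
 have "hom_b T L (hom_a T L (pure S A L (pure T E Pd t \<phi>) l)) =
   lift (tgrp S A L) (%\<phi>' q. pure S A L (pure T E Pd t \<phi>') (br L \<phi> l q)) \<omega>"
  by (simp only: hom_a_pure[OF t \<phi> l] hom_b_pure[OF t br])
 also have "\<dots> = lift (tgrp S A L) (%\<phi>' q. ?g (rsmult Pd \<phi>' (\<phi> q))) \<omega>"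
  by (rule PdP.lift_cong[OF \<omega>_closed SL.T.abg b_inner[OF t br] bal eq])
 also have "\<dots> = ?g \<phi>" by (rule \<omega>_Pd[OF SL.T.abg \<phi> g bal])
 finally show "hom_b T L (hom_a T L (pure S A L (pure T E Pd t \<phi>) l)) =
   pure S A L (pure T E Pd t \<phi>) l" .
qed

lemma hom_ab:
 assumes "w \<in> car (tgrp T E HL)"
 shows "hom_a T L (hom_b T L w) = w"
proof (rule TH.add_hom_eqI[OF add_hom_comp[OF hom_b_hom hom_a_hom] add_hom_id _ assms])
 fix t \<psi> assume t: "t \<in> car T" and \<psi>: "\<psi> \<in> car HL"
 have p: "(%\<psi>. pure T E HL t \<psi>) \<in> add_hom HL (tgrp T E HL)"
  by (rule add_homI) (use t in "simp_all add: TH.pure_add_right del: Hom_simps")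
 have bal: "balanced Pd A P (tgrp T E HL) (%\<phi> q. pure T E HL t (br L \<phi> (\<psi> q)))"
  using balancedD[OF br_hom_balanced[OF L \<psi>]] add_hom_add[OF p] t
  by (intro balancedI) (simp_all del: Hom_simps P_dual_simps)
 have "hom_a T L (hom_b T L (pure T E HL t \<psi>)) =
   lift (tgrp T E HL) (%\<phi> q. pure T E HL t (br L \<phi> (\<psi> q))) \<omega>"
  unfolding hom_b_pure[OF t \<psi>]
  by (rule PdP.lift_hom_comp[OF \<omega>_closed SL.T.abg TH.T.abg b_inner[OF t \<psi>] hom_a_hom bal])
   (use t \<psi> in "simp add: hom_a_pure")
 also have "\<dots> = pure T E HL t (lift HL (%\<phi> q. br L \<phi> (\<psi> q)) \<omega>)"
  by (rule PdP.lift_hom_comp[OF \<omega>_closed Hom_ag[OF L] TH.T.abg br_hom_balanced[OF L \<psi>] p bal, symmetric]) simp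
 finally show "hom_a T L (hom_b T L (pure T E HL t \<psi>)) = pure T E HL t \<psi>"
  using \<omega>_Hom[OF L \<psi>] by simp
qed

end

end

section \<open>Splittings of projective bimodules\<close>

text \<open>
  A bimodule with one of its two actions restricted to the ground field; needed to form tensor products
  over \<open>K\<close>.
\<close>

definition restrict_right :: "('k, 's, 'z) module_scheme => ('r, 's, 'm) bimod => ('r, 'k, 'm) bimod"
 where "restrict_right S M = module.extend (module.truncate M) (bimod.fields (%x c. rsmult M x (scalar S c)))"

definition restrict_left :: "('k, 'r, 'z) module_scheme => ('r, 's, 'm) bimod => ('k, 's, 'm) bimod"
 where "restrict_left R M =
  \<lparr>carrier = car M, monoid.mult = monoid.mult M, monoid.one = monoid.one M, ring.zero = ring.zero M,
   ring.add = ring.add M, smult = (%c x. (scalar R c) \<odot>\<^bsub>M\<^esub> x), rsmult = rsmult M\<rparr>"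

lemma restrict_right_simps [simp]:
 "car (restrict_right S M) = car M" "\<zero>\<^bsub>restrict_right S M\<^esub> = \<zero>\<^bsub>M\<^esub>"
 "ring.add (restrict_right S M) = ring.add M" "smult (restrict_right S M) = smult M"
 "rsmult (restrict_right S M) x c = rsmult M x (scalar S c)"
 by (simp_all add: restrict_right_def module.defs bimod.defs)

lemma restrict_left_simps [simp]:
 "car (restrict_left R M) = car M" "\<zero>\<^bsub>restrict_left R M\<^esub> = \<zero>\<^bsub>M\<^esub>"
 "ring.add (restrict_left R M) = ring.add M" "rsmult (restrict_left R M) = rsmult M"
 "c \<odot>\<^bsub>restrict_left R M\<^esub> x = (scalar R c) \<odot>\<^bsub>M\<^esub> x"
 by (simp_all add: restrict_left_def)

lemma cring_r_one: "[|cring K; c \<in> car K|] ==> c \<otimes>\<^bsub>K\<^esub> \<one>\<^bsub>K\<^esub> = c"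
 by (rule monoid.r_one[OF ring.axioms(2)[OF cring.axioms(1)]])

lemma kscalar_add:
 assumes "k_algebra K R" "c \<in> car K" "d \<in> car K"
 shows "(c \<oplus>\<^bsub>K\<^esub> d) \<odot>\<^bsub>R\<^esub> \<one>\<^bsub>R\<^esub> = scalar R c \<oplus>\<^bsub>R\<^esub> scalar R d"
 by (rule module.smult_l_distr[OF k_algebraD(1)[OF assms(1)] assms(2,3) ring.ring_simprules(6)[OF k_algebraD(2)[OF assms(1)]]])

lemma kscalar_one: "k_algebra K R ==> \<one>\<^bsub>K\<^esub> \<odot>\<^bsub>R\<^esub> \<one>\<^bsub>R\<^esub> = \<one>\<^bsub>R\<^esub>"
 by (rule module.smult_one[OF k_algebraD(1) ring.ring_simprules(6)[OF k_algebraD(2)]])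

lemma bimodule_restrict_right:
 assumes M: "bimodule K R S M"
 shows "bimodule K R (reg K) (restrict_right S M)"
proof -
 interpret bimodule K R S M by fact
 interpret k: module K S by (rule k_algebraD(1)[OF kS])
 have KK: "k_algebra K (reg K)" by (rule k_algebra_self[OF k.R.cring_axioms])
 note kc = kscalar_closed[OF kS]
 have l: "lmodule R (restrict_right S M)"
  by (rule lmoduleI[OF R.ring_axioms abelian_group_cong[OF M.abg]])
   (auto simp: sc_ladd sc_radd sc_assoc)
 show ?thesis
  by (rule bimoduleI[OF l kR KK])
   (auto simp: kc kscalar_add[OF kS] kscalar_times[OF kS] kscalar_one[OF kS] rs_sadd rs_add rs_assoc rs_sc central)
qed

lemma bimodule_restrict_left:
 assumes M: "bimodule K R S M"
 shows "bimodule K (reg K) S (restrict_left R M)"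
proof -
 interpret bimodule K R S M by fact
 interpret k: module K S by (rule k_algebraD(1)[OF kS])
 have KK: "k_algebra K (reg K)" by (rule k_algebra_self[OF k.R.cring_axioms])
 note kc = kscalar_closed[OF kR]
 have l: "lmodule (reg K) (restrict_left R M)"
  by (rule lmoduleI[OF k_algebraD(2)[OF KK] abelian_group_cong[OF M.abg]])
   (auto simp: kc kscalar_add[OF kR] kscalar_times[OF kR] kscalar_one[OF kR] sc_ladd sc_radd sc_assoc)
 show ?thesis
  by (rule bimoduleI[OF l KK kS])
   (auto simp: kc kscalar_add[OF kR] kscalar_times[OF kR] kscalar_one[OF kR] rs_sadd rs_add rs_assoc rs_sc central[symmetric] cring_r_one[OF k.R.cring_axioms])
qed

text \<open>
  The bimodule \<open>M \<otimes>\<^sub>K S\<close>, which the right action maps onto \<open>M\<close>; as a right \<open>S\<close>-module it is induced from a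
  vector space. Symmetrically \<open>R \<otimes>\<^sub>K M\<close> on the left.
\<close>

definition right_cover where
 "right_cover K S M = tbim (restrict_right S M) (reg K) (restrict_left S (reg S))"

definition left_cover where
 "left_cover K R M = tbim (restrict_right R (reg R)) (reg K) (restrict_left R M)"

context
 fixes K :: "('k, 'x1) ring_scheme" and R :: "('k, 'r, 'x2) module_scheme" and S :: "('k, 's, 'x3) module_scheme"
  and M :: "('r, 's, 'm) bimod"
 assumes M: "bimodule K R S M"
begin

interpretation M: bimodule K R S M by (rule M)
interpretation S: ring S by (rule M.ringS)

lemma right_cover_bimodule: "bimodule K R S (right_cover K S M)"
 unfolding right_cover_def
 by (rule bimodule_tensor[OF bimodule_restrict_right[OF M] bimodule_restrict_left[OF bimodule_reg[OF M.kS]]])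

lemma left_cover_bimodule: "bimodule K R S (left_cover K R M)"
 unfolding left_cover_def
 by (rule bimodule_tensor[OF bimodule_restrict_right[OF bimodule_reg[OF M.kR]] bimodule_restrict_left[OF M]])

lemma right_pair: "tensor_pair (restrict_right S M) (reg K) (restrict_left S (reg S))"
 by (rule tensor_pairI[OF bimodule_restrict_right[OF M] lmodule_of_bimodule[OF bimodule_restrict_left[OF bimodule_reg[OF M.kS]]]])

lemma left_pair: "tensor_pair (restrict_right R (reg R)) (reg K) (restrict_left R M)"
 by (rule tensor_pairI[OF bimodule_restrict_right[OF bimodule_reg[OF M.kR]] lmodule_of_bimodule[OF bimodule_restrict_left[OF M]]])

interpretation RC: tensor_pair "restrict_right S M" "reg K" "restrict_left S (reg S)" by (rule right_pair)
interpretation LC: tensor_pair "restrict_right R (reg R)" "reg K" "restrict_left R M" by (rule left_pair)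

lemma right_mu_balanced: "balanced (restrict_right S M) (reg K) (restrict_left S (reg S)) M (rsmult M)"
 by (rule balancedI) (simp_all add: M.rs_add M.rs_sadd M.rs_assoc kscalar_closed[OF M.kS])

lemma left_mu_balanced: "balanced (restrict_right R (reg R)) (reg K) (restrict_left R M) M (smult M)"
 by (rule balancedI) (simp_all add: M.sc_ladd M.sc_radd M.sc_assoc kscalar_closed[OF M.kR])

lemma right_mu_hom: "lift M (rsmult M) \<in> bimod_hom R S (right_cover K S M) M"
proof -
 note ag = M.M.abg
 note lh = RC.lift_add_hom[OF ag right_mu_balanced] and lp = RC.lift_pure[OF ag right_mu_balanced]
 note b1 = bimodule_restrict_right[OF M] and b2 = bimodule_restrict_left[OF bimodule_reg[OF M.kS]]
 have "lift M (rsmult M) \<in> add_hom (right_cover K S M) M"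
  using lh by (simp add: add_hom_def right_cover_def)
 moreover have "lift M (rsmult M) (r \<odot>\<^bsub>right_cover K S M\<^esub> u) = r \<odot>\<^bsub>M\<^esub> lift M (rsmult M) u"
  if r: "r \<in> car R" and u: "u \<in> car (right_cover K S M)" for r u
  unfolding right_cover_def tensor_bimod_smult_eq[OF b1 b2]
  by (rule RC.add_hom_eqI[OF add_hom_comp[OF tensor_smult_add_hom[OF b1 lmodule_of_bimodule[OF b2] r] lh]
     add_hom_comp[OF lh M.sc_right_hom[OF r]]])
   (use r u in "simp_all add: tensor_smult_pure[OF b1 lmodule_of_bimodule[OF b2]] lp[simplified] M.rs_sc right_cover_def")
 moreover have "lift M (rsmult M) (rsmult (right_cover K S M) u s) = rsmult M (lift M (rsmult M) u) s"
  if s: "s \<in> car S" and u: "u \<in> car (right_cover K S M)" for s u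
  unfolding right_cover_def
  by (rule RC.add_hom_eqI[OF add_hom_comp[OF tensor_rsmult_add_hom[OF b1 b2 s] lh]
     add_hom_comp[OF lh M.rs_hom[OF s]]])
   (use s u in "simp_all add: tensor_rsmult_pure[OF b1 b2] lp[simplified] M.rs_assoc right_cover_def")
 ultimately show ?thesis by (rule bimod_homI)
qed

lemma left_mu_hom: "lift M (smult M) \<in> bimod_hom R S (left_cover K R M) M"
proof -
 note ag = M.M.abg
 note lh = LC.lift_add_hom[OF ag left_mu_balanced] and lp = LC.lift_pure[OF ag left_mu_balanced]
 note b2 = bimodule_restrict_left[OF M] and b1 = bimodule_restrict_right[OF bimodule_reg[OF M.kR]]
 have "lift M (smult M) \<in> add_hom (left_cover K R M) M"
  using lh by (simp add: add_hom_def left_cover_def)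
 moreover have "lift M (smult M) (r \<odot>\<^bsub>left_cover K R M\<^esub> u) = r \<odot>\<^bsub>M\<^esub> lift M (smult M) u"
  if r: "r \<in> car R" and u: "u \<in> car (left_cover K R M)" for r u
  unfolding left_cover_def tensor_bimod_smult_eq[OF b1 b2]
  by (rule LC.add_hom_eqI[OF add_hom_comp[OF tensor_smult_add_hom[OF b1 lmodule_of_bimodule[OF b2] r] lh]
     add_hom_comp[OF lh M.sc_right_hom[OF r]]])
   (use r u in "simp_all add: tensor_smult_pure[OF b1 lmodule_of_bimodule[OF b2]] lp[simplified] M.sc_assoc left_cover_def")
 moreover have "lift M (smult M) (rsmult (left_cover K R M) u s) = rsmult M (lift M (smult M) u) s"
  if s: "s \<in> car S" and u: "u \<in> car (left_cover K R M)" for s u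
  unfolding left_cover_def
  by (rule LC.add_hom_eqI[OF add_hom_comp[OF tensor_rsmult_add_hom[OF b1 b2 s] lh]
     add_hom_comp[OF lh M.rs_hom[OF s]]])
   (use s u in "simp_all add: tensor_rsmult_pure[OF b1 b2] lp[simplified] M.rs_sc left_cover_def")
 ultimately show ?thesis by (rule bimod_homI)
qed

lemma right_mu_surj: "lift M (rsmult M) ` car (right_cover K S M) = car M"
proof
 show "lift M (rsmult M) ` car (right_cover K S M) \<subseteq> car M"
  using bimod_homD(3)[OF right_mu_hom] by blast
 show "car M \<subseteq> lift M (rsmult M) ` car (right_cover K S M)"
 proof
  fix x assume x: "x \<in> car M"
  have "lift M (rsmult M) (pure (restrict_right S M) (reg K) (restrict_left S (reg S)) x \<one>\<^bsub>S\<^esub>) = x"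
   using x by (simp add: RC.lift_pure[OF M.M.abg right_mu_balanced])
  then show "x \<in> lift M (rsmult M) ` car (right_cover K S M)"
   using x RC.pure_closed[of x "\<one>\<^bsub>S\<^esub>"] by (intro image_eqI[OF sym]) (auto simp: right_cover_def)
 qed
qed

lemma left_mu_surj: "lift M (smult M) ` car (left_cover K R M) = car M"
proof
 show "lift M (smult M) ` car (left_cover K R M) \<subseteq> car M"
  using bimod_homD(3)[OF left_mu_hom] by blast
 show "car M \<subseteq> lift M (smult M) ` car (left_cover K R M)"
 proof
  fix x assume x: "x \<in> car M"
  have "lift M (smult M) (pure (restrict_right R (reg R)) (reg K) (restrict_left R M) \<one>\<^bsub>R\<^esub> x) = x"
   using x by (simp add: LC.lift_pure[OF M.M.abg left_mu_balanced])
  then show "x \<in> lift M (smult M) ` car (left_cover K R M)"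
   using x LC.pure_closed[of "\<one>\<^bsub>R\<^esub>" x] by (intro image_eqI[OF sym]) (auto simp: left_cover_def)
 qed
qed

lemma kfin_restrict_left: "kfin K R M ==> kfin K (reg K) (restrict_left R M)"
 using module.axioms(1)[OF k_algebraD(1)[OF M.kR]]
 by (auto intro!: kfin_cong[of "restrict_left R M" M] simp: cring_r_one)

lemma kfin_right_cover:
 assumes "kfin K R M" "kfin K S (reg S)"
 shows "kfin K R (right_cover K S M)"
proof -
 have "kfin K (reg K) (restrict_left S (reg S))"
  by (rule kfin_cong[OF _ _ _ _ assms(2)])
   (use module.axioms(1)[OF k_algebraD(1)[OF M.kS]] in "auto simp: cring_r_one")
 moreover have "kfin K R (restrict_right S M)" by (rule kfin_cong[OF _ _ _ _ assms(1)]) auto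
 ultimately show ?thesis
  unfolding right_cover_def
  by (intro kfin_tensor_bimod[OF bimodule_restrict_right[OF M] _ bimodule_restrict_left[OF bimodule_reg[OF M.kS]]])
qed

lemma kfin_left_cover:
 assumes "kfin K R M" "kfin K R (reg R)"
 shows "kfin K R (left_cover K R M)"
proof -
 have "kfin K R (restrict_right R (reg R))" by (rule kfin_cong[OF _ _ _ _ assms(2)]) auto
 then show ?thesis
  unfolding left_cover_def
  by (intro kfin_tensor_bimod[OF bimodule_restrict_right[OF bimodule_reg[OF M.kR]] _ bimodule_restrict_left[OF M] kfin_restrict_left[OF assms(1)]])
qed

end

text \<open>
  Right linearity is what exactness of \<open>T \<otimes>\<^sub>S -\<close> requires, left linearity what lifting maps out of \<open>M\<close> requires.
\<close>

definition right_split where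
 "right_split K S M s \<longleftrightarrow> s \<in> rmod_hom S M (right_cover K S M) \<and> (\<forall>x\<in>car M. lift M (rsmult M) (s x) = x)"

definition left_split where
 "left_split K R M s \<longleftrightarrow> s \<in> lmod_hom R M (left_cover K R M) \<and> (\<forall>x\<in>car M. lift M (smult M) (s x) = x)"

text \<open>
  The action maps are surjective homomorphisms of bimodules onto a projective bimodule.
\<close>

lemma projective_splits:
 fixes K :: "'k ring" and R :: "('k, 'r) module"
 assumes M: "projective_bimodule K R S M" "kfin K R M" and R: "kfin K R (reg R)" and S: "kfin K S (reg S)"
 shows "\<exists>s\<in>bimod_hom R S M (right_cover K S M). \<forall>x\<in>car M. lift M (rsmult M) (s x) = x"
  and "\<exists>s. left_split K R M s"
proof -
 have b: "bimodule K R S M" using M(1) by (simp add: projective_bimodule_def)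
 have id: "(%x. x) \<in> bimod_hom R S M M" by (auto simp: bimod_hom_def lmod_hom_def)
 obtain s where "s \<in> bimod_hom R S M (right_cover K S M)" "!!x. x \<in> car M ==> lift M (rsmult M) (s x) = x"
  using projective_bimodule_lift[OF M(1) right_cover_bimodule[OF b] kfin_right_cover[OF b M(2) S] b M(2)
    right_mu_hom[OF b] right_mu_surj[OF b] id] by metis
 then show "\<exists>s\<in>bimod_hom R S M (right_cover K S M). \<forall>x\<in>car M. lift M (rsmult M) (s x) = x"
  by blast
 obtain s where "s \<in> bimod_hom R S M (left_cover K R M)" "!!x. x \<in> car M ==> lift M (smult M) (s x) = x"
  using projective_bimodule_lift[OF M(1) left_cover_bimodule[OF b] kfin_left_cover[OF b M(2) R] b M(2)
    left_mu_hom[OF b] left_mu_surj[OF b] id] by metis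
 then show "\<exists>s. left_split K R M s"
  unfolding left_split_def by (blast intro: bimod_homD(1))
qed

text \<open>
  A linear solution \<open>g\<close> of the lifting problem induces the left-linear map \<open>a \<otimes> y \<mapsto> a g(y)\<close> on \<open>R \<otimes>\<^sub>K Y\<close>.
  Composition with the splitting \<open>Y \<rightarrow> R \<otimes>\<^sub>K Y\<close> gives a left-linear solution.
\<close>

lemma left_split_lift:
 assumes Y: "bimodule K R S Y" and s: "left_split K R Y s"
  and M: "lmodule R M" and M': "lmodule R M'" and d: "d \<in> lmod_hom R M M'" and \<pi>: "\<pi> \<in> lmod_hom R Y M'"
  and g: "g \<in> klin K R Y R M" and dg: "!!y. y \<in> car Y ==> d (g y) = \<pi> y"
 shows "\<exists>\<theta>\<in>lmod_hom R Y M. \<forall>y\<in>car Y. d (\<theta> y) = \<pi> y"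
proof -
 interpret Y: bimodule K R S Y by fact
 interpret M: lmodule R M by fact
 interpret M': lmodule R M' by fact
 let ?R = "restrict_right R (reg R)" and ?Y = "restrict_left R Y"
 interpret LC: tensor_pair ?R "reg K" ?Y by (rule left_pair[OF Y])
 note b2 = bimodule_restrict_left[OF Y] and b1 = bimodule_restrict_right[OF bimodule_reg[OF Y.kR]]
 have sh: "s \<in> lmod_hom R Y (left_cover K R Y)" and sm: "!!x. x \<in> car Y ==> lift Y (smult Y) (s x) = x"
  using s unfolding left_split_def by auto
 have sc: "s y \<in> car (tgrp ?R (reg K) ?Y)" if "y \<in> car Y" for y
  using lmod_homD(2)[OF sh that] by (simp add: left_cover_def)
 note gh = klinD[OF g]
 have bal: "balanced ?R (reg K) ?Y M (%a y. a \<odot>\<^bsub>M\<^esub> g y)"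
  by (rule balancedI)
   (simp_all add: M.sc_ladd M.sc_radd M.sc_assoc kscalar_closed[OF Y.kR] add_hom_closed[OF gh(1)] add_hom_add[OF gh(1)] gh(2))
 note lh = LC.lift_add_hom[OF M.M.abg bal] and lp = LC.lift_pure[OF M.M.abg bal]
 define \<theta> where "\<theta> y = lift M (%a y. a \<odot>\<^bsub>M\<^esub> g y) (s y)" for y
 have "\<theta> \<in> lmod_hom R Y M"
 proof (rule lmod_homI)
  show "\<theta> \<in> add_hom Y M"
   by (rule add_homI) (use lmod_homD(3)[OF sh] sc in "auto simp: \<theta>_def add_hom_closed[OF lh] add_hom_add[OF lh] left_cover_def")
  fix r y assume r: "r \<in> car R" and y: "y \<in> car Y"
  have "lift M (%a y. a \<odot>\<^bsub>M\<^esub> g y) (r \<odot>\<^bsub>tensor ?R (reg K) ?Y\<^esub> u) = r \<odot>\<^bsub>M\<^esub> lift M (%a y. a \<odot>\<^bsub>M\<^esub> g y) u"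
   if u: "u \<in> car (tgrp ?R (reg K) ?Y)" for u
   by (rule LC.add_hom_eqI[OF add_hom_comp[OF tensor_smult_add_hom[OF b1 lmodule_of_bimodule[OF b2] r] lh]
      add_hom_comp[OF lh M.sc_right_hom[OF r]] _ u])
    (use r in "simp_all add: tensor_smult_pure[OF b1 lmodule_of_bimodule[OF b2]] lp[simplified] M.sc_assoc add_hom_closed[OF gh(1)]")
  then show "\<theta> (r \<odot>\<^bsub>Y\<^esub> y) = r \<odot>\<^bsub>M\<^esub> \<theta> y"
   using lmod_homD(4)[OF sh r y] sc[OF y] tensor_bimod_smult_eq[OF b1 b2, of r "s y"] by (simp add: \<theta>_def left_cover_def)
 qed
 moreover have "d (\<theta> y) = \<pi> y" if y: "y \<in> car Y" for y
 proof -
  have "d (lift M (%a y. a \<odot>\<^bsub>M\<^esub> g y) u) = \<pi> (lift Y (smult Y) u)"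
   if u: "u \<in> car (tgrp ?R (reg K) ?Y)" for u
   by (rule LC.add_hom_eqI[OF add_hom_comp[OF lh lmod_homD(1)[OF d]]
      add_hom_comp[OF LC.lift_add_hom[OF Y.M.abg left_mu_balanced[OF Y]] lmod_homD(1)[OF \<pi>]] _ u])
    (use lmod_homD(4)[OF d] lmod_homD(4)[OF \<pi>] dg in \<open>simp_all add: lp[simplified] add_hom_closed[OF gh(1)]
     LC.lift_pure[OF Y.M.abg left_mu_balanced[OF Y], simplified]\<close>)
  then show ?thesis using sm[OF y] sc[OF y] by (simp add: \<theta>_def)
 qed
 ultimately show ?thesis by blast
qed

text \<open>
  Apply \<open>M \<otimes>\<^sub>S -\<close> to the splitting \<open>Y \<rightarrow> Y \<otimes>\<^sub>K Q\<close>, which is possible because that map is also left \<open>S\<close>-linear.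
  The map \<open>G p\<close> is \<open>y \<otimes> e \<mapsto> (p \<otimes> y) \<otimes> e\<close>.
\<close>

lemma right_split_tensor:
 assumes M: "bimodule K R S M" and Y: "bimodule K S Q Y"
  and sh: "s \<in> bimod_hom S Q Y (right_cover K Q Y)" and sm: "!!y. y \<in> car Y ==> lift Y (rsmult Y) (s y) = y"
 shows "\<exists>s'. right_split K Q (tbim M S Y) s'"
proof -
 interpret M: bimodule K R S M by fact
 interpret Y: bimodule K S Q Y by fact
 interpret T: bimodule K R Q "tbim M S Y" by (rule bimodule_tensor[OF M Y])
 interpret Q: ring Q by (rule Y.ringS)
 let ?T = "tbim M S Y"
 let ?rY = "restrict_right Q Y" and ?rT = "restrict_right Q ?T" and ?KK = "reg K" and ?Q = "restrict_left Q (reg Q)"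
 interpret MY: tensor_pair M S Y by (rule tensor_pairI[OF M Y.lmod])
 interpret CY: tensor_pair ?rY ?KK ?Q by (rule right_pair[OF Y])
 interpret CT: tensor_pair ?rT ?KK ?Q by (rule right_pair[OF T.bm])
 note Yb = bimodule_restrict_right[OF Y] and Tb = bimodule_restrict_right[OF T.bm]
  and Qb = bimodule_restrict_left[OF bimodule_reg[OF Y.kS]]
 let ?C = "tgrp ?rT ?KK ?Q"
 note Cag = CT.T.abg
 define G where "G p = lift ?C (%y e. pure ?rT ?KK ?Q (pure M S Y p y) e)" for p
 have rp: "rsmult ?T (pure M S Y p y) t = pure M S Y p (rsmult Y y t)"
  if "p \<in> car M" "y \<in> car Y" "t \<in> car Q" for p y t
  by (rule tensor_rsmult_pure[OF M Y that(3,1,2)])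
 have bal: "balanced ?rY ?KK ?Q ?C (%y e. pure ?rT ?KK ?Q (pure M S Y p y) e)" if p: "p \<in> car M" for p
 proof (rule balancedI)
  fix y c e assume h: "y \<in> car ?rY" "c \<in> car ?KK" "e \<in> car ?Q"
  then show "pure ?rT ?KK ?Q (pure M S Y p (rsmult ?rY y c)) e =
    pure ?rT ?KK ?Q (pure M S Y p y) (c \<odot>\<^bsub>?Q\<^esub> e)"
   using CT.pure_middle[of "pure M S Y p y" c e] p rp[of p y "scalar Q c"] kscalar_closed[OF Y.kS, of c]
   by simp
 qed (use p CT.pure_add_left CT.pure_add_right CT.pure_closed in "auto simp: MY.pure_add_right")
 note Gh = CY.lift_add_hom[OF Cag bal, folded G_def] and Gp = CY.lift_pure[OF Cag bal, folded G_def]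
 have sc: "s y \<in> car (tgrp ?rY ?KK ?Q)" if "y \<in> car Y" for y
  using bimod_homD(3)[OF sh that] by (simp add: right_cover_def)
 have sa: "s (y \<oplus>\<^bsub>Y\<^esub> y') = s y \<oplus>\<^bsub>tgrp ?rY ?KK ?Q\<^esub> s y'" if "y \<in> car Y" "y' \<in> car Y" for y y'
  using bimod_homD(4)[OF sh that] by (simp add: right_cover_def)
 note sr = bimod_homD(6)[OF sh, unfolded right_cover_def]
 have sl: "s (r \<odot>\<^bsub>Y\<^esub> y) = r \<odot>\<^bsub>tensor ?rY ?KK ?Q\<^esub> s y" if "y \<in> car Y" "r \<in> car S" for y r
  using bimod_homD(5)[OF sh that(2,1)] tensor_bimod_smult_eq[OF Yb Qb, of r "s y"] by (simp add: right_cover_def)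
 have outer: "balanced M S Y ?C (%p y. G p (s y))"
 proof (rule balancedI)
  fix p y assume h: "p \<in> car M" "y \<in> car Y"
  show "G p (s y) \<in> car ?C" by (rule add_hom_closed[OF Gh[OF h(1)] sc[OF h(2)]])
 next
  fix p p' y assume h: "p \<in> car M" "p' \<in> car M" "y \<in> car Y"
  show "G (p \<oplus>\<^bsub>M\<^esub> p') (s y) = G p (s y) \<oplus>\<^bsub>?C\<^esub> G p' (s y)"
   unfolding G_def
   by (rule CY.lift_param_add[OF sc[OF h(3)] Cag bal bal bal])
    (use h CT.pure_add_left in "auto simp: MY.pure_add_left")
 next
  fix p y y' assume h: "p \<in> car M" "y \<in> car Y" "y' \<in> car Y"
  then show "G p (s (y \<oplus>\<^bsub>Y\<^esub> y')) = G p (s y) \<oplus>\<^bsub>?C\<^esub> G p (s y')"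
   by (simp add: sa add_hom_add[OF Gh] sc)
 next
  fix p r y assume h: "p \<in> car M" "r \<in> car S" "y \<in> car Y"
  have pr: "rsmult M p r \<in> car M" using h by simp
  have "G (rsmult M p r) u = G p (r \<odot>\<^bsub>tensor ?rY ?KK ?Q\<^esub> u)" if u: "u \<in> car (tgrp ?rY ?KK ?Q)" for u
  proof (rule CY.add_hom_eqI[OF Gh[OF pr] add_hom_comp[OF tensor_smult_add_hom[OF Yb lmodule_of_bimodule[OF Qb] h(2)] Gh[OF h(1)]] _ u])
   fix y e assume ye: "y \<in> car ?rY" "e \<in> car ?Q"
   show "G (rsmult M p r) (pure ?rY ?KK ?Q y e) = G p (r \<odot>\<^bsub>tensor ?rY ?KK ?Q\<^esub> pure ?rY ?KK ?Q y e)"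
    using ye h Gp[OF pr ye] Gp[OF h(1) _ ye(2), of "r \<odot>\<^bsub>Y\<^esub> y"] MY.pure_middle[OF h(1,2), of y]
    by (simp add: tensor_smult_pure[OF Yb lmodule_of_bimodule[OF Qb] h(2)])
  qed
  then show "G (rsmult M p r) (s y) = G p (s (r \<odot>\<^bsub>Y\<^esub> y))"
   using h sc by (simp add: sl)
 qed
 define s' where "s' = lift ?C (%p y. G p (s y))"
 note s'h = MY.lift_add_hom[OF Cag outer, folded s'_def] and s'p = MY.lift_pure[OF Cag outer, folded s'_def]
 have "s' \<in> rmod_hom Q ?T (right_cover K Q ?T)"
 proof (rule rmod_homI)
  show "s' \<in> add_hom ?T (right_cover K Q ?T)"
   using s'h by (simp add: add_hom_def right_cover_def)
  fix u q assume u: "u \<in> car ?T" and q: "q \<in> car Q"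
  show "s' (rsmult ?T u q) = rsmult (right_cover K Q ?T) (s' u) q"
   unfolding right_cover_def
  proof (rule MY.add_hom_eqI[OF add_hom_comp[OF tensor_rsmult_add_hom[OF M Y q] s'h]
     add_hom_comp[OF s'h tensor_rsmult_add_hom[OF Tb Qb q]]])
   fix p y assume py: "p \<in> car M" "y \<in> car Y"
   have "G p (rsmult (tbim ?rY ?KK ?Q) v q) = rsmult (tbim ?rT ?KK ?Q) (G p v) q"
    if v: "v \<in> car (tgrp ?rY ?KK ?Q)" for v
    by (rule CY.add_hom_eqI[OF add_hom_comp[OF tensor_rsmult_add_hom[OF Yb Qb q] Gh[OF py(1)]]
       add_hom_comp[OF Gh[OF py(1)] tensor_rsmult_add_hom[OF Tb Qb q]] _ v])
     (use q py in "simp_all add: tensor_rsmult_pure[OF Yb Qb q] tensor_rsmult_pure[OF Tb Qb q] Gp[OF py(1), simplified]")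
   then show "s' (rsmult ?T (pure M S Y p y) q) = rsmult (tbim ?rT ?KK ?Q) (s' (pure M S Y p y)) q"
    using rp[OF py q] s'p[OF py] s'p[OF py(1) Y.rs_closed[OF q py(2)]] sr[OF q py(2)] sc[OF py(2)] by simp
  qed (use u in simp)
 qed
 moreover have "lift ?T (rsmult ?T) (s' u) = u" if u: "u \<in> car ?T" for u
 proof -
  note \<mu> = CT.lift_add_hom[OF T.M.abg right_mu_balanced[OF T.bm]]
   and \<mu>p = CT.lift_pure[OF T.M.abg right_mu_balanced[OF T.bm]]
  note \<mu>Y = CY.lift_add_hom[OF Y.M.abg right_mu_balanced[OF Y]]
   and \<mu>Yp = CY.lift_pure[OF Y.M.abg right_mu_balanced[OF Y]]
  show ?thesis
  proof (rule MY.add_hom_eqI[OF add_hom_comp[OF s'h \<mu>]])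
   show "(%x. x) \<in> add_hom (tgrp M S Y) ?T" by (simp add: add_hom_def)
   fix p y assume py: "p \<in> car M" "y \<in> car Y"
   have ph: "(%y. pure M S Y p y) \<in> add_hom Y ?T"
    by (rule add_homI) (use py in "simp_all add: MY.pure_add_right")
   have "lift ?T (rsmult ?T) (G p v) = pure M S Y p (lift Y (rsmult Y) v)"
    if v: "v \<in> car (tgrp ?rY ?KK ?Q)" for v
    by (rule CY.add_hom_eqI[OF add_hom_comp[OF Gh[OF py(1)] \<mu>] add_hom_comp[OF \<mu>Y ph] _ v])
     (use py in "simp_all add: Gp[OF py(1), simplified] \<mu>p[simplified] \<mu>Yp[simplified] rp")
   then show "lift ?T (rsmult ?T) (s' (pure M S Y p y)) = pure M S Y p y"
    using s'p[OF py] sc[OF py(2)] sm[OF py(2)] by simp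
  qed (use u in simp)
 qed
 ultimately show ?thesis unfolding right_split_def by blast
qed

text \<open>
  A section defined on the image of \<open>f\<close> only, as \<open>f\<close> need not be surjective.
\<close>

definition section_on where
 "section_on K R M S N f \<tau> \<longleftrightarrow> (\<forall>y\<in>f ` car M. \<tau> y \<in> car M \<and> f (\<tau> y) = y) \<and>
  (\<forall>y\<in>f ` car M. \<forall>z\<in>f ` car M. \<tau> (y \<oplus>\<^bsub>N\<^esub> z) = \<tau> y \<oplus>\<^bsub>M\<^esub> \<tau> z) \<and>
  (\<forall>c\<in>car K. \<forall>y\<in>f ` car M. \<tau> ((scalar S c) \<odot>\<^bsub>N\<^esub> y) = (scalar R c) \<odot>\<^bsub>M\<^esub> \<tau> y)"

lemma section_onD:
 assumes "section_on K R M S N f \<tau>"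
 shows "y \<in> f ` car M ==> \<tau> y \<in> car M" "y \<in> f ` car M ==> f (\<tau> y) = y"
  "[|y \<in> f ` car M; z \<in> f ` car M|] ==> \<tau> (y \<oplus>\<^bsub>N\<^esub> z) = \<tau> y \<oplus>\<^bsub>M\<^esub> \<tau> z"
  "[|c \<in> car K; y \<in> f ` car M|] ==> \<tau> ((scalar S c) \<odot>\<^bsub>N\<^esub> y) = (scalar R c) \<odot>\<^bsub>M\<^esub> \<tau> y"
 using assms unfolding section_on_def by blast+

lemma section_exists:
 assumes "field K" "k_algebra K R" "lmodule R M" "kfin K R M" "k_algebra K S" "lmodule S N" "f \<in> klin K R M S N"
 shows "\<exists>\<tau>. section_on K R M S N f \<tau>"
 using klin_section[OF assms] unfolding section_on_def by metis

lemma section_comp_klin: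
 assumes "section_on K R M S N f \<tau>" "g \<in> klin K Q L S N" "!!x. x \<in> car L ==> g x \<in> f ` car M"
 shows "(%x. \<tau> (g x)) \<in> klin K Q L R M"
 by (intro klinI add_homI)
  (simp_all add: section_onD[OF assms(1)] assms(3) add_hom_add[OF klinD(1)[OF assms(2)]] klinD(2)[OF assms(2)])

lemma klin_minus:
 assumes "k_algebra K S" "lmodule S N" "f \<in> klin K R M S N" "g \<in> klin K R M S N"
 shows "(%x. f x \<ominus>\<^bsub>N\<^esub> g x) \<in> klin K R M S N"
proof -
 interpret N: lmodule S N by fact
 note f = klinD[OF assms(3)] and g = klinD[OF assms(4)]
 show ?thesis
  by (intro klinI)
   (use add_hom_plus[OF N.M.abg f(1) add_hom_uminus[OF N.M.abg g(1)]]
    in "simp_all add: a_minus_def f g N.sc_radd N.sc_rneg kscalar_closed[OF assms(1)] add_hom_closed[OF f(1)] add_hom_closed[OF g(1)]")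
qed

lemma klin_id: "(%x. x) \<in> klin K R M R M"
 by (simp add: klin_def add_hom_id)

text \<open>
  With sections \<open>\<sigma>\<close> of \<open>d0\<close> and \<open>\<tau>\<close> of \<open>d1\<close>, the element \<open>x - \<tau>(d1 x)\<close> is a cycle, hence a boundary, and \<open>\<sigma>\<close>
  produces a preimage of it.
\<close>

lemma contraction_step:
 assumes S: "k_algebra K S" and N: "lmodule S N0" "lmodule S N1" "lmodule S N2"
  and d0: "d0 \<in> lmod_hom S N0 N1" and d1: "d1 \<in> lmod_hom S N1 N2"
  and ex: "!!x. [|x \<in> car N1; d1 x = \<zero>\<^bsub>N2\<^esub>|] ==> x \<in> d0 ` car N0"
  and \<sigma>: "section_on K S N0 S N1 d0 \<sigma>" and \<tau>: "section_on K S N1 S N2 d1 \<tau>"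
 shows "\<exists>h\<in>klin K S N1 S N0. (\<forall>x\<in>car N1. d0 (h x) = x \<ominus>\<^bsub>N1\<^esub> \<tau> (d1 x)) \<and>
  (\<forall>x\<in>car N1. d1 x = \<zero>\<^bsub>N2\<^esub> --> h x = \<sigma> x)"
proof -
 interpret N1: lmodule S N1 by fact
 interpret N2: lmodule S N2 by fact
 define k where "k x = x \<ominus>\<^bsub>N1\<^esub> \<tau> (d1 x)" for x
 have td: "(%x. \<tau> (d1 x)) \<in> klin K S N1 S N1"
  by (rule section_comp_klin[OF \<tau> klin_lmod_hom[OF S d1]]) simp
 have k: "k \<in> klin K S N1 S N1"
  unfolding k_def by (rule klin_minus[OF S N(2) klin_id td])
 have tc: "\<tau> (d1 x) \<in> car N1" "d1 (\<tau> (d1 x)) = d1 x" if "x \<in> car N1" for x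
  using section_onD(1,2)[OF \<tau>] that by auto
 have kim: "k x \<in> d0 ` car N0" if x: "x \<in> car N1" for x
 proof (rule ex)
  show "k x \<in> car N1" by (rule add_hom_closed[OF klinD(1)[OF k] x])
  show "d1 (k x) = \<zero>\<^bsub>N2\<^esub>"
   unfolding k_def add_hom_minus[OF N1.M.abg N2.M.abg lmod_homD(1)[OF d1] x tc(1)[OF x]] tc(2)[OF x]
   using lmod_homD(2)[OF d1 x] by (simp add: a_minus_def N2.M.r_neg)
 qed
 have "\<tau> \<zero>\<^bsub>N2\<^esub> = \<zero>\<^bsub>N1\<^esub>"
  using add_hom_zero[OF N1.M.abg N1.M.abg klinD(1)[OF td]] lmod_hom_zero[OF N(2,3) d1] by simp
 then have "k x = x" if "x \<in> car N1" "d1 x = \<zero>\<^bsub>N2\<^esub>" for x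
  using that by (simp add: k_def a_minus_def)
 then show ?thesis
  using section_comp_klin[OF \<sigma> k kim] section_onD(2)[OF \<sigma> kim] unfolding k_def[symmetric]
  by (intro bexI[of _ "%x. \<sigma> (k x)"]) auto
qed

text \<open>
  Exact complexes of vector spaces are contractible; the part of the contraction that concerns a single
  degree is all that exactness of a tensored row requires.
\<close>

lemma K_contraction:
 assumes K: "field K" and S: "k_algebra K S"
  and N: "lmodule S N0" "lmodule S N1" "lmodule S N2" "lmodule S N3"
  and fin: "kfin K S N0" "kfin K S N1" "kfin K S N2"
  and d: "d0 \<in> lmod_hom S N0 N1" "d1 \<in> lmod_hom S N1 N2" "d2 \<in> lmod_hom S N2 N3"
  and ex1: "!!x. [|x \<in> car N1; d1 x = \<zero>\<^bsub>N2\<^esub>|] ==> x \<in> d0 ` car N0"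
  and ex2: "!!x. [|x \<in> car N2; d2 x = \<zero>\<^bsub>N3\<^esub>|] ==> x \<in> d1 ` car N1"
  and dd: "!!x. x \<in> car N1 ==> d2 (d1 x) = \<zero>\<^bsub>N3\<^esub>"
 shows "\<exists>h1\<in>klin K S N1 S N0. \<exists>h2\<in>klin K S N2 S N1. \<forall>x\<in>car N1. d0 (h1 x) \<oplus>\<^bsub>N1\<^esub> h2 (d1 x) = x"
proof -
 interpret N1: lmodule S N1 by (rule N(2))
 obtain \<sigma>0 where \<sigma>0: "section_on K S N0 S N1 d0 \<sigma>0" using section_exists[OF K S N(1) fin(1) S N(2) klin_lmod_hom[OF S d(1)]] by blast
 obtain \<sigma>1 where \<sigma>1: "section_on K S N1 S N2 d1 \<sigma>1" using section_exists[OF K S N(2) fin(2) S N(3) klin_lmod_hom[OF S d(2)]] by blast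
 obtain \<sigma>2 where \<sigma>2: "section_on K S N2 S N3 d2 \<sigma>2" using section_exists[OF K S N(3) fin(3) S N(4) klin_lmod_hom[OF S d(3)]] by blast
 obtain h1 where h1: "h1 \<in> klin K S N1 S N0" "!!x. x \<in> car N1 ==> d0 (h1 x) = x \<ominus>\<^bsub>N1\<^esub> \<sigma>1 (d1 x)"
  using contraction_step[OF S N(1,2,3) d(1,2) ex1 \<sigma>0 \<sigma>1] by blast
 obtain h2 where h2: "h2 \<in> klin K S N2 S N1" "!!x. [|x \<in> car N2; d2 x = \<zero>\<^bsub>N3\<^esub>|] ==> h2 x = \<sigma>1 x"
  using contraction_step[OF S N(2,3,4) d(2,3) ex2 \<sigma>1 \<sigma>2] by blast
 have "d0 (h1 x) \<oplus>\<^bsub>N1\<^esub> h2 (d1 x) = x" if x: "x \<in> car N1" for x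
  using section_onD(1)[OF \<sigma>1, of "d1 x"] x lmod_homD(2)[OF d(2) x] dd[OF x] h1(2)[OF x] h2(2)[of "d1 x"]
  by (simp add: a_minus_def N1.M.a_assoc N1.M.l_neg)
 then show ?thesis using h1(1) h2(1) by blast
qed

section \<open>Exactness of tensoring with right-split bimodules\<close>

text \<open>
  With \<open>s t = \<Sum> t\<^sub>i \<otimes> e\<^sub>i\<close> this is \<open>t \<otimes> \<nu> \<mapsto> \<Sum> t\<^sub>i \<otimes> h(e\<^sub>i \<nu>)\<close>. It replaces \<open>1 \<otimes> h\<close> for maps \<open>h\<close> that are only
  \<open>K\<close>-linear.
\<close>

definition split_map where
 "split_map K T S N' s h = lift (tgrp T S N')
  (%t \<nu>. lift (tgrp T S N') (%t' e. pure T S N' t' (h e \<nu>)) (s t))"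

lemma split_map_props:
 assumes T: "bimodule K R S T" and s: "right_split K S T s"
  and N: "lmodule S N" and N': "lmodule S N'" and h: "h \<in> klin K S N S N'"
 defines "H \<equiv> split_map K T S N' s (%e \<nu>. h (e \<odot>\<^bsub>N\<^esub> \<nu>))"
 defines "I \<equiv> %\<nu>. lift (tgrp T S N') (%t' e. pure T S N' t' (h (e \<odot>\<^bsub>N\<^esub> \<nu>)))"
 shows "H \<in> add_hom (tgrp T S N) (tgrp T S N')"
  and "[|t \<in> car T; \<nu> \<in> car N|] ==> H (pure T S N t \<nu>) = I \<nu> (s t)"
  and "\<nu> \<in> car N ==> balanced (restrict_right S T) (reg K) (restrict_left S (reg S)) (tgrp T S N')
   (%t' e. pure T S N' t' (h (e \<odot>\<^bsub>N\<^esub> \<nu>)))"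
proof -
 interpret T: bimodule K R S T by fact
 interpret N: lmodule S N by fact
 interpret N': lmodule S N' by fact
 let ?rT = "restrict_right S T" and ?KK = "reg K" and ?S = "restrict_left S (reg S)"
 interpret C: tensor_pair ?rT ?KK ?S by (rule right_pair[OF T])
 interpret TN: tensor_pair T S N by (rule tensor_pairI[OF T N])
 interpret TN': tensor_pair T S N' by (rule tensor_pairI[OF T N'])
 note ag = TN'.T.abg
 note ha = klinD(1)[OF h] and hk = klinD(2)[OF h]
 note Tb = bimodule_restrict_right[OF T] and Sb = bimodule_restrict_left[OF bimodule_reg[OF T.kS]]
 have bal: "balanced ?rT ?KK ?S (tgrp T S N') (%t' e. pure T S N' t' (h (e \<odot>\<^bsub>N\<^esub> \<nu>)))" if \<nu>: "\<nu> \<in> car N" for \<nu>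
  by (rule balancedI)
   (use \<nu> in \<open>simp_all add: TN'.pure_add_left TN'.pure_add_right add_hom_closed[OF ha] add_hom_add[OF ha] N.sc_ladd
    TN'.pure_middle kscalar_closed[OF T.kS] N.sc_assoc hk\<close>)
 then show "\<nu> \<in> car N ==> balanced ?rT ?KK ?S (tgrp T S N') (%t' e. pure T S N' t' (h (e \<odot>\<^bsub>N\<^esub> \<nu>)))" .
 have Ih: "I \<nu> \<in> add_hom (tgrp ?rT ?KK ?S) (tgrp T S N')" if "\<nu> \<in> car N" for \<nu>
  unfolding I_def by (rule C.lift_add_hom[OF ag bal[OF that]])
 have Ip: "I \<nu> (pure ?rT ?KK ?S x e) = pure T S N' x (h (e \<odot>\<^bsub>N\<^esub> \<nu>))"
  if "\<nu> \<in> car N" "x \<in> car ?rT" "e \<in> car ?S" for \<nu> x e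
  unfolding I_def by (rule C.lift_pure[OF ag bal[OF that(1)] that(2,3)])
 have sh: "s \<in> rmod_hom S T (right_cover K S T)" using s by (simp add: right_split_def)
 have sc: "s t \<in> car (tgrp ?rT ?KK ?S)" if "t \<in> car T" for t
  using rmod_homD(2)[OF sh that] by (simp add: right_cover_def)
 have sa: "s (t \<oplus>\<^bsub>T\<^esub> t') = s t \<oplus>\<^bsub>tgrp ?rT ?KK ?S\<^esub> s t'" if "t \<in> car T" "t' \<in> car T" for t t'
  using rmod_homD(3)[OF sh that] by (simp add: right_cover_def)
 note sr = rmod_homD(4)[OF sh, unfolded right_cover_def]
 have outer: "balanced T S N (tgrp T S N') (%t \<nu>. I \<nu> (s t))"
 proof (rule balancedI)
  fix t \<nu> assume a: "t \<in> car T" "\<nu> \<in> car N"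
  show "I \<nu> (s t) \<in> car (tgrp T S N')" by (rule add_hom_closed[OF Ih[OF a(2)] sc[OF a(1)]])
 next
  fix t t' \<nu> assume a: "t \<in> car T" "t' \<in> car T" "\<nu> \<in> car N"
  then show "I \<nu> (s (t \<oplus>\<^bsub>T\<^esub> t')) = I \<nu> (s t) \<oplus>\<^bsub>tgrp T S N'\<^esub> I \<nu> (s t')"
   by (simp add: sa add_hom_add[OF Ih] sc)
 next
  fix t \<nu> \<nu>' assume a: "t \<in> car T" "\<nu> \<in> car N" "\<nu>' \<in> car N"
  show "I (\<nu> \<oplus>\<^bsub>N\<^esub> \<nu>') (s t) = I \<nu> (s t) \<oplus>\<^bsub>tgrp T S N'\<^esub> I \<nu>' (s t)"
   unfolding I_def
   by (rule C.lift_param_add[OF sc[OF a(1)] ag bal bal bal])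
    (use a in "simp_all add: N.sc_radd add_hom_add[OF ha] add_hom_closed[OF ha] TN'.pure_add_right")
 next
  fix t e \<nu> assume a: "t \<in> car T" "e \<in> car S" "\<nu> \<in> car N"
  have e\<nu>: "e \<odot>\<^bsub>N\<^esub> \<nu> \<in> car N" using a by simp
  have "I \<nu> (rsmult (tbim ?rT ?KK ?S) u e) = I (e \<odot>\<^bsub>N\<^esub> \<nu>) u" if u: "u \<in> car (tgrp ?rT ?KK ?S)" for u
  proof (rule C.add_hom_eqI[OF add_hom_comp[OF tensor_rsmult_add_hom[OF Tb Sb a(2)] Ih[OF a(3)]] Ih[OF e\<nu>] _ u])
   fix x y assume xy: "x \<in> car ?rT" "y \<in> car ?S"
   show "I \<nu> (rsmult (tbim ?rT ?KK ?S) (pure ?rT ?KK ?S x y) e) = I (e \<odot>\<^bsub>N\<^esub> \<nu>) (pure ?rT ?KK ?S x y)"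
    using xy a Ip[OF e\<nu> xy] Ip[OF a(3) xy(1), of "y \<otimes>\<^bsub>S\<^esub> e"] N.sc_assoc[of y e \<nu>]
    by (simp add: tensor_rsmult_pure[OF Tb Sb a(2)])
  qed
  then show "I \<nu> (s (rsmult T t e)) = I (e \<odot>\<^bsub>N\<^esub> \<nu>) (s t)"
   using sr[OF a(1,2)] sc[OF a(1)] by simp
 qed
 show "H \<in> add_hom (tgrp T S N) (tgrp T S N')"
  unfolding H_def split_map_def by (rule TN.lift_add_hom[OF ag outer[unfolded I_def]])
 show "[|t \<in> car T; \<nu> \<in> car N|] ==> H (pure T S N t \<nu>) = I \<nu> (s t)"
  unfolding H_def split_map_def I_def by (rule TN.lift_pure[OF ag outer[unfolded I_def]])
qed

text \<open>
  The identity \<open>d h + h d = 1\<close> survives the passage from \<open>h\<close> to \<open>split_map\<close>, because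
  \<open>\<Sum> t\<^sub>i \<otimes> e\<^sub>i \<nu> = \<Sum> t\<^sub>i e\<^sub>i \<otimes> \<nu> = t \<otimes> \<nu>\<close>.
\<close>

lemma right_split_exact:
 assumes T: "bimodule K R S T" and s: "right_split K S T s"
  and N: "lmodule S N0" "lmodule S N1" "lmodule S N2"
  and d: "d0 \<in> lmod_hom S N0 N1" "d1 \<in> lmod_hom S N1 N2"
  and h1: "h1 \<in> klin K S N1 S N0" and h2: "h2 \<in> klin K S N2 S N1"
  and contr: "!!x. x \<in> car N1 ==> d0 (h1 x) \<oplus>\<^bsub>N1\<^esub> h2 (d1 x) = x"
  and w: "w \<in> car (tgrp T S N1)" "tmap T S N2 (%t. t) d1 w = \<zero>\<^bsub>tgrp T S N2\<^esub>"
 shows "\<exists>v\<in>car (tgrp T S N0). tmap T S N1 (%t. t) d0 v = w"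
proof -
 interpret T: bimodule K R S T by fact
 interpret N0: lmodule S N0 by fact
 interpret N1: lmodule S N1 by fact
 interpret N2: lmodule S N2 by fact
 let ?rT = "restrict_right S T" and ?KK = "reg K" and ?S = "restrict_left S (reg S)"
 interpret C: tensor_pair ?rT ?KK ?S by (rule right_pair[OF T])
 interpret T0: tensor_pair T S N0 by (rule tensor_pairI[OF T N(1)])
 interpret T1: tensor_pair T S N1 by (rule tensor_pairI[OF T N(2)])
 interpret T2: tensor_pair T S N2 by (rule tensor_pairI[OF T N(3)])
 note p1 = split_map_props[OF T s N(2,1) h1] and p2 = split_map_props[OF T s N(3,2) h2]
 note m0 = tensor_map_hom[OF T0.tensor_pair_axioms T1.tensor_pair_axioms rmod_hom_id d(1)]
  and m0p = tensor_map_pure[OF T0.tensor_pair_axioms T1.tensor_pair_axioms rmod_hom_id d(1)]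
 note m1 = tensor_map_hom[OF T1.tensor_pair_axioms T2.tensor_pair_axioms rmod_hom_id d(2)]
  and m1p = tensor_map_pure[OF T1.tensor_pair_axioms T2.tensor_pair_axioms rmod_hom_id d(2)]
 let ?H1 = "split_map K T S N0 s (%e \<nu>. h1 (e \<odot>\<^bsub>N1\<^esub> \<nu>))" and ?H2 = "split_map K T S N1 s (%e \<nu>. h2 (e \<odot>\<^bsub>N2\<^esub> \<nu>))"
 have sh: "s \<in> rmod_hom S T (right_cover K S T)" and sm: "!!t. t \<in> car T ==> lift T (rsmult T) (s t) = t"
  using s by (auto simp: right_split_def)
 have sc: "s t \<in> car (tgrp ?rT ?KK ?S)" if "t \<in> car T" for t
  using rmod_homD(2)[OF sh that] by (simp add: right_cover_def)
 note ag1 = T1.T.abg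
 have eq: "tmap T S N1 (%t. t) d0 (?H1 w) \<oplus>\<^bsub>tgrp T S N1\<^esub> ?H2 (tmap T S N2 (%t. t) d1 w) = w"
 proof (rule T1.add_hom_eqI[OF add_hom_plus[OF ag1 add_hom_comp[OF p1(1) m0] add_hom_comp[OF m1 p2(1)]] add_hom_id _ w(1)])
  fix t \<nu> assume t: "t \<in> car T" and \<nu>: "\<nu> \<in> car N1"
  have d\<nu>: "d1 \<nu> \<in> car N2" by (rule lmod_homD(2)[OF d(2) \<nu>])
  let ?I1 = "lift (tgrp T S N0) (%t' e. pure T S N0 t' (h1 (e \<odot>\<^bsub>N1\<^esub> \<nu>)))"
  let ?I2 = "lift (tgrp T S N1) (%t' e. pure T S N1 t' (h2 (e \<odot>\<^bsub>N2\<^esub> d1 \<nu>)))"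
  have "(%t. pure T S N1 t \<nu>) \<in> add_hom T (tgrp T S N1)"
   by (rule add_homI) (use \<nu> in "simp_all add: T1.pure_add_left")
  note ph = add_hom_comp[OF C.lift_add_hom[OF T.M.abg right_mu_balanced[OF T]] this]
  have "tmap T S N1 (%t. t) d0 (?I1 u) \<oplus>\<^bsub>tgrp T S N1\<^esub> ?I2 u = pure T S N1 (lift T (rsmult T) u) \<nu>"
   if u: "u \<in> car (tgrp ?rT ?KK ?S)" for u
  proof (rule C.add_hom_eqI[OF add_hom_plus[OF ag1 add_hom_comp[OF C.lift_add_hom[OF T0.T.abg p1(3)[OF \<nu>]] m0]
      C.lift_add_hom[OF ag1 p2(3)[OF d\<nu>]]] ph _ u])
   fix x e assume xe: "x \<in> car ?rT" "e \<in> car ?S"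
   have e\<nu>: "e \<odot>\<^bsub>N1\<^esub> \<nu> \<in> car N1" using xe \<nu> by simp
   have c: "d0 (h1 (e \<odot>\<^bsub>N1\<^esub> \<nu>)) \<in> car N1" "h2 (e \<odot>\<^bsub>N2\<^esub> d1 \<nu>) \<in> car N1" "h1 (e \<odot>\<^bsub>N1\<^esub> \<nu>) \<in> car N0"
    using e\<nu> d\<nu> xe add_hom_closed[OF klinD(1)[OF h1]] add_hom_closed[OF klinD(1)[OF h2]] lmod_homD(2)[OF d(1)] by simp_all
   have "pure T S N1 x (d0 (h1 (e \<odot>\<^bsub>N1\<^esub> \<nu>))) \<oplus>\<^bsub>tgrp T S N1\<^esub> pure T S N1 x (h2 (e \<odot>\<^bsub>N2\<^esub> d1 \<nu>)) =
     pure T S N1 x (e \<odot>\<^bsub>N1\<^esub> \<nu>)"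
    using contr[OF e\<nu>] lmod_homD(4)[OF d(2), of e \<nu>] xe \<nu> c T1.pure_add_right[of x "d0 (h1 (e \<odot>\<^bsub>N1\<^esub> \<nu>))" "h2 (e \<odot>\<^bsub>N2\<^esub> d1 \<nu>)"] by simp
   then show "tmap T S N1 (%t. t) d0 (?I1 (pure ?rT ?KK ?S x e)) \<oplus>\<^bsub>tgrp T S N1\<^esub> ?I2 (pure ?rT ?KK ?S x e) =
     pure T S N1 (lift T (rsmult T) (pure ?rT ?KK ?S x e)) \<nu>"
    unfolding C.lift_pure[OF T0.T.abg p1(3)[OF \<nu>] xe] C.lift_pure[OF ag1 p2(3)[OF d\<nu>] xe]
     C.lift_pure[OF T.M.abg right_mu_balanced[OF T] xe]
    using xe c \<nu> T1.pure_middle[of x e \<nu>] by (simp add: m0p)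
  qed
  then show "tmap T S N1 (%t. t) d0 (?H1 (pure T S N1 t \<nu>)) \<oplus>\<^bsub>tgrp T S N1\<^esub>
    ?H2 (tmap T S N2 (%t. t) d1 (pure T S N1 t \<nu>)) = pure T S N1 t \<nu>"
   unfolding m1p[OF t \<nu>] p1(2)[OF t \<nu>] p2(2)[OF t d\<nu>] using sc[OF t] sm[OF t] by simp
 qed
 have cl: "tmap T S N1 (%t. t) d0 (?H1 w) \<in> car (tgrp T S N1)"
  by (rule add_hom_closed[OF add_hom_comp[OF p1(1) m0] w(1)])
 have "?H2 \<zero>\<^bsub>tgrp T S N2\<^esub> = \<zero>\<^bsub>tgrp T S N1\<^esub>"
  by (rule add_hom_zero[OF T2.T.abg ag1 p2(1)])
 then have "tmap T S N1 (%t. t) d0 (?H1 w) = w"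
  using eq w(2) cl by simp
 then show ?thesis using add_hom_closed[OF p1(1) w(1)] by blast
qed

section \<open>Complexes and quasi-isomorphisms\<close>

lemma cpxD:
 assumes "cochain_complex R C"
 shows "lmodule R (obj C i)" "dif C i \<in> lmod_hom R (obj C i) (obj C (i + 1))"
  "x \<in> car (obj C i) ==> dif C (i + 1) (dif C i x) = \<zero>\<^bsub>obj C (i + 2)\<^esub>"
 using assms unfolding cochain_complex_def by blast+

lemma chain_mapD:
 assumes "chain_map R C D \<phi>"
 shows "\<phi> i \<in> lmod_hom R (obj C i) (obj D i)"
  "x \<in> car (obj C i) ==> \<phi> (i + 1) (dif C i x) = dif D i (\<phi> i x)"
 using assms unfolding chain_map_def by blast+

lemma coset_rules:
 assumes "abelian_group G" "B \<subseteq> car G" "\<zero>\<^bsub>G\<^esub> \<in> B" "!!x y. [|x \<in> B; y \<in> B|] ==> x \<oplus>\<^bsub>G\<^esub> y \<in> B" "!!x. x \<in> B ==> \<ominus>\<^bsub>G\<^esub> x \<in> B"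
  and x: "x \<in> car G"
 shows "a_r_coset G B x = {y \<in> car G. y \<ominus>\<^bsub>G\<^esub> x \<in> B}"
  and "y \<in> car G ==> a_r_coset G B x = a_r_coset G B y \<longleftrightarrow> x \<ominus>\<^bsub>G\<^esub> y \<in> B"
proof -
 interpret abelian_group G by fact
 have e: "a_r_coset G B x = {y \<in> car G. y \<ominus>\<^bsub>G\<^esub> x \<in> B}" if x: "x \<in> car G" for x
 proof (intro equalityI subsetI)
  fix y assume "y \<in> a_r_coset G B x"
  then obtain b where b: "b \<in> B" "y = b \<oplus>\<^bsub>G\<^esub> x" by (auto simp: a_r_coset_def')
  then have "y \<ominus>\<^bsub>G\<^esub> x = b" using assms(2) x by (auto simp: a_minus_def a_assoc r_neg)
  then show "y \<in> {y \<in> car G. y \<ominus>\<^bsub>G\<^esub> x \<in> B}" using b assms(2) x by auto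
 next
  fix y assume y: "y \<in> {y \<in> car G. y \<ominus>\<^bsub>G\<^esub> x \<in> B}"
  then have "y = (y \<ominus>\<^bsub>G\<^esub> x) \<oplus>\<^bsub>G\<^esub> x" using x by (auto simp: a_minus_def a_assoc l_neg)
  then show "y \<in> a_r_coset G B x" using y by (auto simp: a_r_coset_def')
 qed
 show "a_r_coset G B x = {y \<in> car G. y \<ominus>\<^bsub>G\<^esub> x \<in> B}" by (rule e[OF x])
 assume y: "y \<in> car G"
 show "a_r_coset G B x = a_r_coset G B y \<longleftrightarrow> x \<ominus>\<^bsub>G\<^esub> y \<in> B"
 proof
  assume "a_r_coset G B x = a_r_coset G B y"
  moreover have "x \<in> a_r_coset G B x" unfolding e[OF x] using x assms(3) by (auto simp: a_minus_def r_neg)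
  ultimately show "x \<ominus>\<^bsub>G\<^esub> y \<in> B" unfolding e[OF y] by simp
 next
  assume d: "x \<ominus>\<^bsub>G\<^esub> y \<in> B"
  have 1: "z \<ominus>\<^bsub>G\<^esub> y = (z \<ominus>\<^bsub>G\<^esub> x) \<oplus>\<^bsub>G\<^esub> (x \<ominus>\<^bsub>G\<^esub> y)" if "z \<in> car G" for z
   using that x y by (simp add: a_minus_def a_assoc r_neg2[symmetric]) (simp add: a_assoc[symmetric] l_neg)
  have 2: "z \<ominus>\<^bsub>G\<^esub> x = (z \<ominus>\<^bsub>G\<^esub> y) \<oplus>\<^bsub>G\<^esub> \<ominus>\<^bsub>G\<^esub> (x \<ominus>\<^bsub>G\<^esub> y)" if "z \<in> car G" for z
  proof -
   have "z \<ominus>\<^bsub>G\<^esub> y \<oplus>\<^bsub>G\<^esub> \<ominus>\<^bsub>G\<^esub> (x \<ominus>\<^bsub>G\<^esub> y) = z \<ominus>\<^bsub>G\<^esub> x \<oplus>\<^bsub>G\<^esub> ((x \<ominus>\<^bsub>G\<^esub> y) \<oplus>\<^bsub>G\<^esub> \<ominus>\<^bsub>G\<^esub> (x \<ominus>\<^bsub>G\<^esub> y))"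
    unfolding 1[OF that] using that x y by (simp add: a_assoc)
   then show ?thesis using that x y by (simp add: r_neg)
  qed
  have 3: "z \<ominus>\<^bsub>G\<^esub> y \<in> B" if "z \<in> car G" "z \<ominus>\<^bsub>G\<^esub> x \<in> B" for z
   unfolding 1[OF that(1)] by (rule assms(4)[OF that(2) d])
  have 4: "z \<ominus>\<^bsub>G\<^esub> x \<in> B" if "z \<in> car G" "z \<ominus>\<^bsub>G\<^esub> y \<in> B" for z
   unfolding 2[OF that(1)] by (rule assms(4)[OF that(2) assms(5)[OF d]])
  show "a_r_coset G B x = a_r_coset G B y"
   unfolding e[OF x] e[OF y] using 3 4 by blast
 qed
qed

lemma coboundaries_rules:
 assumes C: "cochain_complex R C"
 shows "bdry C i \<subseteq> car (obj C i)" "\<zero>\<^bsub>obj C i\<^esub> \<in> bdry C i"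
  "[|x \<in> bdry C i; y \<in> bdry C i|] ==> x \<oplus>\<^bsub>obj C i\<^esub> y \<in> bdry C i"
  "x \<in> bdry C i ==> \<ominus>\<^bsub>obj C i\<^esub> x \<in> bdry C i"
  "x \<in> bdry C i ==> x \<in> cocycles C i"
proof -
 interpret M: lmodule R "obj C (i - 1)" by (rule cpxD(1)[OF C])
 have d: "dif C (i - 1) \<in> lmod_hom R (obj C (i - 1)) (obj C i)"
  using cpxD(2)[OF C, of "i - 1"] by simp
 show "bdry C i \<subseteq> car (obj C i)"
  using lmod_homD(2)[OF d] by (auto simp: coboundaries_def)
 show "\<zero>\<^bsub>obj C i\<^esub> \<in> bdry C i"
  unfolding coboundaries_def
  by (rule image_eqI[of _ _ "\<zero>\<^bsub>obj C (i - 1)\<^esub>"]) (simp_all add: lmod_hom_zero[OF cpxD(1)[OF C] cpxD(1)[OF C] d])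
 show "[|x \<in> bdry C i; y \<in> bdry C i|] ==> x \<oplus>\<^bsub>obj C i\<^esub> y \<in> bdry C i"
  unfolding coboundaries_def by (clarsimp simp: lmod_homD(3)[OF d, symmetric])
 show "x \<in> bdry C i ==> \<ominus>\<^bsub>obj C i\<^esub> x \<in> bdry C i"
  unfolding coboundaries_def
  by (clarsimp simp: lmod_hom_neg[OF cpxD(1)[OF C] cpxD(1)[OF C] d, symmetric])
 show "x \<in> bdry C i ==> x \<in> cocycles C i"
  using cpxD(3)[OF C, of _ "i - 1"] lmod_homD(2)[OF d] by (auto simp: coboundaries_def cocycles_def add.commute)
qed

lemma cocycles_rules:
 assumes C: "cochain_complex R C"
 shows "cocycles C i \<subseteq> car (obj C i)" "\<zero>\<^bsub>obj C i\<^esub> \<in> cocycles C i"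
  "[|x \<in> cocycles C i; y \<in> cocycles C i|] ==> x \<oplus>\<^bsub>obj C i\<^esub> y \<in> cocycles C i"
  "x \<in> cocycles C i ==> \<ominus>\<^bsub>obj C i\<^esub> x \<in> cocycles C i"
proof -
 interpret M: lmodule R "obj C i" by (rule cpxD(1)[OF C])
 interpret N: lmodule R "obj C (i + 1)" by (rule cpxD(1)[OF C])
 note d = cpxD(2)[OF C, of i]
 show "cocycles C i \<subseteq> car (obj C i)" by (auto simp: cocycles_def)
 show "\<zero>\<^bsub>obj C i\<^esub> \<in> cocycles C i" by (simp add: cocycles_def lmod_hom_zero[OF M.lmodule_axioms N.lmodule_axioms d])
 show "[|x \<in> cocycles C i; y \<in> cocycles C i|] ==> x \<oplus>\<^bsub>obj C i\<^esub> y \<in> cocycles C i"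
  by (auto simp: cocycles_def lmod_homD(3)[OF d])
 show "x \<in> cocycles C i ==> \<ominus>\<^bsub>obj C i\<^esub> x \<in> cocycles C i"
  by (auto simp: cocycles_def lmod_hom_neg[OF M.lmodule_axioms N.lmodule_axioms d])
qed

lemma coboundary_coset:
 assumes C: "cochain_complex R C" and x: "x \<in> car (obj C i)" and y: "y \<in> car (obj C i)"
 shows "a_r_coset (obj C i) (bdry C i) x = a_r_coset (obj C i) (bdry C i) y \<longleftrightarrow>
  x \<ominus>\<^bsub>obj C i\<^esub> y \<in> bdry C i"
 by (rule coset_rules(2)[OF abelian_of_lmodule[OF cpxD(1)[OF C]] _ _ _ _ x y])
  (use coboundaries_rules[OF C] in blast)+

context
 fixes R :: "('r, 'x) ring_scheme" and C :: "(('r, 'm) module, 'm) cpx" and D :: "(('r, 'n) module, 'n) cpx" and \<phi>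
 assumes C: "cochain_complex R C" and D: "cochain_complex R D" and \<phi>: "chain_map R C D \<phi>"
begin

lemma Cag: "abelian_group (obj C i)" by (rule abelian_of_lmodule[OF cpxD(1)[OF C]])
lemma Dag: "abelian_group (obj D i)" by (rule abelian_of_lmodule[OF cpxD(1)[OF D]])

lemmas C_coset = coboundary_coset[OF C]
lemmas D_coset = coboundary_coset[OF D]

lemma chain_map_cocycle: "x \<in> cocycles C i ==> \<phi> i x \<in> cocycles D i"
 using chain_mapD(2)[OF \<phi>, of x i] lmod_homD(2)[OF chain_mapD(1)[OF \<phi>]]
  lmod_hom_zero[OF cpxD(1)[OF C] cpxD(1)[OF D] chain_mapD(1)[OF \<phi>], of "i + 1"]
 by (auto simp: cocycles_def)

lemma chain_map_coboundary:
 assumes "x \<in> bdry C i"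
 shows "\<phi> i x \<in> bdry D i"
proof -
 obtain z where z: "z \<in> car (obj C (i - 1))" "x = dif C (i - 1) z" using assms by (auto simp: coboundaries_def)
 have "\<phi> i x = dif D (i - 1) (\<phi> (i - 1) z)"
  using chain_mapD(2)[OF \<phi> z(1)] z(2) by simp
 then show ?thesis
  using lmod_homD(2)[OF chain_mapD(1)[OF \<phi>] z(1)] by (auto simp: coboundaries_def)
qed

lemma induced_coset:
 assumes x: "x \<in> car (obj C i)"
 shows "bdry D i <+>\<^bsub>obj D i\<^esub> \<phi> i ` a_r_coset (obj C i) (bdry C i) x = a_r_coset (obj D i) (bdry D i) (\<phi> i x)"
proof -
 interpret D: abelian_group "obj D i" by (rule Dag)
 note \<phi>i = chain_mapD(1)[OF \<phi>, of i]
 have \<phi>x: "\<phi> i x \<in> car (obj D i)" by (rule lmod_homD(2)[OF \<phi>i x])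
 have B: "b \<in> car (obj C i)" if "b \<in> bdry C i" for b using that coboundaries_rules(1)[OF C] by auto
 have BD: "b \<in> car (obj D i)" if "b \<in> bdry D i" for b using that coboundaries_rules(1)[OF D] by auto
 show ?thesis
 proof (intro equalityI subsetI)
  fix y assume "y \<in> bdry D i <+>\<^bsub>obj D i\<^esub> \<phi> i ` a_r_coset (obj C i) (bdry C i) x"
  then obtain b c where b: "b \<in> bdry D i" "c \<in> bdry C i" "y = b \<oplus>\<^bsub>obj D i\<^esub> \<phi> i (c \<oplus>\<^bsub>obj C i\<^esub> x)"
   by (auto simp: set_add_def' a_r_coset_def')
  have "\<phi> i c \<in> bdry D i" by (rule chain_map_coboundary[OF b(2)])
  moreover have "y = (b \<oplus>\<^bsub>obj D i\<^esub> \<phi> i c) \<oplus>\<^bsub>obj D i\<^esub> \<phi> i x"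
   using b B[OF b(2)] BD[OF b(1)] x \<phi>x lmod_homD(2)[OF \<phi>i] by (simp add: lmod_homD(3)[OF \<phi>i] D.a_assoc)
  ultimately show "y \<in> a_r_coset (obj D i) (bdry D i) (\<phi> i x)"
   using coboundaries_rules(3)[OF D b(1)] by (auto simp: a_r_coset_def')
 next
  fix y assume "y \<in> a_r_coset (obj D i) (bdry D i) (\<phi> i x)"
  then obtain b where b: "b \<in> bdry D i" "y = b \<oplus>\<^bsub>obj D i\<^esub> \<phi> i x" by (auto simp: a_r_coset_def')
  have "x \<in> a_r_coset (obj C i) (bdry C i) x"
   using coboundaries_rules(2)[OF C] x abelian_monoid.l_zero[OF abelian_group.axioms(1)[OF Cag] x]
   by (force simp: a_r_coset_def')
  then show "y \<in> bdry D i <+>\<^bsub>obj D i\<^esub> \<phi> i ` a_r_coset (obj C i) (bdry C i) x"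
   using b by (auto simp: set_add_def')
 qed
qed

text \<open>
  Injectivity and surjectivity on cohomology, in terms of representatives instead of cosets.
\<close>

lemma quasi_iso_iff:
 "quasi_iso R C D \<phi> \<longleftrightarrow>
  (\<forall>i. \<forall>x\<in>cocycles C i. \<phi> i x \<in> bdry D i --> x \<in> bdry C i) \<and>
  (\<forall>i. \<forall>y\<in>cocycles D i. \<exists>x\<in>cocycles C i. y \<ominus>\<^bsub>obj D i\<^esub> \<phi> i x \<in> bdry D i)" (is "_ \<longleftrightarrow> ?R")
proof -
 let ?f = "%i U. bdry D i <+>\<^bsub>obj D i\<^esub> \<phi> i ` U"
 have m0: "x \<ominus>\<^bsub>obj C i\<^esub> \<zero>\<^bsub>obj C i\<^esub> = x" if "x \<in> car (obj C i)" for x i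
 proof -
  interpret abelian_group "obj C i" by (rule Cag)
  show ?thesis using that by (simp add: a_minus_def)
 qed
 have m0D: "x \<ominus>\<^bsub>obj D i\<^esub> \<zero>\<^bsub>obj D i\<^esub> = x" if "x \<in> car (obj D i)" for x i
 proof -
  interpret abelian_group "obj D i" by (rule Dag)
  show ?thesis using that by (simp add: a_minus_def)
 qed
 have zc: "x \<in> car (obj C i)" if "x \<in> cocycles C i" for x i using that by (simp add: cocycles_def)
 have zd: "x \<in> car (obj D i)" if "x \<in> cocycles D i" for x i using that by (simp add: cocycles_def)
 have \<phi>c: "\<phi> i x \<in> car (obj D i)" if "x \<in> car (obj C i)" for x i by (rule lmod_homD(2)[OF chain_mapD(1)[OF \<phi>] that])
 have "(\<forall>i. bij_betw (?f i) (cohomology C i) (cohomology D i)) \<longleftrightarrow> ?R"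
 proof (intro iffI conjI allI ballI impI)
  fix i x assume b: "\<forall>i. bij_betw (?f i) (cohomology C i) (cohomology D i)" and x: "x \<in> cocycles C i" and \<phi>x: "\<phi> i x \<in> bdry D i"
  let ?c = "a_r_coset (obj C i) (bdry C i)"
  have z: "\<phi> i \<zero>\<^bsub>obj C i\<^esub> = \<zero>\<^bsub>obj D i\<^esub>"
   by (rule lmod_hom_zero[OF cpxD(1)[OF C] cpxD(1)[OF D] chain_mapD(1)[OF \<phi>]])
  have zz: "\<zero>\<^bsub>obj C i\<^esub> \<in> cocycles C i" by (rule cocycles_rules(2)[OF C])
  have "?f i (?c x) = ?f i (?c \<zero>\<^bsub>obj C i\<^esub>)"
   unfolding induced_coset[OF zc[OF x]] induced_coset[OF zc[OF zz]]
   using D_coset[OF \<phi>c[OF zc[OF x]] \<phi>c[OF zc[OF zz]]] \<phi>x m0D[OF \<phi>c[OF zc[OF x]]] z by simp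
  then have "?c x = ?c \<zero>\<^bsub>obj C i\<^esub>"
   using b x zz unfolding bij_betw_def inj_on_def cohomology_def by blast
  then show "x \<in> bdry C i"
   using C_coset[OF zc[OF x] zc[OF zz]] m0[OF zc[OF x]] by simp
 next
  fix i y assume b: "\<forall>i. bij_betw (?f i) (cohomology C i) (cohomology D i)" and y: "y \<in> cocycles D i"
  have "a_r_coset (obj D i) (bdry D i) y \<in> ?f i ` cohomology C i"
   using b y unfolding bij_betw_def cohomology_def by blast
  then obtain x where x: "x \<in> cocycles C i" "a_r_coset (obj D i) (bdry D i) y = ?f i (a_r_coset (obj C i) (bdry C i) x)"
   unfolding cohomology_def by blast
  then have "y \<ominus>\<^bsub>obj D i\<^esub> \<phi> i x \<in> bdry D i"
   using D_coset[OF zd[OF y] \<phi>c[OF zc[OF x(1)]]] induced_coset[OF zc[OF x(1)]] by simp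
  then show "\<exists>x\<in>cocycles C i. y \<ominus>\<^bsub>obj D i\<^esub> \<phi> i x \<in> bdry D i" using x(1) by blast
 next
  fix i assume r: ?R
  interpret Ci: lmodule R "obj C i" by (rule cpxD(1)[OF C])
  interpret Di: lmodule R "obj D i" by (rule cpxD(1)[OF D])
  show "bij_betw (?f i) (cohomology C i) (cohomology D i)"
   unfolding bij_betw_def
  proof
   show "inj_on (?f i) (cohomology C i)"
   proof (rule inj_onI)
    fix U V assume "U \<in> cohomology C i" "V \<in> cohomology C i" and e: "?f i U = ?f i V"
    then obtain x y where xy: "x \<in> cocycles C i" "U = a_r_coset (obj C i) (bdry C i) x"
     "y \<in> cocycles C i" "V = a_r_coset (obj C i) (bdry C i) y" by (auto simp: cohomology_def)
    note c = zc[OF xy(1)] zc[OF xy(3)]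
    have "\<phi> i x \<ominus>\<^bsub>obj D i\<^esub> \<phi> i y \<in> bdry D i"
     using e unfolding xy(2,4) induced_coset[OF c(1)] induced_coset[OF c(2)] D_coset[OF \<phi>c[OF c(1)] \<phi>c[OF c(2)]] .
    then have "\<phi> i (x \<ominus>\<^bsub>obj C i\<^esub> y) \<in> bdry D i"
     using add_hom_minus[OF Cag Dag lmod_homD(1)[OF chain_mapD(1)[OF \<phi>]] c] by simp
    moreover have "x \<ominus>\<^bsub>obj C i\<^esub> y \<in> cocycles C i"
     unfolding a_minus_def by (rule cocycles_rules(3)[OF C xy(1) cocycles_rules(4)[OF C xy(3)]])
    ultimately show "U = V" using r C_coset[OF c] xy by simp
   qed
   show "?f i ` cohomology C i = cohomology D i"
   proof (intro equalityI subsetI)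
    fix U assume "U \<in> ?f i ` cohomology C i"
    then obtain x where "x \<in> cocycles C i" "U = ?f i (a_r_coset (obj C i) (bdry C i) x)" by (auto simp: cohomology_def)
    then show "U \<in> cohomology D i" using induced_coset[OF zc] chain_map_cocycle by (auto simp: cohomology_def)
   next
    fix U assume "U \<in> cohomology D i"
    then obtain y where y: "y \<in> cocycles D i" "U = a_r_coset (obj D i) (bdry D i) y" by (auto simp: cohomology_def)
    then obtain x where x: "x \<in> cocycles C i" "y \<ominus>\<^bsub>obj D i\<^esub> \<phi> i x \<in> bdry D i" using r by blast
    have "U = ?f i (a_r_coset (obj C i) (bdry C i) x)"
     using x(2) D_coset[OF zd[OF y(1)] \<phi>c[OF zc[OF x(1)]]] induced_coset[OF zc[OF x(1)]] y(2) by simp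
    then show "U \<in> ?f i ` cohomology C i" using x(1) by (auto simp: cohomology_def)
   qed
  qed
 qed
 then show ?thesis unfolding quasi_iso_def using \<phi> by blast
qed

end

lemma quasi_isoD:
 assumes C: "cochain_complex R C" and D: "cochain_complex R D" and q: "quasi_iso R C D \<phi>"
 shows "chain_map R C D \<phi>"
  and "[|x \<in> cocycles C i; \<phi> i x \<in> bdry D i|] ==> x \<in> bdry C i"
  and "y \<in> cocycles D i ==> \<exists>x\<in>cocycles C i. y \<ominus>\<^bsub>obj D i\<^esub> \<phi> i x \<in> bdry D i"
proof -
 show m: "chain_map R C D \<phi>" using q by (simp add: quasi_iso_def)
 note i = q[unfolded quasi_iso_iff[OF C D m]]
 show "[|x \<in> cocycles C i; \<phi> i x \<in> bdry D i|] ==> x \<in> bdry C i" using i by blast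
 show "y \<in> cocycles D i ==> \<exists>x\<in>cocycles C i. y \<ominus>\<^bsub>obj D i\<^esub> \<phi> i x \<in> bdry D i" using i by blast
qed

lemma quasi_isoI:
 assumes "cochain_complex R C" "cochain_complex R D" "chain_map R C D \<phi>"
  and "!!i x. [|x \<in> cocycles C i; \<phi> i x \<in> bdry D i|] ==> x \<in> bdry C i"
  and "!!i y. y \<in> cocycles D i ==> \<exists>x\<in>cocycles C i. y \<ominus>\<^bsub>obj D i\<^esub> \<phi> i x \<in> bdry D i"
 shows "quasi_iso R C D \<phi>"
 unfolding quasi_iso_iff[OF assms(1-3)] using assms(4,5) by blast

lemma chain_map_id: "chain_map R C C (%i x. x)"
 by (simp add: chain_map_def lmod_hom_def)

lemma chain_map_comp:
 assumes "chain_map R C D \<phi>" "chain_map R D F \<psi>"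
 shows "chain_map R C F (%i. \<psi> i \<circ> \<phi> i)"
 using chain_mapD(2)[OF assms(1)] chain_mapD(2)[OF assms(2)] lmod_homD(2)[OF chain_mapD(1)[OF assms(1)]]
  lmod_hom_comp[OF chain_mapD(1)[OF assms(1)] chain_mapD(1)[OF assms(2)]]
 by (auto simp: chain_map_def comp_def)

lemma quasi_iso_id: "cochain_complex R C ==> quasi_iso R C C (%i x. x)"
proof (rule quasi_isoI)
 fix i y assume C: "cochain_complex R C" and y: "y \<in> cocycles C i"
 interpret lmodule R "obj C i" by (rule cpxD(1)[OF C])
 have "y \<ominus>\<^bsub>obj C i\<^esub> y \<in> bdry C i"
  using y coboundaries_rules(2)[OF C] by (simp add: a_minus_def M.r_neg cocycles_def)
 then show "\<exists>x\<in>cocycles C i. y \<ominus>\<^bsub>obj C i\<^esub> x \<in> bdry C i" using y by blast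
qed (simp_all add: chain_map_id)

lemma quasi_iso_comp:
 assumes C: "cochain_complex R C" and D: "cochain_complex R D" and F: "cochain_complex R F"
  and q: "quasi_iso R C D \<phi>" "quasi_iso R D F \<psi>"
 shows "quasi_iso R C F (%i. \<psi> i \<circ> \<phi> i)"
proof (rule quasi_isoI[OF C F chain_map_comp[OF quasi_isoD(1)[OF C D q(1)] quasi_isoD(1)[OF D F q(2)]]])
 note m1 = quasi_isoD(1)[OF C D q(1)] and m2 = quasi_isoD(1)[OF D F q(2)]
 fix i x assume "x \<in> cocycles C i" "(\<psi> i \<circ> \<phi> i) x \<in> bdry F i"
 then show "x \<in> bdry C i"
  using quasi_isoD(2)[OF C D q(1)] quasi_isoD(2)[OF D F q(2)] chain_map_cocycle[OF C D m1] by simp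
next
 note m1 = quasi_isoD(1)[OF C D q(1)] and m2 = quasi_isoD(1)[OF D F q(2)]
 fix i z assume z: "z \<in> cocycles F i"
 interpret Fi: lmodule R "obj F i" by (rule cpxD(1)[OF F])
 interpret Di: lmodule R "obj D i" by (rule cpxD(1)[OF D])
 obtain y where y: "y \<in> cocycles D i" "z \<ominus>\<^bsub>obj F i\<^esub> \<psi> i y \<in> bdry F i" using quasi_isoD(3)[OF D F q(2) z] by blast
 obtain x where x: "x \<in> cocycles C i" "y \<ominus>\<^bsub>obj D i\<^esub> \<phi> i x \<in> bdry D i" using quasi_isoD(3)[OF C D q(1) y(1)] by blast
 have \<phi>x: "\<phi> i x \<in> car (obj D i)" and yc: "y \<in> car (obj D i)" and zc: "z \<in> car (obj F i)"
  using x(1) y(1) z lmod_homD(2)[OF chain_mapD(1)[OF m1]] by (auto simp: cocycles_def)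
 note c = lmod_homD(2)[OF chain_mapD(1)[OF m2] \<phi>x] lmod_homD(2)[OF chain_mapD(1)[OF m2] yc]
 have "\<psi> i y \<ominus>\<^bsub>obj F i\<^esub> \<psi> i (\<phi> i x) \<in> bdry F i"
  using chain_map_coboundary[OF D F m2 x(2)]
   add_hom_minus[OF Di.M.abg Fi.M.abg lmod_homD(1)[OF chain_mapD(1)[OF m2]] yc \<phi>x] by simp
 from coboundaries_rules(3)[OF F y(2) this]
 have "z \<ominus>\<^bsub>obj F i\<^esub> \<psi> i (\<phi> i x) \<in> bdry F i"
  using c zc by (simp add: a_minus_def Fi.M.a_assoc Fi.M.r_neg1)
 then show "\<exists>x\<in>cocycles C i. z \<ominus>\<^bsub>obj F i\<^esub> (\<psi> i \<circ> \<phi> i) x \<in> bdry F i" using x(1) by auto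
qed

lemma homotopic_refl:
 assumes C: "cochain_complex R C" and D: "cochain_complex R D" and \<phi>: "chain_map R C D \<phi>"
 shows "homotopic R C D \<phi> \<phi>"
 unfolding homotopic_def
proof (intro exI conjI allI ballI)
 fix i
 interpret Di: lmodule R "obj D i" by (rule cpxD(1)[OF D])
 interpret Di1: lmodule R "obj D (i - 1)" by (rule cpxD(1)[OF D])
 show "(%_. \<zero>\<^bsub>obj D (i - 1)\<^esub>) \<in> lmod_hom R (obj C i) (obj D (i - 1))"
  by (rule lmod_hom_const_zero[OF Di1.lmodule_axioms])
 fix x assume "x \<in> car (obj C i)"
 then have "\<phi> i x \<in> car (obj D i)" by (rule lmod_homD(2)[OF chain_mapD(1)[OF \<phi>]])
 moreover have "dif D (i - 1) \<zero>\<^bsub>obj D (i - 1)\<^esub> = \<zero>\<^bsub>obj D i\<^esub>"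
  using lmod_hom_zero[OF cpxD(1)[OF D] cpxD(1)[OF D] cpxD(2)[OF D, of "i - 1"]] by simp
 ultimately show "\<phi> i x \<ominus>\<^bsub>obj D i\<^esub> \<phi> i x = dif D (i - 1) \<zero>\<^bsub>obj D (i - 1)\<^esub> \<oplus>\<^bsub>obj D i\<^esub> \<zero>\<^bsub>obj D (i + 1 - 1)\<^esub>"
  by (simp add: a_minus_def Di.M.r_neg)
qed

text \<open>
  Transport along injections of the finite-dimensional terms.
\<close>

lemma univ_copy:
 fixes A :: "('k, 'a) module" and C :: "(('a, 'm) module, 'm) cpx"
 assumes A: "k_algebra K A" "kfin K A (reg A)" and C: "C \<in> Db A"
 shows "\<exists>(Z :: ('k, 'a) ucpx) s. Z \<in> Db A \<and> quasi_iso A Z C s"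
proof -
 have cc: "cochain_complex A C" and fg: "!!i. fin_gen A (obj C i)"
  and bd: "\<exists>N. \<forall>i. \<bar>i\<bar> > N --> car (obj C i) = {\<zero>\<^bsub>obj C i\<^esub>}"
  using C unfolding Db_def by auto
 note M = cpxD(1)[OF cc] and d = cpxD(2)[OF cc]
 have kf: "kfin K A (obj C i)" for i by (rule kfin_of_fin_gen[OF A M fg])
 have "\<forall>i. \<exists>j :: 'm => 'k univ. inj_on j (car (obj C i))"
  using kfin_inj_univ[OF A(1) M kf] by blast
 then obtain j :: "int => 'm => 'k univ" where j: "!!i. inj_on (j i) (car (obj C i))" by metis
 define s where "s i = inv_into (car (obj C i)) (j i)" for i
 define Z :: "('k, 'a) ucpx" where "Z = \<lparr>obj = (%i. transport_module (j i) (obj C i)), dif = (%i x. j (i + 1) (dif C i (s i x)))\<rparr>"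
 note t = transport_lmodule[OF M j]
 have sj: "s i (j i x) = x" if "x \<in> car (obj C i)" for i x unfolding s_def by (rule inv_into_f_f[OF j that])
 have sc: "s i x \<in> car (obj C i)" if "x \<in> car (obj Z i)" for i x
  using lmod_homD(2)[OF t(3)] that unfolding s_def Z_def by simp
 have js: "j i (s i x) = x" if "x \<in> car (obj Z i)" for i x
  using that sj by (auto simp: Z_def transport_module_simps)
 have jz: "j i x \<in> car (obj Z i)" if "x \<in> car (obj C i)" for i x
  using that by (simp add: Z_def transport_module_simps)
 have Zm: "lmodule A (obj Z i)" for i using t(1) by (simp add: Z_def)
 have ds: "s (i + 1) (dif Z i x) = dif C i (s i x)" if "x \<in> car (obj Z i)" for i x
  using sj[of "dif C i (s i x)" "i + 1"] lmod_homD(2)[OF d sc[OF that]] by (simp add: Z_def)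
 have z: "j i \<zero>\<^bsub>obj C i\<^esub> = \<zero>\<^bsub>obj Z i\<^esub>" for i by (simp add: Z_def transport_module_simps)
 have dZ: "dif Z i \<in> lmod_hom A (obj Z i) (obj Z (i + 1))" for i
  using lmod_hom_comp[OF lmod_hom_comp[OF t(3) d] t(2)] by (simp add: Z_def s_def)
 have Zc: "cochain_complex A Z"
  unfolding cochain_complex_def
 proof (intro allI conjI ballI Zm dZ)
  fix i x assume x: "x \<in> car (obj Z i)"
  have "dif Z (i + 1) (dif Z i x) = j (i + 1 + 1) (dif C (i + 1) (s (i + 1) (dif Z i x)))" by (simp add: Z_def)
  also have "\<dots> = j (i + 2) \<zero>\<^bsub>obj C (i + 2)\<^esub>" unfolding ds[OF x] using cpxD(3)[OF cc sc[OF x]] by (simp add: add.commute)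
  finally show "dif Z (i + 1) (dif Z i x) = \<zero>\<^bsub>obj Z (i + 2)\<^esub>" using z by simp
 qed
 have kfZ: "kfin K A (obj Z i)" for i
  using kfin_lmod_image[OF A(1) M t(1,2) _ kf] by (simp add: Z_def transport_module_simps)
 obtain N where N: "!!i. \<bar>i\<bar> > N ==> car (obj C i) = {\<zero>\<^bsub>obj C i\<^esub>}" using bd by blast
 have ZD: "Z \<in> Db A"
  unfolding Db_def using Zc kfin_imp_fin_gen[OF A(1) kfZ] N by (auto simp: Z_def transport_module_simps intro!: exI[of _ N])
 have sm: "chain_map A Z C s"
  unfolding chain_map_def using t(3) ds by (auto simp: Z_def s_def)
 have "quasi_iso A Z C s"
 proof (rule quasi_isoI[OF Zc cc sm])
  fix i x assume x: "x \<in> cocycles Z i" and sx: "s i x \<in> bdry C i"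
  have xc: "x \<in> car (obj Z i)" using x by (simp add: cocycles_def)
  obtain y where y: "y \<in> car (obj C (i - 1))" "s i x = dif C (i - 1) y" using sx by (auto simp: coboundaries_def)
  have "x = dif Z (i - 1) (j (i - 1) y)"
   using js[OF xc] y sj[OF y(1)] by (simp add: Z_def)
  then show "x \<in> bdry Z i" using jz[OF y(1)] by (auto simp: coboundaries_def)
 next
  fix i y assume y: "y \<in> cocycles C i"
  interpret lmodule A "obj C i" by (rule M)
  have yc: "y \<in> car (obj C i)" using y by (simp add: cocycles_def)
  have "dif Z i (j i y) = \<zero>\<^bsub>obj Z (i + 1)\<^esub>" using y sj[OF yc] z[of "i + 1"] by (simp add: cocycles_def Z_def)
  then have "j i y \<in> cocycles Z i" using jz[OF yc] by (simp add: cocycles_def)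
  moreover have "y \<ominus>\<^bsub>obj C i\<^esub> s i (j i y) \<in> bdry C i"
   using sj[OF yc] yc coboundaries_rules(2)[OF cc] by (simp add: a_minus_def M.r_neg)
  ultimately show "\<exists>x\<in>cocycles Z i. y \<ominus>\<^bsub>obj C i\<^esub> s i x \<in> bdry C i" by blast
 qed
 then show ?thesis using ZD by blast
qed

text \<open>
  The roofs \<open>L \<leftarrow> Z \<rightarrow> M\<close> and \<open>M \<leftarrow> Z \<rightarrow> L\<close> are mutually inverse; the apex is first replaced by a copy in
  the universal type.
\<close>

lemma Db_iso_of_quasi_isos:
 fixes A :: "('k, 'a) module"
 assumes A: "k_algebra K A" "kfin K A (reg A)" and Z: "Z \<in> Db A" and L: "L \<in> Db A" and M: "M \<in> Db A"
  and a: "quasi_iso A Z L a" and b: "quasi_iso A Z M b"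
 shows "Db_iso A L M"
proof -
 obtain W :: "('k, 'a) ucpx" and s where W: "W \<in> Db A" and s: "quasi_iso A W Z s" using univ_copy[OF A Z] by blast
 have cc: "cochain_complex A Z" "cochain_complex A L" "cochain_complex A M" "cochain_complex A W"
  using Z L M W by (auto simp: Db_def)
 define f where "f = (%i. a i \<circ> s i)"
 define g where "g = (%i. b i \<circ> s i)"
 have f: "quasi_iso A W L f" unfolding f_def by (rule quasi_iso_comp[OF cc(4,1,2) s a])
 have g: "quasi_iso A W M g" unfolding g_def by (rule quasi_iso_comp[OF cc(4,1,3) s b])
 note fm = quasi_isoD(1)[OF cc(4,2) f] and gm = quasi_isoD(1)[OF cc(4,3) g]
 have id: "(%i. (u :: int => 'k univ => 'z) i \<circ> (%i x. x) i) = u" for u by (simp add: comp_def)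
 have r: "(W, f, g) \<in> roofs A L M" "(W, g, f) \<in> roofs A M L"
  using W f g fm gm by (auto simp: roofs_def)
 have c1: "roof_comp A M (W, f, g) (W, g, f) (W, f, f)"
  unfolding roof_comp_def prod.case
  by (intro exI[of _ W] exI[of _ "%i x. x"])
   (simp add: W quasi_iso_id[OF cc(4)] chain_map_id comp_def homotopic_refl[OF cc(4,3) gm])
 have c2: "roof_comp A L (W, g, f) (W, f, g) (W, g, g)"
  unfolding roof_comp_def prod.case
  by (intro exI[of _ W] exI[of _ "%i x. x"])
   (simp add: W quasi_iso_id[OF cc(4)] chain_map_id comp_def homotopic_refl[OF cc(4,2) fm])
 have i1: "roof_is_id A L (W, f, f)"
  unfolding roof_is_id_def roof_equiv_def prod.case
  by (intro exI[of _ W] exI[of _ "%i x. x"])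
   (simp add: W f chain_map_id comp_def homotopic_refl[OF cc(4,2) fm])
 have i2: "roof_is_id A M (W, g, g)"
  unfolding roof_is_id_def roof_equiv_def prod.case
  by (intro exI[of _ W] exI[of _ "%i x. x"])
   (simp add: W g chain_map_id comp_def homotopic_refl[OF cc(4,3) gm])
 show ?thesis
  unfolding Db_iso_def using L M r c1 c2 i1 i2 by blast
qed

lemma stalk_simps:
 "obj (stalk M) 0 = M" "i \<noteq> 0 ==> car (obj (stalk M) i) = {\<zero>\<^bsub>M\<^esub>}" "\<zero>\<^bsub>obj (stalk M) i\<^esub> = \<zero>\<^bsub>M\<^esub>"
 "dif (stalk M) i x = \<zero>\<^bsub>M\<^esub>"
 by (auto simp: stalk_def)

lemma stalk_lmodule: "lmodule A M ==> lmodule A (obj (stalk M) i)"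
 using lmodule_zero_carrier[of A M] by (simp add: stalk_def)

lemma stalk_Db:
 fixes M :: "('a, 'm) module"
 assumes A: "k_algebra K A" and M: "lmodule A M" "kfin K A M"
 shows "stalk M \<in> Db A"
proof -
 have z: "(%_. \<zero>\<^bsub>M\<^esub>) \<in> lmod_hom A (obj (stalk M) i) (obj (stalk M) j)" for i j
  using lmod_hom_const_zero[OF stalk_lmodule[OF M(1), of j], of "obj (stalk M) i"] by (simp add: stalk_simps)
 have c: "cochain_complex A (stalk M)"
  unfolding cochain_complex_def using stalk_lmodule[OF M(1)] z by (auto simp: stalk_simps) (auto simp: stalk_def)
 have "kfin K A (obj (stalk M) i)" for i
  by (cases "i = 0") (use M(2) in "auto simp: stalk_simps intro!: kfin_zero_carrier")
 then show ?thesis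
  unfolding Db_def using c kfin_imp_fin_gen[OF A] by (auto simp: stalk_simps intro!: exI[of _ 0])
qed

lemma tensor_map_comp:
 assumes "tensor_pair M S N" "tensor_pair M' S N'" "tensor_pair M'' S N''"
  and f: "f \<in> rmod_hom S M M'" "f' \<in> rmod_hom S M' M''" and g: "g \<in> lmod_hom S N N'" "g' \<in> lmod_hom S N' N''"
  and h: "h \<in> rmod_hom S M M''" "k \<in> lmod_hom S N N''"
  and eq: "!!x. x \<in> car M ==> f' (f x) = h x" "!!y. y \<in> car N ==> g' (g y) = k y"
  and u: "u \<in> car (tgrp M S N)"
 shows "tmap M'' S N'' f' g' (tmap M' S N' f g u) = tmap M'' S N'' h k u"
proof -
 interpret tensor_pair M S N by fact
 show ?thesis
  by (rule add_hom_eqI[OF add_hom_comp[OF tensor_map_hom[OF assms(1,2) f(1) g(1)] tensor_map_hom[OF assms(2,3) f(2) g(2)]]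
     tensor_map_hom[OF assms(1,3) h] _ u])
   (simp add: tensor_map_pure[OF assms(1,2) f(1) g(1)] tensor_map_pure[OF assms(2,3) f(2) g(2)] tensor_map_pure[OF assms(1,3) h]
    rmod_homD(2)[OF f(1)] lmod_homD(2)[OF g(1)] eq)
qed

lemma tensor_map_id:
 assumes "tensor_pair M S N" "f \<in> rmod_hom S M M" "g \<in> lmod_hom S N N"
  and "!!x. x \<in> car M ==> f x = x" "!!y. y \<in> car N ==> g y = y" "u \<in> car (tgrp M S N)"
 shows "tmap M S N f g u = u"
proof -
 interpret tensor_pair M S N by fact
 show ?thesis
  by (rule add_hom_eqI[OF tensor_map_hom[OF assms(1,1,2,3)] add_hom_id _ assms(6)])
   (simp add: tensor_map_pure[OF assms(1,1,2,3)] assms(4,5))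
qed

lemma shift_cochain_complex:
 assumes C: "cochain_complex R C"
 shows "cochain_complex R (shift n C)"
proof -
 have d: "dif C (i + n) \<in> lmod_hom R (obj C (i + n)) (obj C (i + 1 + n))" for i
  using cpxD(2)[OF C, of "i + n"] by (simp add: add.commute add.left_commute)
 have M: "lmodule R (obj C i)" for i by (rule cpxD(1)[OF C])
 have e: "obj C (i + n + 1) = obj C (i + 1 + n)" for i by (simp add: add.commute add.left_commute)
 show ?thesis
  unfolding cochain_complex_def
 proof (intro allI conjI ballI)
  fix i
  show "lmodule R (obj (shift n C) i)" using M by (simp add: shift_def)
  show "dif (shift n C) i \<in> lmod_hom R (obj (shift n C) i) (obj (shift n C) (i + 1))"
   using d[of i] lmod_hom_uminus[OF M d[of i]] by (cases "even n") (simp_all add: shift_def e)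
  fix x assume x: "x \<in> car (obj (shift n C) i)"
  have x': "x \<in> car (obj C (i + n))" using x by (simp add: shift_def)
  have i1: "i + 1 + n = i + n + 1" "i + 2 + n = i + n + 1 + 1" by simp_all
  have dx: "dif C (i + n) x \<in> car (obj C (i + n + 1))" by (rule lmod_homD(2)[OF cpxD(2)[OF C] x'])
  have dd: "dif C (i + n + 1) (dif C (i + n) x) = \<zero>\<^bsub>obj C (i + n + 1 + 1)\<^esub>"
   using cpxD(3)[OF C x'] by (simp add: add.assoc)
  have dn: "dif C (i + n + 1) (\<ominus>\<^bsub>obj C (i + n + 1)\<^esub> dif C (i + n) x) = \<ominus>\<^bsub>obj C (i + n + 1 + 1)\<^esub> \<zero>\<^bsub>obj C (i + n + 1 + 1)\<^esub>"
   using lmod_hom_neg[OF M M cpxD(2)[OF C] dx] dd by simp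
  show "dif (shift n C) (i + 1) (dif (shift n C) i x) = \<zero>\<^bsub>obj (shift n C) (i + 2)\<^esub>"
   unfolding shift_def cpx.simps i1 using dd dn by (simp add: abelian_group.a_inv_zero[OF abelian_of_lmodule[OF M]])
 qed
qed

context projective_setup
begin

lemma Hom_lmodule: "lmodule A L ==> lmodule E (Hom A P L)"
 by (rule lmodule_Hom[OF A Pm])

lemma hom_a_natural_right:
 fixes L :: "('a, 'l) module" and L' :: "('a, 'l2) module"
 assumes T: "bimodule K A E T" and L: "lmodule A L" "lmodule A L'" and d: "d \<in> lmod_hom A L L'"
  and w: "w \<in> car (tgrp (tbim T E Pd) A L)"
 shows "hom_a T L' (tmap (tbim T E Pd) A L' (%x. x) d w) =
  tmap T E (Hom A P L') (%x. x) (push d) (hom_a T L w)"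
proof -
 let ?S = "tbim T E Pd"
 have S: "bimodule K A A ?S" by (rule bimodule_tensor[OF T Pd.bm])
 note SL = tensor_pairI[OF S L(1)] and SL' = tensor_pairI[OF S L(2)]
  and TH = tensor_pairI[OF T Hom_lmodule[OF L(1)]] and TH' = tensor_pairI[OF T Hom_lmodule[OF L(2)]]
 interpret TP: tensor_pair T E Pd by (rule tensor_pairI[OF T Pd.lmod])
 note m1 = tensor_map_hom[OF SL SL' rmod_hom_id d] and p1 = tensor_map_pure[OF SL SL' rmod_hom_id d]
 note m2 = tensor_map_hom[OF TH TH' rmod_hom_id push_hom[OF d]] and p2 = tensor_map_pure[OF TH TH' rmod_hom_id push_hom[OF d]]
 show ?thesis
 proof (rule triple_eqI[OF T L(1) add_hom_comp[OF m1 hom_a_hom[OF T L(2)]] add_hom_comp[OF hom_a_hom[OF T L(1)] m2] _ w])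
  fix t \<phi> l assume h: "t \<in> car T" "\<phi> \<in> car Pd" "l \<in> car L"
  show "hom_a T L' (tmap ?S A L' (%x. x) d (pure ?S A L (pure T E Pd t \<phi>) l)) =
   tmap T E (Hom A P L') (%x. x) (push d) (hom_a T L (pure ?S A L (pure T E Pd t \<phi>) l))"
   using h br_closed[OF L(1) h(2,3)] lmod_homD(2)[OF d h(3)] push_br[OF d h(2,3)]
   by (simp add: p1 p2 hom_a_pure[OF T L(1) h] hom_a_pure[OF T L(2) h(1,2)])
 qed
qed

lemma hom_b_natural_right:
 fixes L :: "('a, 'l) module" and L' :: "('a, 'l2) module"
 assumes T: "bimodule K A E T" and L: "lmodule A L" "lmodule A L'" and d: "d \<in> lmod_hom A L L'"
  and v: "v \<in> car (tgrp T E (Hom A P L))"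
 shows "hom_b T L' (tmap T E (Hom A P L') (%x. x) (push d) v) =
  tmap (tbim T E Pd) A L' (%x. x) d (hom_b T L v)"
proof -
 let ?S = "tbim T E Pd"
 have S: "bimodule K A A ?S" by (rule bimodule_tensor[OF T Pd.bm])
 note SL = tensor_pairI[OF S L(1)] and SL' = tensor_pairI[OF S L(2)]
 have bv: "hom_b T L v \<in> car (tgrp ?S A L)" by (rule add_hom_closed[OF hom_b_hom[OF T L(1)] v])
 have c: "tmap ?S A L' (%x. x) d (hom_b T L v) \<in> car (tgrp ?S A L')"
  by (rule add_hom_closed[OF tensor_map_hom[OF SL SL' rmod_hom_id d] bv])
 show ?thesis
  using hom_a_natural_right[OF T L d bv] hom_ab[OF T L(1) v] hom_ba[OF T L(2) c] by simp
qed



section \<open>Consequences of orthogonality\<close>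

text \<open>
  A cocycle \<open>\<psi>\<close> of \<open>Hom\<^sub>A(P, L)\<close> is a chain map from the stalk complex of \<open>P\<close> to a shift of \<open>L\<close>. By orthogonality
  its composite with some quasi-isomorphism from a complex \<open>W\<close> to \<open>P\<close> is null-homotopic. As \<open>P\<close> is projective,
  it lifts to the cocycles of \<open>W\<close> in degree zero, and the homotopy composed with that lift is a preimage of \<open>\<psi>\<close>,
  up to the sign in the differential of the shift.
\<close>

lemma perp_exact:
 fixes L :: "(('a, 'l) module, 'l) cpx"
 assumes L: "L \<in> perp A P" and \<psi>: "\<psi> \<in> car (Hom A P (obj L i))"
  and z: "!!p. p \<in> car P ==> dif L i (\<psi> p) = \<zero>\<^bsub>obj L (i + 1)\<^esub>"
 shows "\<exists>\<chi>\<in>car (Hom A P (obj L (i - 1))). \<forall>p\<in>car P. dif L (i - 1) (\<chi> p) = \<psi> p"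
proof -
 have cL: "cochain_complex A L" using L by (simp add: perp_def Db_def)
 note cS = shift_cochain_complex[OF cL, of i]
 have sP: "stalk P \<in> Db A" by (rule stalk_Db[OF A Pm finP])
 then have csP: "cochain_complex A (stalk P)" by (simp add: Db_def)
 obtain Z :: "('k, 'a) ucpx" and s where Z: "Z \<in> Db A" and s: "quasi_iso A Z (stalk P) s"
  using univ_copy[OF A finA sP] by blast
 have cZ: "cochain_complex A Z" using Z by (simp add: Db_def)
 note sm = quasi_isoD(1)[OF cZ csP s]
 let ?D = "shift i L"
 define f where "f k = (%x. if k = 0 then \<psi> (s 0 x) else \<zero>\<^bsub>obj ?D k\<^esub>)" for k :: int
 have o0: "obj ?D 0 = obj L i" by (simp add: shift_def)
 have s0: "s 0 \<in> lmod_hom A (obj Z 0) P" using chain_mapD(1)[OF sm, of 0] by (simp add: stalk_simps)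
 have dz: "dif ?D k \<zero>\<^bsub>obj ?D k\<^esub> = \<zero>\<^bsub>obj ?D (k + 1)\<^esub>" for k
  by (rule lmod_hom_zero[OF cpxD(1)[OF cS] cpxD(1)[OF cS] cpxD(2)[OF cS]])
 have \<psi>0: "\<psi> \<zero>\<^bsub>P\<^esub> = \<zero>\<^bsub>obj L i\<^esub>"
  using lmod_hom_zero[OF Pm cpxD(1)[OF cL]] \<psi> by (simp add: Hom_mem)
 have d0: "dif ?D 0 (\<psi> p) = \<zero>\<^bsub>obj ?D 1\<^esub>" if "p \<in> car P" for p
  using z[OF that] abelian_group.a_inv_zero[OF abelian_of_lmodule[OF cpxD(1)[OF cL]]]
  by (simp add: shift_def add.commute)
 have fm: "chain_map A Z ?D f"
  unfolding chain_map_def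
 proof (intro allI conjI ballI)
  fix k
  show "f k \<in> lmod_hom A (obj Z k) (obj ?D k)"
  proof (cases "k = 0")
   case True
   then show ?thesis
    using lmod_hom_comp[OF s0, of \<psi> "obj L i"] \<psi> by (simp add: f_def o0 Hom_mem)
  next
   case False
   then show ?thesis using lmod_hom_const_zero[OF cpxD(1)[OF cS]] by (simp add: f_def)
  qed
  fix x assume x: "x \<in> car (obj Z k)"
  consider "k = 0" | "k = - 1" | "k \<noteq> 0" "k + 1 \<noteq> 0" by linarith
  then show "f (k + 1) (dif Z k x) = dif ?D k (f k x)"
  proof cases
   case 1
   then show ?thesis using d0[OF lmod_homD(2)[OF s0]] x by (simp add: f_def)
  next
   case 2
   have "s 0 (dif Z k x) = \<zero>\<^bsub>P\<^esub>"
    using chain_mapD(2)[OF sm x] 2 by (simp add: stalk_simps)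
   then show ?thesis using 2 dz[of k] \<psi>0 by (simp add: f_def o0)
  next
   case 3
   then show ?thesis using dz[of k] by (simp add: f_def)
  qed
 qed
 have "(Z, s, f) \<in> roofs A (stalk P) ?D" using Z s fm by (simp add: roofs_def)
 then have "roof_is_zero A (stalk P) ?D (Z, s, f)" using L unfolding perp_def by blast
 then obtain W :: "('k, 'a) ucpx" and t t' :: "int => 'k univ => 'k univ" where W: "W \<in> Db A" and t: "chain_map A W Z t"
  and q: "quasi_iso A W (stalk P) (%i. s i \<circ> t i)"
  and ho: "homotopic A W ?D (%i. f i \<circ> t i) (%i. (%_. \<zero>\<^bsub>obj ?D i\<^esub>) \<circ> t' i)"
  unfolding roof_is_zero_def roof_equiv_def by auto
 have cW: "cochain_complex A W" using W by (simp add: Db_def)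
 interpret W0: lmodule A "obj W 0" by (rule cpxD(1)[OF cW])
 interpret W1: lmodule A "obj W 1" by (rule cpxD(1)[OF cW])
 have dW: "dif W 0 \<in> lmod_hom A (obj W 0) (obj W 1)" using cpxD(2)[OF cW, of 0] by simp
 let ?st = "%x. s 0 (t 0 x)"
 have st: "?st \<in> lmod_hom A (obj W 0) P"
  by (rule lmod_hom_comp[OF chain_mapD(1)[OF t] s0])
 have surj: "\<exists>x\<in>car (obj W 0). dif W 0 x = \<zero>\<^bsub>obj W 1\<^esub> \<and> ?st x = p" if p: "p \<in> car P" for p
 proof -
  have "p \<in> cocycles (stalk P) 0" using p by (simp add: cocycles_def stalk_simps)
  then obtain x where x: "x \<in> cocycles W 0" "p \<ominus>\<^bsub>P\<^esub> ?st x \<in> bdry (stalk P) 0"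
   using quasi_isoD(3)[OF cW csP q, of p 0] by (auto simp: stalk_simps)
  have "p \<ominus>\<^bsub>P\<^esub> ?st x = \<zero>\<^bsub>P\<^esub>" using x(2) by (auto simp: coboundaries_def stalk_simps)
  moreover have "?st x \<in> car P" using x(1) lmod_homD(2)[OF st] by (simp add: cocycles_def)
  ultimately have "?st x = p" using p by (metis P.M.add.inv_closed P.M.minus_equality P.M.minus_minus a_minus_def P.M.a_comm)
  then show ?thesis using x(1) by (auto simp: cocycles_def)
 qed
 let ?e = "%p. lift P (%\<phi> q. \<phi> p \<odot>\<^bsub>P\<^esub> q)"
 \<comment> \<open>The lift is found for every tensor in place of \<open>\<omega>\<close>, by choosing preimages of second factors.\<close>
 let ?V = "{u \<in> car (tgrp Pd A P). \<exists>h\<in>car (Hom A P (obj W 0)).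
  \<forall>p\<in>car P. dif W 0 (h p) = \<zero>\<^bsub>obj W 1\<^esub> \<and> ?st (h p) = ?e p u}"
 obtain F where F: "F \<subseteq> car Pd \<times> car P" "tensor_generates Pd A P F \<omega>"
  using tensor_finite_support[OF PdP.tensor_pair_axioms \<omega>_closed] by blast
 have "\<omega> \<in> ?V"
 proof (rule tensor_generatesD[OF F(2)])
  fix \<phi> q assume "(\<phi>, q) \<in> F"
  then have \<phi>: "\<phi> \<in> car Pd" and q: "q \<in> car P" using F(1) by auto
  obtain x where x: "x \<in> car (obj W 0)" "dif W 0 x = \<zero>\<^bsub>obj W 1\<^esub>" "?st x = q" using surj[OF q] by blast
  have "br (obj W 0) \<phi> x \<in> car (Hom A P (obj W 0))" by (rule br_closed[OF W0.lmodule_axioms \<phi> x(1)])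
  moreover have "dif W 0 (br (obj W 0) \<phi> x p) = \<zero>\<^bsub>obj W 1\<^esub> \<and> ?st (br (obj W 0) \<phi> x p) = ?e p (pure Pd A P \<phi> q)"
   if p: "p \<in> car P" for p
   using p \<phi> q x lmod_homD(4)[OF dW _ x(1), of "\<phi> p"] lmod_homD(4)[OF st _ x(1), of "\<phi> p"]
   by (simp add: br_def PdP.lift_pure[OF P.M.abg ev_balanced[OF p]])
  ultimately show "pure Pd A P \<phi> q \<in> ?V" using \<phi> q by auto
 next
  fix u v assume "u \<in> ?V" "v \<in> ?V"
  then obtain h k where u: "u \<in> car (tgrp Pd A P)" "v \<in> car (tgrp Pd A P)"
   and hk: "h \<in> car (Hom A P (obj W 0))" "k \<in> car (Hom A P (obj W 0))"
   and h: "!!p. p \<in> car P ==> dif W 0 (h p) = \<zero>\<^bsub>obj W 1\<^esub> \<and> ?st (h p) = ?e p u"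
   and k: "!!p. p \<in> car P ==> dif W 0 (k p) = \<zero>\<^bsub>obj W 1\<^esub> \<and> ?st (k p) = ?e p v" by blast
  interpret H: abelian_group "Hom A P (obj W 0)" by (rule Hom_ag[OF W0.lmodule_axioms])
  have "dif W 0 ((h \<oplus>\<^bsub>Hom A P (obj W 0)\<^esub> k) p) = \<zero>\<^bsub>obj W 1\<^esub> \<and>
    ?st ((h \<oplus>\<^bsub>Hom A P (obj W 0)\<^esub> k) p) = ?e p (u \<oplus>\<^bsub>tgrp Pd A P\<^esub> v)" if p: "p \<in> car P" for p
   using p hk h[OF p] k[OF p] u lmod_homD(3)[OF dW, of "h p" "k p"] lmod_homD(3)[OF st, of "h p" "k p"]
   by (simp add: PdP.lift_add[OF P.M.abg ev_balanced[OF p]])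
  then show "u \<oplus>\<^bsub>tgrp Pd A P\<^esub> v \<in> ?V" using u H.a_closed[OF hk] PdP.T.a_closed[OF u] by blast
 qed
 then obtain h where h: "h \<in> car (Hom A P (obj W 0))"
  "!!p. p \<in> car P ==> dif W 0 (h p) = \<zero>\<^bsub>obj W 1\<^esub> \<and> ?st (h p) = p"
  using \<omega>_eval by auto
 obtain H where H: "!!i. H i \<in> lmod_hom A (obj W i) (obj ?D (i - 1))"
  "!!i x. x \<in> car (obj W i) ==> (f i \<circ> t i) x \<ominus>\<^bsub>obj ?D i\<^esub> ((%_. \<zero>\<^bsub>obj ?D i\<^esub>) \<circ> t' i) x =
   dif ?D (i - 1) (H i x) \<oplus>\<^bsub>obj ?D i\<^esub> H (i + 1) (dif W i x)"
  using ho unfolding homotopic_def by blast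
 interpret Li: lmodule A "obj L i" by (rule cpxD(1)[OF cL])
 interpret Lj: lmodule A "obj L (i - 1)" by (rule cpxD(1)[OF cL])
 have oj: "obj ?D (- 1) = obj L (i - 1)" by (simp add: shift_def)
 have H0: "H 0 \<in> lmod_hom A (obj W 0) (obj L (i - 1))" using H(1)[of 0] by (simp add: oj)
 have H1: "H 1 \<zero>\<^bsub>obj W 1\<^esub> = \<zero>\<^bsub>obj L i\<^esub>"
  using lmod_hom_zero[OF W1.lmodule_axioms _ H(1)[of 1]] by (simp add: o0 Li.lmodule_axioms)
 have dL: "dif L (i - 1) \<in> lmod_hom A (obj L (i - 1)) (obj L i)" using cpxD(2)[OF cL, of "i - 1"] by simp
 have eq: "\<psi> p = dif ?D (- 1) (H 0 (h p))" if p: "p \<in> car P" for p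
 proof -
  have hp: "h p \<in> car (obj W 0)" using h(1) p by simp
  have "\<psi> p = dif ?D (- 1) (H 0 (h p)) \<oplus>\<^bsub>obj L i\<^esub> \<zero>\<^bsub>obj L i\<^esub>"
   using H(2)[OF hp] h(2)[OF p] H1 \<psi> p by (simp add: f_def o0 a_minus_def)
  moreover have "dif ?D (- 1) (H 0 (h p)) \<in> car (obj L i)"
   using lmod_homD(2)[OF cpxD(2)[OF cS, of "- 1"]] lmod_homD(2)[OF H0 hp] by (simp add: o0 oj)
  ultimately show ?thesis by simp
 qed
 define g where "g = (%x. if even i then H 0 x else \<ominus>\<^bsub>obj L (i - 1)\<^esub> H 0 x)"
 have g: "g \<in> lmod_hom A (obj W 0) (obj L (i - 1))"
  unfolding g_def using H0 lmod_hom_uminus[OF Lj.lmodule_axioms H0] by (cases "even i") simp_all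
 have "dif L (i - 1) (push g h p) = \<psi> p" if p: "p \<in> car P" for p
 proof -
  have hp: "h p \<in> car (obj W 0)" using h(1) p by simp
  have "dif L (i - 1) (g (h p)) = dif ?D (- 1) (H 0 (h p))"
   using lmod_hom_neg[OF Lj.lmodule_axioms Li.lmodule_axioms dL lmod_homD(2)[OF H0 hp]]
   by (simp add: g_def shift_def)
  then show ?thesis using eq[OF p] p by (simp add: push_def)
 qed
 then show ?thesis using push_closed[OF g h(1)] by blast
qed

text \<open>
  The isomorphism \<open>hom_a\<close> turns the row into \<open>T \<otimes>\<^sub>E Hom\<^sub>A(P, L)\<close>, to which \<open>right_split_exact\<close> applies.
\<close>

lemma row_exact:
 fixes L :: "(('a, 'l) module, 'l) cpx"
 assumes L: "L \<in> perp A P" and T: "bimodule K A E T" and s: "right_split K E T s"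
  and w: "w \<in> car (tgrp (tbim T E Pd) A (obj L i))"
   "tmap (tbim T E Pd) A (obj L (i + 1)) (%x. x) (dif L i) w = \<zero>\<^bsub>tgrp (tbim T E Pd) A (obj L (i + 1))\<^esub>"
 shows "\<exists>v\<in>car (tgrp (tbim T E Pd) A (obj L (i - 1))).
  tmap (tbim T E Pd) A (obj L i) (%x. x) (dif L (i - 1)) v = w"
proof -
 have LD: "L \<in> Db A" using L by (simp add: perp_def)
 have cL: "cochain_complex A L" and fg: "!!i. fin_gen A (obj L i)" using LD by (auto simp: Db_def)
 note Lm = cpxD(1)[OF cL]
 have Lk: "kfin K A (obj L i)" for i by (rule kfin_of_fin_gen[OF A finA Lm fg])
 let ?H = "%i. Hom A P (obj L i)"
 have d0: "dif L (i - 1) \<in> lmod_hom A (obj L (i - 1)) (obj L i)" using cpxD(2)[OF cL, of "i - 1"] by simp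
 have d1: "dif L i \<in> lmod_hom A (obj L i) (obj L (i + 1))" by (rule cpxD(2)[OF cL])
 have d2: "dif L (i + 1) \<in> lmod_hom A (obj L (i + 1)) (obj L (i + 2))" using cpxD(2)[OF cL, of "i + 1"] by (simp add: add.commute)
 have ex: "x \<in> push (dif L (k - 1)) ` car (?H (k - 1))"
  if x: "x \<in> car (?H k)" and z: "push (dif L k) x = \<zero>\<^bsub>?H (k + 1)\<^esub>" for k x
 proof -
  have "dif L k (x p) = \<zero>\<^bsub>obj L (k + 1)\<^esub>" if "p \<in> car P" for p
   using fun_cong[OF z, of p] that by (simp add: push_def)
  from perp_exact[OF L x this] obtain \<chi> where \<chi>: "\<chi> \<in> car (?H (k - 1))" "!!p. p \<in> car P ==> dif L (k - 1) (\<chi> p) = x p" by blast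
  have "push (dif L (k - 1)) \<chi> = x"
   by (rule hom_eqI[of _ "car P"]) (use x \<chi>(2) in "auto simp: push_def Hom_mem")
  then show ?thesis using \<chi>(1) by blast
 qed
 have ex2: "x \<in> push (dif L i) ` car (?H i)" if "x \<in> car (?H (i + 1))" "push (dif L (i + 1)) x = \<zero>\<^bsub>?H (i + 2)\<^esub>" for x
  using ex[of x "i + 1"] that by (simp add: add.commute)
 have dd: "push (dif L (i + 1)) (push (dif L i) x) = \<zero>\<^bsub>?H (i + 2)\<^esub>" if "x \<in> car (?H i)" for x
  using that cpxD(3)[OF cL] by (auto simp: push_def intro!: restrict_ext)
 note HL = Hom_lmodule[OF Lm] and HK = kfin_Hom[OF Lm Lk]
 have "\<exists>h1\<in>klin K E (?H i) E (?H (i - 1)). \<exists>h2\<in>klin K E (?H (i + 1)) E (?H i).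
   \<forall>x\<in>car (?H i). push (dif L (i - 1)) (h1 x) \<oplus>\<^bsub>?H i\<^esub> h2 (push (dif L i) x) = x"
  by (rule K_contraction[OF K E HL[of "i - 1"] HL[of i] HL[of "i + 1"] HL[of "i + 2"] HK[of "i - 1"] HK[of i] HK[of "i + 1"]
    push_hom[OF d0] push_hom[OF d1] push_hom[OF d2]]) (fact ex ex2 dd)+
 then obtain h1 h2 where h1: "h1 \<in> klin K E (?H i) E (?H (i - 1))" and h2: "h2 \<in> klin K E (?H (i + 1)) E (?H i)"
  and c: "!!x. x \<in> car (?H i) ==> push (dif L (i - 1)) (h1 x) \<oplus>\<^bsub>?H i\<^esub> h2 (push (dif L i) x) = x"
  by blast
 let ?S = "tbim T E Pd"
 have S: "bimodule K A A ?S" by (rule bimodule_tensor[OF T Pd.bm])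
 let ?w = "hom_a T (obj L i) w"
 have aw: "?w \<in> car (tgrp T E (?H i))" by (rule add_hom_closed[OF hom_a_hom[OF T Lm] w(1)])
 have "tmap T E (?H (i + 1)) (%x. x) (push (dif L i)) ?w = hom_a T (obj L (i + 1)) \<zero>\<^bsub>tgrp ?S A (obj L (i + 1))\<^esub>"
  using hom_a_natural_right[OF T Lm Lm d1 w(1)] w(2) by simp
 also have "\<dots> = \<zero>\<^bsub>tgrp T E (?H (i + 1))\<^esub>"
 proof -
  interpret X: tensor_pair ?S A "obj L (i + 1)" by (rule tensor_pairI[OF S Lm])
  interpret Y: tensor_pair T E "?H (i + 1)" by (rule tensor_pairI[OF T HL])
  show ?thesis by (rule add_hom_zero[OF X.T.abg Y.T.abg hom_a_hom[OF T Lm]])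
 qed
 finally obtain v where v: "v \<in> car (tgrp T E (?H (i - 1)))"
  "tmap T E (?H i) (%x. x) (push (dif L (i - 1))) v = ?w"
  using right_split_exact[OF T s HL[of "i - 1"] HL[of i] HL[of "i + 1"] push_hom[OF d0] push_hom[OF d1] h1 h2 _ aw] c by blast
 have "tmap ?S A (obj L i) (%x. x) (dif L (i - 1)) (hom_b T (obj L (i - 1)) v) = w"
  using hom_b_natural_right[OF T Lm Lm d0 v(1)] v(2) hom_ba[OF T Lm w(1)] by simp
 then show ?thesis using add_hom_closed[OF hom_b_hom[OF T Lm] v(1)] by blast
qed

text \<open>
  The terms of a cone are pairs, so they agree with sandwiches only up to an isomorphism.
\<close>

lemma row_exact_iso:
 fixes L :: "(('a, 'l) module, 'l) cpx"
 assumes L: "L \<in> perp A P" and T: "bimodule K A E T" and s: "right_split K E T s"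
  and Q: "bimodule K A A Q" and emb: "emb \<in> bimod_hom A A (tbim T E Pd) Q" and prj: "prj \<in> bimod_hom A A Q (tbim T E Pd)"
  and ip: "!!x. x \<in> car Q ==> emb (prj x) = x"
  and w: "w \<in> car (tgrp Q A (obj L i))"
   "tmap Q A (obj L (i + 1)) (%x. x) (dif L i) w = \<zero>\<^bsub>tgrp Q A (obj L (i + 1))\<^esub>"
 shows "\<exists>v\<in>car (tgrp Q A (obj L (i - 1))). tmap Q A (obj L i) (%x. x) (dif L (i - 1)) v = w"
proof -
 have cL: "cochain_complex A L" using L by (simp add: perp_def Db_def)
 note Lm = cpxD(1)[OF cL]
 let ?S = "tbim T E Pd"
 have S: "bimodule K A A ?S" by (rule bimodule_tensor[OF T Pd.bm])
 have d0: "dif L (i - 1) \<in> lmod_hom A (obj L (i - 1)) (obj L i)" using cpxD(2)[OF cL, of "i - 1"] by simp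
 have d1: "dif L i \<in> lmod_hom A (obj L i) (obj L (i + 1))" by (rule cpxD(2)[OF cL])
 note SL = tensor_pairI[OF S Lm] and XL = tensor_pairI[OF Q Lm]
 note ir = rmod_hom_of_bimod_hom[OF emb] and prj' = rmod_hom_of_bimod_hom[OF prj]
 let ?w = "tmap ?S A (obj L i) prj (%x. x) w"
 have w': "?w \<in> car (tgrp ?S A (obj L i))" by (rule add_hom_closed[OF tensor_map_hom[OF XL SL prj' lmod_hom_id] w(1)])
 have "tmap ?S A (obj L (i + 1)) (%x. x) (dif L i) ?w = tmap ?S A (obj L (i + 1)) prj (dif L i) w"
  by (rule tensor_map_comp[OF XL SL SL prj' rmod_hom_id lmod_hom_id d1 prj' d1 refl refl w(1)])
 also have "\<dots> = tmap ?S A (obj L (i + 1)) prj (%x. x) (tmap Q A (obj L (i + 1)) (%x. x) (dif L i) w)"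
  by (rule tensor_map_comp[OF XL XL SL rmod_hom_id prj' d1 lmod_hom_id prj' d1 refl refl w(1), symmetric])
 also have "\<dots> = \<zero>\<^bsub>tgrp ?S A (obj L (i + 1))\<^esub>"
 proof -
  interpret X1: tensor_pair Q A "obj L (i + 1)" by (rule XL)
  interpret S1: tensor_pair ?S A "obj L (i + 1)" by (rule SL)
  show ?thesis
   unfolding w(2) by (rule add_hom_zero[OF X1.T.abg S1.T.abg tensor_map_hom[OF XL SL prj' lmod_hom_id]])
 qed
 finally obtain v where v: "v \<in> car (tgrp ?S A (obj L (i - 1)))" "tmap ?S A (obj L i) (%x. x) (dif L (i - 1)) v = ?w"
  using row_exact[OF L T s w'] by blast
 let ?v = "tmap Q A (obj L (i - 1)) emb (%x. x) v"
 have ipr: "(%x. emb (prj x)) \<in> rmod_hom A Q Q"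
  by (rule rmod_hom_of_bimod_hom[OF bimod_hom_comp[OF prj emb]])
 have "tmap Q A (obj L i) (%x. x) (dif L (i - 1)) ?v = tmap Q A (obj L i) emb (dif L (i - 1)) v"
  by (rule tensor_map_comp[OF SL XL XL ir rmod_hom_id lmod_hom_id d0 ir d0 refl refl v(1)])
 also have "\<dots> = tmap Q A (obj L i) emb (%x. x) (tmap ?S A (obj L i) (%x. x) (dif L (i - 1)) v)"
  by (rule tensor_map_comp[OF SL SL XL rmod_hom_id ir d0 lmod_hom_id ir d0 refl refl v(1), symmetric])
 also have "\<dots> = tmap Q A (obj L i) (%x. emb (prj x)) (%x. x) w"
  unfolding v(2) by (rule tensor_map_comp[OF XL SL XL prj' ir lmod_hom_id lmod_hom_id ipr lmod_hom_id refl refl w(1)])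
 also have "\<dots> = w" by (rule tensor_map_id[OF XL ipr lmod_hom_id ip refl w(1)])
 finally show ?thesis using add_hom_closed[OF tensor_map_hom[OF SL XL ir lmod_hom_id] v(1)] by blast
qed

end

section \<open>Total complexes\<close>

text \<open>
  The differentials \<open>D1\<close> and \<open>D2\<close> commute, and the total differential is \<open>D1 + (-1)\<^sup>j D2\<close> on the row \<open>j\<close>.
\<close>

locale double_complex =
 fixes R :: "('r, 'x) ring_scheme" and G :: "int => int => ('r, 'm) module"
  and D1 D2 :: "int => int => 'm => 'm" and Tot :: "(('r, int => 'm) module, int => 'm) cpx"
 assumes ringR: "ring R" and G: "lmodule R (G j k)"
  and D1: "D1 j k \<in> lmod_hom R (G j k) (G (j + 1) k)" and D2: "D2 j k \<in> lmod_hom R (G j k) (G j (k + 1))"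
  and D11: "x \<in> car (G j k) ==> D1 (j + 1) k (D1 j k x) = \<zero>\<^bsub>G (j + 2) k\<^esub>"
  and D22: "x \<in> car (G j k) ==> D2 j (k + 1) (D2 j k x) = \<zero>\<^bsub>G j (k + 2)\<^esub>"
  and D12: "x \<in> car (G j k) ==> D1 j (k + 1) (D2 j k x) = D2 (j + 1) k (D1 j k x)"
  and obj_Tot: "obj Tot n = dsum (%j. G j (n - j))"
  and dif_Tot: "dif Tot n u j = D1 (j - 1) (n + 1 - j) (u (j - 1)) \<oplus>\<^bsub>G j (n + 1 - j)\<^esub>
   (if even j then D2 j (n - j) (u j) else \<ominus>\<^bsub>G j (n + 1 - j)\<^esub> D2 j (n - j) (u j))"
begin

lemma ag: "abelian_group (G j k)" by (rule abelian_of_lmodule[OF G])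

lemma G_zero [simp]: "\<zero>\<^bsub>G j k\<^esub> \<in> car (G j k)"
 by (rule abelian_monoid.zero_closed[OF abelian_group.axioms(1)[OF ag]])

lemma G_closed: "[|x \<in> car (G j k); y \<in> car (G j k)|] ==> x \<oplus>\<^bsub>G j k\<^esub> y \<in> car (G j k)"
 by (rule abelian_monoid.a_closed[OF abelian_group.axioms(1)[OF ag]])

lemma G_l0 [simp]: "x \<in> car (G j k) ==> \<zero>\<^bsub>G j k\<^esub> \<oplus>\<^bsub>G j k\<^esub> x = x"
 by (rule abelian_monoid.l_zero[OF abelian_group.axioms(1)[OF ag]])

lemma G_r0 [simp]: "x \<in> car (G j k) ==> x \<oplus>\<^bsub>G j k\<^esub> \<zero>\<^bsub>G j k\<^esub> = x"
 by (rule abelian_monoid.r_zero[OF abelian_group.axioms(1)[OF ag]])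

lemma G_neg0 [simp]: "\<ominus>\<^bsub>G j k\<^esub> \<zero>\<^bsub>G j k\<^esub> = \<zero>\<^bsub>G j k\<^esub>"
 by (rule abelian_group.a_inv_zero[OF ag])

lemma G_neg [simp]: "x \<in> car (G j k) ==> \<ominus>\<^bsub>G j k\<^esub> x \<in> car (G j k)"
 by (rule abelian_group.a_inv_closed[OF ag])

lemma D1_zero [simp]: "D1 j k \<zero>\<^bsub>G j k\<^esub> = \<zero>\<^bsub>G (j + 1) k\<^esub>"
 by (rule lmod_hom_zero[OF G G D1])

lemma D2_zero [simp]: "D2 j k \<zero>\<^bsub>G j k\<^esub> = \<zero>\<^bsub>G j (k + 1)\<^esub>"
 by (rule lmod_hom_zero[OF G G D2])

lemma D1': "D1 (j - 1) k \<in> lmod_hom R (G (j - 1) k) (G j k)"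
 using D1[of "j - 1" k] by simp

lemma D2': "D2 j (n - j) \<in> lmod_hom R (G j (n - j)) (G j (n + 1 - j))"
proof -
 have "n - j + 1 = n + 1 - j" by simp
 then show ?thesis using D2[of j "n - j"] by metis
qed

lemma Tot_mem: "u \<in> car (obj Tot n) \<longleftrightarrow> (\<forall>j. u j \<in> car (G j (n - j))) \<and> finite {j. u j \<noteq> \<zero>\<^bsub>G j (n - j)\<^esub>}"
 by (simp add: obj_Tot)

lemma Tot_app: "u \<in> car (obj Tot n) ==> u j \<in> car (G j (n - j))"
 by (simp add: Tot_mem)

lemma Tot_app': "u \<in> car (obj Tot n) ==> u (j - 1) \<in> car (G (j - 1) (n + 1 - j))"
 using Tot_app[of u n "j - 1"] by (simp add: algebra_simps)

lemma Tot_lmodule: "lmodule R (obj Tot n)"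
 unfolding obj_Tot by (rule lmodule_dsum[OF G ringR])

lemma Tot_zero: "\<zero>\<^bsub>obj Tot n\<^esub> = (%j. \<zero>\<^bsub>G j (n - j)\<^esub>)"
 and Tot_add: "u \<oplus>\<^bsub>obj Tot n\<^esub> v = (%j. u j \<oplus>\<^bsub>G j (n - j)\<^esub> v j)"
 and Tot_smult: "r \<odot>\<^bsub>obj Tot n\<^esub> u = (%j. r \<odot>\<^bsub>G j (n - j)\<^esub> u j)"
 by (simp_all add: obj_Tot)

lemma Tot_neg:
 assumes u: "u \<in> car (obj Tot n)"
 shows "(\<ominus>\<^bsub>obj Tot n\<^esub> u) j = \<ominus>\<^bsub>G j (n - j)\<^esub> u j"
proof -
 interpret T: lmodule R "obj Tot n" by (rule Tot_lmodule)
 interpret Gj: lmodule R "G j (n - j)" by (rule G)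
 have "(\<ominus>\<^bsub>obj Tot n\<^esub> u) \<oplus>\<^bsub>obj Tot n\<^esub> u = \<zero>\<^bsub>obj Tot n\<^esub>" using u by (simp add: T.M.l_neg)
 then have "(\<ominus>\<^bsub>obj Tot n\<^esub> u) j \<oplus>\<^bsub>G j (n - j)\<^esub> u j = \<zero>\<^bsub>G j (n - j)\<^esub>"
  by (simp add: Tot_add Tot_zero fun_eq_iff)
 then show ?thesis
  using Gj.M.minus_equality Tot_app[OF u] Tot_app[OF T.M.a_inv_closed[OF u]] by metis
qed

definition sg where "sg j M x = (if even (j :: int) then x else \<ominus>\<^bsub>M\<^esub> x)"

lemma dif_Tot': "dif Tot n u j = D1 (j - 1) (n + 1 - j) (u (j - 1)) \<oplus>\<^bsub>G j (n + 1 - j)\<^esub> sg j (G j (n + 1 - j)) (D2 j (n - j) (u j))"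
 by (simp add: dif_Tot sg_def)

lemma sg_props:
 "x \<in> car (G j k) ==> sg i (G j k) x \<in> car (G j k)"
 "sg i (G j k) \<zero>\<^bsub>G j k\<^esub> = \<zero>\<^bsub>G j k\<^esub>"
 "[|x \<in> car (G j k); y \<in> car (G j k)|] ==> sg i (G j k) (x \<oplus>\<^bsub>G j k\<^esub> y) = sg i (G j k) x \<oplus>\<^bsub>G j k\<^esub> sg i (G j k) y"
 "[|r \<in> car R; x \<in> car (G j k)|] ==> sg i (G j k) (r \<odot>\<^bsub>G j k\<^esub> x) = r \<odot>\<^bsub>G j k\<^esub> sg i (G j k) x"
 "x \<in> car (G j k) ==> sg i (G j k) (sg i (G j k) x) = x"
 "x \<in> car (G j k) ==> sg i (G j k) x = \<zero>\<^bsub>G j k\<^esub> ==> x = \<zero>\<^bsub>G j k\<^esub>"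
proof -
 interpret lmodule R "G j k" by (rule G)
 show "x \<in> car (G j k) ==> sg i (G j k) x \<in> car (G j k)"
  "sg i (G j k) \<zero>\<^bsub>G j k\<^esub> = \<zero>\<^bsub>G j k\<^esub>"
  "[|x \<in> car (G j k); y \<in> car (G j k)|] ==> sg i (G j k) (x \<oplus>\<^bsub>G j k\<^esub> y) = sg i (G j k) x \<oplus>\<^bsub>G j k\<^esub> sg i (G j k) y"
  "[|r \<in> car R; x \<in> car (G j k)|] ==> sg i (G j k) (r \<odot>\<^bsub>G j k\<^esub> x) = r \<odot>\<^bsub>G j k\<^esub> sg i (G j k) x"
  and s: "x \<in> car (G j k) ==> sg i (G j k) (sg i (G j k) x) = x"
  by (auto simp: sg_def M.minus_add sc_rneg)
 show "x \<in> car (G j k) ==> sg i (G j k) x = \<zero>\<^bsub>G j k\<^esub> ==> x = \<zero>\<^bsub>G j k\<^esub>"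
  using s by (metis G_neg0 sg_def)
qed

lemma D_terms:
 assumes u: "u \<in> car (obj Tot n)"
 shows "D1 (j - 1) (n + 1 - j) (u (j - 1)) \<in> car (G j (n + 1 - j))"
  "D2 j (n - j) (u j) \<in> car (G j (n + 1 - j))"
 using lmod_homD(2)[OF D1' Tot_app'[OF u]] lmod_homD(2)[OF D2' Tot_app[OF u]] .

lemma dif_zero_comp:
 assumes u: "u \<in> car (obj Tot n)" and z: "u (j - 1) = \<zero>\<^bsub>G (j - 1) (n + 1 - j)\<^esub>"
 shows "dif Tot n u j = sg j (G j (n + 1 - j)) (D2 j (n - j) (u j))"
 using z D_terms(2)[OF u, of j] D1_zero[of "j - 1" "n + 1 - j"] by (simp add: dif_Tot' sg_props)

lemma dif_closed: "u \<in> car (obj Tot n) ==> dif Tot n u \<in> car (obj Tot (n + 1))"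
proof -
 assume u: "u \<in> car (obj Tot n)"
 have "dif Tot n u j \<in> car (G j (n + 1 - j))" for j
  unfolding dif_Tot' by (rule G_closed[OF D_terms(1)[OF u] sg_props(1)[OF D_terms(2)[OF u]]])
 moreover have "{j. dif Tot n u j \<noteq> \<zero>\<^bsub>G j (n + 1 - j)\<^esub>} \<subseteq>
   {j. u j \<noteq> \<zero>\<^bsub>G j (n - j)\<^esub>} \<union> (%j. j + 1) ` {j. u j \<noteq> \<zero>\<^bsub>G j (n - j)\<^esub>}"
 proof
  fix j assume j: "j \<in> {j. dif Tot n u j \<noteq> \<zero>\<^bsub>G j (n + 1 - j)\<^esub>}"
  have i: "n - (j - 1) = n + 1 - j" "n - j + 1 = n + 1 - j" by simp_all
  show "j \<in> {j. u j \<noteq> \<zero>\<^bsub>G j (n - j)\<^esub>} \<union> (%j. j + 1) ` {j. u j \<noteq> \<zero>\<^bsub>G j (n - j)\<^esub>}"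
  proof (rule ccontr)
   assume "\<not> ?thesis"
   then have n: "u j = \<zero>\<^bsub>G j (n - j)\<^esub>" "j \<notin> (%j. j + 1) ` {j. u j \<noteq> \<zero>\<^bsub>G j (n - j)\<^esub>}" by auto
   have "u (j - 1) = \<zero>\<^bsub>G (j - 1) (n - (j - 1))\<^esub>"
   proof (rule ccontr)
    assume "u (j - 1) \<noteq> \<zero>\<^bsub>G (j - 1) (n - (j - 1))\<^esub>"
    then have "j \<in> (%j. j + 1) ` {j. u j \<noteq> \<zero>\<^bsub>G j (n - j)\<^esub>}" by (intro image_eqI[of _ _ "j - 1"]) auto
    then show False using n(2) by simp
   qed
   then have z: "u j = \<zero>\<^bsub>G j (n - j)\<^esub>" "u (j - 1) = \<zero>\<^bsub>G (j - 1) (n + 1 - j)\<^esub>"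
    using n(1) unfolding i by auto
   have "D2 j (n - j) (u j) = \<zero>\<^bsub>G j (n + 1 - j)\<^esub>"
    unfolding z(1) using D2_zero[of j "n - j"] i(2) by metis
   then have "dif Tot n u j = \<zero>\<^bsub>G j (n + 1 - j)\<^esub>"
    using dif_zero_comp[OF u z(2)] by (simp add: sg_props)
   then show False using j by simp
  qed
 qed
 moreover have "finite {j. u j \<noteq> \<zero>\<^bsub>G j (n - j)\<^esub>}" using u by (simp add: Tot_mem)
 ultimately show ?thesis unfolding Tot_mem by (meson finite_UnI finite_imageI finite_subset)
qed

lemma dif_hom: "dif Tot n \<in> lmod_hom R (obj Tot n) (obj Tot (n + 1))"
proof (intro lmod_homI add_homI dif_closed)
 fix u v assume u: "u \<in> car (obj Tot n)" and v: "v \<in> car (obj Tot n)"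
 show "dif Tot n (u \<oplus>\<^bsub>obj Tot n\<^esub> v) = dif Tot n u \<oplus>\<^bsub>obj Tot (n + 1)\<^esub> dif Tot n v"
 proof (rule ext)
  fix j
  interpret lmodule R "G j (n + 1 - j)" by (rule G)
  have i: "n - (j - 1) = n + 1 - j" by simp
  show "dif Tot n (u \<oplus>\<^bsub>obj Tot n\<^esub> v) j = (dif Tot n u \<oplus>\<^bsub>obj Tot (n + 1)\<^esub> dif Tot n v) j"
   using D_terms[OF u, of j] D_terms[OF v, of j] Tot_app[OF u, of j] Tot_app[OF v, of j] Tot_app'[OF u, of j] Tot_app'[OF v, of j]
   by (simp add: dif_Tot' Tot_add i lmod_homD(3)[OF D1'] lmod_homD(3)[OF D2'] sg_props M.a_ac)
 qed
next
 fix r u assume r: "r \<in> car R" and u: "u \<in> car (obj Tot n)"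
 show "dif Tot n (r \<odot>\<^bsub>obj Tot n\<^esub> u) = r \<odot>\<^bsub>obj Tot (n + 1)\<^esub> dif Tot n u"
 proof (rule ext)
  fix j
  interpret lmodule R "G j (n + 1 - j)" by (rule G)
  have i: "n - (j - 1) = n + 1 - j" by simp
  show "dif Tot n (r \<odot>\<^bsub>obj Tot n\<^esub> u) j = (r \<odot>\<^bsub>obj Tot (n + 1)\<^esub> dif Tot n u) j"
   using D_terms[OF u, of j] Tot_app[OF u, of j] Tot_app'[OF u, of j] r
   by (simp add: dif_Tot' Tot_smult i lmod_homD(4)[OF D1'] lmod_homD(4)[OF D2'] sg_props sc_radd)
 qed
qed

lemma dif_dif:
 assumes u: "u \<in> car (obj Tot n)"
 shows "dif Tot (n + 1) (dif Tot n u) = \<zero>\<^bsub>obj Tot (n + 2)\<^esub>"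
proof (rule ext)
 fix j
 define k where "k = n - j"
 have k: "n = k + j" by (simp add: k_def)
 have iA: "n + 1 - j = k + 1" "n - j = k" "n + 1 + 1 - j = k + 2" "n + 1 - (j - 1) = k + 2" "n - (j - 1) = k + 1"
  "n + 2 - j = k + 2" "n - (j - 1 - 1) = k + 2" "j - 1 - 1 + 1 = j - 1" "j - 1 - 1 + 2 = j"
  by (simp_all add: k)
 define x y z where "x = u (j - 1 - 1)" and "y = u (j - 1)" and "z = u j"
 have x: "x \<in> car (G (j - 1 - 1) (k + 2))" and y: "y \<in> car (G (j - 1) (k + 1))" and z: "z \<in> car (G j k)"
  using Tot_app[OF u, of "j - 1 - 1"] Tot_app[OF u, of "j - 1"] Tot_app[OF u, of j]
  unfolding iA x_def y_def z_def by auto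
 interpret lmodule R "G j (k + 2)" by (rule G)
 have hD1: "D1 (j - 1) k' \<in> lmod_hom R (G (j - 1) k') (G j k')" for k' by (rule D1')
 have hD1b: "D1 (j - 1 - 1) k' \<in> lmod_hom R (G (j - 1 - 1) k') (G (j - 1) k')" for k' by (rule D1')
 have hD2: "D2 j' (k + 1) \<in> lmod_hom R (G j' (k + 1)) (G j' (k + 2))" for j'
  using D2[of j' "k + 1"] by (simp add: add.commute)
 have hD2b: "D2 j' k \<in> lmod_hom R (G j' k) (G j' (k + 1))" for j' by (rule D2)
 have e1: "D1 (j - 1) (k + 2) (D1 (j - 1 - 1) (k + 2) x) = \<zero>\<^bsub>G j (k + 2)\<^esub>"
  using D11[OF x] by (simp add: iA)
 have e2: "D2 j (k + 1) (D2 j k z) = \<zero>\<^bsub>G j (k + 2)\<^esub>" by (rule D22[OF z])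
 have e3: "D1 (j - 1) (k + 2) (D2 (j - 1) (k + 1) y) = D2 j (k + 1) (D1 (j - 1) (k + 1) y)"
  using D12[OF y] by (simp add: add.commute)
 have c1: "D1 (j - 1 - 1) (k + 2) x \<in> car (G (j - 1) (k + 2))" by (rule lmod_homD(2)[OF hD1b x])
 have c2: "D2 (j - 1) (k + 1) y \<in> car (G (j - 1) (k + 2))" by (rule lmod_homD(2)[OF hD2 y])
 have c3: "D1 (j - 1) (k + 1) y \<in> car (G j (k + 1))" by (rule lmod_homD(2)[OF hD1 y])
 have c4: "D2 j k z \<in> car (G j (k + 1))" by (rule lmod_homD(2)[OF hD2b z])
 have c5: "D2 j (k + 1) (D1 (j - 1) (k + 1) y) \<in> car (G j (k + 2))" by (rule lmod_homD(2)[OF hD2 c3])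
 let ?w = "D2 j (k + 1) (D1 (j - 1) (k + 1) y)"
 have s1: "D1 (j - 1) (k + 2) (sg (j - 1) (G (j - 1) (k + 2)) (D2 (j - 1) (k + 1) y)) = sg (j - 1) (G j (k + 2)) ?w"
  using lmod_hom_neg[OF G G hD1 c2] e3 by (simp add: sg_def)
 have s2: "D2 j (k + 1) (sg j (G j (k + 1)) (D2 j k z)) = \<zero>\<^bsub>G j (k + 2)\<^esub>"
  using lmod_hom_neg[OF G G hD2 c4] e2 by (simp add: sg_def)
 have "dif Tot (n + 1) (dif Tot n u) j =
   D1 (j - 1) (k + 2) (D1 (j - 1 - 1) (k + 2) x \<oplus>\<^bsub>G (j - 1) (k + 2)\<^esub> sg (j - 1) (G (j - 1) (k + 2)) (D2 (j - 1) (k + 1) y))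
   \<oplus>\<^bsub>G j (k + 2)\<^esub> sg j (G j (k + 2)) (D2 j (k + 1) (D1 (j - 1) (k + 1) y \<oplus>\<^bsub>G j (k + 1)\<^esub> sg j (G j (k + 1)) (D2 j k z)))"
  unfolding dif_Tot' iA x_def y_def z_def by (simp add: algebra_simps)
 also have "\<dots> = sg (j - 1) (G j (k + 2)) ?w \<oplus>\<^bsub>G j (k + 2)\<^esub> sg j (G j (k + 2)) ?w"
  using c1 c2 c3 c4 c5 e1 s1 s2 by (simp add: lmod_homD(3)[OF hD1] lmod_homD(3)[OF hD2] sg_props)
 also have "\<dots> = \<zero>\<^bsub>G j (k + 2)\<^esub>" using c5 by (auto simp: sg_def M.r_neg M.l_neg)
 finally show "dif Tot (n + 1) (dif Tot n u) j = \<zero>\<^bsub>obj Tot (n + 2)\<^esub> j" by (simp add: Tot_zero iA)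
qed

lemma Tot_complex: "cochain_complex R Tot"
 unfolding cochain_complex_def using Tot_lmodule dif_hom dif_dif by blast

lemma single_hom: "dsum_single (%j. G j (n - j)) j \<in> lmod_hom R (G j (n - j)) (obj Tot n)"
 using dsum_single_hom[of R "%j. G j (n - j)" j] G by (simp add: obj_Tot)

text \<open>
  Proceeding upwards from the lowest row: once the components below row \<open>j0\<close> vanish, the one in row \<open>j0\<close> is a
  \<open>D2\<close>-cycle, hence \<open>D2 w\<close> for some \<open>w\<close>, and subtracting the coboundary of \<open>w\<close> (with a sign) changes nothing in
  lower rows.
\<close>

lemma clear_rows:
 assumes N: "!!j k. j < - int N ==> car (G j k) = {\<zero>\<^bsub>G j k\<^esub>}"
  and ex: "!!j k x. [|j < 0; x \<in> car (G j k); D2 j k x = \<zero>\<^bsub>G j (k + 1)\<^esub>|] ==>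
   \<exists>y\<in>car (G j (k - 1)). D2 j (k - 1) y = x"
  and u: "u \<in> car (obj Tot n)" and du: "!!j. j < 0 ==> dif Tot n u j = \<zero>\<^bsub>G j (n + 1 - j)\<^esub>"
 shows "\<exists>v\<in>car (obj Tot (n - 1)). \<forall>j<0. (u \<ominus>\<^bsub>obj Tot n\<^esub> dif Tot (n - 1) v) j = \<zero>\<^bsub>G j (n - j)\<^esub>"
proof -
 interpret Tn: lmodule R "obj Tot n" by (rule Tot_lmodule)
 interpret Tm: lmodule R "obj Tot (n - 1)" by (rule Tot_lmodule)
 have dh: "dif Tot (n - 1) \<in> lmod_hom R (obj Tot (n - 1)) (obj Tot n)" using dif_hom[of "n - 1"] by simp
 have claim: "\<exists>v\<in>car (obj Tot (n - 1)). \<forall>j. j < - int N + int m \<and> j < 0 --> (u \<ominus>\<^bsub>obj Tot n\<^esub> dif Tot (n - 1) v) j = \<zero>\<^bsub>G j (n - j)\<^esub>" for m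
 proof (induction m)
  case 0
  have "(u \<ominus>\<^bsub>obj Tot n\<^esub> dif Tot (n - 1) \<zero>\<^bsub>obj Tot (n - 1)\<^esub>) j = \<zero>\<^bsub>G j (n - j)\<^esub>" if "j < - int N" for j
  proof -
   have "u \<ominus>\<^bsub>obj Tot n\<^esub> dif Tot (n - 1) \<zero>\<^bsub>obj Tot (n - 1)\<^esub> \<in> car (obj Tot n)"
    using u lmod_homD(2)[OF dh Tm.M.zero_closed] by (simp add: a_minus_def)
   from Tot_app[OF this, of j] show ?thesis using N[OF that] by simp
  qed
  then show ?case using Tm.M.zero_closed by auto
 next
  case (Suc m)
  then obtain v where v: "v \<in> car (obj Tot (n - 1))"
   "!!j. [|j < - int N + int m; j < 0|] ==> (u \<ominus>\<^bsub>obj Tot n\<^esub> dif Tot (n - 1) v) j = \<zero>\<^bsub>G j (n - j)\<^esub>" by blast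
  define j0 where "j0 = - int N + int m"
  show ?case
  proof (cases "j0 < 0")
   case False
   then show ?thesis using v by (intro bexI[OF _ v(1)]) (auto simp: j0_def)
  next
   case True
   define u' where "u' = u \<ominus>\<^bsub>obj Tot n\<^esub> dif Tot (n - 1) v"
   have dv: "dif Tot (n - 1) v \<in> car (obj Tot n)" by (rule lmod_homD(2)[OF dh v(1)])
   have u': "u' \<in> car (obj Tot n)" using u dv by (simp add: u'_def a_minus_def)
   have ddv: "dif Tot n (dif Tot (n - 1) v) = \<zero>\<^bsub>obj Tot (n + 1)\<^esub>" using dif_dif[OF v(1)] by (simp add: add.commute)
   interpret Tp: lmodule R "obj Tot (n + 1)" by (rule Tot_lmodule)
   have "dif Tot n u' = dif Tot n u"
    unfolding u'_def using add_hom_minus[OF Tn.M.abg Tp.M.abg lmod_homD(1)[OF dif_hom] u dv] ddv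
     dif_closed[OF u] by (simp add: a_minus_def)
   then have du': "dif Tot n u' j0 = \<zero>\<^bsub>G j0 (n + 1 - j0)\<^esub>" using du[OF True] by simp
   have "u' (j0 - 1) = \<zero>\<^bsub>G (j0 - 1) (n - (j0 - 1))\<^esub>" using v(2)[of "j0 - 1"] True by (simp add: u'_def j0_def)
   then have "u' (j0 - 1) = \<zero>\<^bsub>G (j0 - 1) (n + 1 - j0)\<^esub>" by (simp add: algebra_simps)
   then have "D2 j0 (n - j0) (u' j0) = \<zero>\<^bsub>G j0 (n + 1 - j0)\<^esub>"
    using dif_zero_comp[OF u'] du' sg_props(6)[OF D_terms(2)[OF u']] by metis
   then obtain w where w: "w \<in> car (G j0 (n - j0 - 1))" "D2 j0 (n - j0 - 1) w = u' j0"
    using ex[OF True Tot_app[OF u', of j0]] by (auto simp: algebra_simps)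
   have i1: "n - 1 - j0 = n - j0 - 1" "n - 1 + 1 - j = n - j" for j by simp_all
   let ?w = "sg j0 (G j0 (n - j0 - 1)) w"
   have w': "?w \<in> car (G j0 (n - 1 - j0))" unfolding i1 by (rule sg_props(1)[OF w(1)])
   define y where "y = dsum_single (%j. G j (n - 1 - j)) j0 ?w"
   have y: "y \<in> car (obj Tot (n - 1))" unfolding y_def by (rule lmod_homD(2)[OF single_hom w'])
   have y0: "y j = \<zero>\<^bsub>G j (n - 1 - j)\<^esub>" if "j \<noteq> j0" for j using that by (simp add: y_def dsum_single_def)
   have y0': "y (j - 1) = \<zero>\<^bsub>G (j - 1) (n - 1 + 1 - j)\<^esub>" if "j \<le> j0" for j
    using y0[of "j - 1"] that by (simp add: algebra_simps)
   have u'c: "u' j0 \<in> car (G j0 (n - j0))" by (rule Tot_app[OF u'])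
   have i2: "n - j0 - 1 + 1 = n - j0" by simp
   have D2n: "D2 j0 (n - j0 - 1) \<in> lmod_hom R (G j0 (n - j0 - 1)) (G j0 (n - j0))"
    using D2[of j0 "n - j0 - 1"] by (simp only: i2)
   have dy0: "dif Tot (n - 1) y j0 = u' j0"
   proof -
    have "dif Tot (n - 1) y j0 = sg j0 (G j0 (n - j0)) (D2 j0 (n - j0 - 1) ?w)"
     using dif_zero_comp[OF y y0'[OF order_refl]] by (simp add: i1 y_def dsum_single_def)
    also have "\<dots> = sg j0 (G j0 (n - j0)) (sg j0 (G j0 (n - j0)) (u' j0))"
     using lmod_hom_neg[OF G G D2n w(1)] w(2) by (simp add: sg_def)
    finally show ?thesis using sg_props(5)[OF u'c] by simp
   qed
   have dyj: "dif Tot (n - 1) y j = \<zero>\<^bsub>G j (n - j)\<^esub>" if "j < j0" for j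
   proof -
    have "D2 j (n - 1 - j) (y j) = \<zero>\<^bsub>G j (n - 1 - j + 1)\<^esub>" using y0[of j] that D2_zero[of j "n - 1 - j"] by simp
    then show ?thesis using dif_zero_comp[OF y y0'] that by (simp add: i1 sg_props)
   qed
   let ?v = "v \<oplus>\<^bsub>obj Tot (n - 1)\<^esub> y"
   have dy: "dif Tot (n - 1) y \<in> car (obj Tot n)" by (rule lmod_homD(2)[OF dh y])
   have "u \<ominus>\<^bsub>obj Tot n\<^esub> dif Tot (n - 1) ?v = u' \<oplus>\<^bsub>obj Tot n\<^esub> \<ominus>\<^bsub>obj Tot n\<^esub> dif Tot (n - 1) y"
    unfolding u'_def a_minus_def lmod_homD(3)[OF dh v(1) y] using u dv dy by (simp add: Tn.M.minus_add Tn.M.a_assoc)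
   then have e: "(u \<ominus>\<^bsub>obj Tot n\<^esub> dif Tot (n - 1) ?v) j = u' j \<oplus>\<^bsub>G j (n - j)\<^esub> \<ominus>\<^bsub>G j (n - j)\<^esub> dif Tot (n - 1) y j" for j
    using Tot_neg[OF dy] by (simp add: Tot_add)
   have "(u \<ominus>\<^bsub>obj Tot n\<^esub> dif Tot (n - 1) ?v) j = \<zero>\<^bsub>G j (n - j)\<^esub>" if "j < - int N + int (Suc m)" "j < 0" for j
   proof (cases "j = j0")
    case True
    interpret lmodule R "G j0 (n - j0)" by (rule G)
    show ?thesis unfolding e True dy0 using u'c by (simp add: M.r_neg)
   next
    case False
    then have "j < j0" using that by (simp add: j0_def)
    then show ?thesis unfolding e dyj[OF \<open>j < j0\<close>] using v(2)[of j] that by (simp add: u'_def j0_def)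
   qed
   then show ?thesis using Tm.M.a_closed[OF v(1) y] by blast
  qed
 qed
 from claim[of N] show ?thesis by simp
qed

text \<open>
  Modulo coboundaries every cocycle, and every cochain whose coboundary lies in the row \<open>0\<close>, is concentrated
  in the row \<open>0\<close> by \<open>clear_rows\<close>.
\<close>

theorem row_quasi_iso:
 fixes L :: "(('r, 'l) module, 'l) cpx"
 assumes N: "!!j k. j < - int N ==> car (G j k) = {\<zero>\<^bsub>G j k\<^esub>}" and P: "!!j k. j > 0 ==> car (G j k) = {\<zero>\<^bsub>G j k\<^esub>}"
  and ex: "!!j k x. [|j < 0; x \<in> car (G j k); D2 j k x = \<zero>\<^bsub>G j (k + 1)\<^esub>|] ==>
   \<exists>y\<in>car (G j (k - 1)). D2 j (k - 1) y = x"
  and L: "cochain_complex R L" and \<rho>: "!!k. \<rho> k \<in> lmod_hom R (obj L k) (G 0 k)"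
  and \<rho>b: "!!k. bij_betw (\<rho> k) (car (obj L k)) (car (G 0 k))"
  and \<rho>d: "!!k l. l \<in> car (obj L k) ==> D2 0 k (\<rho> k l) = \<rho> (k + 1) (dif L k l)"
 shows "quasi_iso R L Tot (%k l. dsum_single (%j. G j (k - j)) 0 (\<rho> k l))"
proof (rule quasi_isoI[OF L Tot_complex])
 let ?\<phi> = "%k l. dsum_single (%j. G j (k - j)) 0 (\<rho> k l)"
 have \<phi>: "?\<phi> k \<in> lmod_hom R (obj L k) (obj Tot k)" for k
 proof -
  have "dsum_single (%j. G j (k - j)) 0 \<in> lmod_hom R (G 0 k) (obj Tot k)" using single_hom[where n = k and j = 0] by simp
  from lmod_hom_comp[OF \<rho> this] show ?thesis .
 qed
 have \<phi>0: "?\<phi> k l 0 = \<rho> k l" for k l by (simp add: dsum_single_def)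
 have \<phi>j: "?\<phi> k l j = \<zero>\<^bsub>G j (k - j)\<^esub>" if "j \<noteq> 0" for k l j using that by (simp add: dsum_single_def)
 have supp: "u = ?\<phi> k l" if u: "u \<in> car (obj Tot k)" and z: "!!j. j < 0 ==> u j = \<zero>\<^bsub>G j (k - j)\<^esub>" and 0: "u 0 = \<rho> k l" for u k l
 proof (rule ext)
  fix j show "u j = ?\<phi> k l j"
   using z[of j] 0 P[of j "k - j"] Tot_app[OF u, of j] by (cases "j < 0"; cases "j = 0") (auto simp: \<phi>0 \<phi>j)
 qed
 have \<rho>c: "\<rho> k l \<in> car (G 0 k)" if "l \<in> car (obj L k)" for k l by (rule lmod_homD(2)[OF \<rho> that])
 show cm: "chain_map R L Tot ?\<phi>"
  unfolding chain_map_def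
 proof (intro allI conjI \<phi> ballI)
  fix k l assume l: "l \<in> car (obj L k)"
  have u: "?\<phi> k l \<in> car (obj Tot k)" by (rule lmod_homD(2)[OF \<phi> l])
  have z: "?\<phi> k l (j - 1) = \<zero>\<^bsub>G (j - 1) (k + 1 - j)\<^esub>" if "j \<le> 0" for j
   using \<phi>j[of "j - 1" k l] that by (simp add: algebra_simps)
  show "?\<phi> (k + 1) (dif L k l) = dif Tot k (?\<phi> k l)"
  proof (rule supp[symmetric, OF dif_closed[OF u]])
   fix j :: int assume j: "j < 0"
   have "D2 j (k - j) (?\<phi> k l j) = \<zero>\<^bsub>G j (k - j + 1)\<^esub>" using \<phi>j[of j k l] j D2_zero[of j "k - j"] by simp
   moreover have "k - j + 1 = k + 1 - j" by simp
   ultimately show "dif Tot k (?\<phi> k l) j = \<zero>\<^bsub>G j (k + 1 - j)\<^esub>"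
    using dif_zero_comp[OF u z] j by (simp add: sg_props)
  next
   show "dif Tot k (?\<phi> k l) 0 = \<rho> (k + 1) (dif L k l)"
    using dif_zero_comp[OF u z] \<rho>d[OF l] by (simp add: \<phi>0 sg_def)
  qed
 qed
 have nm: "w \<in> car (obj Tot n) \<and> dif Tot n w = dif Tot n u"
  if "u \<in> car (obj Tot n)" "v \<in> car (obj Tot (n - 1))" "w = u \<ominus>\<^bsub>obj Tot n\<^esub> dif Tot (n - 1) v" for u v w n
 proof -
  interpret Tn: lmodule R "obj Tot n" by (rule Tot_lmodule)
  interpret Tp: lmodule R "obj Tot (n + 1)" by (rule Tot_lmodule)
  have dv: "dif Tot (n - 1) v \<in> car (obj Tot n)" using dif_closed[OF that(2)] by simp
  have ddv: "dif Tot n (dif Tot (n - 1) v) = \<zero>\<^bsub>obj Tot (n + 1)\<^esub>" using dif_dif[OF that(2)] by (simp add: add.commute)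
  show ?thesis
   unfolding that(3) using add_hom_minus[OF Tn.M.abg Tp.M.abg lmod_homD(1)[OF dif_hom] that(1) dv] ddv
    dif_closed[OF that(1)] that(1) dv by (simp add: a_minus_def)
 qed
 have lift: "\<exists>l\<in>car (obj L k). u = ?\<phi> k l \<and> dif Tot k u 0 = \<rho> (k + 1) (dif L k l)"
  if u: "u \<in> car (obj Tot k)" and z: "!!j. j < 0 ==> u j = \<zero>\<^bsub>G j (k - j)\<^esub>" for u k
 proof -
  have "u 0 \<in> car (G 0 k)" using Tot_app[OF u, of 0] by simp
  then obtain l where l: "l \<in> car (obj L k)" "u 0 = \<rho> k l" using \<rho>b[of k] unfolding bij_betw_def by blast
  have e: "u = ?\<phi> k l" by (rule supp[OF u z l(2)])
  have "dif Tot k u 0 = ?\<phi> (k + 1) (dif L k l) 0" unfolding e chain_mapD(2)[OF cm l(1)] ..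
  then show ?thesis using l(1) e \<phi>0 by auto
 qed
 have \<rho>inj: "l = l'" if "l \<in> car (obj L k)" "l' \<in> car (obj L k)" "\<rho> k l = \<rho> k l'" for k l l'
  using \<rho>b[of k] that unfolding bij_betw_def inj_on_def by blast
 {
  fix k l assume l: "l \<in> cocycles L k" and b: "?\<phi> k l \<in> bdry Tot k"
  have lc: "l \<in> car (obj L k)" using l by (simp add: cocycles_def)
  obtain v where v: "v \<in> car (obj Tot (k - 1))" "?\<phi> k l = dif Tot (k - 1) v" using b by (auto simp: coboundaries_def)
  have "dif Tot (k - 1) v j = \<zero>\<^bsub>G j (k - 1 + 1 - j)\<^esub>" if "j < 0" for j
   using fun_cong[OF v(2), of j] \<phi>j[of j k l] that by simp
  from clear_rows[OF N ex v(1) this] obtain w where w: "w \<in> car (obj Tot (k - 1 - 1))"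
   "!!j. j < 0 ==> (v \<ominus>\<^bsub>obj Tot (k - 1)\<^esub> dif Tot (k - 1 - 1) w) j = \<zero>\<^bsub>G j (k - 1 - j)\<^esub>" by blast
  note n = nm[OF v(1) w(1) refl]
  obtain m where m: "m \<in> car (obj L (k - 1))"
   "dif Tot (k - 1) (v \<ominus>\<^bsub>obj Tot (k - 1)\<^esub> dif Tot (k - 1 - 1) w) 0 = \<rho> (k - 1 + 1) (dif L (k - 1) m)"
   using lift[OF conjunct1[OF n] w(2)] by blast
  have "\<rho> k l = \<rho> k (dif L (k - 1) m)"
   using m(2) conjunct2[OF n] fun_cong[OF v(2), of 0] \<phi>0[of k l] by simp
  moreover have "dif L (k - 1) m \<in> car (obj L k)" using lmod_homD(2)[OF cpxD(2)[OF L] m(1)] by simp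
  ultimately have "l = dif L (k - 1) m" using \<rho>inj lc by blast
  then show "l \<in> bdry L k" using m(1) by (auto simp: coboundaries_def)
 next
  fix k u assume u: "u \<in> cocycles Tot k"
  have uc: "u \<in> car (obj Tot k)" and du: "dif Tot k u = \<zero>\<^bsub>obj Tot (k + 1)\<^esub>" using u by (auto simp: cocycles_def)
  have "dif Tot k u j = \<zero>\<^bsub>G j (k + 1 - j)\<^esub>" for j using du by (simp add: Tot_zero)
  from clear_rows[OF N ex uc this] obtain v where v: "v \<in> car (obj Tot (k - 1))"
   "!!j. j < 0 ==> (u \<ominus>\<^bsub>obj Tot k\<^esub> dif Tot (k - 1) v) j = \<zero>\<^bsub>G j (k - j)\<^esub>" by blast
  note n = nm[OF uc v(1) refl]
  obtain l where l: "l \<in> car (obj L k)" "u \<ominus>\<^bsub>obj Tot k\<^esub> dif Tot (k - 1) v = ?\<phi> k l"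
   "dif Tot k (u \<ominus>\<^bsub>obj Tot k\<^esub> dif Tot (k - 1) v) 0 = \<rho> (k + 1) (dif L k l)"
   using lift[OF conjunct1[OF n] v(2)] by blast
  interpret Tk: lmodule R "obj Tot k" by (rule Tot_lmodule)
  have dl: "dif L k l \<in> car (obj L (k + 1))" by (rule lmod_homD(2)[OF cpxD(2)[OF L] l(1)])
  have "\<rho> (k + 1) (dif L k l) = \<zero>\<^bsub>G 0 (k + 1)\<^esub>" using l(3) n du by (simp add: Tot_zero)
  also have "\<dots> = \<rho> (k + 1) \<zero>\<^bsub>obj L (k + 1)\<^esub>" by (rule lmod_hom_zero[OF cpxD(1)[OF L] G \<rho>, symmetric])
  finally have "dif L k l = \<zero>\<^bsub>obj L (k + 1)\<^esub>"
   using \<rho>inj[OF dl] cocycles_rules(2)[OF L, of "k + 1"] by (simp add: cocycles_def)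
  then have "l \<in> cocycles L k" using l(1) by (simp add: cocycles_def)
  moreover have "u \<ominus>\<^bsub>obj Tot k\<^esub> ?\<phi> k l \<in> bdry Tot k"
  proof -
   have dv: "dif Tot (k - 1) v \<in> car (obj Tot k)" using dif_closed[OF v(1)] by simp
   have "u \<ominus>\<^bsub>obj Tot k\<^esub> ?\<phi> k l = dif Tot (k - 1) v"
    unfolding l(2)[symmetric] using uc dv by (simp add: a_minus_def Tk.M.minus_add Tk.M.r_neg2)
   then show ?thesis using v(1) by (auto simp: coboundaries_def)
  qed
  ultimately show "\<exists>x\<in>cocycles L k. u \<ominus>\<^bsub>obj Tot k\<^esub> ?\<phi> k x \<in> bdry Tot k" by blast
 }
qed

end

definition bimod_complex where
 "bimod_complex K R S C \<longleftrightarrow> (\<forall>i. bimodule K R S (obj C i) \<and> dif C i \<in> bimod_hom R S (obj C i) (obj C (i + 1)) \<and>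
  (\<forall>x\<in>car (obj C i). dif C (i + 1) (dif C i x) = \<zero>\<^bsub>obj C (i + 2)\<^esub>))"

lemma bimod_complexD:
 assumes "bimod_complex K R S C"
 shows "bimodule K R S (obj C i)" "dif C i \<in> bimod_hom R S (obj C i) (obj C (i + 1))"
  "x \<in> car (obj C i) ==> dif C (i + 1) (dif C i x) = \<zero>\<^bsub>obj C (i + 2)\<^esub>"
 using assms unfolding bimod_complex_def by blast+

lemma tensor_double_complex:
 fixes C :: "(('r, 's, 'm) bimod, 'm) cpx" and L :: "(('s, 'n) module, 'n) cpx"
 assumes C: "bimod_complex K R S C" and L: "cochain_complex S L"
 shows "double_complex R (%j k. tensor (obj C j) S (obj L k))
  (%j k. tmap (obj C (j + 1)) S (obj L k) (dif C j) (%y. y))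
  (%j k. tmap (obj C j) S (obj L (k + 1)) (%x. x) (dif L k)) (tensor_cpx C S L)"
proof -
 note Cb = bimod_complexD(1)[OF C] and dC = bimod_complexD(2)[OF C] and Lm = cpxD(1)[OF L] and dL = cpxD(2)[OF L]
 note TP = tensor_pairI[OF Cb Lm]
 have id: "(%x. x) \<in> bimod_hom R S (obj C j) (obj C j)" for j by (simp add: bimod_hom_def lmod_hom_def)
 note r = rmod_hom_of_bimod_hom[OF dC]
 have dC2: "(%x. dif C (j + 1) (dif C j x)) \<in> rmod_hom S (obj C j) (obj C (j + 2))" for j
  using rmod_hom_of_bimod_hom[OF bimod_hom_comp[OF dC[of j] dC[of "j + 1"]]] by (simp add: add.commute)
 have dL2: "(%x. dif L (k + 1) (dif L k x)) \<in> lmod_hom S (obj L k) (obj L (k + 2))" for k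
  using lmod_hom_comp[OF dL[of k] dL[of "k + 1"]] by (simp add: add.commute)
 have dC1: "dif C (j + 1) \<in> rmod_hom S (obj C (j + 1)) (obj C (j + 2))" for j using r[of "j + 1"] by (simp add: add.commute)
 have dL1: "dif L (k + 1) \<in> lmod_hom S (obj L (k + 1)) (obj L (k + 2))" for k using dL[of "k + 1"] by (simp add: add.commute)
 show ?thesis
 proof (rule double_complex.intro)
  show "ring R" using Cb[of 0] by (simp add: bimodule_def lmodule_def)
  fix j k
  show "lmodule R (tensor (obj C j) S (obj L k))" by (rule lmodule_tensor[OF Cb Lm])
  show "tmap (obj C (j + 1)) S (obj L k) (dif C j) (%y. y) \<in> lmod_hom R (tensor (obj C j) S (obj L k)) (tensor (obj C (j + 1)) S (obj L k))"
   by (rule tensor_map_lmod_hom[OF Cb Lm Cb Lm dC lmod_hom_id])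
  show "tmap (obj C j) S (obj L (k + 1)) (%x. x) (dif L k) \<in> lmod_hom R (tensor (obj C j) S (obj L k)) (tensor (obj C j) S (obj L (k + 1)))"
   by (rule tensor_map_lmod_hom[OF Cb Lm Cb Lm id dL])
  fix x assume "x \<in> car (tensor (obj C j) S (obj L k))"
  then have x: "x \<in> car (tgrp (obj C j) S (obj L k))" by simp
  interpret T: tensor_pair "obj C j" S "obj L k" by (rule TP)
  have "tmap (obj C (j + 2)) S (obj L k) (dif C (j + 1)) (%y. y) (tmap (obj C (j + 1)) S (obj L k) (dif C j) (%y. y) x) =
    tmap (obj C (j + 2)) S (obj L k) (%x. dif C (j + 1) (dif C j x)) (%y. y) x"
   by (rule tensor_map_comp[OF TP TP TP r dC1 lmod_hom_id lmod_hom_id dC2 lmod_hom_id refl refl x])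
  also have "\<dots> = \<zero>\<^bsub>tgrp (obj C (j + 2)) S (obj L k)\<^esub>"
  proof -
   interpret T2: tensor_pair "obj C (j + 2)" S "obj L k" by (rule TP)
   show ?thesis
    by (rule T.add_hom_eqI[OF tensor_map_hom[OF TP TP dC2 lmod_hom_id] add_hom_const_zero[OF T2.T.abg] _ x])
     (simp add: tensor_map_pure[OF TP TP dC2 lmod_hom_id] bimod_complexD(3)[OF C])
  qed
  finally show "tmap (obj C (j + 1 + 1)) S (obj L k) (dif C (j + 1)) (%y. y) (tmap (obj C (j + 1)) S (obj L k) (dif C j) (%y. y) x) =
    \<zero>\<^bsub>tensor (obj C (j + 2)) S (obj L k)\<^esub>" by (simp add: add.commute)
  have "tmap (obj C j) S (obj L (k + 2)) (%x. x) (dif L (k + 1)) (tmap (obj C j) S (obj L (k + 1)) (%x. x) (dif L k) x) =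
    tmap (obj C j) S (obj L (k + 2)) (%x. x) (%x. dif L (k + 1) (dif L k x)) x"
   by (rule tensor_map_comp[OF TP TP TP rmod_hom_id rmod_hom_id dL dL1 rmod_hom_id dL2 refl refl x])
  also have "\<dots> = \<zero>\<^bsub>tgrp (obj C j) S (obj L (k + 2))\<^esub>"
  proof -
   interpret T2: tensor_pair "obj C j" S "obj L (k + 2)" by (rule TP)
   show ?thesis
    by (rule T.add_hom_eqI[OF tensor_map_hom[OF TP TP rmod_hom_id dL2] add_hom_const_zero[OF T2.T.abg] _ x])
     (simp add: tensor_map_pure[OF TP TP rmod_hom_id dL2] cpxD(3)[OF L])
  qed
  finally show "tmap (obj C j) S (obj L (k + 1 + 1)) (%x. x) (dif L (k + 1)) (tmap (obj C j) S (obj L (k + 1)) (%x. x) (dif L k) x) =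
    \<zero>\<^bsub>tensor (obj C j) S (obj L (k + 2))\<^esub>" by (simp add: add.commute)
  have "tmap (obj C (j + 1)) S (obj L (k + 1)) (dif C j) (%y. y) (tmap (obj C j) S (obj L (k + 1)) (%x. x) (dif L k) x) =
    tmap (obj C (j + 1)) S (obj L (k + 1)) (dif C j) (dif L k) x"
   by (rule tensor_map_comp[OF TP TP TP rmod_hom_id r dL lmod_hom_id r dL refl refl x])
  also have "\<dots> = tmap (obj C (j + 1)) S (obj L (k + 1)) (%x. x) (dif L k) (tmap (obj C (j + 1)) S (obj L k) (dif C j) (%y. y) x)"
   by (rule tensor_map_comp[OF TP TP TP r rmod_hom_id lmod_hom_id dL r dL refl refl x, symmetric])
  finally show "tmap (obj C (j + 1)) S (obj L (k + 1)) (dif C j) (%y. y) (tmap (obj C j) S (obj L (k + 1)) (%x. x) (dif L k) x) =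
    tmap (obj C (j + 1)) S (obj L (k + 1)) (%x. x) (dif L k) (tmap (obj C (j + 1)) S (obj L k) (dif C j) (%y. y) x)" .
 next
  fix n
  show "obj (tensor_cpx C S L) n = dsum (%j. tensor (obj C j) S (obj L (n - j)))" by (simp add: tensor_cpx_def)
  fix u j
  have i: "n - j + 1 = n + 1 - j" by simp
  show "dif (tensor_cpx C S L) n u j = tmap (obj C (j - 1 + 1)) S (obj L (n + 1 - j)) (dif C (j - 1)) (%y. y) (u (j - 1))
    \<oplus>\<^bsub>tensor (obj C j) S (obj L (n + 1 - j))\<^esub>
    (if even j then tmap (obj C j) S (obj L (n - j + 1)) (%x. x) (dif L (n - j)) (u j)
     else \<ominus>\<^bsub>tensor (obj C j) S (obj L (n + 1 - j))\<^esub> tmap (obj C j) S (obj L (n - j + 1)) (%x. x) (dif L (n - j)) (u j))"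
   unfolding i by (simp add: tensor_cpx_def Let_def)
 qed
qed

lemma tensor_trivial:
 assumes "bimodule K R S M" "lmodule S N" "car M = {\<zero>\<^bsub>M\<^esub>} \<or> car N = {\<zero>\<^bsub>N\<^esub>}"
 shows "car (tgrp M S N) = {\<zero>\<^bsub>tgrp M S N\<^esub>}"
proof -
 interpret tensor_pair M S N by (rule tensor_pairI[OF assms(1,2)])
 have "u = \<zero>\<^bsub>tgrp M S N\<^esub>" if "u \<in> car (tgrp M S N)" for u
  using that
 proof (induction u rule: tensor_induct)
  case (pure x y)
  then show ?case using assms(3) pure_zero_left[of y] pure_zero_right[of x] by auto
 next
  case (add u v)
  then show ?case using T.l_zero[OF T.zero_closed] by simp
 qed
 then show ?thesis using T.zero_closed by auto
qed

lemma tensor_cpx_Db: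
 fixes A :: "('k, 'a) module" and C :: "(('a, 'a, 'm) bimod, 'm) cpx" and L :: "(('a, 'n) module, 'n) cpx"
 assumes A: "k_algebra K A" "kfin K A (reg A)" and C: "bimod_complex K A A C" "!!i. kfin K A (obj C i)"
  and bd: "!!j. j < - int N \<or> j > 0 ==> car (obj C j) = {\<zero>\<^bsub>obj C j\<^esub>}" and L: "L \<in> Db A"
 shows "tensor_cpx C A L \<in> Db A"
proof -
 have cL: "cochain_complex A L" and fg: "!!i. fin_gen A (obj L i)" using L by (auto simp: Db_def)
 note Lm = cpxD(1)[OF cL] and Cb = bimod_complexD(1)[OF C(1)]
 have Lk: "kfin K A (obj L i)" for i by (rule kfin_of_fin_gen[OF A Lm fg])
 interpret double_complex A "%j k. tensor (obj C j) A (obj L k)" "%j k. tmap (obj C (j + 1)) A (obj L k) (dif C j) (%y. y)"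
  "%j k. tmap (obj C j) A (obj L (k + 1)) (%x. x) (dif L k)" "tensor_cpx C A L"
  by (rule tensor_double_complex[OF C(1) cL])
 have fin: "kfin K A (obj (tensor_cpx C A L) n)" for n
  unfolding obj_Tot
 proof (rule kfin_dsum[OF A(1)])
  show "finite {- int N..0}" by simp
  show "car (tensor (obj C i) A (obj L (n - i))) = {\<zero>\<^bsub>tensor (obj C i) A (obj L (n - i))\<^esub>}" if "i \<notin> {- int N..0}" for i
   using tensor_trivial[OF Cb Lm, of i "n - i"] bd[of i] that by auto
  show "kfin K A (tensor (obj C i) A (obj L (n - i)))" for i by (rule kfin_tensor[OF Cb C(2) Lm Lk])
 qed (rule G)
 obtain B where B: "!!i. \<bar>i\<bar> > B ==> car (obj L i) = {\<zero>\<^bsub>obj L i\<^esub>}" using L by (auto simp: Db_def)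
 have "car (obj (tensor_cpx C A L) n) = {\<zero>\<^bsub>obj (tensor_cpx C A L) n\<^esub>}" if n: "\<bar>n\<bar> > int N + \<bar>B\<bar>" for n
 proof -
  have "car (tgrp (obj C j) A (obj L (n - j))) = {\<zero>\<^bsub>tgrp (obj C j) A (obj L (n - j))\<^esub>}" for j
  proof (rule tensor_trivial[OF Cb Lm])
   show "car (obj C j) = {\<zero>\<^bsub>obj C j\<^esub>} \<or> car (obj L (n - j)) = {\<zero>\<^bsub>obj L (n - j)\<^esub>}"
   proof (cases "j < - int N \<or> j > 0")
    case True
    then show ?thesis using bd by blast
   next
    case False
    then have "\<bar>n - j\<bar> > B" using n by linarith
    then show ?thesis using B by blast
   qed
  qed
  then show ?thesis by (auto simp: Tot_mem Tot_zero fun_eq_iff)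
 qed
 then show ?thesis
  unfolding Db_def using Tot_complex kfin_imp_fin_gen[OF A(1) fin] by blast
qed

section \<open>The twist complex\<close>

definition sub_bimodule where
 "sub_bimodule R S M B \<longleftrightarrow> B \<subseteq> car M \<and> \<zero>\<^bsub>M\<^esub> \<in> B \<and> (\<forall>x\<in>B. \<forall>y\<in>B. x \<oplus>\<^bsub>M\<^esub> y \<in> B) \<and> (\<forall>x\<in>B. \<ominus>\<^bsub>M\<^esub> x \<in> B) \<and>
  (\<forall>r\<in>car R. \<forall>x\<in>B. r \<odot>\<^bsub>M\<^esub> x \<in> B) \<and> (\<forall>s\<in>car S. \<forall>x\<in>B. rsmult M x s \<in> B)"

lemma sub_bimodule_image:
 assumes M: "bimodule K R S M" and g: "g \<in> bimod_hom R S N M" and N: "abelian_group N"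
  and Nr: "!!r x. [|r \<in> car R; x \<in> car N|] ==> r \<odot>\<^bsub>N\<^esub> x \<in> car N"
  and Ns: "!!s x. [|s \<in> car S; x \<in> car N|] ==> rsmult N x s \<in> car N"
 shows "sub_bimodule R S M (g ` car N)"
proof -
 interpret M: bimodule K R S M by fact
 interpret N: abelian_group N by fact
 have z: "\<zero>\<^bsub>M\<^esub> \<in> g ` car N"
  using add_hom_zero[OF N.abg M.M.abg bimod_homD(2)[OF g]] N.zero_closed by (metis imageI)
 show ?thesis
  unfolding sub_bimodule_def
 proof (intro conjI ballI z)
  show "g ` car N \<subseteq> car M" using bimod_homD(3)[OF g] by auto
 qed (clarsimp simp: bimod_homD(4-6)[OF g, symmetric] Nr Ns
   add_hom_neg[OF N.abg M.M.abg bimod_homD(2)[OF g], symmetric])+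
qed

text \<open>
  The composite of the projection onto \<open>M / B\<close> with the isomorphism \<open>h\<close>.
\<close>

lemma quot_iso_projection:
 assumes M: "bimodule K R S M" and N: "bimodule K R S N" and h: "h \<in> bimod_iso R S (quot_bimod M B) N"
  and sB: "sub_bimodule R S M B"
 defines "f \<equiv> %y. h (a_r_coset M B y)"
 shows "f \<in> bimod_hom R S M N" "f ` car M = car N" "x \<in> car M ==> f x = \<zero>\<^bsub>N\<^esub> \<longleftrightarrow> x \<in> B"
proof -
 interpret M: bimodule K R S M by fact
 interpret N: bimodule K R S N by fact
 have B: "B \<subseteq> car M" "\<zero>\<^bsub>M\<^esub> \<in> B" "!!x y. [|x \<in> B; y \<in> B|] ==> x \<oplus>\<^bsub>M\<^esub> y \<in> B" "!!x. x \<in> B ==> \<ominus>\<^bsub>M\<^esub> x \<in> B"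
   "!!r x. [|r \<in> car R; x \<in> B|] ==> r \<odot>\<^bsub>M\<^esub> x \<in> B" "!!s x. [|s \<in> car S; x \<in> B|] ==> rsmult M x s \<in> B"
  using sB by (simp_all add: sub_bimodule_def)
 let ?Q = "quot_bimod M B" and ?c = "a_r_coset M B"
 have hh: "h \<in> bimod_hom R S ?Q N" and hb: "bij_betw h (car ?Q) (car N)" using h by (auto simp: bimod_iso_def)
 have qs: "car ?Q = ?c ` car M" "ring.add ?Q = set_add M" "smult ?Q = (%r U. set_add M B (smult M r ` U))"
  "rsmult ?Q = (%U s. set_add M B ((%x. rsmult M x s) ` U))" by (simp_all add: quot_bimod_def)
 have Bc: "b \<in> car M" if "b \<in> B" for b using B(1) that by auto
 note crules = M.M.a_closed
 have xin: "x \<in> ?c x" if "x \<in> car M" for x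
  using B(2) that M.M.l_zero[OF that] by (force simp: a_r_coset_def')
 have ceq: "?c x = ?c y \<longleftrightarrow> x \<ominus>\<^bsub>M\<^esub> y \<in> B" if "x \<in> car M" "y \<in> car M" for x y
  by (rule coset_rules(2)[OF M.M.abg B(1,2) _ _ that]) (use B(3,4) in blast)+
 have cadd: "set_add M (?c x) (?c y) = ?c (x \<oplus>\<^bsub>M\<^esub> y)" if xy: "x \<in> car M" "y \<in> car M" for x y
 proof (intro equalityI subsetI)
  fix z assume "z \<in> set_add M (?c x) (?c y)"
  then obtain b c where b: "b \<in> B" "c \<in> B" "z = (b \<oplus>\<^bsub>M\<^esub> x) \<oplus>\<^bsub>M\<^esub> (c \<oplus>\<^bsub>M\<^esub> y)" by (auto simp: a_r_coset_def' set_add_def')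
  then have "z = (b \<oplus>\<^bsub>M\<^esub> c) \<oplus>\<^bsub>M\<^esub> (x \<oplus>\<^bsub>M\<^esub> y)" using xy Bc by (simp add: M.M.a_ac)
  then show "z \<in> ?c (x \<oplus>\<^bsub>M\<^esub> y)" using B(3)[OF b(1,2)] by (auto simp: a_r_coset_def')
 next
  fix z assume "z \<in> ?c (x \<oplus>\<^bsub>M\<^esub> y)"
  then obtain b where b: "b \<in> B" "z = b \<oplus>\<^bsub>M\<^esub> (x \<oplus>\<^bsub>M\<^esub> y)" by (auto simp: a_r_coset_def')
  then have "z = (b \<oplus>\<^bsub>M\<^esub> x) \<oplus>\<^bsub>M\<^esub> y" using xy Bc by (simp add: M.M.a_assoc)
  moreover have "b \<oplus>\<^bsub>M\<^esub> x \<in> ?c x" using b(1) by (auto simp: a_r_coset_def')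
  ultimately show "z \<in> set_add M (?c x) (?c y)" using xin[OF xy(2)] by (auto simp: set_add_def')
 qed
 have cact: "set_add M B (g ` ?c x) = ?c (g x)" if x: "x \<in> car M" and g: "g \<in> add_hom M M" and gB: "!!b. b \<in> B ==> g b \<in> B" for g x
 proof (intro equalityI subsetI)
  fix z assume "z \<in> set_add M B (g ` ?c x)"
  then obtain b c where b: "b \<in> B" "c \<in> B" "z = b \<oplus>\<^bsub>M\<^esub> g (c \<oplus>\<^bsub>M\<^esub> x)" by (auto simp: a_r_coset_def' set_add_def')
  then have "z = (b \<oplus>\<^bsub>M\<^esub> g c) \<oplus>\<^bsub>M\<^esub> g x" using x Bc by (simp add: add_hom_add[OF g] add_hom_closed[OF g] M.M.a_assoc)
  then show "z \<in> ?c (g x)" using B(3)[OF b(1) gB[OF b(2)]] by (auto simp: a_r_coset_def')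
 next
  fix z assume "z \<in> ?c (g x)"
  then obtain b where b: "b \<in> B" "z = b \<oplus>\<^bsub>M\<^esub> g x" by (auto simp: a_r_coset_def')
  then show "z \<in> set_add M B (g ` ?c x)" using xin[OF x] by (auto simp: set_add_def')
 qed
 have cin: "?c x \<in> car ?Q" if "x \<in> car M" for x using that by (simp add: qs)
 show f: "f \<in> bimod_hom R S M N"
 proof (intro bimod_homI add_homI)
  fix x assume "x \<in> car M" then show "f x \<in> car N" unfolding f_def by (rule bimod_homD(3)[OF hh cin])
 next
  fix x y assume "x \<in> car M" "y \<in> car M"
  then show "f (x \<oplus>\<^bsub>M\<^esub> y) = f x \<oplus>\<^bsub>N\<^esub> f y"
   using bimod_homD(4)[OF hh cin cin, of x y] by (simp add: f_def qs cadd)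
 next
  fix r x assume "r \<in> car R" "x \<in> car M"
  then show "f (r \<odot>\<^bsub>M\<^esub> x) = r \<odot>\<^bsub>N\<^esub> f x"
   using bimod_homD(5)[OF hh _ cin, of r x] cact[OF _ M.sc_right_hom[of r] B(5), of x] by (simp add: f_def qs)
 next
  fix s x assume "s \<in> car S" "x \<in> car M"
  then show "f (rsmult M x s) = rsmult N (f x) s"
   using bimod_homD(6)[OF hh _ cin, of s x] cact[OF _ M.rs_hom[of s] B(6), of x] by (simp add: f_def qs)
 qed
 show "f ` car M = car N"
  using hb unfolding bij_betw_def qs f_def by (simp add: image_image)
 assume x: "x \<in> car M"
 have f0: "f \<zero>\<^bsub>M\<^esub> = \<zero>\<^bsub>N\<^esub>" by (rule lmod_hom_zero[OF M.lmod N.lmod bimod_homD(1)[OF f]])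
 have "f x = \<zero>\<^bsub>N\<^esub> \<longleftrightarrow> f x = f \<zero>\<^bsub>M\<^esub>" using f0 by simp
 also have "\<dots> \<longleftrightarrow> ?c x = ?c \<zero>\<^bsub>M\<^esub>"
  using hb cin[OF x] cin[OF M.M.zero_closed] unfolding bij_betw_def inj_on_def f_def by auto
 also have "\<dots> \<longleftrightarrow> x \<in> B" using ceq[OF x M.M.zero_closed] x by (simp add: a_minus_def)
 finally show "f x = \<zero>\<^bsub>N\<^esub> \<longleftrightarrow> x \<in> B" .
qed

lemma bimodule_zero_carrier: "bimodule K R S M ==> bimodule K R S (M\<lparr>carrier := {\<zero>\<^bsub>M\<^esub>}\<rparr>)"
proof -
 assume "bimodule K R S M"
 then interpret bimodule K R S M .
 interpret S: ring S by (rule ringS)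
 have l: "lmodule R (M\<lparr>carrier := {\<zero>\<^bsub>M\<^esub>}\<rparr>)"
  by (rule lmoduleI[OF R.ring_axioms abelian_groupI]) auto
 show ?thesis
  by (rule bimoduleI[OF l kR kS]) (use kscalar_closed[OF kR] kscalar_closed[OF kS] in auto)
qed

locale twisted_setup = projective_setup K A P
 for K :: "'k ring" and A :: "('k, 'a) module" and P :: "('a, 'p) module" +
 fixes n :: nat and \<sigma> :: "('p => 'p) => 'p => 'p" and Y :: "(('p => 'p, 'p => 'p, 'y) bimod, 'y) cpx"
  and \<iota> :: "('p => 'p) => 'y" and h :: "'y set => 'p => 'p"
 assumes tr: "truncated_resolution K (End_op A P) n \<sigma> Y \<iota> h"
begin

lemmas tr1 = tr[unfolded truncated_resolution_def conj_assoc]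
lemmas tr2 = tr1[THEN conjunct2, THEN conjunct2, THEN conjunct2]
lemmas tr3 = tr2[THEN conjunct2, THEN conjunct2]
lemmas tr4 = tr3[THEN conjunct2, THEN conjunct2]
lemmas n1 = tr1[THEN conjunct1]
lemmas \<sigma> = tr1[THEN conjunct2, THEN conjunct1]
lemmas Yp = tr2[THEN conjunct1, rule_format, THEN conjunct1]
lemmas Yfg = tr2[THEN conjunct1, rule_format, THEN conjunct2, THEN conjunct1]
lemmas dY = tr2[THEN conjunct1, rule_format, THEN conjunct2, THEN conjunct2]
lemmas Ytriv = tr2[THEN conjunct2, THEN conjunct1, rule_format]
lemmas \<iota> = tr3[THEN conjunct1]
lemmas \<iota>_inj = tr3[THEN conjunct2, THEN conjunct1]
lemmas Yex = tr4[THEN conjunct1, rule_format, OF conjI]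
lemmas h = tr4[THEN conjunct2]

lemma Yb: "bimodule K E E (obj Y i)" using Yp[of i] by (simp add: projective_bimodule_def)
lemma Yk: "kfin K E (obj Y i)" by (rule kfin_of_bimod_fin_gen[OF Yb Yfg finE finE])
lemma rE: "bimodule K E E (reg E)" by (rule bimodule_reg[OF E])

lemma Ym: "lmodule E (obj Y i)" by (rule lmodule_of_bimodule[OF Yb])

lemma twisted_simps:
 "car (twisted_reg E \<sigma>) = car E" "\<zero>\<^bsub>twisted_reg E \<sigma>\<^esub> = \<zero>\<^bsub>E\<^esub>" "ring.add (twisted_reg E \<sigma>) = ring.add E"
 "smult (twisted_reg E \<sigma>) = monoid.mult E" "rsmult (twisted_reg E \<sigma>) x e = x \<otimes>\<^bsub>E\<^esub> \<sigma> e"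
 by (simp_all add: twisted_reg_def)

lemma E_mult: "[|x \<in> car E; y \<in> car E|] ==> x \<otimes>\<^bsub>E\<^esub> y \<in> car E"
 by (rule monoid.m_closed[OF ring.axioms(2)[OF k_algebraD(2)[OF E]]])

abbreviation "I0 \<equiv> incoming_image E n Y \<iota> 0"

lemma I0_sub: "sub_bimodule E E (obj Y 0) I0"
proof (cases "n = 1")
 case True
 have e: "I0 = \<iota> ` car (twisted_reg E \<sigma>)" using True by (simp add: incoming_image_def twisted_simps)
 have "\<sigma> s \<in> car E" if "s \<in> car E" for s using \<sigma> that by (auto simp: ring_iso_def ring_hom_def)
 moreover have "abelian_group (twisted_reg E \<sigma>)" by (rule abelian_group_cong[OF ring.is_abelian_group[OF k_algebraD(2)[OF E]]]) (simp_all add: twisted_simps)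
 moreover have "\<iota> \<in> bimod_hom E E (twisted_reg E \<sigma>) (obj Y 0)" using \<iota> True by simp
 ultimately show ?thesis
  unfolding e by (intro sub_bimodule_image[OF Yb]) (simp_all only: twisted_simps E_mult)
next
 case False
 then have e: "I0 = dif Y (- 1) ` car (obj Y (- 1))" using n1 by (simp add: incoming_image_def)
 have d: "dif Y (- 1) \<in> bimod_hom E E (obj Y (- 1)) (obj Y 0)" using dY[of "- 1"] by simp
 interpret Y1: bimodule K E E "obj Y (- 1)" by (rule Yb)
 show ?thesis unfolding e by (rule sub_bimodule_image[OF Yb d Y1.M.abg Y1.sc_closed Y1.rs_closed])
qed

lemma I0_closed:
 "I0 \<subseteq> car (obj Y 0)" "\<zero>\<^bsub>obj Y 0\<^esub> \<in> I0" "[|x \<in> I0; y \<in> I0|] ==> x \<oplus>\<^bsub>obj Y 0\<^esub> y \<in> I0" "x \<in> I0 ==> \<ominus>\<^bsub>obj Y 0\<^esub> x \<in> I0"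
 "[|e \<in> car E; x \<in> I0|] ==> e \<odot>\<^bsub>obj Y 0\<^esub> x \<in> I0" "[|e \<in> car E; x \<in> I0|] ==> rsmult (obj Y 0) x e \<in> I0"
 using I0_sub by (simp_all add: sub_bimodule_def)

abbreviation "f \<equiv> augmentation E n Y \<iota> h"

lemma f_eq: "f = (%y. h (a_r_coset (obj Y 0) I0 y))"
 by (auto simp: augmentation_def)

lemma f: "f \<in> bimod_hom E E (obj Y 0) (reg E)"
 unfolding f_eq by (rule quot_iso_projection(1)[OF Yb rE h I0_sub])

lemma f_surj: "f ` car (obj Y 0) = car E"
 unfolding f_eq using quot_iso_projection(2)[OF Yb rE h I0_sub] by simp

lemma f_ker: "y \<in> car (obj Y 0) ==> f y = \<zero>\<^bsub>E\<^esub> \<longleftrightarrow> y \<in> I0"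
 unfolding f_eq using quot_iso_projection(3)[OF Yb rE h I0_sub] by simp

end

lemma bimod_hom_id: "(%x. x) \<in> bimod_hom R S M M"
 by (simp add: bimod_hom_def lmod_hom_def)

lemma bimod_hom_uminus:
 assumes M: "bimodule K R S N" and f: "f \<in> bimod_hom R S M N"
 shows "(%x. \<ominus>\<^bsub>N\<^esub> f x) \<in> bimod_hom R S M N"
proof -
 interpret bimodule K R S N by fact
 show ?thesis
  using add_hom_uminus[OF M.abg bimod_homD(2)[OF f]]
  by (intro bimod_homI) (simp_all add: bimod_homD[OF f] sc_rneg rs_neg)
qed

lemma bimod_hom_const_zero:
 assumes "bimodule K R S N"
 shows "(%x. \<zero>\<^bsub>N\<^esub>) \<in> bimod_hom R S M N"
proof -
 interpret bimodule K R S N by fact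
 show ?thesis by (auto simp: bimod_hom_def lmod_hom_def)
qed

lemma bimod_hom_zero:
 assumes "bimodule K R S M" "bimodule K R S N" "f \<in> bimod_hom R S M N"
 shows "f \<zero>\<^bsub>M\<^esub> = \<zero>\<^bsub>N\<^esub>"
 by (rule lmod_hom_zero[OF lmodule_of_bimodule[OF assms(1)] lmodule_of_bimodule[OF assms(2)] bimod_homD(1)[OF assms(3)]])

context twisted_setup
begin

lemma dYdY: "x \<in> car (obj Y i) ==> dif Y (i + 1) (dif Y i x) = \<zero>\<^bsub>obj Y (i + 2)\<^esub>"
proof -
 assume x: "x \<in> car (obj Y i)"
 have d1: "dif Y (i + 1) \<in> bimod_hom E E (obj Y (i + 1)) (obj Y (i + 2))" using dY[of "i + 1"] by (simp add: add.commute)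
 have dx: "dif Y i x \<in> car (obj Y (i + 1))" by (rule bimod_homD(3)[OF dY x])
 have z: "dif Y (i + 1) \<zero>\<^bsub>obj Y (i + 1)\<^esub> = \<zero>\<^bsub>obj Y (i + 2)\<^esub>" by (rule bimod_hom_zero[OF Yb Yb d1])
 consider "i + 2 > 0" | "i < 1 - int n" | "1 - int n \<le> i" "i + 1 < 0" by linarith
 then show ?thesis
 proof cases
  case 1
  then show ?thesis using bimod_homD(3)[OF d1 dx] Ytriv[of "i + 2"] by auto
 next
  case 2
  then have "x = \<zero>\<^bsub>obj Y i\<^esub>" using x Ytriv[of i] by auto
  then show ?thesis using bimod_hom_zero[OF Yb Yb dY] z by simp
 next
  case 3
  then have "incoming_image E n Y \<iota> (i + 1) = dif Y i ` car (obj Y i)" by (simp add: incoming_image_def)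
  then have "dif Y i x \<in> {x \<in> car (obj Y (i + 1)). dif Y (i + 1) x = \<zero>\<^bsub>obj Y (i + 1 + 1)\<^esub>}"
   using x Yex[of "i + 1"] 3 by simp
  then show ?thesis by (simp add: add.commute)
 qed
qed

text \<open>
  The image of the differential is the subspace that is divided out in the definition of the augmentation.
\<close>

lemma f_d: "x \<in> car (obj Y (- 1)) ==> f (dif Y (- 1) x) = \<zero>\<^bsub>E\<^esub>"
proof -
 assume x: "x \<in> car (obj Y (- 1))"
 have d: "dif Y (- 1) \<in> bimod_hom E E (obj Y (- 1)) (obj Y 0)" using dY[of "- 1"] by simp
 show ?thesis
 proof (cases "n = 1")
  case True
  then have "x = \<zero>\<^bsub>obj Y (- 1)\<^esub>" using x Ytriv[of "- 1"] by auto
  then have "dif Y (- 1) x \<in> I0" using bimod_hom_zero[OF Yb Yb d] I0_closed(2) by simp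
  then show ?thesis using f_ker[OF bimod_homD(3)[OF d x]] by simp
 next
  case False
  then have "dif Y (- 1) x \<in> I0" using x n1 by (simp add: incoming_image_def)
  then show ?thesis using f_ker[OF bimod_homD(3)[OF d x]] by simp
 qed
qed

text \<open>
  The complexes \<open>P \<otimes>\<^sub>E Y\<close> and \<open>P \<otimes>\<^sub>E Y \<otimes>\<^sub>E P\<^sup>\<or>\<close>.
\<close>

abbreviation "Tn i \<equiv> tbim (P_bimod P) E (obj Y i)"
abbreviation "Sn i \<equiv> tbim (Tn i) E Pd"
definition "dT i = tmap (P_bimod P) E (obj Y (i + 1)) (%p. p) (dif Y i)"
definition "dS i = tmap (Tn (i + 1)) E Pd (dT i) (%\<phi>. \<phi>)"

lemma Tb: "bimodule K A E (Tn i)" by (rule bimodule_tensor[OF Pb.bm Yb])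
lemma Sb: "bimodule K A A (Sn i)" by (rule bimodule_tensor[OF Tb Pd.bm])
lemma Tk: "kfin K A (Tn i)" by (rule kfin_tensor_bimod[OF Pb.bm finPb Yb Yk])
lemma Sk: "kfin K A (Sn i)" by (rule kfin_tensor_bimod[OF Tb Tk Pd.bm finPd])

lemma PYp: "tensor_pair (P_bimod P) E (obj Y i)" by (rule tensor_pairI[OF Pb.bm Ym])
lemma TPp: "tensor_pair (Tn i) E Pd" by (rule tensor_pairI[OF Tb Pd.lmod])

lemma dT_hom: "dT i \<in> bimod_hom A E (Tn i) (Tn (i + 1))"
 unfolding dT_def by (rule tensor_map_bimod_hom[OF Pb.bm Yb Pb.bm Yb bimod_hom_id dY])

lemma dS_hom: "dS i \<in> bimod_hom A A (Sn i) (Sn (i + 1))"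
 unfolding dS_def by (rule tensor_map_bimod_hom[OF Tb Pd.bm Tb Pd.bm dT_hom bimod_hom_id])

lemma dT_pure: "[|p \<in> car P; y \<in> car (obj Y i)|] ==>
 dT i (pure (P_bimod P) E (obj Y i) p y) = pure (P_bimod P) E (obj Y (i + 1)) p (dif Y i y)"
 unfolding dT_def by (rule tensor_map_pure[OF PYp PYp rmod_hom_id bimod_homD(1)[OF dY]]) simp_all

lemma dS_pure: "[|t \<in> car (Tn i); \<phi> \<in> car Pd|] ==> dS i (pure (Tn i) E Pd t \<phi>) = pure (Tn (i + 1)) E Pd (dT i t) \<phi>"
 unfolding dS_def by (rule tensor_map_pure[OF TPp TPp rmod_hom_of_bimod_hom[OF dT_hom] lmod_hom_id])

lemma T_eqI:
 assumes "g \<in> add_hom (Tn i) G" "g' \<in> add_hom (Tn i) G"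
  "!!p y. [|p \<in> car P; y \<in> car (obj Y i)|] ==> g (pure (P_bimod P) E (obj Y i) p y) = g' (pure (P_bimod P) E (obj Y i) p y)"
  "t \<in> car (Tn i)"
 shows "g t = g' t"
 by (rule tensor_pair.add_hom_eqI[OF PYp, of g _ G g']) (use assms in "simp_all add: add_hom_def")

lemma S_eqI:
 assumes g: "g \<in> add_hom (Sn i) G" "g' \<in> add_hom (Sn i) G"
  and eq: "!!t \<phi>. [|t \<in> car (Tn i); \<phi> \<in> car Pd|] ==> g (pure (Tn i) E Pd t \<phi>) = g' (pure (Tn i) E Pd t \<phi>)"
  and s: "s \<in> car (Sn i)"
 shows "g s = g' s"
 by (rule tensor_pair.add_hom_eqI[OF TPp, of g _ G g']) (use assms in "simp_all add: add_hom_def")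

lemma dTdT: "t \<in> car (Tn i) ==> dT (i + 1) (dT i t) = \<zero>\<^bsub>Tn (i + 2)\<^esub>"
proof -
 assume t: "t \<in> car (Tn i)"
 have d1: "dT (i + 1) \<in> bimod_hom A E (Tn (i + 1)) (Tn (i + 2))" using dT_hom[of "i + 1"] by (simp add: add.commute)
 have 1: "(%t. dT (i + 1) (dT i t)) \<in> add_hom (Tn i) (Tn (i + 2))"
  by (rule add_hom_comp[OF bimod_homD(2)[OF dT_hom] bimod_homD(2)[OF d1]])
 show ?thesis
 proof (rule T_eqI[OF 1 add_hom_const_zero[OF abelian_of_bimodule[OF Tb]] _ t])
 fix p y assume h: "p \<in> car P" "y \<in> car (obj Y i)"
 interpret X2: tensor_pair "P_bimod P" E "obj Y (i + 2)" by (rule PYp)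
 show "dT (i + 1) (dT i (pure (P_bimod P) E (obj Y i) p y)) = \<zero>\<^bsub>Tn (i + 2)\<^esub>"
  using h dT_pure[OF h(1) bimod_homD(3)[OF dY h(2)]] dYdY[OF h(2)] by (simp add: dT_pure add.commute)
 qed
qed

lemma dSdS: "s \<in> car (Sn i) ==> dS (i + 1) (dS i s) = \<zero>\<^bsub>Sn (i + 2)\<^esub>"
proof -
 assume s: "s \<in> car (Sn i)"
 have d1: "dS (i + 1) \<in> bimod_hom A A (Sn (i + 1)) (Sn (i + 2))" using dS_hom[of "i + 1"] by (simp add: add.commute)
 have 1: "(%t. dS (i + 1) (dS i t)) \<in> add_hom (Sn i) (Sn (i + 2))"
  by (rule add_hom_comp[OF bimod_homD(2)[OF dS_hom] bimod_homD(2)[OF d1]])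
 show ?thesis
 proof (rule S_eqI[OF 1 add_hom_const_zero[OF abelian_of_bimodule[OF Sb]] _ s])
 fix t \<phi> assume h: "t \<in> car (Tn i)" "\<phi> \<in> car Pd"
 interpret X2: tensor_pair "Tn (i + 2)" E Pd by (rule TPp)
 show "dS (i + 1) (dS i (pure (Tn i) E Pd t \<phi>)) = \<zero>\<^bsub>Sn (i + 2)\<^esub>"
  using h dS_pure[OF bimod_homD(3)[OF dT_hom h(1)] h(2)] dTdT[OF h(1)] X2.pure_zero_left[OF h(2)] by (simp add: dS_pure add.commute)
 qed
qed

lemma ev_bal: "balanced (P_bimod P) E Pd A (%p \<phi>. \<phi> p)"
 by (rule balancedI) (simp_all add: Pd_add)

lemma mu_bal: "balanced (P_bimod P) E (reg E) P (%p e. rsmult (P_bimod P) p e)"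
 by (rule balancedI) (simp_all add: E_add)

abbreviation "ER \<equiv> reg E"

lemma PEp: "tensor_pair (P_bimod P) E ER" by (rule tensor_pairI[OF Pb.bm lmodule_of_bimodule[OF rE]])
lemma PPp: "tensor_pair (P_bimod P) E Pd" by (rule tensor_pairI[OF Pb.bm Pd.lmod])
lemma PEb: "bimodule K A E (tbim (P_bimod P) E ER)" by (rule bimodule_tensor[OF Pb.bm rE])
text \<open>
  The factors of the map \<open>g\<close> in degree zero: \<open>1 \<otimes> f\<close>, the isomorphism \<open>P \<otimes>\<^sub>E E \<cong> P\<close>, and evaluation.
\<close>

definition "m1 = tmap (P_bimod P) E ER (%p. p) f"
definition "m2 = lift P (%p e. rsmult (P_bimod P) p e)"
definition "ev = lift A (%p \<phi>. \<phi> p)"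

lemma A_ag: "abelian_group A" by (rule ring.is_abelian_group[OF k_algebraD(2)[OF A]])

lemma m1_hom: "m1 \<in> bimod_hom A E (Tn 0) (tbim (P_bimod P) E ER)"
 unfolding m1_def by (rule tensor_map_bimod_hom[OF Pb.bm Yb Pb.bm rE bimod_hom_id f])

lemma m1_pure: "[|p \<in> car P; y \<in> car (obj Y 0)|] ==> m1 (pure (P_bimod P) E (obj Y 0) p y) = pure (P_bimod P) E ER p (f y)"
 unfolding m1_def using tensor_map_pure[OF PYp PEp rmod_hom_id bimod_homD(1)[OF f], of p y] by simp

lemma P_rsmult: "rsmult (P_bimod P) = (%p e. e p)" by (simp add: fun_eq_iff)

lemma m2_pure: "[|p \<in> car P; e \<in> car E|] ==> m2 (pure (P_bimod P) E ER p e) = e p"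
 unfolding m2_def using tensor_pair.lift_pure[OF PEp P.M.abg mu_bal, of p e] by (simp add: P_rsmult)

lemma m2_hom: "m2 \<in> bimod_hom A E (tbim (P_bimod P) E ER) (P_bimod P)"
proof -
 interpret PE: tensor_pair "P_bimod P" E ER by (rule PEp)
 have lh: "m2 \<in> add_hom (tgrp (P_bimod P) E ER) P"
  unfolding m2_def by (rule PE.lift_add_hom[OF P.M.abg mu_bal])
 show ?thesis
 proof (rule bimod_homI)
  show "m2 \<in> add_hom (tbim (P_bimod P) E ER) (P_bimod P)" using lh by (simp add: add_hom_def)
  fix r u assume r: "r \<in> car A" and u: "u \<in> car (tbim (P_bimod P) E ER)"
  have "m2 (r \<odot>\<^bsub>tensor (P_bimod P) E ER\<^esub> u) = r \<odot>\<^bsub>P\<^esub> m2 u"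
   by (rule PE.add_hom_eqI[OF add_hom_comp[OF tensor_smult_add_hom[OF Pb.bm lmodule_of_bimodule[OF rE] r] lh] add_hom_comp[OF lh P.sc_right_hom[OF r]]])
    (use r u in "simp_all add: tensor_smult_pure[OF Pb.bm lmodule_of_bimodule[OF rE] r] m2_pure E_smult")
  then show "m2 (r \<odot>\<^bsub>tbim (P_bimod P) E ER\<^esub> u) = r \<odot>\<^bsub>P_bimod P\<^esub> m2 u"
   by (simp add: tensor_bimod_smult_eq[OF Pb.bm rE])
 next
  fix e u assume e: "e \<in> car E" and u: "u \<in> car (tbim (P_bimod P) E ER)"
  have eh: "(%x. e x) \<in> add_hom P P" using e by (intro add_homI) (simp_all add: E_add)
  have ee: "(\<lambda>p\<in>car P. e (e' p)) \<in> car E" if "e' \<in> car E" for e'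
   using E_mult[OF that e] by simp
  show "m2 (rsmult (tbim (P_bimod P) E ER) u e) = rsmult (P_bimod P) (m2 u) e"
   unfolding P_bimod_simps
   by (rule PE.add_hom_eqI[OF add_hom_comp[OF tensor_rsmult_add_hom[OF Pb.bm rE e] lh] add_hom_comp[OF lh eh]])
    (use e u ee in "simp_all add: tensor_rsmult_pure[OF Pb.bm rE e] m2_pure")
 qed
qed

lemma ev_pure: "[|p \<in> car P; \<phi> \<in> car Pd|] ==> ev (pure (P_bimod P) E Pd p \<phi>) = \<phi> p"
 unfolding ev_def using tensor_pair.lift_pure[OF PPp A_ag ev_bal, of p \<phi>] by simp

lemma ev_hom: "ev \<in> bimod_hom A A (tbim (P_bimod P) E Pd) (reg A)"
proof -
 interpret PP: tensor_pair "P_bimod P" E Pd by (rule PPp)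
 interpret rA: bimodule K A A "reg A" by (rule bimodule_reg[OF A])
 have lh: "ev \<in> add_hom (tgrp (P_bimod P) E Pd) (reg A)"
  using PP.lift_add_hom[OF A_ag ev_bal] unfolding ev_def by (simp add: add_hom_def)
 show ?thesis
 proof (rule bimod_homI)
  show "ev \<in> add_hom (tbim (P_bimod P) E Pd) (reg A)" using lh by (simp add: add_hom_def)
  fix r u assume r: "r \<in> car A" and u: "u \<in> car (tbim (P_bimod P) E Pd)"
  have "ev (r \<odot>\<^bsub>tensor (P_bimod P) E Pd\<^esub> u) = r \<odot>\<^bsub>reg A\<^esub> ev u"
   by (rule PP.add_hom_eqI[OF add_hom_comp[OF tensor_smult_add_hom[OF Pb.bm Pd.lmod r] lh] add_hom_comp[OF lh rA.sc_right_hom[OF r]]])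
    (use r u in "simp_all add: tensor_smult_pure[OF Pb.bm Pd.lmod r] ev_pure Pd_smult")
  then show "ev (r \<odot>\<^bsub>tbim (P_bimod P) E Pd\<^esub> u) = r \<odot>\<^bsub>reg A\<^esub> ev u"
   by (simp add: tensor_bimod_smult_eq[OF Pb.bm Pd.bm])
 next
  fix a u assume a: "a \<in> car A" and u: "u \<in> car (tbim (P_bimod P) E Pd)"
  show "ev (rsmult (tbim (P_bimod P) E Pd) u a) = rsmult (reg A) (ev u) a"
   by (rule PP.add_hom_eqI[OF add_hom_comp[OF tensor_rsmult_add_hom[OF Pb.bm Pd.bm a] lh] add_hom_comp[OF lh rA.rs_hom[OF a]]])
    (use a u Pd.rs_closed[OF a] in "simp_all add: tensor_rsmult_pure[OF Pb.bm Pd.bm a] ev_pure")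
 qed
qed

definition "G0 = twist_map A P Y f 0"

lemma G0_eq: "G0 = (%s. ev (tmap (P_bimod P) E Pd m2 (%\<phi>. \<phi>) (tmap (tbim (P_bimod P) E ER) E Pd m1 (%\<phi>. \<phi>) s)))"
 by (simp add: G0_def twist_map_def Let_def evaluation_def ev_def m1_def m2_def comp_def P_rsmult)

lemma G0_hom: "G0 \<in> bimod_hom A A (Sn 0) (reg A)"
 unfolding G0_eq
 by (rule bimod_hom_comp[OF bimod_hom_comp[OF tensor_map_bimod_hom[OF Tb Pd.bm PEb Pd.bm m1_hom bimod_hom_id]
    tensor_map_bimod_hom[OF PEb Pd.bm Pb.bm Pd.bm m2_hom bimod_hom_id]] ev_hom])

lemma G0_pure: "[|t \<in> car (Tn 0); \<phi> \<in> car Pd|] ==> G0 (pure (Tn 0) E Pd t \<phi>) = \<phi> (m2 (m1 t))"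
proof -
 assume t: "t \<in> car (Tn 0)" and \<phi>: "\<phi> \<in> car Pd"
 have c1: "m1 t \<in> car (tbim (P_bimod P) E ER)" by (rule bimod_homD(3)[OF m1_hom t])
 have c2: "m2 (m1 t) \<in> car P" using bimod_homD(3)[OF m2_hom c1] by simp
 note pE = tensor_pairI[OF PEb Pd.lmod]
 show ?thesis
  unfolding G0_eq
  using tensor_map_pure[OF TPp pE rmod_hom_of_bimod_hom[OF m1_hom] lmod_hom_id t \<phi>]
   tensor_map_pure[OF pE PPp rmod_hom_of_bimod_hom[OF m2_hom] lmod_hom_id c1 \<phi>] ev_pure[OF c2 \<phi>] by simp
qed

text \<open>
  This is \<open>f_d\<close> tensored with \<open>P\<close>.
\<close>

lemma m21_dT: "t \<in> car (Tn (- 1)) ==> m2 (m1 (dT (- 1) t)) = \<zero>\<^bsub>P\<^esub>"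
proof -
 assume t: "t \<in> car (Tn (- 1))"
 have d: "dT (- 1) \<in> bimod_hom A E (Tn (- 1)) (Tn 0)" using dT_hom[of "- 1"] by simp
 have "m2 (m1 (dT (- 1) t)) = \<zero>\<^bsub>P_bimod P\<^esub>"
 proof (rule T_eqI[OF add_hom_comp[OF bimod_homD(2)[OF bimod_hom_comp[OF d m1_hom]] bimod_homD(2)[OF m2_hom]] add_hom_const_zero[OF Pb.M.abg] _ t])
  fix p y assume h: "p \<in> car P" "y \<in> car (obj Y (- 1))"
  have dy: "dif Y (- 1) y \<in> car (obj Y 0)" using bimod_homD(3)[OF dY h(2)] by simp
  show "m2 (m1 (dT (- 1) (pure (P_bimod P) E (obj Y (- 1)) p y))) = \<zero>\<^bsub>P_bimod P\<^esub>"
   using h dT_pure[OF h] m1_pure[OF h(1) dy] f_d[OF h(2)] m2_pure[of p "\<zero>\<^bsub>E\<^esub>"] abelian_monoid.zero_closed[OF abelian_group.axioms(1)[OF ring.is_abelian_group[OF k_algebraD(2)[OF E]]]]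
   by simp
 qed
 then show ?thesis by simp
qed

lemma G0_dS: "s \<in> car (Sn (- 1)) ==> G0 (dS (- 1) s) = \<zero>\<^bsub>A\<^esub>"
proof -
 assume s: "s \<in> car (Sn (- 1))"
 have d: "dS (- 1) \<in> bimod_hom A A (Sn (- 1)) (Sn 0)" using dS_hom[of "- 1"] by simp
 have dt: "dT (- 1) \<in> bimod_hom A E (Tn (- 1)) (Tn 0)" using dT_hom[of "- 1"] by simp
 have "G0 (dS (- 1) s) = \<zero>\<^bsub>reg A\<^esub>"
 proof (rule S_eqI[OF add_hom_comp[OF bimod_homD(2)[OF d] bimod_homD(2)[OF G0_hom]] add_hom_const_zero[OF abelian_group_reg[OF k_algebraD(2)[OF A]]] _ s])
  fix t \<phi> assume h: "t \<in> car (Tn (- 1))" "\<phi> \<in> car Pd"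
  have "\<phi> \<zero>\<^bsub>P\<^esub> = \<zero>\<^bsub>A\<^esub>" using lmod_hom_zero[OF Pm rA] h(2) by (simp add: Pd_mem)
  then show "G0 (dS (- 1) (pure (Tn (- 1)) E Pd t \<phi>)) = \<zero>\<^bsub>reg A\<^esub>"
   using dS_pure[OF h] G0_pure[OF bimod_homD(3)[OF dt h(1)] h(2)] m21_dT[OF h(1)] by simp
 qed
 then show ?thesis by simp
qed

section \<open>The cone\<close>

abbreviation "Xc \<equiv> twist_complex A P n Y \<iota> h"
abbreviation "Ast i \<equiv> obj (stalk (reg A)) i"

definition "gm i = twist_map A P Y f i"

lemma gm0: "gm 0 = G0" "i \<noteq> 0 ==> gm i = (%_. \<zero>\<^bsub>A\<^esub>)"
 by (auto simp: gm_def G0_def twist_map_def Let_def)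

lemma Ast_b: "bimodule K A A (Ast i)"
 using bimodule_reg[OF A] bimodule_zero_carrier[OF bimodule_reg[OF A]] by (simp add: stalk_def)

lemma Ast_zero: "\<zero>\<^bsub>Ast i\<^esub> = \<zero>\<^bsub>A\<^esub>" by (simp add: stalk_def)

lemma Ast_k: "kfin K A (Ast i)"
 using finA kfin_zero_carrier[of "Ast i" K A] by (cases "i = 0") (auto simp: stalk_simps)

lemma gm_hom: "gm i \<in> bimod_hom A A (Sn i) (Ast i)"
proof (cases "i = 0")
 case True
 then show ?thesis using G0_hom by (simp add: gm0 stalk_simps)
next
 case False
 then show ?thesis using bimod_hom_const_zero[OF Ast_b[of i], where M = "Sn i"] by (simp add: gm0 Ast_zero)
qed

lemma Xc_obj: "obj Xc i = bimod_sum (Sn (i + 1)) (Ast i)"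
 by (simp add: twist_complex_def cone_def sandwich_def Let_def)

lemma Xc_b: "bimodule K A A (obj Xc i)" unfolding Xc_obj by (rule bimodule_sum[OF Sb Ast_b])
lemma Xc_k: "kfin K A (obj Xc i)" unfolding Xc_obj by (rule kfin_sum[OF Sb Sk Ast_b Ast_k])

lemma Xc_dif:
 assumes "x \<in> car (obj Xc i)"
 shows "dif Xc i x = (\<ominus>\<^bsub>Sn (i + 2)\<^esub> dS (i + 1) (fst x), gm (i + 1) (fst x))"
proof -
 interpret a: bimodule K A A "Ast (i + 1)" by (rule Ast_b)
 have i: "1 + (i + 1) = i + 2" "i + 1 + 1 = i + 2" by simp_all
 have fx: "fst x \<in> car (Sn (i + 1))" using assms by (auto simp: Xc_obj)
 have "gm (i + 1) (fst x) \<in> car (Ast (i + 1))" by (rule bimod_homD(3)[OF gm_hom fx])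
 then have g: "gm (i + 1) (fst x) \<oplus>\<^bsub>Ast (i + 1)\<^esub> \<zero>\<^bsub>A\<^esub> = gm (i + 1) (fst x)" using a.M.r_zero by (simp add: Ast_zero)
 show ?thesis
  using g by (simp add: twist_complex_def cone_def sandwich_def Let_def gm_def dS_def dT_def split_beta stalk_simps(4) i add.commute)
qed

lemma dS1: "dS (i + 1) \<in> bimod_hom A A (Sn (i + 1)) (Sn (i + 2))" using dS_hom[of "i + 1"] by (simp add: add.commute)

lemma Xc_dif_hom: "dif Xc i \<in> bimod_hom A A (obj Xc i) (obj Xc (i + 1))"
proof -
 have i: "i + 1 + 1 = i + 2" by simp
 interpret Xi: bimodule K A A "obj Xc i" by (rule Xc_b)
 note n = bimod_hom_uminus[OF Sb dS1, of i]
 note nd = bimod_homD[OF n] and gd = bimod_homD[OF gm_hom[of "i + 1"]]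
 have cl: "x \<in> car (obj Xc i) ==> fst x \<in> car (Sn (i + 1))" for x by (auto simp: Xc_obj)
 show ?thesis
 proof (intro bimod_homI add_homI)
  fix x assume x: "x \<in> car (obj Xc i)"
  show "dif Xc i x \<in> car (obj Xc (i + 1))"
   unfolding Xc_dif[OF x] using nd(3)[OF cl[OF x]] gd(3)[OF cl[OF x]] by (simp add: Xc_obj i)
  {
   fix y assume y: "y \<in> car (obj Xc i)"
   show "dif Xc i (x \<oplus>\<^bsub>obj Xc i\<^esub> y) = dif Xc i x \<oplus>\<^bsub>obj Xc (i + 1)\<^esub> dif Xc i y"
    unfolding Xc_dif[OF x] Xc_dif[OF y] Xc_dif[OF Xi.M.a_closed[OF x y]]
    using nd(4)[OF cl[OF x] cl[OF y]] gd(4)[OF cl[OF x] cl[OF y]] by (simp add: Xc_obj i)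
  next
   fix r assume r: "r \<in> car A"
   show "dif Xc i (r \<odot>\<^bsub>obj Xc i\<^esub> x) = r \<odot>\<^bsub>obj Xc (i + 1)\<^esub> dif Xc i x"
    unfolding Xc_dif[OF x] Xc_dif[OF Xi.sc_closed[OF r x]]
    using nd(5)[OF r cl[OF x]] gd(5)[OF r cl[OF x]] by (simp add: Xc_obj i)
   show "dif Xc i (rsmult (obj Xc i) x r) = rsmult (obj Xc (i + 1)) (dif Xc i x) r"
    unfolding Xc_dif[OF x] Xc_dif[OF Xi.rs_closed[OF r x]]
    using nd(6)[OF r cl[OF x]] gd(6)[OF r cl[OF x]] by (simp add: Xc_obj i)
  }
 qed
qed

text \<open>
  The only nontrivial composite in the second component is \<open>g d\<close> in degree \<open>-1\<close>, which vanishes by \<open>G0_dS\<close>.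
\<close>

lemma Xc_complex: "bimod_complex K A A Xc"
 unfolding bimod_complex_def
proof (intro allI conjI ballI Xc_b Xc_dif_hom)
 fix i x assume x: "x \<in> car (obj Xc i)"
 have fx: "fst x \<in> car (Sn (i + 1))" using x by (auto simp: Xc_obj)
 have i: "i + 1 + 1 = i + 2" "i + 1 + 2 = i + 3" "i + 2 + 1 = i + 3" by simp_all
 interpret S3: bimodule K A A "Sn (i + 3)" by (rule Sb)
 interpret S2: bimodule K A A "Sn (i + 2)" by (rule Sb)
 have d2: "dS (i + 2) \<in> bimod_hom A A (Sn (i + 2)) (Sn (i + 3))" using dS1[of "i + 1"] by (simp only: i)
 have dd: "dS (i + 2) (dS (i + 1) (fst x)) = \<zero>\<^bsub>Sn (i + 3)\<^esub>" using dSdS[OF fx] by (simp only: i)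
 have ds: "dS (i + 1) (fst x) \<in> car (Sn (i + 2))" by (rule bimod_homD(3)[OF dS1 fx])
 have 1: "\<ominus>\<^bsub>Sn (i + 3)\<^esub> dS (i + 2) (\<ominus>\<^bsub>Sn (i + 2)\<^esub> dS (i + 1) (fst x)) = \<zero>\<^bsub>Sn (i + 3)\<^esub>"
  using lmod_hom_neg[OF S2.lmod S3.lmod bimod_homD(1)[OF d2] ds] dd S3.M.a_inv_zero by simp
 have 2: "gm (i + 2) (\<ominus>\<^bsub>Sn (i + 2)\<^esub> dS (i + 1) (fst x)) = \<zero>\<^bsub>Ast (i + 2)\<^esub>"
 proof (cases "i + 2 = 0")
  case True
  then have i2: "i = - 2" by simp
  have "G0 (\<ominus>\<^bsub>Sn 0\<^esub> dS (- 1) (fst x)) = \<ominus>\<^bsub>reg A\<^esub> G0 (dS (- 1) (fst x))"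
   using lmod_hom_neg[OF S2.lmod _ bimod_homD(1)] G0_hom rA ds i2 by auto
  also have "\<dots> = \<zero>\<^bsub>reg A\<^esub>"
   using G0_dS[of "fst x"] fx i2 abelian_group.a_inv_zero[OF abelian_group_reg[OF k_algebraD(2)[OF A]]] by simp
  finally show ?thesis using i2 by (simp add: gm0 Ast_zero)
 next
  case False
  then show ?thesis by (simp add: gm0 Ast_zero)
 qed
 show "dif Xc (i + 1) (dif Xc i x) = \<zero>\<^bsub>obj Xc (i + 2)\<^esub>"
  unfolding Xc_dif[OF bimod_homD(3)[OF Xc_dif_hom x]] unfolding Xc_dif[OF x] Xc_obj fst_conv i bimod_sum_simps using 1 2 by simp
qed

lemma S_triv: "i < 1 - int n \<or> i > 0 ==> car (Sn i) = {\<zero>\<^bsub>Sn i\<^esub>}"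
proof -
 assume "i < 1 - int n \<or> i > 0"
 from tensor_trivial[OF Pb.bm Ym disjI2[OF Ytriv[OF this]]] have "car (Tn i) = {\<zero>\<^bsub>Tn i\<^esub>}" by simp
 from tensor_trivial[OF Tb Pd.lmod disjI1[OF this]] show ?thesis by simp
qed

lemma Xc_triv: "j < - int n \<or> j > 0 ==> car (obj Xc j) = {\<zero>\<^bsub>obj Xc j\<^esub>}"
 using S_triv[of "j + 1"] stalk_simps(2)[of j "reg A"] by (auto simp: Xc_obj Ast_zero)

lemma twist_Db: "L \<in> Db A ==> periodic_twist A P n Y \<iota> h L \<in> Db A"
 unfolding periodic_twist_def by (rule tensor_cpx_Db[OF A finA Xc_complex Xc_k Xc_triv])

lemma T_right_split: "\<exists>s. right_split K E (Tn i) s"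
proof -
 obtain s where "s \<in> bimod_hom E E (obj Y i) (right_cover K E (obj Y i))" "!!y. y \<in> car (obj Y i) ==> lift (obj Y i) (rsmult (obj Y i)) (s y) = y"
  using projective_splits(1)[OF Yp Yk finE finE] by blast
 then show ?thesis by (rule right_split_tensor[OF Pb.bm Yb])
qed

lemma Xc_emb: "j \<noteq> 0 ==> (%s. (s, \<zero>\<^bsub>A\<^esub>)) \<in> bimod_hom A A (Sn (j + 1)) (obj Xc j)"
 and Xc_prj: "fst \<in> bimod_hom A A (obj Xc j) (Sn (j + 1))"
proof -
 interpret a: bimodule K A A "Ast j" by (rule Ast_b)
 show "(%s. (s, \<zero>\<^bsub>A\<^esub>)) \<in> bimod_hom A A (Sn (j + 1)) (obj Xc j)"
  unfolding Ast_zero[of j, symmetric] by (intro bimod_homI add_homI) (simp_all add: Xc_obj)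
 show "fst \<in> bimod_hom A A (obj Xc j) (Sn (j + 1))"
  by (intro bimod_homI add_homI) (auto simp: Xc_obj)
qed

text \<open>
  In degree \<open>0\<close> the sandwich \<open>P \<otimes> Y\<^sup>1 \<otimes> P\<^sup>\<or>\<close> is zero, so \<open>X\<^sup>0\<close> is \<open>A\<close> with unit \<open>X0_unit\<close>, and \<open>l \<mapsto> 1 \<otimes> l\<close> identifies
  \<open>L\<close> with \<open>X\<^sup>0 \<otimes>\<^sub>A L\<close>.
\<close>

abbreviation "X0_unit \<equiv> (\<zero>\<^bsub>Sn 1\<^esub>, \<one>\<^bsub>A\<^esub>)"

lemma Xc_0: "obj Xc 0 = bimod_sum (Sn 1) (reg A)" by (simp add: Xc_obj stalk_simps)

lemma X0_unit:
 shows "X0_unit \<in> car (obj Xc 0)" "a \<in> car A ==> a \<odot>\<^bsub>obj Xc 0\<^esub> X0_unit = rsmult (obj Xc 0) X0_unit a"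
  "x \<in> car (obj Xc 0) ==> rsmult (obj Xc 0) X0_unit (snd x) = x"
proof -
 interpret S1: bimodule K A A "Sn 1" by (rule Sb)
 note one = monoid.l_one[OF ring.axioms(2)[OF k_algebraD(2)[OF A]]] monoid.r_one[OF ring.axioms(2)[OF k_algebraD(2)[OF A]]]
 show "X0_unit \<in> car (obj Xc 0)"
  using monoid.one_closed[OF ring.axioms(2)[OF k_algebraD(2)[OF A]]] by (simp add: Xc_0 S1.M.zero_closed[simplified])
 show "a \<in> car A ==> a \<odot>\<^bsub>obj Xc 0\<^esub> X0_unit = rsmult (obj Xc 0) X0_unit a"
  using S1.sc_rzero[of a] S1.rs_zero[of a] by (simp add: Xc_0 one)
 assume x: "x \<in> car (obj Xc 0)"
 have c: "fst x \<in> car (Sn 1)" "snd x \<in> car A" using x by (auto simp: Xc_0)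
 then have "fst x = \<zero>\<^bsub>Sn 1\<^esub>" using S_triv[of 1] by simp
 then show "rsmult (obj Xc 0) X0_unit (snd x) = x" using S1.rs_zero[OF c(2)] c(2) by (simp add: Xc_0 one prod_eq_iff)
qed

context
 fixes L :: "('a, 'l) module"
 assumes L: "lmodule A L"
begin

interpretation L: lmodule A L by (rule L)
interpretation XL: tensor_pair "obj Xc 0" A L by (rule tensor_pairI[OF Xc_b L])

lemma X0_balanced: "balanced (obj Xc 0) A L L (%x l. snd x \<odot>\<^bsub>L\<^esub> l)"
 by (rule balancedI) (auto simp: Xc_0 L.sc_ladd L.sc_radd L.sc_assoc)

lemma X0_lift: "lift L (%x l. snd x \<odot>\<^bsub>L\<^esub> l) \<in> add_hom (tgrp (obj Xc 0) A L) L"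
 "[|x \<in> car (obj Xc 0); l \<in> car L|] ==>
  lift L (%x l. snd x \<odot>\<^bsub>L\<^esub> l) (pure (obj Xc 0) A L x l) = snd x \<odot>\<^bsub>L\<^esub> l"
 by (rule XL.lift_add_hom[OF abelian_of_lmodule[OF L] X0_balanced], rule XL.lift_pure[OF abelian_of_lmodule[OF L] X0_balanced])

lemma X0_unit_hom: "(%l. pure (obj Xc 0) A L X0_unit l) \<in> lmod_hom A L (tensor (obj Xc 0) A L)"
proof (intro lmod_homI add_homI)
 fix r x assume r: "r \<in> car A" and x: "x \<in> car L"
 show "pure (obj Xc 0) A L X0_unit (r \<odot>\<^bsub>L\<^esub> x) = r \<odot>\<^bsub>tensor (obj Xc 0) A L\<^esub> pure (obj Xc 0) A L X0_unit x"
  unfolding tensor_smult_pure[OF Xc_b L r X0_unit(1) x] X0_unit(2)[OF r] by (rule XL.pure_middle[OF X0_unit(1) r x, symmetric])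
qed (use X0_unit(1) in "simp_all add: XL.pure_add_right")

lemma X0_unit_lift:
 assumes w: "w \<in> car (tgrp (obj Xc 0) A L)"
 shows "pure (obj Xc 0) A L X0_unit (lift L (%x l. snd x \<odot>\<^bsub>L\<^esub> l) w) = w"
proof -
 have h: "(%l. pure (obj Xc 0) A L X0_unit l) \<in> add_hom L (tgrp (obj Xc 0) A L)"
  using lmod_homD(1)[OF X0_unit_hom] by (simp add: add_hom_def)
 show ?thesis
 proof (rule XL.add_hom_eqI[OF add_hom_comp[OF X0_lift(1) h] add_hom_id _ w])
  fix x l assume x: "x \<in> car (obj Xc 0)" and l: "l \<in> car L"
  have s: "snd x \<in> car A" using x by (auto simp: Xc_0)
  show "pure (obj Xc 0) A L X0_unit (lift L (%x l. snd x \<odot>\<^bsub>L\<^esub> l) (pure (obj Xc 0) A L x l)) = pure (obj Xc 0) A L x l"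
   unfolding X0_lift(2)[OF x l] XL.pure_middle[OF X0_unit(1) s l, symmetric] X0_unit(3)[OF x] ..
 qed
qed

lemma X0_unit_bij: "bij_betw (%l. pure (obj Xc 0) A L X0_unit l) (car L) (car (tensor (obj Xc 0) A L))"
proof (rule bij_betw_byWitness[of _ "lift L (%x l. snd x \<odot>\<^bsub>L\<^esub> l)"])
 show "\<forall>l\<in>car L. lift L (%x l. snd x \<odot>\<^bsub>L\<^esub> l) (pure (obj Xc 0) A L X0_unit l) = l"
  using X0_lift(2)[OF X0_unit(1)] by (simp add: L.sc_one)
 show "(%l. pure (obj Xc 0) A L X0_unit l) ` car L \<subseteq> car (tensor (obj Xc 0) A L)"
  using lmod_homD(2)[OF X0_unit_hom] by blast
qed (use X0_unit_lift add_hom_closed[OF X0_lift(1)] in auto)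

end

lemma twist_perp:
 fixes L :: "(('a, 'l) module, 'l) cpx"
 assumes L: "L \<in> perp A P"
 shows "Db_iso A (periodic_twist A P n Y \<iota> h L) L"
proof -
 have LD: "L \<in> Db A" using L by (simp add: perp_def)
 have cL: "cochain_complex A L" using LD by (simp add: Db_def)
 note Lm = cpxD(1)[OF cL] and dL = cpxD(2)[OF cL]
 interpret D: double_complex A "%j k. tensor (obj Xc j) A (obj L k)" "%j k. tmap (obj Xc (j + 1)) A (obj L k) (dif Xc j) (%y. y)"
  "%j k. tmap (obj Xc j) A (obj L (k + 1)) (%x. x) (dif L k)" "tensor_cpx Xc A L"
  by (rule tensor_double_complex[OF Xc_complex cL])
 define \<rho> where "\<rho> k l = pure (obj Xc 0) A (obj L k) X0_unit l" for k l
 note TP = tensor_pairI[OF Xc_b Lm]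
 have \<rho>h: "\<rho> k \<in> lmod_hom A (obj L k) (tensor (obj Xc 0) A (obj L k))" for k
  unfolding \<rho>_def by (rule X0_unit_hom[OF Lm])
 have \<rho>b: "bij_betw (\<rho> k) (car (obj L k)) (car (tensor (obj Xc 0) A (obj L k)))" for k
  unfolding \<rho>_def by (rule X0_unit_bij[OF Lm])
 have \<rho>d: "tmap (obj Xc 0) A (obj L (k + 1)) (%x. x) (dif L k) (\<rho> k l) = \<rho> (k + 1) (dif L k l)" if "l \<in> car (obj L k)" for k l
  unfolding \<rho>_def by (rule tensor_map_pure[OF TP TP rmod_hom_id dL X0_unit(1) that])
 have q: "quasi_iso A L (tensor_cpx Xc A L) (%k l. dsum_single (%j. tensor (obj Xc j) A (obj L (k - j))) 0 (\<rho> k l))"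
 proof (rule D.row_quasi_iso[where N = n, OF _ _ _ cL \<rho>h \<rho>b \<rho>d])
  show "car (tensor (obj Xc j) A (obj L k)) = {\<zero>\<^bsub>tensor (obj Xc j) A (obj L k)\<^esub>}" if "j < - int n" for j k
   using tensor_trivial[OF Xc_b Lm disjI1[OF Xc_triv]] that by simp
  show "car (tensor (obj Xc j) A (obj L k)) = {\<zero>\<^bsub>tensor (obj Xc j) A (obj L k)\<^esub>}" if "j > 0" for j k
   using tensor_trivial[OF Xc_b Lm disjI1[OF Xc_triv]] that by simp
  fix j k x assume j: "(j :: int) < 0" and x: "x \<in> car (tensor (obj Xc j) A (obj L k))"
   and z: "tmap (obj Xc j) A (obj L (k + 1)) (%x. x) (dif L k) x = \<zero>\<^bsub>tensor (obj Xc j) A (obj L (k + 1))\<^esub>"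
  obtain s where s: "right_split K E (Tn (j + 1)) s" using T_right_split by blast
  have ip: "(fst x, \<zero>\<^bsub>A\<^esub>) = x" if "x \<in> car (obj Xc j)" for x
   using that j stalk_simps(2)[of j "reg A"] by (auto simp: Xc_obj prod_eq_iff)
  have x': "x \<in> car (tgrp (obj Xc j) A (obj L k))"
   "tmap (obj Xc j) A (obj L (k + 1)) (%x. x) (dif L k) x = \<zero>\<^bsub>tgrp (obj Xc j) A (obj L (k + 1))\<^esub>"
   using x z by simp_all
  have j0: "j \<noteq> 0" using j by simp
  from row_exact_iso[OF L Tb s Xc_b Xc_emb[OF j0] Xc_prj ip x']
  show "\<exists>y\<in>car (tensor (obj Xc j) A (obj L (k - 1))). tmap (obj Xc j) A (obj L (k - 1 + 1)) (%x. x) (dif L (k - 1)) y = x" by simp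
 qed
 have TD: "periodic_twist A P n Y \<iota> h L \<in> Db A" by (rule twist_Db[OF LD])
 show ?thesis
  by (rule Db_iso_of_quasi_isos[OF A finA LD TD LD q[folded periodic_twist_def] quasi_iso_id[OF cL]])
qed

end

lemma lmod_hom_inv_into:
 assumes M: "lmodule R M" and f: "f \<in> lmod_hom R M N" and b: "bij_betw f (car M) (car N)"
 shows "inv_into (car M) f \<in> lmod_hom R N M"
proof -
 interpret M: lmodule R M by fact
 let ?g = "inv_into (car M) f"
 have inj: "inj_on f (car M)" and im: "f ` car M = car N" using b by (auto simp: bij_betw_def)
 have c: "?g y \<in> car M" "f (?g y) = y" if "y \<in> car N" for y
  using that inv_into_into[of y f "car M"] f_inv_into_f[of y f "car M"] im by auto
 have e: "?g y = x" if "x \<in> car M" "f x = y" for x y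
  using inv_into_f_f[OF inj that(1)] that(2) by simp
 show ?thesis
 proof (intro lmod_homI add_homI)
  fix x y assume "x \<in> car N" "y \<in> car N"
  then show "?g (x \<oplus>\<^bsub>N\<^esub> y) = ?g x \<oplus>\<^bsub>M\<^esub> ?g y" by (intro e) (simp_all add: c lmod_homD(3)[OF f])
 next
  fix r x assume "r \<in> car R" "x \<in> car N"
  then show "?g (r \<odot>\<^bsub>N\<^esub> x) = r \<odot>\<^bsub>M\<^esub> ?g x" by (intro e) (simp_all add: c lmod_homD(4)[OF f])
 qed (rule c)
qed

context double_complex
begin

text \<open>
  If only the column \<open>k = 0\<close> is nonzero, then the total complex is that column.
\<close>

lemma column_quasi_iso:
 fixes L :: "(('r, 'l) module, 'l) cpx"
 assumes triv: "!!j k. k \<noteq> 0 ==> car (G j k) = {\<zero>\<^bsub>G j k\<^esub>}"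
  and L: "cochain_complex R L" and \<kappa>: "!!i. \<kappa> i \<in> lmod_hom R (obj L i) (G i 0)"
  and \<kappa>d: "!!i x. x \<in> car (obj L i) ==> D1 i 0 (\<kappa> i x) = \<kappa> (i + 1) (dif L i x)"
  and inj: "!!i x w. [|x \<in> cocycles L i; w \<in> car (G (i - 1) 0); \<kappa> i x = D1 (i - 1) 0 w|] ==> x \<in> bdry L i"
  and surj: "!!i w. [|w \<in> car (G i 0); D1 i 0 w = \<zero>\<^bsub>G (i + 1) 0\<^esub>|] ==>
   \<exists>x\<in>cocycles L i. \<exists>v\<in>car (G (i - 1) 0). w = \<kappa> i x \<oplus>\<^bsub>G i 0\<^esub> D1 (i - 1) 0 v"
 shows "quasi_iso R L Tot (%i x. dsum_single (%j. G j (i - j)) i (\<kappa> i x))"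
proof -
 define s where "s i = dsum_single (%j. G j (i - j)) i" for i
 have sh: "s i \<in> lmod_hom R (G i 0) (obj Tot i)" for i using single_hom[of i i] by (simp add: s_def)
 have sj: "s i w j = (if j = i then w else \<zero>\<^bsub>G j (i - j)\<^esub>)" for i w j by (simp add: s_def dsum_single_def)
 have col: "u = s i (u i)" if u: "u \<in> car (obj Tot i)" for u i
 proof (rule ext)
  fix j show "u j = s i (u i) j" using Tot_app[OF u, of j] triv[of "i - j" j] by (cases "j = i") (auto simp: sj)
 qed
 have ds: "dif Tot i (s i w) = s (i + 1) (D1 i 0 w)" if w: "w \<in> car (G i 0)" for i w
 proof -
  have sw: "s i w \<in> car (obj Tot i)" by (rule lmod_homD(2)[OF sh w])
  have "dif Tot i (s i w) (i + 1) = D1 i 0 w"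
   using G_r0[OF lmod_homD(2)[OF D1 w]] D2_zero[of "i + 1" "- 1"] sg_props(2)[of "i + 1" "i + 1" 0] by (simp add: dif_Tot' sj)
  then show ?thesis using col[OF dif_closed[OF sw]] by simp
 qed
 have D1i: "D1 (i - 1) 0 \<in> lmod_hom R (G (i - 1) 0) (G i 0)" for i by (rule D1')
 have sinj: "w = w'" if "s i w = s i w'" for i w w' using fun_cong[OF that, of i] by (simp add: sj)
 have cm: "chain_map R L Tot (%i x. s i (\<kappa> i x))"
  unfolding chain_map_def
 proof (intro allI conjI ballI)
  show "(%x. s i (\<kappa> i x)) \<in> lmod_hom R (obj L i) (obj Tot i)" for i by (rule lmod_hom_comp[OF \<kappa> sh])
  show "s (i + 1) (\<kappa> (i + 1) (dif L i x)) = dif Tot i (s i (\<kappa> i x))" if x: "x \<in> car (obj L i)" for i x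
   using ds[OF lmod_homD(2)[OF \<kappa> x]] \<kappa>d[OF x] by simp
 qed
 have "quasi_iso R L Tot (%i x. s i (\<kappa> i x))"
 proof (rule quasi_isoI[OF L Tot_complex cm])
  fix i x assume x: "x \<in> cocycles L i" and b: "s i (\<kappa> i x) \<in> bdry Tot i"
  obtain v where v: "v \<in> car (obj Tot (i - 1))" "s i (\<kappa> i x) = dif Tot (i - 1) v" using b by (auto simp: coboundaries_def)
  have vc: "v (i - 1) \<in> car (G (i - 1) 0)" using Tot_app[OF v(1), of "i - 1"] by simp
  have "s i (\<kappa> i x) = s i (D1 (i - 1) 0 (v (i - 1)))" using v(2) col[OF v(1)] ds[OF vc] by simp
  then show "x \<in> bdry L i" using inj[OF x vc] sinj by blast
 next
  fix i u assume u: "u \<in> cocycles Tot i"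
  then have uc: "u \<in> car (obj Tot i)" and du: "dif Tot i u = \<zero>\<^bsub>obj Tot (i + 1)\<^esub>" by (auto simp: cocycles_def)
  have w: "u i \<in> car (G i 0)" using Tot_app[OF uc, of i] by simp
  have "dif Tot i (s i (u i)) (i + 1) = \<zero>\<^bsub>G (i + 1) 0\<^esub>" using du col[OF uc] by (simp add: Tot_zero)
  then have "D1 i 0 (u i) = \<zero>\<^bsub>G (i + 1) 0\<^esub>" using ds[OF w] by (simp add: sj)
  then obtain x v where x: "x \<in> cocycles L i" and v: "v \<in> car (G (i - 1) 0)" and e: "u i = \<kappa> i x \<oplus>\<^bsub>G i 0\<^esub> D1 (i - 1) 0 v"
   using surj[OF w] by blast
  have xc: "x \<in> car (obj L i)" using x by (simp add: cocycles_def)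
  note kx = lmod_homD(2)[OF \<kappa> xc] and dv = lmod_homD(2)[OF D1i v]
  interpret T: lmodule R "obj Tot i" by (rule Tot_lmodule)
  have a: "s i (\<kappa> i x) \<in> car (obj Tot i)" and b: "s i (D1 (i - 1) 0 v) \<in> car (obj Tot i)"
   by (rule lmod_homD(2)[OF sh kx], rule lmod_homD(2)[OF sh dv])
  have "u = s i (\<kappa> i x) \<oplus>\<^bsub>obj Tot i\<^esub> s i (D1 (i - 1) 0 v)" using col[OF uc] e lmod_homD(3)[OF sh kx dv] by simp
  then have "u \<ominus>\<^bsub>obj Tot i\<^esub> s i (\<kappa> i x) = s i (D1 (i - 1) 0 v)"
   using a b T.M.r_neg2[OF a b] T.M.a_comm[OF b T.M.a_inv_closed[OF a]] by (simp add: a_minus_def T.M.a_assoc)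
  also have "\<dots> = dif Tot (i - 1) (s (i - 1) v)" using ds[OF v] by simp
  finally have "u \<ominus>\<^bsub>obj Tot i\<^esub> s i (\<kappa> i x) \<in> bdry Tot i"
   using lmod_homD(2)[OF sh v] by (auto simp: coboundaries_def)
  then show "\<exists>x\<in>cocycles L i. u \<ominus>\<^bsub>obj Tot i\<^esub> s i (\<kappa> i x) \<in> bdry Tot i" using x by blast
 qed
 then show ?thesis by (simp only: s_def)
qed

end

section \<open>Sandwiches applied to P\<close>

context projective_setup
begin

text \<open>
  The isomorphism \<open>T \<otimes>\<^sub>E P\<^sup>\<or> \<otimes>\<^sub>A P \<cong> T \<otimes>\<^sub>E Hom\<^sub>A(P, P) = T \<otimes>\<^sub>E E \<cong> T\<close>.
\<close>

definition "eval_a T w = lift T (rsmult T) (hom_a T P w)"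

lemma HP_carrier: "car (Hom A P P) = car E"
 by (simp add: Hom_simps(1) End_op_simps(1))

context
 fixes T :: "('a, 'p => 'p, 't) bimod"
 assumes T: "bimodule K A E T"
begin

interpretation T: bimodule K A E T by (rule T)
interpretation TH: tensor_pair T E "Hom A P P" by (rule tensor_pairI[OF T Hom_lmodule[OF Pm]])
interpretation TP: tensor_pair T E Pd by (rule tensor_pairI[OF T Pd.lmod])

lemma rsmult_Hom_balanced: "balanced T E (Hom A P P) T (rsmult T)"
 using T.rs_sadd T.rs_assoc by (intro balancedI) (simp_all add: HP_carrier T.rs_add)

lemma SP: "bimodule K A A (tbim T E Pd)" by (rule bimodule_tensor[OF T Pd.bm])

lemma eval_a_hom: "eval_a T \<in> add_hom (tgrp (tbim T E Pd) A P) T"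
 unfolding eval_a_def by (rule add_hom_comp[OF hom_a_hom[OF T Pm] TH.lift_add_hom[OF T.M.abg rsmult_Hom_balanced]])

lemma eval_a_pure: "[|t \<in> car T; \<phi> \<in> car Pd; p \<in> car P|] ==>
 eval_a T (pure (tbim T E Pd) A P (pure T E Pd t \<phi>) p) = rsmult T t (br P \<phi> p)"
 unfolding eval_a_def using TH.lift_pure[OF T.M.abg rsmult_Hom_balanced _ br_closed[OF Pm]]
 by (simp add: hom_a_pure[OF T Pm])

lemma eval_a_lmod_hom: "eval_a T \<in> lmod_hom A (tensor (tbim T E Pd) A P) T"
proof (rule lmod_homI)
 show "eval_a T \<in> add_hom (tensor (tbim T E Pd) A P) T" using eval_a_hom by (simp add: add_hom_def)
 fix r w assume r: "r \<in> car A" and w: "w \<in> car (tensor (tbim T E Pd) A P)"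
 show "eval_a T (r \<odot>\<^bsub>tensor (tbim T E Pd) A P\<^esub> w) = r \<odot>\<^bsub>T\<^esub> eval_a T w"
 proof (rule triple_eqI[OF T Pm add_hom_comp[OF tensor_smult_add_hom[OF SP Pm r] eval_a_hom] add_hom_comp[OF eval_a_hom T.sc_right_hom[OF r]]])
  fix t \<phi> l assume h: "t \<in> car T" "\<phi> \<in> car Pd" "l \<in> car P"
  have c: "pure T E Pd t \<phi> \<in> car (tbim T E Pd)" using TP.pure_closed[OF h(1,2)] by simp
  have b: "br P \<phi> l \<in> car E" using br_closed[OF Pm h(2,3)] by (simp add: HP_carrier)
  have "r \<odot>\<^bsub>tbim T E Pd\<^esub> pure T E Pd t \<phi> = pure T E Pd (r \<odot>\<^bsub>T\<^esub> t) \<phi>"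
   using tensor_smult_pure[OF T Pd.lmod r h(1,2)] by (simp add: tensor_bimod_smult_eq[OF T Pd.bm])
  then show "eval_a T (r \<odot>\<^bsub>tensor (tbim T E Pd) A P\<^esub> pure (tbim T E Pd) A P (pure T E Pd t \<phi>) l) =
   r \<odot>\<^bsub>T\<^esub> eval_a T (pure (tbim T E Pd) A P (pure T E Pd t \<phi>) l)"
   unfolding tensor_smult_pure[OF SP Pm r c h(3)] using eval_a_pure[OF _ h(2,3)] h(1) r b T.rs_sc by simp
 qed (use w in simp)
qed

lemma eval_a_bij: "bij_betw (eval_a T) (car (tensor (tbim T E Pd) A P)) (car T)"
proof -
 let ?H = "Hom A P P"
 define b where "b t = hom_b T P (pure T E ?H t \<one>\<^bsub>E\<^esub>)" for t
 have one: "\<one>\<^bsub>E\<^esub> \<in> car ?H" unfolding HP_carrier by (rule monoid.one_closed[OF ring.axioms(2)[OF k_algebraD(2)[OF E]]])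
 have ph: "(%t. pure T E ?H t \<one>\<^bsub>E\<^esub>) \<in> add_hom T (tgrp T E ?H)"
  by (rule add_homI) (rule TH.pure_closed[OF _ one] TH.pure_add_left[OF _ _ one], assumption+)+
 have bh: "b \<in> add_hom T (tgrp (tbim T E Pd) A P)"
  unfolding b_def by (rule add_hom_comp[OF ph hom_b_hom[OF T Pm]])
 note lh = TH.lift_add_hom[OF T.M.abg rsmult_Hom_balanced] and lp = TH.lift_pure[OF T.M.abg rsmult_Hom_balanced]
 have ab: "eval_a T (b t) = t" if t: "t \<in> car T" for t
  unfolding eval_a_def b_def hom_ab[OF T Pm add_hom_closed[OF ph t]] lp[OF t one] by (rule T.rs_one[OF t])
 have "b (lift T (rsmult T) v) = hom_b T P v" if v: "v \<in> car (tgrp T E ?H)" for v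
 proof (rule TH.add_hom_eqI[OF add_hom_comp[OF lh bh] hom_b_hom[OF T Pm] _ v])
  fix t \<psi> assume t: "t \<in> car T" and \<psi>: "\<psi> \<in> car ?H"
  have \<psi>E: "\<psi> \<in> car E" using \<psi> by (simp add: HP_carrier)
  have "\<psi> \<odot>\<^bsub>?H\<^esub> \<one>\<^bsub>E\<^esub> = \<psi>"
   by (rule Hom_eqI[OF lmodule.sc_closed[OF Hom_lmodule[OF Pm] \<psi>E one] \<psi>]) (use \<psi>E in simp)
  then show "b (lift T (rsmult T) (pure T E ?H t \<psi>)) = hom_b T P (pure T E ?H t \<psi>)"
   unfolding b_def lp[OF t \<psi>] using TH.pure_middle[OF t \<psi>E one] by simp
 qed
 then have ba: "b (eval_a T w) = w" if "w \<in> car (tgrp (tbim T E Pd) A P)" for w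
  unfolding eval_a_def using add_hom_closed[OF hom_a_hom[OF T Pm] that] hom_ba[OF T Pm that] by simp
 show ?thesis
  by (rule bij_betw_byWitness[of _ b]) (use ab ba add_hom_closed[OF bh] add_hom_closed[OF eval_a_hom] in auto)
qed

end

end

context twisted_setup
begin

lemma eval_a_pure_hom: "p \<in> car P ==> (%s. eval_a (Tn i) (pure (Sn i) A P s p)) \<in> add_hom (Sn i) (Tn i)"
proof -
 assume p: "p \<in> car P"
 interpret SP: tensor_pair "Sn i" A P by (rule tensor_pairI[OF Sb Pm])
 have "(%s. pure (Sn i) A P s p) \<in> add_hom (Sn i) (tgrp (Sn i) A P)"
  by (rule add_homI) (rule SP.pure_closed[OF _ p] SP.pure_add_left[OF _ _ p], assumption+)+
 then show ?thesis by (rule add_hom_comp[OF _ eval_a_hom[OF Tb]])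
qed

lemma eval_a_dS:
 assumes s: "s \<in> car (Sn i)" and p: "p \<in> car P"
 shows "eval_a (Tn (i + 1)) (pure (Sn (i + 1)) A P (dS i s) p) = dT i (eval_a (Tn i) (pure (Sn i) A P s p))"
proof (rule S_eqI[OF add_hom_comp[OF bimod_homD(2)[OF dS_hom] eval_a_pure_hom[OF p]] add_hom_comp[OF eval_a_pure_hom[OF p] bimod_homD(2)[OF dT_hom]] _ s])
 fix t \<phi> assume t: "t \<in> car (Tn i)" and \<phi>: "\<phi> \<in> car Pd"
 have b: "br P \<phi> p \<in> car E" using br_closed[OF Pm \<phi> p] by (simp add: HP_carrier)
 show "eval_a (Tn (i + 1)) (pure (Sn (i + 1)) A P (dS i (pure (Tn i) E Pd t \<phi>)) p) =
  dT i (eval_a (Tn i) (pure (Sn i) A P (pure (Tn i) E Pd t \<phi>) p))"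
  unfolding dS_pure[OF t \<phi>] eval_a_pure[OF Tb t \<phi> p] eval_a_pure[OF Tb bimod_homD(3)[OF dT_hom t] \<phi> p]
  by (rule bimod_homD(6)[OF dT_hom b t, symmetric])
qed

text \<open>
  On \<open>t \<otimes> \<phi> \<otimes> p\<close> both sides are \<open>\<phi>(q) p\<close>, where \<open>q\<close> is the image of \<open>t\<close> in \<open>P\<close>.
\<close>

lemma eval_a_G0:
 assumes s: "s \<in> car (Sn 0)" and p: "p \<in> car P"
 shows "G0 s \<odot>\<^bsub>P\<^esub> p = m2 (m1 (eval_a (Tn 0) (pure (Sn 0) A P s p)))"
proof -
 have g: "G0 \<in> add_hom (Sn 0) A" using bimod_homD(2)[OF G0_hom] by (simp add: add_hom_def)
 have m: "(%t. m2 (m1 t)) \<in> bimod_hom A E (Tn 0) (P_bimod P)" by (rule bimod_hom_comp[OF m1_hom m2_hom])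
 have m': "(%t. m2 (m1 t)) \<in> add_hom (Tn 0) P" using bimod_homD(2)[OF m] by (simp add: add_hom_def)
 show ?thesis
 proof (rule S_eqI[OF add_hom_comp[OF g P.sc_left_hom[OF p]] add_hom_comp[OF eval_a_pure_hom[OF p] m'] _ s])
  fix t \<phi> assume t: "t \<in> car (Tn 0)" and \<phi>: "\<phi> \<in> car Pd"
  have b: "br P \<phi> p \<in> car E" using br_closed[OF Pm \<phi> p] by (simp add: HP_carrier)
  have c: "m2 (m1 t) \<in> car P" using bimod_homD(3)[OF m t] by simp
  show "G0 (pure (Tn 0) E Pd t \<phi>) \<odot>\<^bsub>P\<^esub> p = m2 (m1 (eval_a (Tn 0) (pure (Sn 0) A P (pure (Tn 0) E Pd t \<phi>) p)))"
   unfolding eval_a_pure[OF Tb t \<phi> p] G0_pure[OF t \<phi>] using bimod_homD(6)[OF m b t] c by (simp add: br_def)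
 qed
qed

end

section \<open>The truncated resolution tensored with P\<close>

lemma add_hom_diff:
 assumes "abelian_group H" "f \<in> add_hom G H" "g \<in> add_hom G H"
 shows "(%x. f x \<ominus>\<^bsub>H\<^esub> g x) \<in> add_hom G H"
 unfolding a_minus_def by (rule add_hom_plus[OF assms(1,2) add_hom_uminus[OF assms(1,3)]])

lemma lmod_hom_diff:
 assumes "lmodule R N" "f \<in> lmod_hom R M N" "g \<in> lmod_hom R M N"
 shows "(%x. f x \<ominus>\<^bsub>N\<^esub> g x) \<in> lmod_hom R M N"
 unfolding a_minus_def by (rule lmod_hom_plus[OF assms(1,2) lmod_hom_uminus[OF assms(1,3)]])

context twisted_setup
begin

abbreviation "II i \<equiv> incoming_image E n Y \<iota> i"
abbreviation "pt i \<equiv> pure (P_bimod P) E (obj Y i)"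

lemma E_one: "\<one>\<^bsub>E\<^esub> \<in> car E" by (rule monoid.one_closed[OF ring.axioms(2)[OF k_algebraD(2)[OF E]]])

text \<open>
  The kernel condition for the map that leaves \<open>P \<otimes> Y\<^sup>i\<close>; for \<open>i = 0\<close> this is the augmentation into \<open>P\<close>.
\<close>

definition "closed_at i x \<longleftrightarrow> (if i = 0 then m2 (m1 x) = \<zero>\<^bsub>P\<^esub> else dT i x = \<zero>\<^bsub>Tn (i + 1)\<^esub>)"

text \<open>
  A left-linear projection \<open>\<pi>\<close> of \<open>Y\<^sup>i\<close> onto the image of the incoming map. The projections
  constructed below have the form \<open>\<pi> = 1 - \<eta> d\<close>, where \<open>d\<close> is
  the map that leaves \<open>Y\<^sup>i\<close>; only a consequence of this for \<open>P \<otimes> Y\<^sup>i\<close> is recorded, because the target of \<open>d\<close> is \<open>E\<close>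
  for \<open>i = 0\<close> and \<open>Y\<^sup>i\<^sup>+\<^sup>1\<close> otherwise.
\<close>

definition "splitting i \<pi> \<longleftrightarrow> \<pi> \<in> lmod_hom E (obj Y i) (obj Y i) \<and> (\<forall>y\<in>car (obj Y i). \<pi> y \<in> II i) \<and> (\<forall>y\<in>II i. \<pi> y = y) \<and>
 (\<forall>x\<in>car (Tn i). closed_at i x --> tmap (P_bimod P) E (obj Y i) (%p. p) \<pi> x = x)"

lemma splittingD:
 assumes "splitting i \<pi>"
 shows "\<pi> \<in> lmod_hom E (obj Y i) (obj Y i)" "y \<in> car (obj Y i) ==> \<pi> y \<in> II i" "y \<in> II i ==> \<pi> y = y"
  "[|x \<in> car (Tn i); closed_at i x|] ==> tmap (P_bimod P) E (obj Y i) (%p. p) \<pi> x = x"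
 using assms by (simp_all add: splitting_def)

lemma pt_closed: "[|p \<in> car P; y \<in> car (obj Y i)|] ==> pt i p y \<in> car (Tn i)"
 using tensor_pair.pure_closed[OF PYp, of p y i] by simp

lemma pt_minus:
 assumes "p \<in> car P" "y \<in> car (obj Y i)" "z \<in> car (obj Y i)"
 shows "pt i p (y \<ominus>\<^bsub>obj Y i\<^esub> z) = pt i p y \<ominus>\<^bsub>Tn i\<^esub> pt i p z"
proof -
 interpret YP: tensor_pair "P_bimod P" E "obj Y i" by (rule PYp)
 have Y: "abelian_group (obj Y i)" and T: "abelian_group (Tn i)" by (rule abelian_of_bimodule[OF Yb], rule abelian_of_bimodule[OF Tb])
 have "(%y. pt i p y) \<in> add_hom (obj Y i) (Tn i)"
  using YP.pure_add_right pt_closed assms(1) by (intro add_homI) simp_all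
 from add_hom_neg[OF Y T this assms(3)] add_hom_add[OF this assms(2) abelian_group.a_inv_closed[OF Y assms(3)]]
 show ?thesis by (simp add: a_minus_def)
qed

lemma tensor_Y_hom: "\<theta> \<in> lmod_hom E (obj Y i) (obj Y j) ==> tmap (P_bimod P) E (obj Y j) (%p. p) \<theta> \<in> add_hom (Tn i) (Tn j)"
 using tensor_map_hom[OF PYp PYp rmod_hom_id, of \<theta> i j] by (simp add: add_hom_def)

lemma tensor_Y_pure: "[|\<theta> \<in> lmod_hom E (obj Y i) (obj Y j); p \<in> car P; y \<in> car (obj Y i)|] ==>
  tmap (P_bimod P) E (obj Y j) (%p. p) \<theta> (pt i p y) = pt j p (\<theta> y)"
 by (rule tensor_map_pure[OF PYp PYp rmod_hom_id]) simp_all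

lemma T_ag: "abelian_group (Tn i)" by (rule abelian_of_bimodule[OF Tb])

text \<open>
  Choose \<open>y0\<close> with \<open>f(y0) = 1\<close>. Then \<open>e \<mapsto> e y0\<close> is a left-linear section of \<open>f\<close>, and \<open>\<pi>(y) = y - f(y) y0\<close>. On
  \<open>P \<otimes> Y\<^sup>0\<close> the same element shows that \<open>p \<otimes> y0\<close> maps to \<open>p\<close>.
\<close>

lemma splitting_zero: "\<exists>\<pi>. splitting 0 \<pi>" and P_cover: "p \<in> car P ==> \<exists>t\<in>car (Tn 0). m2 (m1 t) = p"
proof -
 have "\<one>\<^bsub>E\<^esub> \<in> f ` car (obj Y 0)" unfolding f_surj by (rule E_one)
 then obtain y0 where "\<one>\<^bsub>E\<^esub> = f y0" "y0 \<in> car (obj Y 0)" by (rule imageE)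
 then have y0: "y0 \<in> car (obj Y 0)" "f y0 = \<one>\<^bsub>E\<^esub>" by (simp_all only:)
 interpret Y0: bimodule K E E "obj Y 0" by (rule Yb)
 interpret T0: bimodule K A E "Tn 0" by (rule Tb)
 interpret YP: tensor_pair "P_bimod P" E "obj Y 0" by (rule PYp)
 note fD = bimod_homD[OF f]
 have fc: "f y \<in> car E" if "y \<in> car (obj Y 0)" for y using fD(3)[OF that] by simp
 have m21_pure: "m2 (m1 (pt 0 p y)) = f y p" if "p \<in> car P" "y \<in> car (obj Y 0)" for p y
  by (simp add: m1_pure[OF that] m2_pure[OF that(1) fc[OF that(2)]])
 have m21: "(%t. m2 (m1 t)) \<in> add_hom (Tn 0) P"
  using bimod_homD(2)[OF bimod_hom_comp[OF m1_hom m2_hom]] by (simp add: add_hom_def)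
 show "\<exists>t\<in>car (Tn 0). m2 (m1 t) = p" if "p \<in> car P"
  using m21_pure[OF that y0(1)] pt_closed[OF that y0(1)] y0(2) that by (intro bexI[of _ "pt 0 p y0"]) simp_all
 define g where "g y = f y \<odot>\<^bsub>obj Y 0\<^esub> y0" for y
 have g: "g \<in> lmod_hom E (obj Y 0) (obj Y 0)"
 proof (intro lmod_homI add_homI)
  fix y z assume "y \<in> car (obj Y 0)" "z \<in> car (obj Y 0)"
  then show "g (y \<oplus>\<^bsub>obj Y 0\<^esub> z) = g y \<oplus>\<^bsub>obj Y 0\<^esub> g z" using fD(4)[of y z] Y0.sc_ladd[OF fc fc y0(1)] by (simp add: g_def del: End_op_simps)
 next
  fix e y assume "e \<in> car E" "y \<in> car (obj Y 0)"
  then show "g (e \<odot>\<^bsub>obj Y 0\<^esub> y) = e \<odot>\<^bsub>obj Y 0\<^esub> g y" using fD(5)[of e y] Y0.sc_assoc[OF _ fc y0(1)] by (simp add: g_def del: End_op_simps)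
 qed (use fc y0 in "simp add: g_def")
 define \<pi> where "\<pi> y = y \<ominus>\<^bsub>obj Y 0\<^esub> g y" for y
 have \<pi>: "\<pi> \<in> lmod_hom E (obj Y 0) (obj Y 0)"
  unfolding \<pi>_def by (rule lmod_hom_diff[OF Ym bimod_homD(1)[OF bimod_hom_id] g])
 have "splitting 0 \<pi>"
  unfolding splitting_def
 proof (intro conjI ballI impI \<pi>)
  fix y assume y: "y \<in> car (obj Y 0)"
  interpret ER: bimodule K E E ER by (rule rE)
  have gy: "g y \<in> car (obj Y 0)" by (rule lmod_homD(2)[OF g y])
  have "f (g y) = f y \<otimes>\<^bsub>E\<^esub> \<one>\<^bsub>E\<^esub>" using fD(5)[OF fc[OF y] y0(1)] y0(2) by (simp add: g_def del: End_op_simps)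
  then have fg: "f (g y) = f y" using monoid.r_one[OF ring.axioms(2)[OF k_algebraD(2)[OF E]] fc[OF y]] by (simp del: End_op_simps)
  have "f (\<pi> y) = f y \<oplus>\<^bsub>ER\<^esub> \<ominus>\<^bsub>ER\<^esub> f (g y)"
   unfolding \<pi>_def a_minus_def fD(4)[OF y Y0.M.a_inv_closed[OF gy]] lmod_hom_neg[OF Y0.lmod ER.lmod fD(1) gy] ..
  then have "f (\<pi> y) = \<zero>\<^bsub>ER\<^esub>" using fg ER.M.r_neg[OF fD(3)[OF y]] by simp
  then have "f (\<pi> y) = \<zero>\<^bsub>E\<^esub>" by (simp del: End_op_simps)
  then show "\<pi> y \<in> II 0" using f_ker[OF lmod_homD(2)[OF \<pi> y]] by simp
 next
  fix y assume y: "y \<in> II 0"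
  then have yc: "y \<in> car (obj Y 0)" using I0_closed(1) by blast
  have "f y = \<zero>\<^bsub>E\<^esub>" using f_ker[OF yc] y by simp
  then have "g y = \<zero>\<^bsub>obj Y 0\<^esub>" using Y0.sc_lzero[OF y0(1)] by (simp add: g_def del: End_op_simps)
  then show "\<pi> y = y" using yc by (simp add: \<pi>_def a_minus_def Y0.M.a_inv_zero)
 next
  fix x assume x: "x \<in> car (Tn 0)" and c: "closed_at 0 x"
  have h: "(%q. pt 0 q y0) \<in> add_hom P (Tn 0)" using YP.pure_add_left pt_closed y0(1) by (intro add_homI) simp_all
  have "tmap (P_bimod P) E (obj Y 0) (%p. p) \<pi> x = x \<ominus>\<^bsub>Tn 0\<^esub> pt 0 (m2 (m1 x)) y0"
  proof (rule T_eqI[OF tensor_Y_hom[OF \<pi>] add_hom_diff[OF T_ag add_hom_id add_hom_comp[OF m21 h]] _ x])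
   fix p y assume p: "p \<in> car P" and y: "y \<in> car (obj Y 0)"
   have "pt 0 p (g y) = pt 0 (f y p) y0" unfolding g_def using YP.pure_middle[of p "f y" y0] p fc[OF y] y0(1) by simp
   then show "tmap (P_bimod P) E (obj Y 0) (%p. p) \<pi> (pt 0 p y) = pt 0 p y \<ominus>\<^bsub>Tn 0\<^esub> pt 0 (m2 (m1 (pt 0 p y))) y0"
    unfolding tensor_Y_pure[OF \<pi> p y] m21_pure[OF p y] using pt_minus[OF p y lmod_homD(2)[OF g y]] by (simp add: \<pi>_def)
  qed
  also have "pt 0 (m2 (m1 x)) y0 = \<zero>\<^bsub>Tn 0\<^esub>" using c YP.pure_zero_left[OF y0(1)] by (simp add: closed_at_def)
  also have "x \<ominus>\<^bsub>Tn 0\<^esub> \<zero>\<^bsub>Tn 0\<^esub> = x" using x T0.M.a_inv_zero T0.M.r_zero[OF x] by (simp only: a_minus_def)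
  finally show "tmap (P_bimod P) E (obj Y 0) (%p. p) \<pi> x = x" .
 qed
 then show "\<exists>\<pi>. splitting 0 \<pi>" by blast
qed

text \<open>
  Over a field \<open>\<pi>\<close> lifts linearly through the differential; \<open>left_split_lift\<close> makes the lift left-linear.
\<close>

lemma splitting_lift:
 assumes \<pi>: "splitting (j + 1) \<pi>" and j: "1 - int n \<le> j"
 shows "\<exists>\<theta>\<in>lmod_hom E (obj Y (j + 1)) (obj Y j). \<forall>y\<in>car (obj Y (j + 1)). dif Y j (\<theta> y) = \<pi> y"
proof -
 have I: "II (j + 1) = dif Y j ` car (obj Y j)" using j by (simp add: incoming_image_def)
 note d = bimod_homD(1)[OF dY[of j]]
 obtain \<tau> where \<tau>: "section_on K E (obj Y j) E (obj Y (j + 1)) (dif Y j) \<tau>"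
  using section_exists[OF K E Ym Yk E Ym klin_lmod_hom[OF E d]] by blast
 have im: "\<pi> y \<in> dif Y j ` car (obj Y j)" if "y \<in> car (obj Y (j + 1))" for y
  using splittingD(2)[OF \<pi> that] I by simp
 obtain s where s: "left_split K E (obj Y (j + 1)) s" using projective_splits(2)[OF Yp Yk finE finE] by blast
 show ?thesis
  by (rule left_split_lift[OF Yb s Ym Ym d splittingD(1)[OF \<pi>] section_comp_klin[OF \<tau> klin_lmod_hom[OF E splittingD(1)[OF \<pi>]] im]
     section_onD(2)[OF \<tau> im]])
qed

text \<open>
  If \<open>\<theta>\<close> lifts \<open>\<pi>\<close> through \<open>d\<close>, then \<open>1 - \<theta> d\<close> is the projection one degree lower, as \<open>d(y - \<theta>(d y)) = d y - \<pi>(d y) = 0\<close>.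
  For a cycle \<open>x\<close> of \<open>P \<otimes> Y\<close> one gets \<open>x = (1 \<otimes> \<pi>) x = (1 \<otimes> d)(1 \<otimes> \<theta>) x\<close>.
\<close>

lemma splitting_step:
 assumes \<pi>: "splitting (j + 1) \<pi>" and j: "1 - int n \<le> j" "j < 0"
 shows "\<exists>\<pi>'. splitting j \<pi>'" and "[|x \<in> car (Tn (j + 1)); closed_at (j + 1) x|] ==> \<exists>x'\<in>car (Tn j). dT j x' = x"
proof -
 obtain \<theta> where \<theta>: "\<theta> \<in> lmod_hom E (obj Y (j + 1)) (obj Y j)" and d\<theta>: "!!y. y \<in> car (obj Y (j + 1)) ==> dif Y j (\<theta> y) = \<pi> y"
  using splitting_lift[OF \<pi> j(1)] by blast
 have I: "II (j + 1) = dif Y j ` car (obj Y j)" using j by (simp add: incoming_image_def)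
 note d = bimod_homD(1)[OF dY[of j]]
 {
  assume x: "x \<in> car (Tn (j + 1))" and c: "closed_at (j + 1) x"
  have "dT j (tmap (P_bimod P) E (obj Y j) (%p. p) \<theta> x) = tmap (P_bimod P) E (obj Y (j + 1)) (%p. p) \<pi> x"
   unfolding dT_def by (rule tensor_map_comp[OF PYp PYp PYp rmod_hom_id rmod_hom_id \<theta> d rmod_hom_id splittingD(1)[OF \<pi>] refl d\<theta>]) (use x in simp_all)
  then have "dT j (tmap (P_bimod P) E (obj Y j) (%p. p) \<theta> x) = x" using splittingD(4)[OF \<pi> x c] by simp
  then show "\<exists>x'\<in>car (Tn j). dT j x' = x" using add_hom_closed[OF tensor_Y_hom[OF \<theta>] x] by blast
 }
 interpret Yj: bimodule K E E "obj Y j" by (rule Yb)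
 interpret Yi: bimodule K E E "obj Y (j + 1)" by (rule Yb)
 interpret Tj: bimodule K A E "Tn j" by (rule Tb)
 define \<pi>' where "\<pi>' y = y \<ominus>\<^bsub>obj Y j\<^esub> \<theta> (dif Y j y)" for y
 have \<theta>d: "(%y. \<theta> (dif Y j y)) \<in> lmod_hom E (obj Y j) (obj Y j)" by (rule lmod_hom_comp[OF d \<theta>])
 have \<pi>': "\<pi>' \<in> lmod_hom E (obj Y j) (obj Y j)" unfolding \<pi>'_def by (rule lmod_hom_diff[OF Ym bimod_homD(1)[OF bimod_hom_id] \<theta>d])
 have ker: "{x \<in> car (obj Y j). dif Y j x = \<zero>\<^bsub>obj Y (j + 1)\<^esub>} = II j" by (rule Yex[OF j])
 have "splitting j \<pi>'"
  unfolding splitting_def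
 proof (intro conjI ballI impI \<pi>')
  fix y assume y: "y \<in> car (obj Y j)"
  have dy: "dif Y j y \<in> car (obj Y (j + 1))" by (rule lmod_homD(2)[OF d y])
  have ty: "\<theta> (dif Y j y) \<in> car (obj Y j)" by (rule lmod_homD(2)[OF \<theta> dy])
  have "\<pi> (dif Y j y) = dif Y j y" using splittingD(3)[OF \<pi>] y I by blast
  then have "dif Y j (\<pi>' y) = dif Y j y \<oplus>\<^bsub>obj Y (j + 1)\<^esub> \<ominus>\<^bsub>obj Y (j + 1)\<^esub> dif Y j y"
   unfolding \<pi>'_def a_minus_def lmod_homD(3)[OF d y Yj.M.a_inv_closed[OF ty]] lmod_hom_neg[OF Ym Ym d ty] d\<theta>[OF dy] by simp
  then have "dif Y j (\<pi>' y) = \<zero>\<^bsub>obj Y (j + 1)\<^esub>" using Yi.M.r_neg[OF dy] by simp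
  then show "\<pi>' y \<in> II j" using ker lmod_homD(2)[OF \<pi>' y] by blast
 next
  fix y assume "y \<in> II j"
  then have y: "y \<in> car (obj Y j)" "dif Y j y = \<zero>\<^bsub>obj Y (j + 1)\<^esub>" using ker by auto
  then show "\<pi>' y = y" using lmod_hom_zero[OF Ym Ym \<theta>] by (simp add: \<pi>'_def a_minus_def Yj.M.a_inv_zero)
 next
  fix x assume x: "x \<in> car (Tn j)" and "closed_at j x"
  then have c: "dT j x = \<zero>\<^bsub>Tn (j + 1)\<^esub>" using j(2) by (simp add: closed_at_def)
  have "tmap (P_bimod P) E (obj Y j) (%p. p) \<pi>' x = x \<ominus>\<^bsub>Tn j\<^esub> tmap (P_bimod P) E (obj Y j) (%p. p) \<theta> (dT j x)"
  proof (rule T_eqI[OF tensor_Y_hom[OF \<pi>'] add_hom_diff[OF T_ag add_hom_id add_hom_comp[OF bimod_homD(2)[OF dT_hom] tensor_Y_hom[OF \<theta>]]] _ x])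
   fix p y assume p: "p \<in> car P" and y: "y \<in> car (obj Y j)"
   have dy: "dif Y j y \<in> car (obj Y (j + 1))" by (rule lmod_homD(2)[OF d y])
   show "tmap (P_bimod P) E (obj Y j) (%p. p) \<pi>' (pt j p y) =
    pt j p y \<ominus>\<^bsub>Tn j\<^esub> tmap (P_bimod P) E (obj Y j) (%p. p) \<theta> (dT j (pt j p y))"
    unfolding tensor_Y_pure[OF \<pi>' p y] dT_pure[OF p y] tensor_Y_pure[OF \<theta> p dy] \<pi>'_def
    by (rule pt_minus[OF p y lmod_homD(2)[OF \<theta> dy]])
  qed
  also have "tmap (P_bimod P) E (obj Y j) (%p. p) \<theta> (dT j x) = \<zero>\<^bsub>Tn j\<^esub>"
   unfolding c by (rule add_hom_zero[OF T_ag T_ag tensor_Y_hom[OF \<theta>]])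
  also have "x \<ominus>\<^bsub>Tn j\<^esub> \<zero>\<^bsub>Tn j\<^esub> = x" using Tj.M.a_inv_zero Tj.M.r_zero[OF x] by (simp only: a_minus_def)
  finally show "tmap (P_bimod P) E (obj Y j) (%p. p) \<pi>' x = x" .
 qed
 then show "\<exists>\<pi>'. splitting j \<pi>'" by blast
qed

lemma splitting_exists: "[|1 - int n \<le> i; i \<le> 0|] ==> \<exists>\<pi>. splitting i \<pi>"
proof (induction "nat (- i)" arbitrary: i)
 case 0
 then show ?case using splitting_zero by simp
next
 case (Suc m)
 have "m = nat (- (i + 1))" "1 - int n \<le> i + 1" "i + 1 \<le> 0" using Suc(2-4) by linarith+
 from Suc(1)[OF this] obtain \<pi> where "splitting (i + 1) \<pi>" by blast
 then show ?case using splitting_step(1)[of i \<pi>] \<open>i + 1 \<le> 0\<close> Suc(3) by simp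
qed

lemma PY_exact:
 assumes "1 - int n \<le> j" "j < 0" "x \<in> car (Tn (j + 1))" "closed_at (j + 1) x"
 shows "\<exists>x'\<in>car (Tn j). dT j x' = x"
 using splitting_exists[of "j + 1"] splitting_step(2)[of j _ x] assms by auto

text \<open>
  In the lowest degree \<open>\<pi>\<close> maps onto the image of \<open>\<iota>\<close>, and \<open>\<rho> = \<iota>\<^sup>-\<^sup>1 \<pi>\<close> is a left-linear retraction of \<open>\<iota>\<close>. From
  \<open>\<pi>(y) = \<rho>(y) \<iota>(1)\<close> one obtains \<open>p \<otimes> \<pi>(y) = p \<rho>(y) \<otimes> \<iota>(1)\<close>.
\<close>

lemma PY_bottom:
 shows "[|x \<in> car (Tn (1 - int n)); closed_at (1 - int n) x|] ==> \<exists>p\<in>car P. x = pt (1 - int n) p (\<iota> \<one>\<^bsub>E\<^esub>)"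
  and "[|p \<in> car P; pt (1 - int n) p (\<iota> \<one>\<^bsub>E\<^esub>) = \<zero>\<^bsub>Tn (1 - int n)\<^esub>|] ==> p = \<zero>\<^bsub>P\<^esub>"
proof -
 let ?i = "1 - int n"
 obtain \<pi> where \<pi>: "splitting ?i \<pi>" using splitting_exists[of ?i] n1 by auto
 have I: "II ?i = \<iota> ` car E" by (simp add: incoming_image_def)
 interpret Yi: bimodule K E E "obj Y ?i" by (rule Yb)
 interpret YP: tensor_pair "P_bimod P" E "obj Y ?i" by (rule PYp)
 note \<iota>D = bimod_homD[OF \<iota>, unfolded twisted_simps]
 note \<pi>h = splittingD(1)[OF \<pi>]
 define \<rho> where "\<rho> y = inv_into (car E) \<iota> (\<pi> y)" for y
 have \<rho>: "\<rho> y \<in> car E" "\<iota> (\<rho> y) = \<pi> y" if "y \<in> car (obj Y ?i)" for y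
  using splittingD(2)[OF \<pi> that] I unfolding \<rho>_def by (auto simp: inv_into_f_f[OF \<iota>_inj])
 have \<rho>e: "\<rho> y = e" if "e \<in> car E" "\<pi> y = \<iota> e" for y e
  unfolding \<rho>_def that(2) by (rule inv_into_f_f[OF \<iota>_inj that(1)])
 have E_add_closed: "a \<oplus>\<^bsub>E\<^esub> b \<in> car E" if "a \<in> car E" "b \<in> car E" for a b
  by (rule ring.ring_simprules(1)[OF k_algebraD(2)[OF E] that])
 have \<rho>add: "\<rho> (y \<oplus>\<^bsub>obj Y ?i\<^esub> z) = \<rho> y \<oplus>\<^bsub>E\<^esub> \<rho> z" if "y \<in> car (obj Y ?i)" "z \<in> car (obj Y ?i)" for y z
  by (rule \<rho>e[OF E_add_closed[OF \<rho>(1)[OF that(1)] \<rho>(1)[OF that(2)]]])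
   (simp only: lmod_homD(3)[OF \<pi>h that] \<iota>D(4)[OF \<rho>(1)[OF that(1)] \<rho>(1)[OF that(2)]] \<rho>(2) that)
 have \<rho>sc: "\<rho> (e \<odot>\<^bsub>obj Y ?i\<^esub> y) = e \<otimes>\<^bsub>E\<^esub> \<rho> y" if "e \<in> car E" "y \<in> car (obj Y ?i)" for e y
  by (rule \<rho>e[OF E_mult[OF that(1) \<rho>(1)[OF that(2)]]])
   (simp only: lmod_homD(4)[OF \<pi>h that] \<iota>D(5)[OF that(1) \<rho>(1)[OF that(2)]] \<rho>(2) that)
 have bal: "balanced (P_bimod P) E (obj Y ?i) P (%p y. \<rho> y p)"
  by (rule balancedI) (simp_all add: \<rho> \<rho>add \<rho>sc E_add)
 note qh = YP.lift_add_hom[OF P.M.abg bal] and qp = YP.lift_pure[OF P.M.abg bal]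
 define q where "q = lift P (%p y. \<rho> y p)"
 have qh: "q \<in> add_hom (Tn ?i) P" using qh by (simp add: q_def add_hom_def)
 have qp: "q (pt ?i p y) = \<rho> y p" if "p \<in> car P" "y \<in> car (obj Y ?i)" for p y unfolding q_def using qp[of p y] that by simp
 have \<iota>1: "\<iota> \<one>\<^bsub>E\<^esub> \<in> car (obj Y ?i)" by (rule \<iota>D(3)[OF E_one])
 have h: "(%p. pt ?i p (\<iota> \<one>\<^bsub>E\<^esub>)) \<in> add_hom P (Tn ?i)" using YP.pure_add_left pt_closed \<iota>1 by (intro add_homI) simp_all
 have e: "tmap (P_bimod P) E (obj Y ?i) (%p. p) \<pi> x = pt ?i (q x) (\<iota> \<one>\<^bsub>E\<^esub>)" if x: "x \<in> car (Tn ?i)" for x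
 proof (rule T_eqI[OF tensor_Y_hom[OF \<pi>h] add_hom_comp[OF qh h] _ x])
  fix p y assume p: "p \<in> car P" and y: "y \<in> car (obj Y ?i)"
  have "\<pi> y = \<iota> (\<rho> y \<otimes>\<^bsub>E\<^esub> \<one>\<^bsub>E\<^esub>)" using \<rho>[OF y] monoid.r_one[OF ring.axioms(2)[OF k_algebraD(2)[OF E]]] by (simp del: End_op_simps)
  also have "\<dots> = \<rho> y \<odot>\<^bsub>obj Y ?i\<^esub> \<iota> \<one>\<^bsub>E\<^esub>" by (rule \<iota>D(5)[OF \<rho>(1)[OF y] E_one])
  finally have "\<pi> y = \<rho> y \<odot>\<^bsub>obj Y ?i\<^esub> \<iota> \<one>\<^bsub>E\<^esub>" .
  then show "tmap (P_bimod P) E (obj Y ?i) (%p. p) \<pi> (pt ?i p y) = pt ?i (q (pt ?i p y)) (\<iota> \<one>\<^bsub>E\<^esub>)"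
   unfolding tensor_Y_pure[OF \<pi>h p y] qp[OF p y] using YP.pure_middle[of p "\<rho> y" "\<iota> \<one>\<^bsub>E\<^esub>"] p \<rho>(1)[OF y] \<iota>1 by (simp del: End_op_simps)
 qed
 show "\<exists>p\<in>car P. x = pt ?i p (\<iota> \<one>\<^bsub>E\<^esub>)" if "x \<in> car (Tn ?i)" "closed_at ?i x"
  using e[OF that(1)] splittingD(4)[OF \<pi> that] add_hom_closed[OF qh that(1)] by auto
 show "p = \<zero>\<^bsub>P\<^esub>" if p: "p \<in> car P" and z: "pt ?i p (\<iota> \<one>\<^bsub>E\<^esub>) = \<zero>\<^bsub>Tn ?i\<^esub>"
 proof -
  have "\<iota> \<one>\<^bsub>E\<^esub> \<in> II ?i" unfolding I by (rule imageI[OF E_one])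
  then have "\<rho> (\<iota> \<one>\<^bsub>E\<^esub>) = \<one>\<^bsub>E\<^esub>" by (intro \<rho>e E_one splittingD(3)[OF \<pi>])
  then have "p = q (pt ?i p (\<iota> \<one>\<^bsub>E\<^esub>))" using qp[OF p \<iota>1] p by simp
  also have "\<dots> = \<zero>\<^bsub>P\<^esub>" unfolding z by (rule add_hom_zero[OF T_ag P.M.abg qh])
  finally show ?thesis .
 qed
qed

end

section \<open>The periodic twist of P\<close>

lemma shift_Db: "C \<in> Db A ==> shift m C \<in> Db A"
proof -
 assume C: "C \<in> Db A"
 then obtain N where N: "!!i. \<bar>i\<bar> > N ==> car (obj C i) = {\<zero>\<^bsub>obj C i\<^esub>}" unfolding Db_def by blast
 have "car (obj (shift m C) i) = {\<zero>\<^bsub>obj (shift m C) i\<^esub>}" if "\<bar>i\<bar> > N + \<bar>m\<bar>" for i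
  using N[of "i + m"] that by (simp add: shift_def)
 then have "\<exists>N. \<forall>i. \<bar>i\<bar> > N --> car (obj (shift m C) i) = {\<zero>\<^bsub>obj (shift m C) i\<^esub>}" by blast
 then show ?thesis using C shift_cochain_complex[of A C m] by (simp add: Db_def shift_def)
qed

context twisted_setup
begin

abbreviation "Rn m \<equiv> tensor (obj Xc m) A P"
abbreviation "dR m \<equiv> tmap (obj Xc (m + 1)) A P (dif Xc m) (%p. p)"

text \<open>
  The isomorphisms from \<open>X\<^sup>m \<otimes>\<^sub>A P\<close> to \<open>P \<otimes>\<^sub>E Y\<^sup>m\<^sup>+\<^sup>1\<close> for \<open>m < 0\<close> and to \<open>P\<close> for \<open>m = 0\<close>.
\<close>

definition "row_iso m w = eval_a (Tn (m + 1)) (tmap (Sn (m + 1)) A P fst (%p. p) w)"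
definition "row_iso0 = lift P (%x p. snd x \<odot>\<^bsub>P\<^esub> p)"

lemma XPp: "tensor_pair (obj Xc m) A P" by (rule tensor_pairI[OF Xc_b Pm])
lemma SPp: "tensor_pair (Sn m) A P" by (rule tensor_pairI[OF Sb Pm])
lemma Rm: "lmodule A (Rn m)" by (rule lmodule_tensor[OF Xc_b Pm])
lemma P_id: "(%p. p) \<in> lmod_hom A P P" by (simp add: lmod_hom_def)

lemma row_iso_hom: "row_iso m \<in> lmod_hom A (Rn m) (Tn (m + 1))"
 unfolding row_iso_def by (rule lmod_hom_comp[OF tensor_map_lmod_hom[OF Xc_b Pm Sb Pm Xc_prj P_id] eval_a_lmod_hom[OF Tb]])

lemma row_iso_pure: "[|x \<in> car (obj Xc m); p \<in> car P|] ==>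
  row_iso m (pure (obj Xc m) A P x p) = eval_a (Tn (m + 1)) (pure (Sn (m + 1)) A P (fst x) p)"
 unfolding row_iso_def by (simp add: tensor_map_pure[OF XPp SPp rmod_hom_of_bimod_hom[OF Xc_prj] P_id])

lemma row_iso_bij:
 assumes "m \<noteq> 0"
 shows "bij_betw (row_iso m) (car (Rn m)) (car (Tn (m + 1)))"
proof -
 let ?e = "%s. (s, \<zero>\<^bsub>A\<^esub>)"
 note e = rmod_hom_of_bimod_hom[OF Xc_emb[OF assms]] and q = rmod_hom_of_bimod_hom[OF Xc_prj[of m]]
 have ip: "?e (fst x) = x" if "x \<in> car (obj Xc m)" for x
  using that assms stalk_simps(2)[of m "reg A"] by (auto simp: Xc_obj prod_eq_iff)
 have 1: "tmap (obj Xc m) A P ?e (%p. p) (tmap (Sn (m + 1)) A P fst (%p. p) w) = w"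
  if w: "w \<in> car (tgrp (obj Xc m) A P)" for w
  using tensor_map_comp[OF XPp SPp XPp q e P_id P_id rmod_hom_id P_id ip refl w] tensor_map_id[OF XPp rmod_hom_id P_id refl refl w] by simp
 have 2: "tmap (Sn (m + 1)) A P fst (%p. p) (tmap (obj Xc m) A P ?e (%p. p) w) = w"
  if w: "w \<in> car (tgrp (Sn (m + 1)) A P)" for w
  using tensor_map_comp[OF SPp XPp SPp e q P_id P_id rmod_hom_id P_id fst_conv refl w] tensor_map_id[OF SPp rmod_hom_id P_id refl refl w] by simp
 have b: "bij_betw (tmap (Sn (m + 1)) A P fst (%p. p)) (car (Rn m)) (car (tensor (Sn (m + 1)) A P))"
  by (rule bij_betw_byWitness[of _ "tmap (obj Xc m) A P ?e (%p. p)"])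
   (use 1 2 add_hom_closed[OF tensor_map_hom[OF XPp SPp q P_id]] add_hom_closed[OF tensor_map_hom[OF SPp XPp e P_id]] in auto)
 have e: "row_iso m = eval_a (Tn (m + 1)) \<circ> tmap (Sn (m + 1)) A P fst (%p. p)" by (auto simp: row_iso_def)
 show ?thesis unfolding e by (rule bij_betw_trans[OF b eval_a_bij[OF Tb]])
qed

lemma row_iso_surj: "[|m \<noteq> 0; t \<in> car (Tn (m + 1))|] ==> \<exists>v\<in>car (Rn m). row_iso m v = t"
proof -
 assume m: "m \<noteq> 0" and t: "t \<in> car (Tn (m + 1))"
 have "t \<in> row_iso m ` car (Rn m)" unfolding bij_betw_imp_surj_on[OF row_iso_bij[OF m]] by (rule t)
 then obtain v where "t = row_iso m v" "v \<in> car (Rn m)" by (rule imageE)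
 then show ?thesis by (intro bexI[of _ v]) (simp only:)
qed

lemma dR_hom: "dR m \<in> lmod_hom A (Rn m) (Rn (m + 1))"
 by (rule tensor_map_lmod_hom[OF Xc_b Pm Xc_b Pm Xc_dif_hom P_id])

lemma dR_pure: "[|x \<in> car (obj Xc m); p \<in> car P|] ==>
  dR m (pure (obj Xc m) A P x p) = pure (obj Xc (m + 1)) A P (dif Xc m x) p"
 by (rule tensor_map_pure[OF XPp XPp rmod_hom_of_bimod_hom[OF Xc_dif_hom] P_id])

lemma R_eqI:
 assumes g: "g \<in> add_hom (Rn m) G" "g' \<in> add_hom (Rn m) G"
  and eq: "!!x p. [|x \<in> car (obj Xc m); p \<in> car P|] ==> g (pure (obj Xc m) A P x p) = g' (pure (obj Xc m) A P x p)"
  and w: "w \<in> car (Rn m)"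
 shows "g w = g' w"
 by (rule tensor_pair.add_hom_eqI[OF XPp, of g _ G g']) (use assms in "simp_all add: add_hom_def")

text \<open>
  The sign is that of the differential of the cone.
\<close>

lemma row_iso_dR:
 assumes w: "w \<in> car (Rn m)"
 shows "row_iso (m + 1) (dR m w) = \<ominus>\<^bsub>Tn (m + 2)\<^esub> dT (m + 1) (row_iso m w)"
proof -
 have i: "m + 1 + 1 = m + 2" by simp
 have Gh: "row_iso (m + 1) \<in> add_hom (Rn (m + 1)) (Tn (m + 2))" using lmod_homD(1)[OF row_iso_hom[of "m + 1"]] by (simp only: i)
 have dh: "dT (m + 1) \<in> add_hom (Tn (m + 1)) (Tn (m + 2))" using bimod_homD(2)[OF dT_hom[of "m + 1"]] by (simp only: i)
 have eh: "(%s. eval_a (Tn (m + 2)) (pure (Sn (m + 2)) A P s p)) \<in> add_hom (Sn (m + 2)) (Tn (m + 2))" if "p \<in> car P" for p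
  by (rule eval_a_pure_hom[OF that])
 show ?thesis
 proof (rule R_eqI[OF add_hom_comp[OF lmod_homD(1)[OF dR_hom] Gh] add_hom_uminus[OF T_ag add_hom_comp[OF lmod_homD(1)[OF row_iso_hom] dh]] _ w])
  fix x p assume x: "x \<in> car (obj Xc m)" and p: "p \<in> car P"
  have s: "fst x \<in> car (Sn (m + 1))" using x by (auto simp: Xc_obj)
  have ds: "dS (m + 1) (fst x) \<in> car (Sn (m + 2))" by (rule bimod_homD(3)[OF dS1 s])
  have "row_iso (m + 1) (dR m (pure (obj Xc m) A P x p)) = eval_a (Tn (m + 2)) (pure (Sn (m + 2)) A P (\<ominus>\<^bsub>Sn (m + 2)\<^esub> dS (m + 1) (fst x)) p)"
   unfolding dR_pure[OF x p] row_iso_pure[OF bimod_homD(3)[OF Xc_dif_hom x] p] unfolding Xc_dif[OF x] fst_conv i ..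
  also have "\<dots> = \<ominus>\<^bsub>Tn (m + 2)\<^esub> eval_a (Tn (m + 2)) (pure (Sn (m + 2)) A P (dS (m + 1) (fst x)) p)"
   by (rule add_hom_neg[OF abelian_of_bimodule[OF Sb] T_ag eh[OF p] ds])
  also have "eval_a (Tn (m + 2)) (pure (Sn (m + 2)) A P (dS (m + 1) (fst x)) p) = dT (m + 1) (row_iso m (pure (obj Xc m) A P x p))"
   unfolding row_iso_pure[OF x p] using eval_a_dS[OF s p] by (simp only: i)
  finally show "row_iso (m + 1) (dR m (pure (obj Xc m) A P x p)) = \<ominus>\<^bsub>Tn (m + 2)\<^esub> dT (m + 1) (row_iso m (pure (obj Xc m) A P x p))" .
 qed
qed

lemma row_iso0_hom: "row_iso0 \<in> add_hom (Rn 0) P"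
 using X0_lift(1)[OF Pm] by (simp add: row_iso0_def add_hom_def)

lemma row_iso0_inj: "[|v \<in> car (Rn 0); w \<in> car (Rn 0); row_iso0 v = row_iso0 w|] ==> v = w"
 using X0_unit_lift[OF Pm, of v] X0_unit_lift[OF Pm, of w] by (simp add: row_iso0_def)

lemma dR_last: "w \<in> car (Rn (- 1)) ==> dR (- 1) w \<in> car (Rn 0)"
 using lmod_homD(2)[OF dR_hom, of w "- 1"] by simp

lemma row_iso0_dR:
 assumes w: "w \<in> car (Rn (- 1))"
 shows "row_iso0 (dR (- 1) w) = m2 (m1 (row_iso (- 1) w))"
proof -
 have dh: "dR (- 1) \<in> add_hom (Rn (- 1)) (Rn 0)" using lmod_homD(1)[OF dR_hom[of "- 1"]] by simp
 have Gh: "row_iso (- 1) \<in> add_hom (Rn (- 1)) (Tn 0)" using lmod_homD(1)[OF row_iso_hom[of "- 1"]] by simp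
 have m: "(%t. m2 (m1 t)) \<in> add_hom (Tn 0) P" using bimod_homD(2)[OF bimod_hom_comp[OF m1_hom m2_hom]] by (simp add: add_hom_def)
 show ?thesis
 proof (rule R_eqI[OF add_hom_comp[OF dh row_iso0_hom] add_hom_comp[OF Gh m] _ w])
  fix x p assume x: "x \<in> car (obj Xc (- 1))" and p: "p \<in> car P"
  have s: "fst x \<in> car (Sn 0)" using x by (auto simp: Xc_obj)
  have dx: "dif Xc (- 1) x \<in> car (obj Xc 0)" using bimod_homD(3)[OF Xc_dif_hom x] by simp
  have "snd (dif Xc (- 1) x) = G0 (fst x)" using Xc_dif[OF x] by (simp add: gm0)
  then show "row_iso0 (dR (- 1) (pure (obj Xc (- 1)) A P x p)) = m2 (m1 (row_iso (- 1) (pure (obj Xc (- 1)) A P x p)))"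
   using dR_pure[OF x p] X0_lift(2)[OF Pm dx p] row_iso_pure[OF x p] eval_a_G0[OF s p] by (simp add: row_iso0_def)
 qed
qed

lemma dR_zero_iff:
 assumes w: "w \<in> car (Rn m)" and m: "m < 0"
 shows "dR m w = \<zero>\<^bsub>Rn (m + 1)\<^esub> \<longleftrightarrow> closed_at (m + 1) (row_iso m w)"
proof (cases "m = - 1")
 case True
 have w': "w \<in> car (Rn (- 1))" using w True by simp
 have "\<zero>\<^bsub>Rn 0\<^esub> \<in> car (Rn 0)" "row_iso0 \<zero>\<^bsub>Rn 0\<^esub> = \<zero>\<^bsub>P\<^esub>"
  by (rule abelian_monoid.zero_closed[OF abelian_group.axioms(1)[OF abelian_of_lmodule[OF Rm]]],
    rule add_hom_zero[OF abelian_of_lmodule[OF Rm] P.M.abg row_iso0_hom])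
 then have "dR (- 1) w = \<zero>\<^bsub>Rn 0\<^esub> \<longleftrightarrow> row_iso0 (dR (- 1) w) = \<zero>\<^bsub>P\<^esub>" using row_iso0_inj[OF dR_last[OF w']] by metis
 then show ?thesis using row_iso0_dR[OF w'] True by (simp add: closed_at_def)
next
 case False
 have i: "m + 1 + 1 = m + 2" by simp
 have Z: "\<zero>\<^bsub>Rn (m + 1)\<^esub> \<in> car (Rn (m + 1))" "row_iso (m + 1) \<zero>\<^bsub>Rn (m + 1)\<^esub> = \<zero>\<^bsub>Tn (m + 2)\<^esub>"
  using abelian_monoid.zero_closed[OF abelian_group.axioms(1)[OF abelian_of_lmodule[OF Rm]]]
   lmod_hom_zero[OF Rm lmodule_of_bimodule[OF Tb] row_iso_hom, of "m + 1"] by (simp_all only: i)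
 have inj: "inj_on (row_iso (m + 1)) (car (Rn (m + 1)))" using row_iso_bij[of "m + 1"] False by (simp add: bij_betw_def)
 have "dR m w = \<zero>\<^bsub>Rn (m + 1)\<^esub> \<longleftrightarrow> row_iso (m + 1) (dR m w) = \<zero>\<^bsub>Tn (m + 2)\<^esub>"
  using inj_onD[OF inj _ lmod_homD(2)[OF dR_hom w] Z(1)] Z(2) by metis
 also have "\<dots> \<longleftrightarrow> dT (m + 1) (row_iso m w) = \<zero>\<^bsub>Tn (m + 2)\<^esub>"
 proof -
  interpret T: bimodule K A E "Tn (m + 2)" by (rule Tb)
  have c: "dT (m + 1) (row_iso m w) \<in> car (Tn (m + 2))" using bimod_homD(3)[OF dT_hom lmod_homD(2)[OF row_iso_hom w]] by (simp only: i)
  show ?thesis unfolding row_iso_dR[OF w] using T.M.minus_minus[OF c] T.M.a_inv_zero by metis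
 qed
 finally show ?thesis using False m by (simp add: closed_at_def i)
qed

lemma \<iota>_closed: "p \<in> car P ==> pt (1 - int n) p (\<iota> \<one>\<^bsub>E\<^esub>) \<in> car (Tn (1 - int n))"
 and \<iota>_cycle: "p \<in> car P ==> closed_at (1 - int n) (pt (1 - int n) p (\<iota> \<one>\<^bsub>E\<^esub>))"
proof -
 assume p: "p \<in> car P"
 have y: "\<iota> \<one>\<^bsub>E\<^esub> \<in> car (obj Y (1 - int n))" by (rule bimod_homD(3)[OF \<iota>, unfolded twisted_simps, OF E_one])
 have I: "\<iota> \<one>\<^bsub>E\<^esub> \<in> II (1 - int n)" using E_one by (simp add: incoming_image_def del: End_op_simps)
 show "pt (1 - int n) p (\<iota> \<one>\<^bsub>E\<^esub>) \<in> car (Tn (1 - int n))" by (rule pt_closed[OF p y])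
 show "closed_at (1 - int n) (pt (1 - int n) p (\<iota> \<one>\<^bsub>E\<^esub>))"
 proof (cases "n = 1")
  case True
  then have y0: "\<iota> \<one>\<^bsub>E\<^esub> \<in> car (obj Y 0)" "\<iota> \<one>\<^bsub>E\<^esub> \<in> II 0" using y I by simp_all
  have fz: "f (\<iota> \<one>\<^bsub>E\<^esub>) = \<zero>\<^bsub>E\<^esub>" using f_ker[OF y0(1)] y0(2) by simp
  have z: "\<zero>\<^bsub>E\<^esub> \<in> car E" by (rule ring.ring_simprules(2)[OF k_algebraD(2)[OF E]])
  have "m2 (m1 (pt 0 p (\<iota> \<one>\<^bsub>E\<^esub>))) = \<zero>\<^bsub>P\<^esub>" unfolding m1_pure[OF p y0(1)] fz m2_pure[OF p z] using p by simp
  moreover have "1 - int n = 0" using True by simp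
  ultimately show ?thesis by (simp only: closed_at_def simp_thms if_True)
 next
  case False
  then have "dif Y (1 - int n) (\<iota> \<one>\<^bsub>E\<^esub>) = \<zero>\<^bsub>obj Y (1 - int n + 1)\<^esub>" using Yex[of "1 - int n"] I n1 by auto
  then have "dT (1 - int n) (pt (1 - int n) p (\<iota> \<one>\<^bsub>E\<^esub>)) = \<zero>\<^bsub>Tn (1 - int n + 1)\<^esub>"
   unfolding dT_pure[OF p y] using tensor_pair.pure_zero_right[OF PYp, of p "1 - int n + 1"] p by simp
  then show ?thesis using False by (simp add: closed_at_def)
 qed
qed

text \<open>
  The map \<open>\<kappa>\<close> is \<open>p \<mapsto> p \<otimes> \<iota>(1)\<close> in degree \<open>-n\<close>, read through \<open>row_iso\<close>, and zero in all other degrees.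
\<close>

lemma twist_P: "Db_iso A (periodic_twist A P n Y \<iota> h (stalk P)) (shift (int n) (stalk P))"
proof -
 let ?Z = "shift (int n) (stalk P)"
 have sP: "stalk P \<in> Db A" by (rule stalk_Db[OF A Pm finP])
 have ZD: "?Z \<in> Db A" by (rule shift_Db[OF sP])
 have cZ: "cochain_complex A ?Z" and cP: "cochain_complex A (stalk P)" using ZD sP by (simp_all add: Db_def)
 note TD = twist_Db[OF sP]
 have Zo: "obj ?Z (- int n) = P" by (simp add: shift_def stalk_simps)
 have Z0: "\<zero>\<^bsub>obj ?Z i\<^esub> = \<zero>\<^bsub>P\<^esub>" for i by (simp add: shift_def stalk_simps)
 have Zt: "car (obj ?Z i) = {\<zero>\<^bsub>P\<^esub>}" if "i \<noteq> - int n" for i using that by (simp add: shift_def stalk_simps)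
 have Zd: "dif ?Z i x = \<zero>\<^bsub>P\<^esub>" for i x
  using abelian_group.a_inv_zero[OF abelian_of_lmodule[OF stalk_lmodule[OF Pm]]] by (simp add: shift_def stalk_simps)
 have Zc: "\<zero>\<^bsub>P\<^esub> \<in> cocycles ?Z i" for i using cocycles_rules(2)[OF cZ, of i] by (simp add: Z0)
 interpret D: double_complex A "%j k. tensor (obj Xc j) A (obj (stalk P) k)"
  "%j k. tmap (obj Xc (j + 1)) A (obj (stalk P) k) (dif Xc j) (%y. y)"
  "%j k. tmap (obj Xc j) A (obj (stalk P) (k + 1)) (%x. x) (dif (stalk P) k)" "tensor_cpx Xc A (stalk P)"
  by (rule tensor_double_complex[OF Xc_complex cP])
 define \<kappa> where "\<kappa> i = (if i = - int n then %p. inv_into (car (Rn i)) (row_iso i) (pt (1 - int n) p (\<iota> \<one>\<^bsub>E\<^esub>)) else (%_. \<zero>\<^bsub>Rn i\<^esub>))" for i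
 have nn: "- int n \<noteq> 0" "- int n < 0" using n1 by simp_all
 have bij: "bij_betw (row_iso (- int n)) (car (Rn (- int n))) (car (Tn (1 - int n)))" using row_iso_bij[OF nn(1)] by simp
 have \<iota>h: "(%p. pt (1 - int n) p (\<iota> \<one>\<^bsub>E\<^esub>)) \<in> lmod_hom A P (Tn (1 - int n))"
 proof (intro lmod_homI add_homI \<iota>_closed)
  interpret YP: tensor_pair "P_bimod P" E "obj Y (1 - int n)" by (rule PYp)
  have y: "\<iota> \<one>\<^bsub>E\<^esub> \<in> car (obj Y (1 - int n))" by (rule bimod_homD(3)[OF \<iota>, unfolded twisted_simps, OF E_one])
  show "pt (1 - int n) (p \<oplus>\<^bsub>P\<^esub> q) (\<iota> \<one>\<^bsub>E\<^esub>) = pt (1 - int n) p (\<iota> \<one>\<^bsub>E\<^esub>) \<oplus>\<^bsub>Tn (1 - int n)\<^esub> pt (1 - int n) q (\<iota> \<one>\<^bsub>E\<^esub>)"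
   if "p \<in> car P" "q \<in> car P" for p q using YP.pure_add_left[of p q] that y by simp
  show "pt (1 - int n) (r \<odot>\<^bsub>P\<^esub> p) (\<iota> \<one>\<^bsub>E\<^esub>) = r \<odot>\<^bsub>Tn (1 - int n)\<^esub> pt (1 - int n) p (\<iota> \<one>\<^bsub>E\<^esub>)"
   if "r \<in> car A" "p \<in> car P" for r p
   using tensor_smult_pure[OF Pb.bm Ym that(1) _ y, of p] that by (simp add: tensor_bimod_smult_eq[OF Pb.bm Yb])
 qed
 have row_iso_n: "row_iso (- int n) \<in> lmod_hom A (Rn (- int n)) (Tn (1 - int n))" using row_iso_hom[of "- int n"] by simp
 have \<kappa>n: "\<kappa> (- int n) p \<in> car (Rn (- int n))" "row_iso (- int n) (\<kappa> (- int n) p) = pt (1 - int n) p (\<iota> \<one>\<^bsub>E\<^esub>)" if "p \<in> car P" for p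
  using bij_betw_imp_surj_on[OF bij] \<iota>_closed[OF that] f_inv_into_f[of "pt (1 - int n) p (\<iota> \<one>\<^bsub>E\<^esub>)" "row_iso (- int n)" "car (Rn (- int n))"]
   inv_into_into[of "pt (1 - int n) p (\<iota> \<one>\<^bsub>E\<^esub>)" "row_iso (- int n)" "car (Rn (- int n))"] by (simp_all add: \<kappa>_def)
 have \<kappa>h: "\<kappa> i \<in> lmod_hom A (obj ?Z i) (Rn i)" for i
 proof (cases "i = - int n")
  case True
  have "\<kappa> (- int n) \<in> lmod_hom A P (Rn (- int n))"
   using lmod_hom_comp[OF \<iota>h lmod_hom_inv_into[OF Rm row_iso_n bij]] by (simp add: \<kappa>_def)
  then show ?thesis using True Zo by simp
 next
  case False
  have "\<kappa> i = (%_. \<zero>\<^bsub>Rn i\<^esub>)" using False by (simp add: \<kappa>_def)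
  then show ?thesis using lmod_hom_const_zero[OF Rm] by simp
 qed
 have \<kappa>0: "\<kappa> i \<zero>\<^bsub>P\<^esub> = \<zero>\<^bsub>Rn i\<^esub>" for i using lmod_hom_zero[OF cpxD(1)[OF cZ] Rm \<kappa>h, of i] by (simp only: Z0)
 have dR0: "dR i \<zero>\<^bsub>Rn i\<^esub> = \<zero>\<^bsub>Rn (i + 1)\<^esub>" for i by (rule lmod_hom_zero[OF Rm Rm dR_hom])
 have Rz: "\<zero>\<^bsub>Rn i\<^esub> \<in> car (Rn i)" for i by (rule abelian_monoid.zero_closed[OF abelian_group.axioms(1)[OF abelian_of_lmodule[OF Rm]]])
 have Rt: "w = \<zero>\<^bsub>Rn i\<^esub>" if "i < - int n \<or> i > 0" "w \<in> car (Rn i)" for i w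
  using tensor_trivial[OF Xc_b Pm disjI1[OF Xc_triv[OF that(1)]]] that(2) by simp
 have dRp: "dR (i - 1) \<in> lmod_hom A (Rn (i - 1)) (Rn i)" for i using dR_hom[of "i - 1"] by simp
 have cyc: "dR (- int n) (\<kappa> (- int n) p) = \<zero>\<^bsub>Rn (- int n + 1)\<^esub>" if "p \<in> car P" for p
  using dR_zero_iff[OF \<kappa>n(1)[OF that] nn(2)] \<kappa>n(2)[OF that] \<iota>_cycle[OF that] by simp
 have boundary: "\<exists>v\<in>car (Rn (i - 1)). w = dR (i - 1) v"
  if w: "w \<in> car (Rn i)" and dw: "dR i w = \<zero>\<^bsub>Rn (i + 1)\<^esub>" and i: "- int n < i" "i \<le> 0" for i w
 proof (cases "i = 0")
  case True
  have w0: "w \<in> car (Rn 0)" using w True by simp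
  obtain t where t: "t \<in> car (Tn 0)" "m2 (m1 t) = row_iso0 w" using P_cover[OF add_hom_closed[OF row_iso0_hom w0]] by blast
  obtain v where v: "v \<in> car (Rn (- 1))" "row_iso (- 1) v = t" using row_iso_surj[of "- 1" t] t(1) by auto
  have "w = dR (- 1) v" by (rule row_iso0_inj[OF w0 dR_last[OF v(1)]]) (use row_iso0_dR[OF v(1)] v(2) t(2) in simp)
  then show ?thesis using v(1) True by auto
 next
  case False
  then have i0: "i < 0" using i by simp
  interpret T1: bimodule K A E "Tn (i + 1)" by (rule Tb)
  interpret T0: bimodule K A E "Tn i" by (rule Tb)
  note Gw = lmod_homD(2)[OF row_iso_hom w]
  have "closed_at (i + 1) (row_iso i w)" using dR_zero_iff[OF w i0] dw by simp
  then obtain t where t: "t \<in> car (Tn i)" "dT i t = row_iso i w" using PY_exact[of i "row_iso i w"] Gw i i0 by auto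
  have nt: "\<ominus>\<^bsub>Tn i\<^esub> t \<in> car (Tn i)" by (rule T0.M.a_inv_closed[OF t(1)])
  obtain v where v: "v \<in> car (Rn (i - 1))" "row_iso (i - 1) v = \<ominus>\<^bsub>Tn i\<^esub> t"
   using row_iso_surj[of "i - 1" "\<ominus>\<^bsub>Tn i\<^esub> t"] nt i0 by auto
  have "row_iso i (dR (i - 1) v) = \<ominus>\<^bsub>Tn (i + 1)\<^esub> dT i (\<ominus>\<^bsub>Tn i\<^esub> t)" using row_iso_dR[OF v(1)] v(2) by (simp add: add.commute)
  also have "\<dots> = row_iso i w"
   using lmod_hom_neg[OF T0.lmod T1.lmod bimod_homD(1)[OF dT_hom] t(1)] t(2) T1.M.minus_minus[OF Gw] by simp
  finally have "dR (i - 1) v = w"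
   using row_iso_bij[of i] i0 w lmod_homD(2)[OF dRp v(1)] unfolding bij_betw_def inj_on_def by blast
  then show ?thesis using v(1) by blast
 qed
 have "quasi_iso A ?Z (tensor_cpx Xc A (stalk P)) (%i x. dsum_single (%j. tensor (obj Xc j) A (obj (stalk P) (i - j))) i (\<kappa> i x))"
 proof (rule D.column_quasi_iso[OF _ cZ], unfold stalk_simps(1))
  show "car (tensor (obj Xc j) A (obj (stalk P) k)) = {\<zero>\<^bsub>tensor (obj Xc j) A (obj (stalk P) k)\<^esub>}" if "k \<noteq> 0" for j k
   using tensor_trivial[OF Xc_b stalk_lmodule[OF Pm] disjI2, of k j] stalk_simps(2)[OF that, of P] stalk_simps(3)[of P k] by simp
  show "\<kappa> i \<in> lmod_hom A (obj ?Z i) (Rn i)" for i by (rule \<kappa>h)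
  show "dR i (\<kappa> i x) = \<kappa> (i + 1) (dif ?Z i x)" if x: "x \<in> car (obj ?Z i)" for i x
  proof (cases "i = - int n")
   case True
   then show ?thesis using cyc[of x] x Zo Zd \<kappa>0 by simp
  next
   case False
   then show ?thesis using x Zt[OF False] Zd \<kappa>0 dR0 by simp
  qed
  fix i
  show "x \<in> bdry ?Z i" if x: "x \<in> cocycles ?Z i" and w: "w \<in> car (Rn (i - 1))" and e: "\<kappa> i x = dR (i - 1) w" for x w
  proof -
   have xc: "x \<in> car (obj ?Z i)" using x by (simp add: cocycles_def)
   have "x = \<zero>\<^bsub>P\<^esub>"
   proof (cases "i = - int n")
    case True
    have p: "x \<in> car P" using xc True Zo by simp
    have "w = \<zero>\<^bsub>Rn (i - 1)\<^esub>" by (rule Rt[OF _ w]) (use True in simp)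
    then have "\<kappa> (- int n) x = \<zero>\<^bsub>Rn (- int n)\<^esub>" using e lmod_hom_zero[OF Rm Rm dRp, of i] True by simp
    then have "pt (1 - int n) x (\<iota> \<one>\<^bsub>E\<^esub>) = \<zero>\<^bsub>Tn (1 - int n)\<^esub>"
     using \<kappa>n(2)[OF p] lmod_hom_zero[OF Rm lmodule_of_bimodule[OF Tb] row_iso_n] by simp
    then show ?thesis by (rule PY_bottom(2)[OF p])
   next
    case False
    then show ?thesis using xc Zt by simp
   qed
   then show ?thesis using coboundaries_rules(2)[OF cZ, of i] by (simp add: Z0)
  qed
  show "\<exists>x\<in>cocycles ?Z i. \<exists>v\<in>car (Rn (i - 1)). w = \<kappa> i x \<oplus>\<^bsub>Rn i\<^esub> dR (i - 1) v"
   if w: "w \<in> car (Rn i)" and dw: "dR i w = \<zero>\<^bsub>Rn (i + 1)\<^esub>" for w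
  proof -
   interpret R: lmodule A "Rn i" by (rule Rm)
   note z = lmod_hom_zero[OF Rm Rm dRp, of i]
   consider "i < - int n \<or> i > 0" | "- int n < i" "i \<le> 0" | "i = - int n" by linarith
   then show ?thesis
   proof cases
    case 1
    have "w = \<kappa> i \<zero>\<^bsub>P\<^esub> \<oplus>\<^bsub>Rn i\<^esub> dR (i - 1) \<zero>\<^bsub>Rn (i - 1)\<^esub>" unfolding z \<kappa>0 Rt[OF 1 w] using R.M.r_zero[OF Rz] by simp
    then show ?thesis using Zc Rz by blast
   next
    case 2
    then obtain v where v: "v \<in> car (Rn (i - 1))" "w = dR (i - 1) v" using boundary[OF w dw] by blast
    have "w = \<kappa> i \<zero>\<^bsub>P\<^esub> \<oplus>\<^bsub>Rn i\<^esub> dR (i - 1) v" unfolding \<kappa>0 v(2)[symmetric] using R.M.l_zero[OF w] by simp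
    then show ?thesis using Zc v(1) by blast
   next
    case 3
    have w': "w \<in> car (Rn (- int n))" using w 3 by simp
    have "closed_at (1 - int n) (row_iso (- int n) w)" using dR_zero_iff[OF w' nn(2)] dw 3 by simp
    then obtain p where p: "p \<in> car P" "row_iso (- int n) w = pt (1 - int n) p (\<iota> \<one>\<^bsub>E\<^esub>)"
     using PY_bottom(1)[OF lmod_homD(2)[OF row_iso_n w']] by blast
    have "w = \<kappa> i p"
     using inj_onD[OF bij_betw_imp_inj_on[OF bij] _ w' \<kappa>n(1)[OF p(1)]] p(2) \<kappa>n(2)[OF p(1)] 3 by simp
    then have "w = \<kappa> i p \<oplus>\<^bsub>Rn i\<^esub> dR (i - 1) \<zero>\<^bsub>Rn (i - 1)\<^esub>" unfolding z using R.M.r_zero[OF w] by simp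
    moreover have "p \<in> cocycles ?Z i" using p(1) 3 Zo by (simp add: cocycles_def Zd Z0)
    ultimately show ?thesis using Rz by blast
   qed
  qed
 qed
 then show ?thesis
  by (intro Db_iso_of_quasi_isos[OF A finA ZD TD ZD _ quasi_iso_id[OF cZ]]) (simp only: periodic_twist_def)
qed

end

theorem corollary3p3p4:
  fixes K :: "'k ring" and A :: "('k, 'a) module" and P :: "('a, 'p) module"
    and n :: nat and \<sigma> :: "('p \<Rightarrow> 'p) \<Rightarrow> ('p \<Rightarrow> 'p)"
    and Y :: "(('p \<Rightarrow> 'p, 'p \<Rightarrow> 'p, 'y) bimod, 'y) cpx"
    and \<iota> :: "('p \<Rightarrow> 'p) \<Rightarrow> 'y" and h :: "'y set \<Rightarrow> ('p \<Rightarrow> 'p)"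
  assumes "algebraically_closed K"
    and "k_algebra K A" and "fin_gen K A"
    and "symmetric_algebra K A"
    and "projective_lmodule A P" and "fin_gen A P"
    and "truncated_resolution K (End_op A P) n \<sigma> Y \<iota> h"
  shows "(\<forall>L :: (('a, 'l) module, 'l) cpx. L \<in> perp A P \<longrightarrow> Db_iso A (periodic_twist A P n Y \<iota> h L) L) \<and>
    Db_iso A (periodic_twist A P n Y \<iota> h (stalk P)) (shift (int n) (stalk P))"
proof -
  have K: "field K" using assms(1) by (simp add: algebraically_closed_def)
  have Pm: "lmodule A P" using assms(5) by (simp add: projective_lmodule_def)
  have fA: "kfin K A (reg A)" by (rule kfin_reg[OF assms(2,3)])
  interpret twisted_setup K A P n \<sigma> Y \<iota> h
    by (rule twisted_setup.intro[OF projective_setup.intro[OF K assms(2) fA assms(5) kfin_of_fin_gen[OF assms(2) fA Pm assms(6)]]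
          twisted_setup_axioms.intro[OF assms(7)]])
  show ?thesis using twist_perp twist_P by blast
qed

end
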